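(* Let $p$ be a prime, $1\le m\le 4$, and let $X_m=\{x_1,\dots,x_m\}\subset\mathbb{Z}_p$ be an ordered set of $m$ elements whose reductions modulo $p$ are pairwise distinct. For $(H_1,\dots,H_m)\in\mathcal{M}_{\mathbb{Z}_p}^m$ write $H_i\cong \mathbb{Z}_p^{d_{\infty,i}}\times\prod_{r=1}^{\infty}(\mathbb{Z}/p^r\mathbb{Z})^{d_{r,i}}$, put $D_r:=\sum_{i=1}^m d_{r,i}$ and $s_i:=\operatorname{rank}_{\mathbb{F}_p}(H_i/pH_i)=\sum_{r=1}^\infty d_{r,i}+d_{\infty,i}$. Then: (1) $\mathcal{C}_{X_1}=\mathcal{M}_{\mathbb{Z}_p}$. (2) $\mathcal{C}_{X_2}=\{(H_1,H_2)\in\mathcal{M}_{\mathbb{Z}_p}^2: s_1=s_2\}$. (3) $\mathcal{C}_{X_3}=\{(H_1,H_2,H_3)\in\mathcal{M}_{\mathbb{Z}_p}^3: s_1=s_2=s_3 \text{ and } 2d_{1,i}\le D_1 \text{ for } 1\le i\le 3\}$. (4) $\mathcal{C}_{X_4}=\{(H_1,H_2,H_3,H_4)\in\mathcal{M}_{\mathbb{Z}_p}^4: s_1=s_2=s_3=s_4,\ 3d_{1,i}\le D_1 \text{ for } 1\le i\le 4, \text{ and } d_{1,i}+2(d_{1,j}+d_{2,j})\le D_1+D_2 \text{ for all } 1\le i,j\le 4\}$.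
   Context: $\mathbb{Z}_p$ denotes the ring of $p$-adic integers and $\mathbb{F}_p=\mathbb{Z}/p\mathbb{Z}$. $\mathcal{M}_{\mathbb{Z}_p}$ denotes the set of isomorphism classes of finitely generated $\mathbb{Z}_p$-modules. For such $X_m$, define $\mathcal{C}_{X_m}$ to be the set of all $(H_1,\dots,H_m)\in\mathcal{M}_{\mathbb{Z}_p}^m$ for which there exist a positive integer $n$ and a matrix $A\in\operatorname{M}_n(\mathbb{Z}_p)$ with $\operatorname{cok}(A+px_iI_n)\cong H_i$ for every $1\le i\le m$, where $\operatorname{cok}(B)=\mathbb{Z}_p^n/B\mathbb{Z}_p^n$ and $I_n$ is the identity matrix. *)

theory Defs
  imports
    "Berlekamp_Zassenhaus.Finite_Field"
    "Jordan_Normal_Form.Matrix"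
    "Jordan_Normal_Form.VS_Connect"
begin

hide_const (open) Multiset.mult
hide_const (open) Polynomial.smult
hide_const (open) Modules.module

(* The prime p is CARD('p) for a type 'p of class prime_card, and F_p is 'p mod_ring.
   The ring Z_p is the inverse limit of the rings Z/p^n, whose elements are represented by
   the integers 0, ..., p^n - 1. *)

typedef 'p padic_int =
  "{f :: nat \<Rightarrow> int. \<forall>n. f n \<in> {0..<int CARD('p::prime_card) ^ n} \<and>
      f (Suc n) mod int CARD('p) ^ n = f n}"
  morphisms padic_residue Abs_padic_int
  by (rule exI[of _ "\<lambda>_. 0"]) (simp add: prime_gt_0_nat prime_card)

setup_lifting type_definition_padic_int

lemma card_power_pos: "0 < int CARD('p::prime_card) ^ n"
  by (simp add: prime_gt_0_nat prime_card)

lemma mod_power_Suc_mod: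
  "(a mod int CARD('p::prime_card) ^ Suc n) mod int CARD('p) ^ n = a mod int CARD('p) ^ n"
  by (rule mod_mod_cancel) simp

instantiation padic_int :: (prime_card) comm_ring_1
begin

lift_definition zero_padic_int :: "'a padic_int" is "\<lambda>n. 0"
  by (simp add: prime_gt_0_nat prime_card)

lift_definition one_padic_int :: "'a padic_int" is "\<lambda>n. 1 mod int CARD('a) ^ n"
  using card_power_pos[where 'p='a] by (simp add: mod_power_Suc_mod[where 'p='a, simplified])

lift_definition plus_padic_int :: "'a padic_int \<Rightarrow> 'a padic_int \<Rightarrow> 'a padic_int" is
  "\<lambda>f g n. (f n + g n) mod int CARD('a) ^ n"
proof -
  fix f g :: "nat \<Rightarrow> int"
  let ?P = "\<lambda>n. int CARD('a) ^ n"
  assume f: "\<And>n. f n \<in> {0..<?P n} \<and> f (Suc n) mod ?P n = f n"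
    and g: "\<And>n. g n \<in> {0..<?P n} \<and> g (Suc n) mod ?P n = g n"
  have "(f (Suc n) + g (Suc n)) mod ?P n = (f n + g n) mod ?P n" for n
    using mod_add_eq[of "f (Suc n)" "?P n" "g (Suc n)"] f g by simp
  then show "(f n + g n) mod ?P n \<in> {0..<?P n} \<and>
      (f (Suc n) + g (Suc n)) mod ?P (Suc n) mod ?P n = (f n + g n) mod ?P n" for n
    using card_power_pos[where 'p='a] mod_power_Suc_mod[where 'p='a] by simp
qed

lift_definition times_padic_int :: "'a padic_int \<Rightarrow> 'a padic_int \<Rightarrow> 'a padic_int" is
  "\<lambda>f g n. (f n * g n) mod int CARD('a) ^ n"
proof -
  fix f g :: "nat \<Rightarrow> int"
  let ?P = "\<lambda>n. int CARD('a) ^ n"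
  assume f: "\<And>n. f n \<in> {0..<?P n} \<and> f (Suc n) mod ?P n = f n"
    and g: "\<And>n. g n \<in> {0..<?P n} \<and> g (Suc n) mod ?P n = g n"
  have "(f (Suc n) * g (Suc n)) mod ?P n = (f n * g n) mod ?P n" for n
    using mod_mult_eq[of "f (Suc n)" "?P n" "g (Suc n)"] f g by simp
  then show "(f n * g n) mod ?P n \<in> {0..<?P n} \<and>
      (f (Suc n) * g (Suc n)) mod ?P (Suc n) mod ?P n = (f n * g n) mod ?P n" for n
    using card_power_pos[where 'p='a] mod_power_Suc_mod[where 'p='a] by simp
qed

lift_definition uminus_padic_int :: "'a padic_int \<Rightarrow> 'a padic_int" is
  "\<lambda>f n. (- f n) mod int CARD('a) ^ n"
proof -
  fix f :: "nat \<Rightarrow> int"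
  let ?P = "\<lambda>n. int CARD('a) ^ n"
  assume f: "\<And>n. f n \<in> {0..<?P n} \<and> f (Suc n) mod ?P n = f n"
  have "(- f (Suc n)) mod ?P n = (- f n) mod ?P n" for n
    using mod_minus_eq[of "f (Suc n)" "?P n"] f by simp
  then show "(- f n) mod ?P n \<in> {0..<?P n} \<and>
      (- f (Suc n)) mod ?P (Suc n) mod ?P n = (- f n) mod ?P n" for n
    using card_power_pos[where 'p='a] mod_power_Suc_mod[where 'p='a] by simp
qed

definition minus_padic_int :: "'a padic_int \<Rightarrow> 'a padic_int \<Rightarrow> 'a padic_int" where
  "minus_padic_int x y = x + - y"

instance
proof
  fix a b c :: "'a padic_int"
  show "a * b * c = a * (b * c)"
    by transfer (auto simp: fun_eq_iff mod_simps ac_simps)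
  show "a * b = b * a"
    by transfer (auto simp: fun_eq_iff ac_simps)
  show "1 * a = a"
    by transfer (auto simp: fun_eq_iff mod_simps)
  show "a + b + c = a + (b + c)"
    by transfer (auto simp: fun_eq_iff mod_simps ac_simps)
  show "a + b = b + a"
    by transfer (auto simp: fun_eq_iff ac_simps)
  show "0 + a = a"
    by transfer (auto simp: fun_eq_iff)
  show "- a + a = 0"
    by transfer (auto simp: fun_eq_iff mod_simps)
  show "a - b = a + - b"
    by (rule minus_padic_int_def)
  show "(a + b) * c = a * c + b * c"
    by transfer (auto simp: fun_eq_iff mod_simps algebra_simps)
  show "(0::'a padic_int) \<noteq> 1"
  proof transfer
    have "1 mod int CARD('a) ^ 1 = 1"
      using prime_gt_1_nat[OF prime_card[where 'a='a]] by simp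
    then show "(\<lambda>n. 0) \<noteq> (\<lambda>n. 1 mod int CARD('a) ^ n)"
      by (metis zero_neq_one)
  qed
qed

end

definition padic_reduce :: "'p::prime_card padic_int \<Rightarrow> 'p mod_ring" where
  "padic_reduce x = of_int_mod_ring (padic_residue x 1)"

(* As in module_vec, the fields mult and one of a module record play no role. *)

definition quot_module :: "('r, 'c) module \<Rightarrow> 'c set \<Rightarrow> ('r, 'c set) module" where
  "quot_module M N =
    \<lparr>carrier = a_rcosets\<^bsub>M\<^esub> N, mult = undefined, one = undefined, zero = N,
     add = (\<lambda>X Y. X <+>\<^bsub>M\<^esub> Y),
     smult = (\<lambda>c X. \<Union>v\<in>X. N +>\<^bsub>M\<^esub> (c \<odot>\<^bsub>M\<^esub> v))\<rparr>"

definition prod_module :: "'i set \<Rightarrow> ('i \<Rightarrow> ('r, 'c) module) \<Rightarrow> ('r, 'i \<Rightarrow> 'c) module" where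
  "prod_module I M =
    \<lparr>carrier = (\<Pi>\<^sub>E i\<in>I. carrier (M i)), mult = undefined, one = undefined,
     zero = (\<lambda>i\<in>I. \<zero>\<^bsub>M i\<^esub>),
     add = (\<lambda>v w. \<lambda>i\<in>I. v i \<oplus>\<^bsub>M i\<^esub> w i),
     smult = (\<lambda>c v. \<lambda>i\<in>I. c \<odot>\<^bsub>M i\<^esub> v i)\<rparr>"

definition module_iso :: "('r, 'k) ring_scheme \<Rightarrow> ('r, 'b, 'm) module_scheme \<Rightarrow>
    ('r, 'c, 'n) module_scheme \<Rightarrow> bool" where
  "module_iso R M N \<longleftrightarrow> (\<exists>h\<in>module_hom R M N. bij_betw h (carrier M) (carrier N))"

abbreviation padic_iso :: "('p::prime_card padic_int, 'b) module \<Rightarrow>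
    ('p padic_int, 'c) module \<Rightarrow> bool" (infix "\<cong>\<^sub>p" 50) where
  "M \<cong>\<^sub>p N \<equiv> module_iso class_ring M N"

(* M_{Z_p}. An isomorphism class is given by any of its members, so that a set of tuples of
   isomorphism classes is an isomorphism-closed set of tuples of modules. The type 'a of
   module elements is arbitrary. *)

definition fg_modules :: "('p::prime_card padic_int, 'a) module set" where
  "fg_modules = {H. module class_ring H \<and>
    (\<exists>S. finite S \<and> S \<subseteq> carrier H \<and>
      LinearCombinations.module.span class_ring H S = carrier H)}"

definition cok :: "'p::prime_card padic_int mat \<Rightarrow> ('p padic_int, 'p padic_int vec set) module" where
  "cok B = quot_module (module_vec TYPE('p padic_int) (dim_row B))
     ((\<lambda>v. B *\<^sub>v v) ` carrier_vec (dim_col B))"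

definition cok_tuples :: "nat \<Rightarrow> (nat \<Rightarrow> 'p::prime_card padic_int) \<Rightarrow>
    (nat \<Rightarrow> ('p padic_int, 'a) module) set" where
  "cok_tuples m x = {H \<in> {1..m} \<rightarrow>\<^sub>E fg_modules.
     \<exists>n A. 0 < n \<and> A \<in> carrier_mat n n \<and>
       (\<forall>i\<in>{1..m}. cok (A + (of_nat CARD('p) * x i) \<cdot>\<^sub>m 1\<^sub>m n) \<cong>\<^sub>p H i)}"

(* Z/p^r, on which Z_p acts through the projection to the r-th level of the inverse limit *)
definition cyclic_module :: "nat \<Rightarrow> ('p::prime_card padic_int, int) module" where
  "cyclic_module r =
    \<lparr>carrier = {0..<int CARD('p) ^ r}, mult = undefined, one = undefined, zero = 0,
     add = (\<lambda>a b. (a + b) mod int CARD('p) ^ r),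
     smult = (\<lambda>x a. (padic_residue x r * a) mod int CARD('p) ^ r)\<rparr>"

(* Z_p^e x (the product over r >= 1 of (Z/p^r)^(d r)); the value d 0 is irrelevant *)
definition std_module :: "nat \<Rightarrow> (nat \<Rightarrow> nat) \<Rightarrow>
    ('p::prime_card padic_int, 'p padic_int vec \<times> (nat \<times> nat \<Rightarrow> int)) module" where
  "std_module e d = direct_sum (module_vec TYPE('p padic_int) e)
     (prod_module {(r, k). 1 \<le> r \<and> k < d r} (\<lambda>(r, k). cyclic_module r))"

definition has_type :: "('p::prime_card padic_int, 'a) module \<Rightarrow> nat \<Rightarrow> (nat \<Rightarrow> nat) \<Rightarrow> bool" where
  "has_type H e d \<longleftrightarrow> finite {r. 1 \<le> r \<and> d r \<noteq> 0} \<and> H \<cong>\<^sub>p std_module e d"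

definition module_type :: "('p::prime_card padic_int, 'a) module \<Rightarrow> nat \<times> (nat \<Rightarrow> nat)" where
  "module_type H = (SOME (e, d). has_type H e d)"

definition d_inf :: "('p::prime_card padic_int, 'a) module \<Rightarrow> nat" where
  "d_inf H = fst (module_type H)"

definition d_mult :: "nat \<Rightarrow> ('p::prime_card padic_int, 'a) module \<Rightarrow> nat" where
  "d_mult r H = snd (module_type H) r"

(* H/pH as a vector space over F_p; a scalar acts through any of its lifts to Z_p *)
definition mod_p :: "('p::prime_card padic_int, 'a) module \<Rightarrow> ('p mod_ring, 'a set) module" where
  "mod_p H = (let Q = quot_module H ((\<lambda>h. of_nat CARD('p) \<odot>\<^bsub>H\<^esub> h) ` carrier H) in
    \<lparr>carrier = carrier Q, mult = undefined, one = undefined, zero = \<zero>\<^bsub>Q\<^esub>,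
     add = (\<lambda>X Y. X \<oplus>\<^bsub>Q\<^esub> Y),
     smult = (\<lambda>c X. of_int (to_int_mod_ring c) \<odot>\<^bsub>Q\<^esub> X)\<rparr>)"

definition p_rank :: "('p::prime_card padic_int, 'a) module \<Rightarrow> nat" where
  "p_rank H = vectorspace.dim class_ring (mod_p H)"

end

(* Up to equivalence, A is a unit block plus p A'. Eliminating the unit block from A + p x_i by a
   Schur complement turns cok(A + p x_i) into the cokernel of p F_i, where F_i is congruent to
   C_0 + x_i C_1 + p x_i^2 C_2 modulo p^2 for matrices C_l that do not depend on i. Hence s_i is
   the size of F_i, and d_{1,i} and d_{1,i} + d_{2,i} are the ranks of F_i modulo p and modulo p^2,
   where the rank of a matrix modulo p^k is the least inner dimension of a factorization modulo p^k.
   The inequalities come from the Lagrange relations between the F_i together with Sylvester type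
   inequalities for these ranks.

   Conversely, a block companion matrix realizes every family
   F_i = C_0 + sum_{0<l<m} p^(l-1) x_i^l C_l + p^(m-1) x_i^m. By interpolation this only restricts
   F_i modulo p^(m-2), so it suffices to find a quadratic pencil with prescribed ranks modulo p and
   p^2, and a direct sum of pencils of size 1 and 2 does this. *)
theory Submission
  imports Defs "Jordan_Normal_Form.Column_Operations"
begin

subsection \<open>Arithmetic of p-adic integers\<close>

text \<open>Two precisions meet at four points. The Schur complement is a quadratic pencil modulo
  p^2, and interpolation at m nodes absorbs every perturbation divisible by p^(m-2); as m - 2 is at
  most 2 here, nothing beyond d_1 and d_2 is ever constrained. The delicate necessary condition is
  the one with i \<noteq> j. Stacking rank factorizations of three of the F_k and applying
  Sylvester's inequality reaches only i = j. For i \<noteq> j the part of F_i with unit invariant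
  factors is split off, because modulo p it is dependent on the other two matrices and costs no
  extra rank. For existence the obstacle is an index j whose d_2 is too large to be shared. A scalar
  block p q(x) with q quadratic is nonzero modulo p^2 at two or more of the four nodes, or at none.
  Blocks of size 2, with a cubic Schur complement or divisible by p at x_j, serve j alone; each uses
  up a constant block or a block with a root at x_j, and the supply of these is what the mixed
  inequality measures.\<close>

definition uniformizer :: "'p::prime_card padic_int" ("\<varpi>") where
  "\<varpi> = of_nat CARD('p)"

lemma pcard_gt_1: "1 < int CARD('p::prime_card)"
  using prime_gt_1_nat[OF prime_card[where 'a='p]] by simp

lemma padic_eqI: "(\<And>n. padic_residue x n = padic_residue y n) \<Longrightarrow> x = y"
  by (metis ext padic_residue_inject)

lemma padic_residue_bounds:
  "0 \<le> padic_residue (x :: 'p::prime_card padic_int) n"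
  "padic_residue x n < int CARD('p) ^ n"
  using padic_residue[of x] by auto

lemma padic_residue_Suc_mod:
  "padic_residue (x :: 'p::prime_card padic_int) (Suc n) mod int CARD('p) ^ n = padic_residue x n"
  using padic_residue[of x] by auto

lemma padic_residue_mod:
  assumes "n \<le> m"
  shows "padic_residue (x :: 'p::prime_card padic_int) m mod int CARD('p) ^ n = padic_residue x n"
  using assms
proof (induction rule: dec_induct)
  case base
  show ?case using padic_residue_bounds[of x n] by simp
next
  case (step m)
  have "padic_residue x (Suc m) mod int CARD('p) ^ n
      = padic_residue x (Suc m) mod int CARD('p) ^ m mod int CARD('p) ^ n"
    using step(1) by (metis le_imp_power_dvd mod_mod_cancel)
  then show ?case using step by (simp add: padic_residue_Suc_mod)
qed

lemma padic_residue_self_mod [simp]: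
  "padic_residue (x :: 'p::prime_card padic_int) n mod int CARD('p) ^ n = padic_residue x n"
  by (rule padic_residue_mod) simp

lemma padic_residue_0 [simp]: "padic_residue 0 n = 0"
  by transfer simp

lemma padic_residue_add:
  "padic_residue (x + y :: 'p::prime_card padic_int) n
    = (padic_residue x n + padic_residue y n) mod int CARD('p) ^ n"
  by transfer simp

lemma padic_residue_mult:
  "padic_residue (x * y :: 'p::prime_card padic_int) n
    = (padic_residue x n * padic_residue y n) mod int CARD('p) ^ n"
  by transfer simp

lemma padic_residue_uminus:
  "padic_residue (- x :: 'p::prime_card padic_int) n = (- padic_residue x n) mod int CARD('p) ^ n"
  by transfer simp

lemma padic_residue_1:
  "padic_residue (1 :: 'p::prime_card padic_int) n = 1 mod int CARD('p) ^ n"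
  by transfer simp

lemma padic_residue_of_nat:
  "padic_residue (of_nat a :: 'p::prime_card padic_int) n = int a mod int CARD('p) ^ n"
  by (induction a) (simp_all add: padic_residue_add padic_residue_1 mod_simps)

lemma padic_residue_of_int:
  "padic_residue (of_int a :: 'p::prime_card padic_int) n = a mod int CARD('p) ^ n"
  by (cases a rule: int_cases2) (simp_all add: padic_residue_of_nat padic_residue_uminus mod_simps)

lemma padic_residue_uniformizer_power:
  "padic_residue (\<varpi> ^ k :: 'p::prime_card padic_int) n = int CARD('p) ^ k mod int CARD('p) ^ n"
  unfolding uniformizer_def by (metis of_nat_power padic_residue_of_nat)

text \<open>If the residue at level n vanishes, all higher residues are multiples of p^n. Dividing
  the residue at level n + k by p^n gives a compatible sequence in k, which is the quotient.\<close>

lemma uniformizer_power_dvd_iff: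
  fixes x :: "'p::prime_card padic_int"
  shows "\<varpi> ^ n dvd x \<longleftrightarrow> padic_residue x n = 0"
proof
  assume "\<varpi> ^ n dvd x"
  then obtain y where "x = \<varpi> ^ n * y" ..
  then show "padic_residue x n = 0"
    by (simp add: padic_residue_mult padic_residue_uniformizer_power)
next
  assume x: "padic_residue x n = 0"
  let ?P = "\<lambda>n. int CARD('p) ^ n"
  define f where "f k = padic_residue x (n + k) div ?P n" for k
  have dvd: "?P n dvd padic_residue x (n + k)" for k
    using padic_residue_mod[of n "n + k" x] x by auto
  have fx: "padic_residue x (n + k) = ?P n * f k" for k
    unfolding f_def using dvd by simp
  have "f k \<in> {0..<?P k} \<and> f (Suc k) mod ?P k = f k" for k
  proof -
    have pos: "0 < ?P n" by (rule card_power_pos)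
    have "0 \<le> f k" unfolding f_def using pos padic_residue_bounds(1)[of x "n + k"]
      by (simp add: pos_imp_zdiv_nonneg_iff)
    moreover have "f k < ?P k"
    proof -
      have "?P n * f k < ?P n * ?P k"
        using padic_residue_bounds(2)[of x "n + k"] by (simp add: fx power_add)
      then show ?thesis using pos by simp
    qed
    moreover have "?P n * (f (Suc k) mod ?P k) = ?P n * f k"
      using padic_residue_Suc_mod[of x "n + k"] fx[of "Suc k"] fx[of k]
      by (simp only: power_add mult_mod_right add_Suc_right)
    ultimately show ?thesis using pos by simp
  qed
  then have res: "padic_residue (Abs_padic_int f :: 'p padic_int) = f"
    by (subst Abs_padic_int_inverse) auto
  have "x = \<varpi> ^ n * Abs_padic_int f"
  proof (rule padic_eqI)
    fix k
    have "padic_residue (\<varpi> ^ n * Abs_padic_int f :: 'p padic_int) k = ?P n * f k mod ?P k"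
      by (simp add: padic_residue_mult padic_residue_uniformizer_power res mod_simps)
    also have "\<dots> = padic_residue x (n + k) mod ?P k" by (simp add: fx)
    also have "\<dots> = padic_residue x k" by (rule padic_residue_mod) simp
    finally show "padic_residue x k = padic_residue (\<varpi> ^ n * Abs_padic_int f :: 'p padic_int) k" by simp
  qed
  then show "\<varpi> ^ n dvd x" by (rule dvdI)
qed

lemma uniformizer_dvd_iff: "\<varpi> dvd x \<longleftrightarrow> padic_residue x 1 = 0"
  using uniformizer_power_dvd_iff[of 1 x] by simp

lemma uniformizer_not_dvd_1 [simp]: "\<not> \<varpi> dvd 1"
  using pcard_gt_1 by (simp add: uniformizer_dvd_iff padic_residue_1)

lemma uniformizer_neq_0 [simp]: "\<varpi> ^ n \<noteq> 0"
proof
  assume "(\<varpi> ^ n :: 'p::prime_card padic_int) = 0"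
  then have "padic_residue (\<varpi> ^ n :: 'p padic_int) (Suc n) = 0" by simp
  moreover have "int CARD('p) ^ n < int CARD('p) ^ Suc n"
    using pcard_gt_1[where 'p='p] by (metis lessI power_strict_increasing)
  ultimately show False
    using card_power_pos[where 'p='p, of n]
    by (simp add: padic_residue_uniformizer_power del: power_Suc)
qed

text \<open>The residue of \<open>x - y\<close> at level k is read off from the given relation at
  level n + k. The argument stays on residues because the domain property is itself derived from
  this cancellation.\<close>

lemma uniformizer_mult_cancel:
  assumes "\<varpi> ^ n * x = \<varpi> ^ n * (y :: 'p::prime_card padic_int)"
  shows "x = y"
proof (rule padic_eqI)
  fix k
  have eq: "\<varpi> ^ n * (x - y) = 0" using assms by (simp add: algebra_simps)
  let ?P = "\<lambda>n. int CARD('p) ^ n"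
  have "?P n * padic_residue (x - y) (n + k) mod ?P (n + k) = 0"
    using arg_cong[OF eq, of "\<lambda>z. padic_residue z (n + k)"]
    by (simp add: padic_residue_mult padic_residue_uniformizer_power mod_simps)
  then have "?P n * ?P k dvd ?P n * padic_residue (x - y) (n + k)"
    by (simp add: power_add dvd_eq_mod_eq_0)
  then have "?P k dvd padic_residue (x - y) (n + k)"
    using card_power_pos[where 'p='p, of n] by simp
  then have 0: "padic_residue (x - y) k = 0"
    using padic_residue_mod[of k "n + k" "x - y"] by auto
  have "x = (x - y) + y" by simp
  then have "padic_residue x k = (padic_residue (x - y) k + padic_residue y k) mod ?P k"
    by (metis padic_residue_add)
  then show "padic_residue x k = padic_residue y k" using 0 by simp
qed

text \<open>The inverse is assembled level by level: the residue of x at level n is coprime to p^n,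
  and uniqueness of inverses modulo p^n makes the chosen ones compatible.\<close>

lemma padic_unit_iff:
  fixes x :: "'p::prime_card padic_int"
  shows "x dvd 1 \<longleftrightarrow> \<not> \<varpi> dvd x"
proof
  assume "x dvd 1"
  then show "\<not> \<varpi> dvd x" using dvd_trans uniformizer_not_dvd_1 by blast
next
  assume "\<not> \<varpi> dvd x"
  then have x1: "padic_residue x 1 \<noteq> 0" by (simp add: uniformizer_dvd_iff)
  let ?P = "\<lambda>n. int CARD('p) ^ n"
  have cop: "coprime (padic_residue x n) (?P n)" for n
  proof (cases n)
    case (Suc k)
    have "padic_residue x n mod int CARD('p) ^ 1 = padic_residue x 1"
      by (rule padic_residue_mod) (simp add: Suc)
    then have "\<not> int CARD('p) dvd padic_residue x n"
      using x1 by (metis dvd_imp_mod_0 power_one_right)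
    then have "coprime (int CARD('p)) (padic_residue x n)"
      using prime_card[where 'a='p] by (intro prime_imp_coprime) simp_all
    then show ?thesis unfolding Suc by (simp only: coprime_power_right_iff coprime_commute) simp
  qed simp
  define f where "f n = (SOME y. padic_residue x n * y mod ?P n = 1 mod ?P n) mod ?P n" for n
  have f: "padic_residue x n * f n mod ?P n = 1 mod ?P n" for n
  proof -
    have "\<exists>y. padic_residue x n * y mod ?P n = 1 mod ?P n"
      using cong_solve_coprime_int[OF cop[of n]] by (auto simp: cong_def)
    from someI_ex[OF this] show ?thesis unfolding f_def by (simp add: mod_simps)
  qed
  have "f n \<in> {0..<?P n} \<and> f (Suc n) mod ?P n = f n" for n
  proof -
    have r: "f n \<in> {0..<?P n}" unfolding f_def using card_power_pos[where 'p='p, of n] by simp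
    have "padic_residue x n * f (Suc n) mod ?P n
        = padic_residue x (Suc n) * f (Suc n) mod ?P n"
      by (metis mod_mult_left_eq padic_residue_Suc_mod)
    also have "\<dots> = padic_residue x (Suc n) * f (Suc n) mod ?P (Suc n) mod ?P n"
      by (rule mod_power_Suc_mod[symmetric])
    also have "\<dots> = 1 mod ?P n" by (simp only: f mod_power_Suc_mod)
    finally have "[padic_residue x n * f (Suc n) = padic_residue x n * f n] (mod ?P n)"
      using f[of n] by (simp add: cong_def)
    then have "[f (Suc n) = f n] (mod ?P n)"
      using cong_mult_lcancel[OF cop[of n]] by blast
    then show ?thesis using r by (simp add: cong_def)
  qed
  then have res: "padic_residue (Abs_padic_int f :: 'p padic_int) = f"
    by (subst Abs_padic_int_inverse) auto
  have "x * Abs_padic_int f = 1"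
    by (rule padic_eqI) (simp add: padic_residue_mult res f padic_residue_1)
  then show "x dvd 1" by (metis dvdI)
qed

lemma uniformizer_dvd_mult_iff:
  fixes a b :: "'p::prime_card padic_int"
  shows "\<varpi> dvd a * b \<longleftrightarrow> \<varpi> dvd a \<or> \<varpi> dvd b"
proof
  assume ab: "\<varpi> dvd a * b"
  show "\<varpi> dvd a \<or> \<varpi> dvd b"
  proof (rule ccontr)
    assume "\<not> ?thesis"
    then have "a * b dvd 1" using padic_unit_iff[of a] padic_unit_iff[of b] mult_dvd_mono[of a 1 b 1]
      by simp
    then show False using ab padic_unit_iff by blast
  qed
qed auto

text \<open>A nonzero x has a nonzero residue, so some power of \<varpi> does not divide it. The
  exponent k is the predecessor of the least such power, and the cofactor is then a unit.\<close>

lemma padic_decompose: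
  fixes x :: "'p::prime_card padic_int"
  assumes "x \<noteq> 0"
  obtains k u where "u dvd 1" "x = \<varpi> ^ k * u"
proof -
  have "\<exists>n. \<not> \<varpi> ^ n dvd x"
    using assms padic_eqI[of x 0] by (auto simp: uniformizer_power_dvd_iff)
  then obtain n where n: "\<not> \<varpi> ^ n dvd x" "\<forall>m<n. \<varpi> ^ m dvd x"
    using exists_least_iff[of "\<lambda>n. \<not> \<varpi> ^ n dvd x"] by blast
  then obtain k where k: "n = Suc k" by (cases n) auto
  with n obtain u where u: "x = \<varpi> ^ k * u" by (metis dvdE lessI)
  have "\<not> \<varpi> dvd u"
  proof
    assume "\<varpi> dvd u"
    then have "\<varpi> ^ k * \<varpi> dvd x" unfolding u by (rule mult_dvd_mono[OF dvd_refl])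
    then show False using n(1) k by (metis power_Suc2)
  qed
  then have "u dvd 1" by (simp add: padic_unit_iff)
  then show ?thesis using u by (rule that)
qed

text \<open>A product of two nonzero elements is a power of \<varpi> times a unit. If it vanished,
  cancelling the power would make 0 a unit.\<close>

instance padic_int :: (prime_card) idom
proof
  fix a b :: "'a padic_int"
  assume a: "a \<noteq> 0" and b: "b \<noteq> 0"
  obtain k u where u: "u dvd 1" "a = \<varpi> ^ k * u" by (rule padic_decompose[OF a])
  obtain l v where v: "v dvd 1" "b = \<varpi> ^ l * v" by (rule padic_decompose[OF b])
  show "a * b \<noteq> 0"
  proof
    assume "a * b = 0"
    moreover have "a * b = \<varpi> ^ (k + l) * (u * v)"
      unfolding u(2) v(2) by (simp only: power_add ac_simps)
    ultimately have "\<varpi> ^ (k + l) * (u * v) = \<varpi> ^ (k + l) * 0" by simp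
    then have "u * v = 0" by (rule uniformizer_mult_cancel)
    moreover have "u * v dvd 1" using mult_dvd_mono[OF u(1) v(1)] by simp
    ultimately show False by simp
  qed
qed

lemma uniformizer_power_dvd_power_iff [simp]:
  "\<varpi> ^ k dvd (\<varpi> ^ l :: 'p::prime_card padic_int) \<longleftrightarrow> k \<le> l"
proof
  assume *: "\<varpi> ^ k dvd (\<varpi> ^ l :: 'p padic_int)"
  show "k \<le> l"
  proof (rule ccontr)
    assume "\<not> k \<le> l"
    then obtain m where "k = l + Suc m" using less_imp_Suc_add[of l k] by auto
    then have "\<varpi> ^ l * \<varpi> ^ Suc m dvd (\<varpi> ^ l * 1 :: 'p padic_int)" using * by (simp add: power_add)
    then have "\<varpi> ^ Suc m dvd (1 :: 'p padic_int)"
      using uniformizer_neq_0[of l, where 'a='p] dvd_mult_cancel_left by blast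
    then show False using uniformizer_not_dvd_1 dvd_mult_left power_Suc by metis
  qed
qed (rule le_imp_power_dvd)

lemma uniformizer_power_eq_iff [simp]:
  "(\<varpi> ^ k :: 'p::prime_card padic_int) = \<varpi> ^ l \<longleftrightarrow> k = l"
  using uniformizer_power_dvd_power_iff[of k l, where 'p='p] uniformizer_power_dvd_power_iff[of l k, where 'p='p]
  by (metis dvd_refl order_antisym)

lemma padic_reduce_eq_0_iff: "padic_reduce x = 0 \<longleftrightarrow> \<varpi> dvd (x :: 'p::prime_card padic_int)"
  unfolding padic_reduce_def uniformizer_dvd_iff
  using padic_residue_bounds[of x 1]
  by (metis of_int_mod_ring_hom.hom_zero power_one_right to_int_mod_ring_hom.hom_zero
      to_int_mod_ring_of_int_mod_ring)

lemma of_int_mod_pcard: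
  "of_int (a mod int CARD('p)) = (of_int a :: 'p::prime_card mod_ring)"
  unfolding of_int_of_int_mod_ring by transfer simp

lemma padic_reduce_eq: "padic_reduce x = of_int (padic_residue x 1)"
  by (simp add: padic_reduce_def of_int_of_int_mod_ring)

lemma padic_reduce_add: "padic_reduce (x + y) = padic_reduce x + padic_reduce y"
  unfolding padic_reduce_eq padic_residue_add power_one_right of_int_mod_pcard by (rule of_int_add)

lemma padic_reduce_mult: "padic_reduce (x * y) = padic_reduce x * padic_reduce y"
  unfolding padic_reduce_eq padic_residue_mult power_one_right of_int_mod_pcard by (rule of_int_mult)

lemma padic_reduce_of_int: "padic_reduce (of_int a) = of_int a"
  by (simp add: padic_reduce_eq padic_residue_of_int of_int_mod_pcard)

lemma padic_reduce_diff: "padic_reduce (x - y) = padic_reduce x - padic_reduce y"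
  using padic_reduce_add[of "x - y" y] by (metis add_diff_cancel diff_add_cancel)

lemma padic_reduce_eq_iff: "padic_reduce x = padic_reduce y \<longleftrightarrow> \<varpi> dvd x - y"
  using padic_reduce_eq_0_iff[of "x - y"] by (simp add: padic_reduce_diff)

lemma padic_reduce_lift: "padic_reduce (of_int (to_int_mod_ring c)) = c"
  by (simp add: padic_reduce_of_int of_int_of_int_mod_ring)

subsection \<open>Block matrices and equivalence of matrices\<close>

lemma mat_mult_assoc:
  fixes A B C :: "'a::semiring_0 mat"
  assumes "dim_col A = dim_row B" "dim_col B = dim_row C"
  shows "A * B * C = A * (B * C)"
  using assms by (intro assoc_mult_mat) (auto intro!: carrier_matI)

definition direct_sum_mat :: "'a::zero mat \<Rightarrow> 'a mat \<Rightarrow> 'a mat" (infixr "\<oplus>\<^sub>m" 66) where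
  "A \<oplus>\<^sub>m B = four_block_mat A (0\<^sub>m (dim_row A) (dim_col B)) (0\<^sub>m (dim_row B) (dim_col A)) B"

text \<open>An empty block row, and in \<open>vcat\<close> an empty block column, makes the product
  rules for juxtaposed matrices instances of \<open>mult_four_block_mat\<close>.\<close>

definition hcat :: "'a::zero mat \<Rightarrow> 'a mat \<Rightarrow> 'a mat" where
  "hcat A B = four_block_mat A B (0\<^sub>m 0 (dim_col A)) (0\<^sub>m 0 (dim_col B))"

definition vcat :: "'a::zero mat \<Rightarrow> 'a mat \<Rightarrow> 'a mat" where
  "vcat A B = four_block_mat A (0\<^sub>m (dim_row A) 0) B (0\<^sub>m (dim_row B) 0)"

lemma dim_direct_sum_mat [simp]:
  "dim_row (A \<oplus>\<^sub>m B) = dim_row A + dim_row B" "dim_col (A \<oplus>\<^sub>m B) = dim_col A + dim_col B"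
  by (simp_all add: direct_sum_mat_def)

lemma direct_sum_mat_carrier [simp]:
  "A \<in> carrier_mat a b \<Longrightarrow> B \<in> carrier_mat c d \<Longrightarrow> A \<oplus>\<^sub>m B \<in> carrier_mat (a + c) (b + d)"
  by (auto intro!: carrier_matI)

lemma direct_sum_mat_mult_carrier:
  fixes A :: "'a::semiring_0 mat"
  assumes "A \<in> carrier_mat a n" "B \<in> carrier_mat b m" "C \<in> carrier_mat n c" "D \<in> carrier_mat m d"
  shows "(A \<oplus>\<^sub>m B) * (C \<oplus>\<^sub>m D) = (A * C) \<oplus>\<^sub>m (B * D)"
proof -
  have "(A \<oplus>\<^sub>m B) * (C \<oplus>\<^sub>m D) =
      four_block_mat A (0\<^sub>m a m) (0\<^sub>m b n) B * four_block_mat C (0\<^sub>m n d) (0\<^sub>m m c) D"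
    using assms by (simp add: direct_sum_mat_def)
  also have "\<dots> = four_block_mat (A * C) (0\<^sub>m a d) (0\<^sub>m b c) (B * D)"
    using assms by (subst mult_four_block_mat[of _ a n _ m _ b _ _ c _ d]) auto
  finally show ?thesis using assms by (simp add: direct_sum_mat_def)
qed

lemma direct_sum_mat_mult:
  fixes A :: "'a::semiring_0 mat"
  assumes "dim_col A = dim_row C" "dim_col B = dim_row D"
  shows "(A \<oplus>\<^sub>m B) * (C \<oplus>\<^sub>m D) = (A * C) \<oplus>\<^sub>m (B * D)"
  using assms by (intro direct_sum_mat_mult_carrier) (auto intro!: carrier_matI)

lemma direct_sum_mat_one [simp]: "1\<^sub>m a \<oplus>\<^sub>m 1\<^sub>m b = 1\<^sub>m (a + b)"
  by (simp add: direct_sum_mat_def)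

lemma direct_sum_mat_add:
  fixes A :: "'a::monoid_add mat"
  assumes "dim_row A = dim_row C" "dim_col A = dim_col C" "dim_row B = dim_row D" "dim_col B = dim_col D"
  shows "(A \<oplus>\<^sub>m B) + (C \<oplus>\<^sub>m D) = (A + C) \<oplus>\<^sub>m (B + D)"
  using assms by (intro eq_matI) (auto simp: direct_sum_mat_def)

lemma direct_sum_mat_smult:
  fixes A :: "'a::semiring_0 mat"
  shows "c \<cdot>\<^sub>m (A \<oplus>\<^sub>m B) = (c \<cdot>\<^sub>m A) \<oplus>\<^sub>m (c \<cdot>\<^sub>m B)"
  by (intro eq_matI) (auto simp: direct_sum_mat_def)

lemma direct_sum_mat_assoc: "A \<oplus>\<^sub>m (B \<oplus>\<^sub>m C) = (A \<oplus>\<^sub>m B) \<oplus>\<^sub>m C"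
  unfolding direct_sum_mat_def by (rule assoc_four_block_mat)

lemma direct_sum_mat_diag:
  "mat_diag a f \<oplus>\<^sub>m mat_diag b g = mat_diag (a + b) (\<lambda>i. if i < a then f i else g (i - a))"
  by (intro eq_matI) (auto simp: direct_sum_mat_def mat_diag_def)

lemma dim_hcat [simp]: "dim_row (hcat A B) = dim_row A" "dim_col (hcat A B) = dim_col A + dim_col B"
  by (simp_all add: hcat_def)

lemma dim_vcat [simp]: "dim_row (vcat A B) = dim_row A + dim_row B" "dim_col (vcat A B) = dim_col A"
  by (simp_all add: vcat_def)

lemma hcat_carrier [simp]:
  "A \<in> carrier_mat n a \<Longrightarrow> B \<in> carrier_mat n b \<Longrightarrow> hcat A B \<in> carrier_mat n (a + b)"
  by (auto intro!: carrier_matI)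

lemma vcat_carrier [simp]:
  "A \<in> carrier_mat a n \<Longrightarrow> B \<in> carrier_mat b n \<Longrightarrow> vcat A B \<in> carrier_mat (a + b) n"
  by (auto intro!: carrier_matI)

lemma hcat_mult_vcat:
  fixes A :: "'a::semiring_0 mat"
  assumes "A \<in> carrier_mat n a" "B \<in> carrier_mat n b" "C \<in> carrier_mat a m" "D \<in> carrier_mat b m"
  shows "hcat A B * vcat C D = A * C + B * D"
proof -
  have "hcat A B * vcat C D = four_block_mat (A * C + B * D) (A * 0\<^sub>m a 0 + B * 0\<^sub>m b 0)
     (0\<^sub>m 0 a * C + 0\<^sub>m 0 b * D) (0\<^sub>m 0 a * 0\<^sub>m a 0 + 0\<^sub>m 0 b * 0\<^sub>m b 0)"
    unfolding hcat_def vcat_def using assms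
    by (subst mult_four_block_mat[of _ n a _ b _ 0 _ _ m _ 0]) auto
  also have "\<dots> = A * C + B * D" using assms by (intro eq_matI) auto
  finally show ?thesis .
qed

lemma mult_hcat:
  fixes A :: "'a::semiring_0 mat"
  assumes "A \<in> carrier_mat n m" "B \<in> carrier_mat m b" "C \<in> carrier_mat m c"
  shows "A * hcat B C = hcat (A * B) (A * C)"
proof -
  have "(A \<oplus>\<^sub>m 0\<^sub>m 0 0) * hcat B C = hcat (A * B) (A * C)"
    unfolding hcat_def direct_sum_mat_def using assms
    by (subst mult_four_block_mat[of _ n m _ 0 _ 0 _ _ b _ c]) auto
  moreover have "A \<oplus>\<^sub>m 0\<^sub>m 0 0 = A" using assms by (intro eq_matI) (auto simp: direct_sum_mat_def)
  ultimately show ?thesis by simp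
qed

lemma vcat_mult:
  fixes A :: "'a::semiring_0 mat"
  assumes "B \<in> carrier_mat b m" "C \<in> carrier_mat c m" "A \<in> carrier_mat m n"
  shows "vcat B C * A = vcat (B * A) (C * A)"
proof -
  have "vcat B C * (A \<oplus>\<^sub>m 0\<^sub>m 0 0) = vcat (B * A) (C * A)"
    unfolding vcat_def direct_sum_mat_def using assms
    by (subst mult_four_block_mat[of _ b m _ 0 _ c _ _ n _ 0]) auto
  moreover have "A \<oplus>\<^sub>m 0\<^sub>m 0 0 = A" using assms by (intro eq_matI) (auto simp: direct_sum_mat_def)
  ultimately show ?thesis by simp
qed

section \<open>Invertible matrices and equivalence\<close>

definition gl :: "nat \<Rightarrow> 'a::semiring_1 mat \<Rightarrow> bool" where
  "gl n U \<longleftrightarrow> U \<in> carrier_mat n n \<and> (\<exists>V\<in>carrier_mat n n. U * V = 1\<^sub>m n \<and> V * U = 1\<^sub>m n)"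

lemma gl_carrier: "gl n U \<Longrightarrow> U \<in> carrier_mat n n"
  by (simp add: gl_def)

lemma gl_inverse:
  assumes "gl n U"
  obtains V where "gl n V" "U * V = 1\<^sub>m n" "V * U = 1\<^sub>m n"
  using assms unfolding gl_def by metis

lemma gl_one [simp]: "gl n (1\<^sub>m n)"
  unfolding gl_def by (auto intro!: bexI[of _ "1\<^sub>m n"])

lemma gl_mult:
  assumes "gl n U" "gl n V" shows "gl n (U * V)"
proof -
  obtain U' where U': "gl n U'" "U * U' = 1\<^sub>m n" "U' * U = 1\<^sub>m n" by (rule gl_inverse[OF assms(1)])
  obtain V' where V': "gl n V'" "V * V' = 1\<^sub>m n" "V' * V = 1\<^sub>m n" by (rule gl_inverse[OF assms(2)])
  note c = gl_carrier[OF assms(1)] gl_carrier[OF assms(2)] gl_carrier[OF U'(1)] gl_carrier[OF V'(1)]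
  have "U * V * (V' * U') = U * ((V * V') * U')" using c by (simp add: mat_mult_assoc)
  also have "\<dots> = 1\<^sub>m n" using c U' V' by simp
  finally have 1: "U * V * (V' * U') = 1\<^sub>m n" .
  have "V' * U' * (U * V) = V' * ((U' * U) * V)" using c by (simp add: mat_mult_assoc)
  also have "\<dots> = 1\<^sub>m n" using c U' V' by simp
  finally have 2: "V' * U' * (U * V) = 1\<^sub>m n" .
  show ?thesis unfolding gl_def
    by (intro conjI bexI[of _ "V' * U'"] 1 2 mult_carrier_mat[of _ n n _ n] c)
qed

lemma gl_direct_sum:
  fixes U :: "'a::semiring_1 mat"
  assumes "gl n U" "gl m V" shows "gl (n + m) (U \<oplus>\<^sub>m V)"
proof -
  obtain U' where U': "gl n U'" "U * U' = 1\<^sub>m n" "U' * U = 1\<^sub>m n" by (rule gl_inverse[OF assms(1)])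
  obtain V' where V': "gl m V'" "V * V' = 1\<^sub>m m" "V' * V = 1\<^sub>m m" by (rule gl_inverse[OF assms(2)])
  note c = gl_carrier[OF assms(1)] gl_carrier[OF assms(2)] gl_carrier[OF U'(1)] gl_carrier[OF V'(1)]
  show ?thesis unfolding gl_def using c U' V'
    by (auto intro!: bexI[of _ "U' \<oplus>\<^sub>m V'"] simp: direct_sum_mat_mult)
qed

definition equiv_mat :: "'a::semiring_1 mat \<Rightarrow> 'a mat \<Rightarrow> bool" where
  "equiv_mat A B \<longleftrightarrow> dim_row A = dim_row B \<and> dim_col A = dim_col B \<and>
     (\<exists>U V. gl (dim_row A) U \<and> gl (dim_col A) V \<and> A = U * B * V)"

lemma equiv_matI:
  assumes "B \<in> carrier_mat n m" "gl n U" "gl m V" "A = U * B * V"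
  shows "equiv_mat A B"
  using assms gl_carrier[OF assms(2)] gl_carrier[OF assms(3)] unfolding equiv_mat_def
  by (intro conjI exI[of _ U] exI[of _ V]) simp_all

lemma equiv_matE:
  assumes "equiv_mat A B" "A \<in> carrier_mat n m"
  obtains U V where "gl n U" "gl m V" "A = U * B * V" "B \<in> carrier_mat n m"
  using assms unfolding equiv_mat_def by (metis carrier_matD carrier_matI)

lemma equiv_mat_dim:
  "equiv_mat A B \<Longrightarrow> dim_row A = dim_row B" "equiv_mat A B \<Longrightarrow> dim_col A = dim_col B"
  by (simp_all add: equiv_mat_def)

lemma equiv_mat_refl [simp]: "equiv_mat A A"
  by (rule equiv_matI[of _ "dim_row A" "dim_col A" "1\<^sub>m (dim_row A)" "1\<^sub>m (dim_col A)"])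
    (simp_all add: left_mult_one_mat[OF carrier_matI] right_mult_one_mat[OF carrier_matI])

lemma equiv_mat_sym:
  assumes "equiv_mat A B" shows "equiv_mat B A"
proof -
  define n m where "n = dim_row A" and "m = dim_col A"
  then have A: "A \<in> carrier_mat n m" by auto
  obtain U V where UV: "gl n U" "gl m V" "A = U * B * V" and B: "B \<in> carrier_mat n m"
    using assms A by (rule equiv_matE)
  obtain U' where U': "gl n U'" "U * U' = 1\<^sub>m n" "U' * U = 1\<^sub>m n" by (rule gl_inverse[OF UV(1)])
  obtain V' where V': "gl m V'" "V * V' = 1\<^sub>m m" "V' * V = 1\<^sub>m m" by (rule gl_inverse[OF UV(2)])
  note c = A B gl_carrier[OF UV(1)] gl_carrier[OF UV(2)] gl_carrier[OF U'(1)] gl_carrier[OF V'(1)]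
  have "U' * A * V' = (U' * U) * B * (V * V')"
    using c unfolding UV(3) by (simp add: mat_mult_assoc)
  then have "B = U' * A * V'" using c U' V' by simp
  then show ?thesis using A U' V' by (intro equiv_matI)
qed

lemma equiv_mat_trans:
  assumes "equiv_mat A B" "equiv_mat B C" shows "equiv_mat A C"
proof -
  define n m where "n = dim_row A" and "m = dim_col A"
  then have A: "A \<in> carrier_mat n m" by auto
  obtain U V where UV: "gl n U" "gl m V" "A = U * B * V" and B: "B \<in> carrier_mat n m"
    using assms(1) A by (rule equiv_matE)
  obtain U' V' where UV': "gl n U'" "gl m V'" "B = U' * C * V'" and C: "C \<in> carrier_mat n m"
    using assms(2) B by (rule equiv_matE)
  have "A = (U * U') * C * (V' * V)"
    unfolding UV(3) UV'(3)
    using C gl_carrier[OF UV(1)] gl_carrier[OF UV(2)] gl_carrier[OF UV'(1)] gl_carrier[OF UV'(2)]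
    by (simp add: mat_mult_assoc)
  then show ?thesis using C UV UV' by (intro equiv_matI) (auto intro: gl_mult)
qed

lemma equiv_mat_smult:
  fixes A :: "'a::comm_ring_1 mat"
  assumes "equiv_mat A B" shows "equiv_mat (c \<cdot>\<^sub>m A) (c \<cdot>\<^sub>m B)"
proof -
  have A: "A \<in> carrier_mat (dim_row A) (dim_col A)" by auto
  obtain U V where UV: "gl (dim_row A) U" "gl (dim_col A) V" "A = U * B * V"
    and B: "B \<in> carrier_mat (dim_row A) (dim_col A)"
    using assms A by (rule equiv_matE)
  note c = gl_carrier[OF UV(1)] gl_carrier[OF UV(2)]
  have "c \<cdot>\<^sub>m A = U * (c \<cdot>\<^sub>m B) * V"
    using B c by (subst UV(3)) (simp add: mult_smult_distrib[OF c(1) B]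
        mult_smult_assoc_mat[OF mult_carrier_mat[OF c(1) B] c(2)])
  then show ?thesis using B UV by (intro equiv_matI) auto
qed

lemma equiv_mat_direct_sum:
  fixes A :: "'a::semiring_1 mat"
  assumes "equiv_mat A B" "equiv_mat C D" shows "equiv_mat (A \<oplus>\<^sub>m C) (B \<oplus>\<^sub>m D)"
proof -
  have A: "A \<in> carrier_mat (dim_row A) (dim_col A)" by auto
  have C: "C \<in> carrier_mat (dim_row C) (dim_col C)" by auto
  obtain U V where UV: "gl (dim_row A) U" "gl (dim_col A) V" "A = U * B * V"
    and B: "B \<in> carrier_mat (dim_row A) (dim_col A)"
    using assms(1) A by (rule equiv_matE)
  obtain U' V' where UV': "gl (dim_row C) U'" "gl (dim_col C) V'" "C = U' * D * V'"
    and D: "D \<in> carrier_mat (dim_row C) (dim_col C)"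
    using assms(2) C by (rule equiv_matE)
  note c = gl_carrier[OF UV(1)] gl_carrier[OF UV(2)] gl_carrier[OF UV'(1)] gl_carrier[OF UV'(2)]
  have "A \<oplus>\<^sub>m C = (U * B * V) \<oplus>\<^sub>m (U' * D * V')"
    by (simp add: UV(3)[symmetric] UV'(3)[symmetric])
  also have "\<dots> = (U \<oplus>\<^sub>m U') * (B \<oplus>\<^sub>m D) * (V \<oplus>\<^sub>m V')"
    using B D c by (simp add: direct_sum_mat_mult)
  finally show ?thesis using B D UV UV'
    by (intro equiv_matI[of _ _ _ "U \<oplus>\<^sub>m U'" "V \<oplus>\<^sub>m V'"]) (auto intro: gl_direct_sum)
qed

subsection \<open>Smith normal form over the p-adic integers\<close>

lemma equiv_mat_swap_corner:
  fixes M :: "'a::comm_ring_1 mat"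
  assumes M: "M \<in> carrier_mat n m" and ij: "i < n" "j < m"
  obtains M' where "equiv_mat M M'" "M' $$ (0, 0) = M $$ (i, j)"
proof -
  let ?R = "swaprows_mat n 0 i :: 'a mat" and ?C = "swaprows_mat m 0 j :: 'a mat"
  let ?M = "?R * M * ?C"
  have "swapcols 0 j (swaprows 0 i M) = ?M"
    using M ij by (subst swapcols_mat[of _ n]) (auto simp: swaprows_mat[OF M])
  moreover have "swapcols 0 j (swaprows 0 i M) $$ (0, 0) = M $$ (i, j)"
    using M ij by (cases "j = 0"; cases "i = 0") (simp_all add: mat_swapcols_def)
  moreover have "gl n ?R" using ij swaprows_mat_inv[of 0 n i, where 'a='a] unfolding gl_def
    by (auto intro!: bexI[of _ ?R])
  moreover have "gl m ?C" using ij swaprows_mat_inv[of 0 m j, where 'a='a] unfolding gl_def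
    by (auto intro!: bexI[of _ ?C])
  ultimately show ?thesis
    using that[of ?M] equiv_mat_sym[OF equiv_matI[OF M, of ?R ?C ?M]] by metis
qed

text \<open>Block elimination with explicit factors: the matrix is \<open>?L\<close>, lower
  triangular with diagonal blocks \<open>S\<close> and 1, times the direct sum, times
  \<open>?R\<close>, upper unitriangular with corner \<open>S' * B\<close>. The inverses
  \<open>?L'\<close> and \<open>?R'\<close> are written down and checked block by block.\<close>

lemma equiv_mat_schur_complement:
  fixes S :: "'a::comm_ring_1 mat"
  assumes S: "S \<in> carrier_mat k k" and S': "S' \<in> carrier_mat k k"
    and inv: "S * S' = 1\<^sub>m k" "S' * S = 1\<^sub>m k"
    and B: "B \<in> carrier_mat k m" and C: "C \<in> carrier_mat n k" and D: "D \<in> carrier_mat n m"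
  shows "equiv_mat (four_block_mat S B C D) (1\<^sub>m k \<oplus>\<^sub>m (D - C * (S' * B)))"
proof -
  define E where "E = D - C * (S' * B)"
  have E: "E \<in> carrier_mat n m" using C S' B unfolding E_def by (intro minus_carrier_mat mult_carrier_mat)
  have SB: "S' * B \<in> carrier_mat k m" and CS: "C * S' \<in> carrier_mat n k"
    using S' B C by auto
  have CSB: "C * (S' * B) \<in> carrier_mat n m" using C SB by auto
  have neg: "- (S' * B) \<in> carrier_mat k m" "- (C * S') \<in> carrier_mat n k"
    using SB CS by auto
  let ?L = "four_block_mat S (0\<^sub>m k n) C (1\<^sub>m n)"
  let ?R = "four_block_mat (1\<^sub>m k) (S' * B) (0\<^sub>m m k) (1\<^sub>m m)"
  let ?L' = "four_block_mat S' (0\<^sub>m k n) (- (C * S')) (1\<^sub>m n)"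
  let ?R' = "four_block_mat (1\<^sub>m k) (- (S' * B)) (0\<^sub>m m k) (1\<^sub>m m)"
  have "?L * (1\<^sub>m k \<oplus>\<^sub>m E) = four_block_mat S (0\<^sub>m k m) C E"
    unfolding direct_sum_mat_def using S C E
    by (subst mult_four_block_mat[of _ k k _ n _ n _ _ k _ m]) auto
  then have LER: "?L * (1\<^sub>m k \<oplus>\<^sub>m E) * ?R
      = four_block_mat S (S * (S' * B)) C (C * (S' * B) + E)"
    using S C E SB CSB by (simp, subst mult_four_block_mat[of _ k k _ m _ n _ _ k _ m]) auto
  have SSB: "S * (S' * B) = B"
    using S S' B inv(1) by (simp add: mat_mult_assoc[symmetric])
  have CE: "C * (S' * B) + E = D"
  proof (rule eq_matI)
    fix i j assume "i < dim_row D" "j < dim_col D"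
    then show "(C * (S' * B) + E) $$ (i, j) = D $$ (i, j)"
      unfolding E_def using C B S' D by simp
  qed (use C E D CSB in auto)
  have eqM: "four_block_mat S B C D = ?L * (1\<^sub>m k \<oplus>\<^sub>m E) * ?R"
    unfolding LER SSB CE by (rule refl)
  have "?L * ?L' = four_block_mat (S * S' + 0\<^sub>m k n * - (C * S')) (S * 0\<^sub>m k n + 0\<^sub>m k n * 1\<^sub>m n)
      (C * S' + 1\<^sub>m n * - (C * S')) (C * 0\<^sub>m k n + 1\<^sub>m n * 1\<^sub>m n)"
    by (rule mult_four_block_mat[OF S zero_carrier_mat C one_carrier_mat S' zero_carrier_mat neg(2) one_carrier_mat])
  also have "\<dots> = four_block_mat (1\<^sub>m k) (0\<^sub>m k n) (0\<^sub>m n k) (1\<^sub>m n)"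
    by (intro cong_four_block_mat)
      (use S S' C neg in \<open>simp_all add: inv(1) left_mult_one_mat[OF neg(2)] add_uminus_minus_mat[OF CS CS] minus_r_inv_mat[OF CS]
        left_mult_zero_mat[OF neg(2)] del: uminus_mult_right_mat\<close>)
  finally have LL': "?L * ?L' = 1\<^sub>m (k + n)" by simp
  have "- (C * S') * S = - (C * (S' * S))"
    using S S' C by (simp add: mat_mult_assoc)
  then have CSS: "- (C * S') * S = - C" using C by (simp add: inv(2))
  have "?L' * ?L = four_block_mat (S' * S + 0\<^sub>m k n * C) (S' * 0\<^sub>m k n + 0\<^sub>m k n * 1\<^sub>m n)
      (- (C * S') * S + 1\<^sub>m n * C) (- (C * S') * 0\<^sub>m k n + 1\<^sub>m n * 1\<^sub>m n)"
    by (rule mult_four_block_mat[OF S' zero_carrier_mat neg(2) one_carrier_mat S zero_carrier_mat C one_carrier_mat])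
  also have "\<dots> = four_block_mat (1\<^sub>m k) (0\<^sub>m k n) (0\<^sub>m n k) (1\<^sub>m n)"
    unfolding CSS by (intro cong_four_block_mat)
      (use S' C neg in \<open>simp_all add: inv(2) uminus_l_inv_mat[OF C] right_mult_zero_mat[OF neg(2)]
        del: uminus_mult_left_mat\<close>)
  finally have L'L: "?L' * ?L = 1\<^sub>m (k + n)" by simp
  have glL: "gl (k + n) ?L" unfolding gl_def using S S' C CS LL' L'L
    by (intro conjI bexI[of _ ?L']) (auto intro!: carrier_matI)
  have "?R * ?R' = four_block_mat (1\<^sub>m k * 1\<^sub>m k + S' * B * 0\<^sub>m m k) (1\<^sub>m k * - (S' * B) + S' * B * 1\<^sub>m m)
      (0\<^sub>m m k * 1\<^sub>m k + 1\<^sub>m m * 0\<^sub>m m k) (0\<^sub>m m k * - (S' * B) + 1\<^sub>m m * 1\<^sub>m m)"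
    by (rule mult_four_block_mat[OF one_carrier_mat SB zero_carrier_mat one_carrier_mat one_carrier_mat neg(1) zero_carrier_mat one_carrier_mat])
  also have "\<dots> = four_block_mat (1\<^sub>m k) (0\<^sub>m k m) (0\<^sub>m m k) (1\<^sub>m m)"
    by (intro cong_four_block_mat)
      (use neg in \<open>simp_all add: left_mult_one_mat[OF neg(1)] right_mult_one_mat[OF SB] uminus_l_inv_mat[OF SB]
        right_mult_zero_mat[OF SB] left_mult_zero_mat[OF neg(1)] del: uminus_mult_right_mat\<close>)
  finally have RR': "?R * ?R' = 1\<^sub>m (k + m)" by simp
  have "?R' * ?R = four_block_mat (1\<^sub>m k * 1\<^sub>m k + - (S' * B) * 0\<^sub>m m k) (1\<^sub>m k * (S' * B) + - (S' * B) * 1\<^sub>m m)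
      (0\<^sub>m m k * 1\<^sub>m k + 1\<^sub>m m * 0\<^sub>m m k) (0\<^sub>m m k * (S' * B) + 1\<^sub>m m * 1\<^sub>m m)"
    by (rule mult_four_block_mat[OF one_carrier_mat neg(1) zero_carrier_mat one_carrier_mat one_carrier_mat SB zero_carrier_mat one_carrier_mat])
  also have "\<dots> = four_block_mat (1\<^sub>m k) (0\<^sub>m k m) (0\<^sub>m m k) (1\<^sub>m m)"
    by (intro cong_four_block_mat)
      (use neg in \<open>simp_all add: left_mult_one_mat[OF SB] right_mult_one_mat[OF neg(1)] add_uminus_minus_mat[OF SB SB]
        minus_r_inv_mat[OF SB] right_mult_zero_mat[OF neg(1)] left_mult_zero_mat[OF SB] del: uminus_mult_left_mat\<close>)
  finally have R'R: "?R' * ?R = 1\<^sub>m (k + m)" by simp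
  have glR: "gl (k + m) ?R" unfolding gl_def using SB neg RR' R'R
    by (intro conjI bexI[of _ ?R']) (auto intro!: carrier_matI)
  show ?thesis
    using E unfolding E_def[symmetric] by (intro equiv_matI[OF _ glL glR eqM]) simp
qed

text \<open>The unit is moved to the corner and eliminated by a Schur complement with a block of
  size 1. Both normal forms below are iterations of this step.\<close>

lemma equiv_mat_unit_pivot:
  fixes M :: "'a::comm_ring_1 mat"
  assumes M: "M \<in> carrier_mat (Suc n) (Suc m)"
    and ij: "i < Suc n" "j < Suc m" and u: "M $$ (i, j) dvd 1"
  obtains E where "E \<in> carrier_mat n m" "equiv_mat M (1\<^sub>m 1 \<oplus>\<^sub>m E)"
proof -
  obtain M' where eq: "equiv_mat M M'" and M'00: "M' $$ (0, 0) = M $$ (i, j)"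
    by (rule equiv_mat_swap_corner[OF M ij])
  have M': "M' \<in> carrier_mat (Suc n) (Suc m)"
    using M equiv_mat_dim[OF eq] by (metis carrier_matD carrier_matI)
  obtain b where b: "M' $$ (0, 0) * b = 1" using u unfolding M'00 by (metis dvdE)
  define S where "S = mat 1 1 (\<lambda>_. M' $$ (0, 0))"
  define S' where "S' = mat 1 1 (\<lambda>_. b)"
  define B where "B = mat 1 m (\<lambda>(i, j). M' $$ (0, Suc j))"
  define C where "C = mat n 1 (\<lambda>(i, j). M' $$ (Suc i, 0))"
  define D where "D = mat n m (\<lambda>(i, j). M' $$ (Suc i, Suc j))"
  have c: "S \<in> carrier_mat 1 1" "S' \<in> carrier_mat 1 1" "B \<in> carrier_mat 1 m"
    "C \<in> carrier_mat n 1" "D \<in> carrier_mat n m"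
    by (simp_all add: S_def S'_def B_def C_def D_def)
  have inv: "S * S' = 1\<^sub>m 1" "S' * S = 1\<^sub>m 1" using b unfolding S_def S'_def
    by (auto intro!: eq_matI simp: scalar_prod_def mult.commute)
  have "M' = four_block_mat S B C D"
  proof (rule eq_matI)
    fix i j assume "i < dim_row (four_block_mat S B C D)" "j < dim_col (four_block_mat S B C D)"
    then show "M' $$ (i, j) = four_block_mat S B C D $$ (i, j)"
      by (cases i; cases j) (auto simp: S_def B_def C_def D_def)
  qed (use M' in \<open>auto simp: S_def D_def\<close>)
  then have "equiv_mat M' (1\<^sub>m 1 \<oplus>\<^sub>m (D - C * (S' * B)))"
    using equiv_mat_schur_complement[OF c(1,2) inv c(3-5)] by simp
  moreover have "D - C * (S' * B) \<in> carrier_mat n m"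
    using c by (intro minus_carrier_mat mult_carrier_mat)
  ultimately show ?thesis using that equiv_mat_trans[OF eq] by blast
qed

lemma uniformizer_neq_zero [simp]: "\<varpi> \<noteq> 0"
  using uniformizer_neq_0[of 1] by simp

text \<open>Representatives of the elements up to units, with 0 as the power of infinite exponent.
  Two of them are equal as soon as they are divisible by the same powers of \<varpi>.\<close>

definition p_power :: "'p::prime_card padic_int \<Rightarrow> bool" where
  "p_power x \<longleftrightarrow> x = 0 \<or> (\<exists>k. x = \<varpi> ^ k)"

lemma mat_all_dvd_smult:
  fixes M :: "'a::comm_semiring_1 mat"
  assumes "M \<in> carrier_mat n m" "\<And>i j. i < n \<Longrightarrow> j < m \<Longrightarrow> c dvd M $$ (i, j)"
  obtains E where "E \<in> carrier_mat n m" "M = c \<cdot>\<^sub>m E"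
proof -
  have "\<exists>e. \<forall>i<n. \<forall>j<m. M $$ (i, j) = c * e i j"
    using assms(2) unfolding dvd_def by metis
  then obtain e where e: "\<And>i j. i < n \<Longrightarrow> j < m \<Longrightarrow> M $$ (i, j) = c * e i j" by blast
  show ?thesis
    by (rule that[of "mat n m (\<lambda>(i, j). e i j)"]) (use assms(1) e in \<open>auto intro!: eq_matI\<close>)
qed

text \<open>The exponent k is the least valuation among the entries. It is found as the predecessor
  of the least l such that \<varpi>^l fails to divide some entry; that entry becomes the
  unit.\<close>

lemma padic_mat_min_valuation:
  fixes M :: "'p::prime_card padic_int mat"
  assumes M: "M \<in> carrier_mat n m" and ne: "M \<noteq> 0\<^sub>m n m"
  obtains k M' i j where "M' \<in> carrier_mat n m" "M = \<varpi> ^ k \<cdot>\<^sub>m M'" "i < n" "j < m" "M' $$ (i, j) dvd 1"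
proof -
  define P where "P k \<longleftrightarrow> (\<exists>i<n. \<exists>j<m. \<not> \<varpi> ^ k dvd M $$ (i, j))" for k
  obtain i j where ij: "i < n" "j < m" "M $$ (i, j) \<noteq> 0"
    using M ne by (auto simp: mat_eq_iff)
  obtain k u where "u dvd 1" "M $$ (i, j) = \<varpi> ^ k * u" by (rule padic_decompose[OF ij(3)])
  then have "\<not> \<varpi> ^ Suc k dvd M $$ (i, j)"
    using padic_unit_iff[of u] by (simp add: mult.commute[of \<varpi>])
  then have "P (Suc k)" using ij unfolding P_def by blast
  then obtain l where l: "P l" "\<And>l'. l' < l \<Longrightarrow> \<not> P l'"
    using exists_least_iff[of P] by blast
  have "\<not> P 0" by (simp add: P_def)
  then obtain k' where k': "l = Suc k'" using l(1) by (cases l) auto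
  have "\<varpi> ^ k' dvd M $$ (i, j)" if "i < n" "j < m" for i j
    using l(2)[of k'] k' that unfolding P_def by blast
  then obtain M' where M': "M' \<in> carrier_mat n m" "M = \<varpi> ^ k' \<cdot>\<^sub>m M'"
    by (rule mat_all_dvd_smult[OF M])
  obtain i' j' where ij': "i' < n" "j' < m" "\<not> \<varpi> ^ l dvd M $$ (i', j')"
    using l(1) unfolding P_def by blast
  then have "\<not> \<varpi> dvd M' $$ (i', j')"
    using M' by (auto simp: k' mult.commute[of \<varpi>])
  then show ?thesis using that[OF M' ij'(1,2)] by (simp add: padic_unit_iff)
qed

definition rect_diag :: "nat \<Rightarrow> nat \<Rightarrow> (nat \<Rightarrow> 'a) \<Rightarrow> 'a::zero mat" where
  "rect_diag n m f = mat n m (\<lambda>(i, j). if i = j then f i else 0)"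

lemma rect_diag_carrier [simp]: "rect_diag n m f \<in> carrier_mat n m"
  by (simp add: rect_diag_def)

lemma dim_rect_diag [simp]: "dim_row (rect_diag n m f) = n" "dim_col (rect_diag n m f) = m"
  by (simp_all add: rect_diag_def)

lemma rect_diag_square: "rect_diag n n f = mat_diag n f"
  by (intro eq_matI) (auto simp: rect_diag_def mat_diag_def)

text \<open>Dividing by the least valuation leaves a unit to pivot on. The factor \<varpi>^k is put
  back before the recursion, since the complement of \<open>\<varpi> ^ k \<cdot>\<^sub>m M'\<close>
  is the complement of \<open>M'\<close> times the same factor. The order of the diagonal entries is
  left open because later arguments only count entries of each valuation.\<close>

theorem smith_normal_form:
  fixes M :: "'p::prime_card padic_int mat"
  assumes "M \<in> carrier_mat n m"
  obtains f where "\<And>i. p_power (f i)" "equiv_mat M (rect_diag n m f)"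
proof -
  have "\<exists>f. (\<forall>i. p_power (f i)) \<and> equiv_mat M (rect_diag n m f)"
    using assms
  proof (induction n arbitrary: m M)
    case 0
    then have "M = rect_diag 0 m (\<lambda>_. 0)" by (intro eq_matI) auto
    then show ?case by (intro exI[of _ "\<lambda>_. 0"]) (auto simp: p_power_def)
  next
    case (Suc n)
    show ?case
    proof (cases "M = 0\<^sub>m (Suc n) m")
      case True
      then have "M = rect_diag (Suc n) m (\<lambda>_. 0)" by (intro eq_matI) (auto simp: rect_diag_def)
      then show ?thesis by (intro exI[of _ "\<lambda>_. 0"]) (auto simp: p_power_def)
    next
      case False
      obtain k M' i j where M': "M' \<in> carrier_mat (Suc n) m" "M = \<varpi> ^ k \<cdot>\<^sub>m M'"
        and ij: "i < Suc n" "j < m" and u: "M' $$ (i, j) dvd 1"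
        by (rule padic_mat_min_valuation[OF Suc.prems False])
      obtain m' where m: "m = Suc m'" using ij(2) by (cases m) auto
      obtain E where E: "E \<in> carrier_mat n m'" "equiv_mat M' (1\<^sub>m 1 \<oplus>\<^sub>m E)"
        using M'(1) ij u unfolding m by (rule equiv_mat_unit_pivot)
      obtain f where f: "\<And>i. p_power (f i)" "equiv_mat (\<varpi> ^ k \<cdot>\<^sub>m E) (rect_diag n m' f)"
        using Suc.IH[of "\<varpi> ^ k \<cdot>\<^sub>m E" m'] E(1) by auto
      define g where "g i = (case i of 0 \<Rightarrow> \<varpi> ^ k | Suc i \<Rightarrow> f i)" for i
      have "equiv_mat M (\<varpi> ^ k \<cdot>\<^sub>m (1\<^sub>m 1 \<oplus>\<^sub>m E))"
        unfolding M'(2) by (rule equiv_mat_smult[OF E(2)])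
      also have "\<varpi> ^ k \<cdot>\<^sub>m (1\<^sub>m 1 \<oplus>\<^sub>m E) = (\<varpi> ^ k \<cdot>\<^sub>m 1\<^sub>m 1) \<oplus>\<^sub>m (\<varpi> ^ k \<cdot>\<^sub>m E)"
        by (rule direct_sum_mat_smult)
      finally have "equiv_mat M ((\<varpi> ^ k \<cdot>\<^sub>m 1\<^sub>m 1) \<oplus>\<^sub>m (\<varpi> ^ k \<cdot>\<^sub>m E))" .
      then have "equiv_mat M ((\<varpi> ^ k \<cdot>\<^sub>m 1\<^sub>m 1) \<oplus>\<^sub>m rect_diag n m' f)"
        by (rule equiv_mat_trans[OF _ equiv_mat_direct_sum[OF equiv_mat_refl f(2)]])
      moreover have "(\<varpi> ^ k \<cdot>\<^sub>m 1\<^sub>m 1) \<oplus>\<^sub>m rect_diag n m' f = rect_diag (Suc n) m g"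
        unfolding m by (intro eq_matI) (auto simp: direct_sum_mat_def rect_diag_def g_def split: nat.splits)
      moreover have "p_power (g i)" for i
        using f(1) by (auto simp: g_def p_power_def split: nat.splits)
      ultimately show ?thesis by auto
    qed
  qed
  then show ?thesis using that by blast
qed

text \<open>Unit pivots are split off as long as one exists. When none is left every entry is
  divisible by \<varpi>, which supplies the factor in front of \<open>E\<close>.\<close>

lemma equiv_mat_unit_block:
  fixes M :: "'p::prime_card padic_int mat"
  assumes "M \<in> carrier_mat n m"
  obtains g E where "g \<le> n" "g \<le> m" "E \<in> carrier_mat (n - g) (m - g)"
    "equiv_mat M (1\<^sub>m g \<oplus>\<^sub>m (\<varpi> \<cdot>\<^sub>m E))"
proof -
  have "\<exists>g E. g \<le> n \<and> g \<le> m \<and> E \<in> carrier_mat (n - g) (m - g) \<and> equiv_mat M (1\<^sub>m g \<oplus>\<^sub>m (\<varpi> \<cdot>\<^sub>m E))"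
    using assms
  proof (induction n arbitrary: m M)
    case 0
    then have "M = 1\<^sub>m 0 \<oplus>\<^sub>m (\<varpi> \<cdot>\<^sub>m 0\<^sub>m 0 m)" by (intro eq_matI) auto
    then show ?case by (intro exI[of _ 0] exI[of _ "0\<^sub>m 0 m"]) auto
  next
    case (Suc n)
    show ?case
    proof (cases "\<forall>i<Suc n. \<forall>j<m. \<varpi> dvd M $$ (i, j)")
      case True
      then obtain E where E: "E \<in> carrier_mat (Suc n) m" "M = \<varpi> \<cdot>\<^sub>m E"
        using mat_all_dvd_smult[OF Suc.prems] by blast
      then have "M = 1\<^sub>m 0 \<oplus>\<^sub>m (\<varpi> \<cdot>\<^sub>m E)" by (intro eq_matI) (auto simp: direct_sum_mat_def)
      then show ?thesis using E(1) by (intro exI[of _ 0] exI[of _ E]) auto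
    next
      case False
      then obtain i j where ij: "i < Suc n" "j < m" and u: "M $$ (i, j) dvd 1"
        by (auto simp: padic_unit_iff)
      obtain m' where m: "m = Suc m'" using ij(2) by (cases m) auto
      obtain F where F: "F \<in> carrier_mat n m'" "equiv_mat M (1\<^sub>m 1 \<oplus>\<^sub>m F)"
        using Suc.prems ij u unfolding m by (rule equiv_mat_unit_pivot)
      obtain g E where gE: "g \<le> n" "g \<le> m'" "E \<in> carrier_mat (n - g) (m' - g)"
        "equiv_mat F (1\<^sub>m g \<oplus>\<^sub>m (\<varpi> \<cdot>\<^sub>m E))"
        using Suc.IH[OF F(1)] by blast
      have "equiv_mat M (1\<^sub>m 1 \<oplus>\<^sub>m (1\<^sub>m g \<oplus>\<^sub>m (\<varpi> \<cdot>\<^sub>m E)))"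
        by (rule equiv_mat_trans[OF F(2) equiv_mat_direct_sum[OF equiv_mat_refl gE(4)]])
      then have "equiv_mat M (1\<^sub>m (1 + g) \<oplus>\<^sub>m (\<varpi> \<cdot>\<^sub>m E))"
        by (simp only: direct_sum_mat_assoc direct_sum_mat_one)
      then show ?thesis using gE(1-3) unfolding m
        by (intro exI[of _ "1 + g"] exI[of _ E]) auto
    qed
  qed
  then show ?thesis using that by blast
qed

subsection \<open>Congruence of matrices and rank modulo powers of the uniformizer\<close>

definition cong_mat :: "nat \<Rightarrow> 'p::prime_card padic_int mat \<Rightarrow> 'p padic_int mat \<Rightarrow> bool" where
  "cong_mat k A B \<longleftrightarrow> dim_row A = dim_row B \<and> dim_col A = dim_col B \<and>
     (\<forall>i<dim_row B. \<forall>j<dim_col B. \<varpi> ^ k dvd A $$ (i, j) - B $$ (i, j))"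

lemma cong_mat_dim:
  "cong_mat k A B \<Longrightarrow> dim_row A = dim_row B" "cong_mat k A B \<Longrightarrow> dim_col A = dim_col B"
  by (simp_all add: cong_mat_def)

lemma cong_matI:
  assumes "A \<in> carrier_mat n m" "B \<in> carrier_mat n m"
    "\<And>i j. i < n \<Longrightarrow> j < m \<Longrightarrow> \<varpi> ^ k dvd A $$ (i, j) - B $$ (i, j)"
  shows "cong_mat k A B"
  using assms by (simp add: cong_mat_def)

lemma cong_matD:
  "cong_mat k A B \<Longrightarrow> i < dim_row B \<Longrightarrow> j < dim_col B \<Longrightarrow> \<varpi> ^ k dvd A $$ (i, j) - B $$ (i, j)"
  by (simp add: cong_mat_def)

lemma cong_mat_refl [simp]: "cong_mat k A A"
  by (simp add: cong_mat_def)

lemma cong_mat_sym: "cong_mat k A B \<Longrightarrow> cong_mat k B A"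
  unfolding cong_mat_def by (metis dvd_minus_iff minus_diff_eq)

lemma cong_mat_trans:
  assumes "cong_mat k A B" "cong_mat k B C" shows "cong_mat k A C"
proof (rule cong_matI[of _ "dim_row C" "dim_col C"])
  fix i j assume "i < dim_row C" "j < dim_col C"
  then have "\<varpi> ^ k dvd (A $$ (i, j) - B $$ (i, j)) + (B $$ (i, j) - C $$ (i, j))"
    using assms by (intro dvd_add cong_matD) (auto simp: cong_mat_def)
  then show "\<varpi> ^ k dvd A $$ (i, j) - C $$ (i, j)" by simp
qed (use assms in \<open>auto simp: cong_mat_def intro!: carrier_matI\<close>)

lemma cong_mat_le:
  assumes "cong_mat k A B" "l \<le> k" shows "cong_mat l A B"
  using assms dvd_trans[OF le_imp_power_dvd] unfolding cong_mat_def by blast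

lemma cong_mat_add:
  assumes "cong_mat k A B" "cong_mat k C D" "dim_row A = dim_row C" "dim_col A = dim_col C"
  shows "cong_mat k (A + C) (B + D)"
proof (rule cong_matI[of _ "dim_row D" "dim_col D"])
  fix i j assume "i < dim_row D" "j < dim_col D"
  moreover from this have "\<varpi> ^ k dvd (A $$ (i, j) - B $$ (i, j)) + (C $$ (i, j) - D $$ (i, j))"
    using assms by (intro dvd_add cong_matD) (auto simp: cong_mat_def)
  ultimately show "\<varpi> ^ k dvd (A + C) $$ (i, j) - (B + D) $$ (i, j)"
    using assms by (simp add: cong_mat_def algebra_simps)
qed (use assms in \<open>auto simp: cong_mat_def intro!: carrier_matI\<close>)

lemma cong_mat_smult:
  assumes "cong_mat k A B" shows "cong_mat k (c \<cdot>\<^sub>m A) (c \<cdot>\<^sub>m B)"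
  using assms unfolding cong_mat_def by (auto simp flip: right_diff_distrib)

lemma cong_mat_mult:
  assumes "cong_mat k A B" "cong_mat k C D" "dim_col A = dim_row C"
  shows "cong_mat k (A * C) (B * D)"
proof (rule cong_matI[of _ "dim_row B" "dim_col D"])
  fix i j assume i: "i < dim_row B" and j: "j < dim_col D"
  let ?n = "dim_row D"
  have d: "dim_col A = ?n" "dim_col B = ?n" "dim_row C = ?n" "dim_row A = dim_row B" "dim_col C = dim_col D"
    using assms by (auto simp: cong_mat_def)
  have "(A * C) $$ (i, j) - (B * D) $$ (i, j)
     = (\<Sum>l = 0..<?n. A $$ (i, l) * C $$ (l, j)) - (\<Sum>l = 0..<?n. B $$ (i, l) * D $$ (l, j))"
    using i j d by (simp add: scalar_prod_def)
  also have "\<dots> = (\<Sum>l = 0..<?n. (A $$ (i, l) - B $$ (i, l)) * C $$ (l, j)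
      + B $$ (i, l) * (C $$ (l, j) - D $$ (l, j)))"
    unfolding sum_subtractf[symmetric] by (intro sum.cong) (auto simp: algebra_simps)
  also have "\<varpi> ^ k dvd \<dots>"
    using i j d assms(1,2) by (intro dvd_sum dvd_add dvd_mult dvd_mult2 cong_matD) auto
  finally show "\<varpi> ^ k dvd (A * C) $$ (i, j) - (B * D) $$ (i, j)" .
qed (use assms in \<open>auto simp: cong_mat_def intro!: carrier_matI\<close>)

lemma cong_mat_iff:
  assumes "A \<in> carrier_mat n m" "B \<in> carrier_mat n m"
  shows "cong_mat k A B \<longleftrightarrow> (\<exists>E\<in>carrier_mat n m. A = B + \<varpi> ^ k \<cdot>\<^sub>m E)"
proof
  assume c: "cong_mat k A B"
  then have "\<varpi> ^ k dvd (A - B) $$ (i, j)" if "i < n" "j < m" for i j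
    using assms that cong_matD[OF c] by simp
  then obtain E where E: "E \<in> carrier_mat n m" "A - B = \<varpi> ^ k \<cdot>\<^sub>m E"
    using mat_all_dvd_smult[OF minus_carrier_mat[OF assms(2)]] by blast
  have "A = B + (A - B)" using assms by (intro eq_matI) auto
  then show "\<exists>E\<in>carrier_mat n m. A = B + \<varpi> ^ k \<cdot>\<^sub>m E" using E by metis
next
  assume "\<exists>E\<in>carrier_mat n m. A = B + \<varpi> ^ k \<cdot>\<^sub>m E"
  then show "cong_mat k A B" using assms by (auto simp: cong_mat_def)
qed

section \<open>Rank modulo a power of the uniformizer\<close>

text \<open>Modulo \<varpi>^k there are zero divisors, so row rank, column rank and minors no longer
  agree. With inner dimensions, invariance under equivalence, subadditivity and monotonicity under
  products are immediate; the price is that lower bounds need an argument, given in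
  \<open>uniformizer_scalar_factor\<close>.\<close>

definition prank :: "nat \<Rightarrow> 'p::prime_card padic_int mat \<Rightarrow> nat" where
  "prank k M = (LEAST t. \<exists>X\<in>carrier_mat (dim_row M) t. \<exists>Y\<in>carrier_mat t (dim_col M). cong_mat k M (X * Y))"

lemma prank_le:
  assumes "X \<in> carrier_mat n t" "Y \<in> carrier_mat t m" "cong_mat k M (X * Y)"
  shows "prank k M \<le> t"
proof -
  have "dim_row M = n" "dim_col M = m" using assms by (auto simp: cong_mat_def)
  then show ?thesis unfolding prank_def using assms by (intro Least_le bexI[of _ X] bexI[of _ Y]) auto
qed

lemma prank_factor:
  assumes "M \<in> carrier_mat n m"
  obtains X Y where "X \<in> carrier_mat n (prank k M)" "Y \<in> carrier_mat (prank k M) m" "cong_mat k M (X * Y)"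
proof -
  let ?P = "\<lambda>t. \<exists>X\<in>carrier_mat (dim_row M) t. \<exists>Y\<in>carrier_mat t (dim_col M). cong_mat k M (X * Y)"
  have "?P m"
    using assms by (intro bexI[of _ M] bexI[of _ "1\<^sub>m m"]) auto
  then have "?P (prank k M)" unfolding prank_def by (rule LeastI)
  then show ?thesis using that assms by auto
qed

lemma prank_cong:
  assumes "cong_mat k A B" shows "prank k A = prank k B"
proof -
  have "cong_mat k A C \<longleftrightarrow> cong_mat k B C" for C
    using assms cong_mat_sym cong_mat_trans by blast
  then show ?thesis using cong_mat_dim[OF assms] by (simp add: prank_def)
qed

lemma prank_mult_right:
  assumes "A \<in> carrier_mat n m" "B \<in> carrier_mat m q"
  shows "prank k (A * B) \<le> prank k A"
proof -
  obtain X Y where XY: "X \<in> carrier_mat n (prank k A)" "Y \<in> carrier_mat (prank k A) m"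
    "cong_mat k A (X * Y)" by (rule prank_factor[OF assms(1)])
  have "cong_mat k (A * B) (X * (Y * B))"
    using cong_mat_mult[OF XY(3) cong_mat_refl[of k B]] XY assms by (simp add: mat_mult_assoc)
  then show ?thesis using XY assms by (intro prank_le) auto
qed

lemma prank_mult_left:
  assumes "A \<in> carrier_mat n m" "B \<in> carrier_mat m q"
  shows "prank k (A * B) \<le> prank k B"
proof -
  obtain X Y where XY: "X \<in> carrier_mat m (prank k B)" "Y \<in> carrier_mat (prank k B) q"
    "cong_mat k B (X * Y)" by (rule prank_factor[OF assms(2)])
  have "cong_mat k (A * B) ((A * X) * Y)"
    using cong_mat_mult[OF cong_mat_refl[of k A] XY(3)] XY assms by (simp add: mat_mult_assoc)
  then show ?thesis using XY assms by (intro prank_le[of "A * X"]) auto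
qed

lemma prank_equiv:
  fixes A B :: "'p::prime_card padic_int mat"
  assumes "equiv_mat A B" shows "prank k A = prank k B"
proof -
  have le: "prank k A \<le> prank k B" if e: "equiv_mat A B" for A B :: "'p padic_int mat"
  proof -
    have A: "A \<in> carrier_mat (dim_row A) (dim_col A)" by auto
    obtain U V where UV: "gl (dim_row A) U" "gl (dim_col A) V" "A = U * B * V"
      and B: "B \<in> carrier_mat (dim_row A) (dim_col A)"
      using e A by (rule equiv_matE)
    have "prank k (U * B * V) \<le> prank k (U * B)"
      using B gl_carrier[OF UV(1)] gl_carrier[OF UV(2)] by (intro prank_mult_right) auto
    also have "\<dots> \<le> prank k B"
      using B gl_carrier[OF UV(1)] by (rule prank_mult_left[rotated])
    finally show ?thesis unfolding UV(3)[symmetric] .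
  qed
  show ?thesis using le[OF assms] le[OF equiv_mat_sym[OF assms]] by simp
qed

lemma prank_add:
  assumes "A \<in> carrier_mat n m" "B \<in> carrier_mat n m"
  shows "prank k (A + B) \<le> prank k A + prank k B"
proof -
  obtain X Y where XY: "X \<in> carrier_mat n (prank k A)" "Y \<in> carrier_mat (prank k A) m"
    "cong_mat k A (X * Y)" by (rule prank_factor[OF assms(1)])
  obtain X' Y' where XY': "X' \<in> carrier_mat n (prank k B)" "Y' \<in> carrier_mat (prank k B) m"
    "cong_mat k B (X' * Y')" by (rule prank_factor[OF assms(2)])
  have "cong_mat k (A + B) (hcat X X' * vcat Y Y')"
    using XY XY' assms by (subst hcat_mult_vcat) (auto intro!: cong_mat_add)
  then show ?thesis using XY XY' by (intro prank_le[OF hcat_carrier vcat_carrier])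
qed

lemma prank_le_dim:
  assumes "M \<in> carrier_mat n m" shows "prank k M \<le> n" "prank k M \<le> m"
  using assms prank_le[of "1\<^sub>m n" n n M m k M] prank_le[of M n m "1\<^sub>m m" m k M] by auto

text \<open>If t were smaller than g, a Smith form of \<open>Y\<close> would have a zero last
  column. Conjugation by \<open>V\<close> fixes the scalar matrix, so the last diagonal entry of the
  transformed product is 0 and yet congruent to \<varpi>^l modulo \<varpi>^(l+1), which is
  absurd.\<close>

lemma uniformizer_scalar_factor:
  fixes X :: "'p::prime_card padic_int mat"
  assumes X: "X \<in> carrier_mat g t" and Y: "Y \<in> carrier_mat t g"
    and c: "cong_mat (Suc l) (\<varpi> ^ l \<cdot>\<^sub>m 1\<^sub>m g) (X * Y)"
  shows "g \<le> t"
proof (rule ccontr)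
  assume "\<not> g \<le> t"
  then have tg: "t < g" by simp
  obtain f where f: "equiv_mat Y (rect_diag t g f)"
    using smith_normal_form[OF Y] by metis
  obtain U V where UV: "gl t U" "gl g V" "Y = U * rect_diag t g f * V"
    using f Y by (rule equiv_matE)
  obtain V' where V': "gl g V'" "V * V' = 1\<^sub>m g" "V' * V = 1\<^sub>m g" by (rule gl_inverse[OF UV(2)])
  note cr = X gl_carrier[OF UV(1)] gl_carrier[OF UV(2)] gl_carrier[OF V'(1)]
  have "cong_mat (Suc l) (V * (\<varpi> ^ l \<cdot>\<^sub>m 1\<^sub>m g) * V') (V * (X * Y) * V')"
    by (intro cong_mat_mult c cong_mat_refl) (use cr in auto)
  moreover have "V * (\<varpi> ^ l \<cdot>\<^sub>m 1\<^sub>m g) * V' = \<varpi> ^ l \<cdot>\<^sub>m 1\<^sub>m g"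
  proof -
    have "V * (\<varpi> ^ l \<cdot>\<^sub>m 1\<^sub>m g) = \<varpi> ^ l \<cdot>\<^sub>m V"
      using mult_smult_distrib[OF cr(3) one_carrier_mat, of "\<varpi> ^ l"] cr(3) by simp
    then show ?thesis using mult_smult_assoc_mat[OF cr(3,4), of "\<varpi> ^ l"] V'(2) by simp
  qed
  moreover have "V * (X * Y) * V' = (V * (X * U)) * rect_diag t g f"
  proof -
    have "V * (X * Y) * V' = V * (X * (U * (rect_diag t g f * (V * V'))))"
      unfolding UV(3) using cr by (simp add: mat_mult_assoc)
    also have "\<dots> = (V * (X * U)) * rect_diag t g f"
      using cr V'(2) by (simp add: mat_mult_assoc right_mult_one_mat[of _ t])
    finally show ?thesis .
  qed
  ultimately have "cong_mat (Suc l) (\<varpi> ^ l \<cdot>\<^sub>m 1\<^sub>m g) ((V * (X * U)) * rect_diag t g f)" by simp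
  from cong_matD[OF this, of "g - 1" "g - 1"]
  have "\<varpi> ^ Suc l dvd \<varpi> ^ l - ((V * (X * U)) * rect_diag t g f) $$ (g - 1, g - 1)"
    using tg cr by simp
  moreover have "((V * (X * U)) * rect_diag t g f) $$ (g - 1, g - 1) = 0"
  proof -
    have "V * (X * U) \<in> carrier_mat g t" using cr by auto
    then show ?thesis using tg
      by (subst index_mult_mat) (auto simp: scalar_prod_def rect_diag_def intro!: sum.neutral)
  qed
  ultimately have "(\<varpi> :: 'p padic_int) ^ Suc l dvd \<varpi> ^ l" by simp
  then show False by (simp del: power_Suc)
qed

text \<open>A certificate for lower bounds: \<open>P\<close> and \<open>Q\<close> compress
  \<open>M\<close> to a scalar matrix that is still nonzero modulo \<varpi>^(l+1), and a
  factorization of \<open>M\<close> is compressed along with it.\<close>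

lemma prank_ge:
  fixes M :: "'p::prime_card padic_int mat"
  assumes M: "M \<in> carrier_mat n m" and P: "P \<in> carrier_mat g n" and Q: "Q \<in> carrier_mat m g"
    and c: "cong_mat (Suc l) (P * M * Q) (\<varpi> ^ l \<cdot>\<^sub>m 1\<^sub>m g)"
  shows "g \<le> prank (Suc l) M"
proof -
  obtain X Y where XY: "X \<in> carrier_mat n (prank (Suc l) M)" "Y \<in> carrier_mat (prank (Suc l) M) m"
    "cong_mat (Suc l) M (X * Y)" by (rule prank_factor[OF M])
  have "cong_mat (Suc l) (P * M * Q) (P * (X * Y) * Q)"
    by (intro cong_mat_mult cong_mat_refl XY(3)) (use M P Q in auto)
  also have "P * (X * Y) * Q = (P * X) * (Y * Q)"
    using M P Q XY by (simp add: mat_mult_assoc)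
  finally have "cong_mat (Suc l) (\<varpi> ^ l \<cdot>\<^sub>m 1\<^sub>m g) ((P * X) * (Y * Q))"
    using c cong_mat_sym cong_mat_trans by blast
  then show ?thesis by (rule uniformizer_scalar_factor[rotated 2]) (use P Q XY in auto)
qed

lemma mat_add_distrib:
  fixes A B C :: "'a::semiring_0 mat"
  shows "dim_col A = dim_row B \<Longrightarrow> dim_row B = dim_row C \<Longrightarrow> dim_col B = dim_col C \<Longrightarrow> A * (B + C) = A * B + A * C"
    and "dim_row A = dim_row B \<Longrightarrow> dim_col A = dim_col B \<Longrightarrow> dim_col A = dim_row C \<Longrightarrow> (A + B) * C = A * C + B * C"
   by (rule mult_add_distrib_mat, (rule carrier_matI, (rule refl | simp)+)+,
       rule add_mult_distrib_mat, (rule carrier_matI, (rule refl | simp)+)+)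

lemma mat_smult_distrib:
  fixes A B :: "'a::comm_semiring_1 mat"
  shows "dim_col A = dim_row B \<Longrightarrow> (c \<cdot>\<^sub>m A) * B = c \<cdot>\<^sub>m (A * B)"
    and "dim_col A = dim_row B \<Longrightarrow> A * (c \<cdot>\<^sub>m B) = c \<cdot>\<^sub>m (A * B)"
    and "dim_row A = dim_row B \<Longrightarrow> dim_col A = dim_col B \<Longrightarrow> c \<cdot>\<^sub>m (A + B) = c \<cdot>\<^sub>m A + c \<cdot>\<^sub>m B"
    and "c \<cdot>\<^sub>m (d \<cdot>\<^sub>m A) = (c * d) \<cdot>\<^sub>m A"
proof -
  show "dim_col A = dim_row B \<Longrightarrow> (c \<cdot>\<^sub>m A) * B = c \<cdot>\<^sub>m (A * B)"
    by (rule mult_smult_assoc_mat[OF carrier_matI[OF refl] carrier_matI[OF refl refl]])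
  show "dim_col A = dim_row B \<Longrightarrow> A * (c \<cdot>\<^sub>m B) = c \<cdot>\<^sub>m (A * B)"
    by (rule mult_smult_distrib[OF carrier_matI[OF refl] carrier_matI[OF refl refl]])
  show "dim_row A = dim_row B \<Longrightarrow> dim_col A = dim_col B \<Longrightarrow> c \<cdot>\<^sub>m (A + B) = c \<cdot>\<^sub>m A + c \<cdot>\<^sub>m B"
    by (intro eq_matI) (auto simp: algebra_simps)
  show "c \<cdot>\<^sub>m (d \<cdot>\<^sub>m A) = (c * d) \<cdot>\<^sub>m A"
    by (intro eq_matI) (auto simp: mult.assoc)
qed

lemma mat_add_ac:
  fixes A B C :: "'a::comm_monoid_add mat"
  shows "dim_row A = dim_row B \<Longrightarrow> dim_col A = dim_col B \<Longrightarrow> A + B = B + A"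
    and "dim_row A = dim_row B \<Longrightarrow> dim_col A = dim_col B \<Longrightarrow> dim_row B = dim_row C \<Longrightarrow> dim_col B = dim_col C \<Longrightarrow>
      A + B + C = A + (B + C)"
    and "dim_row A = dim_row B \<Longrightarrow> dim_col A = dim_col B \<Longrightarrow> dim_row B = dim_row C \<Longrightarrow> dim_col B = dim_col C \<Longrightarrow>
      A + (B + C) = B + (A + C)"
  by (intro eq_matI; auto simp: ac_simps)+

lemmas mat_algebra = mat_mult_assoc mat_add_distrib mat_smult_distrib mat_add_ac

lemma cong_mat_add_smult:
  assumes "A \<in> carrier_mat n m" "B \<in> carrier_mat n m"
  shows "cong_mat k (A + \<varpi> ^ k \<cdot>\<^sub>m B) A"
  using assms by (auto simp: cong_mat_def)

lemma hcat_mult_direct_sum: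
  fixes A :: "'a::semiring_0 mat"
  assumes "A \<in> carrier_mat n a" "B \<in> carrier_mat n b" "C \<in> carrier_mat a c" "D \<in> carrier_mat b d"
  shows "hcat A B * (C \<oplus>\<^sub>m D) = hcat (A * C) (B * D)"
proof -
  have "hcat A B * four_block_mat C (0\<^sub>m a d) (0\<^sub>m b c) D
    = four_block_mat (A * C + B * 0\<^sub>m b c) (A * 0\<^sub>m a d + B * D)
     (0\<^sub>m 0 a * C + 0\<^sub>m 0 b * 0\<^sub>m b c) (0\<^sub>m 0 a * 0\<^sub>m a d + 0\<^sub>m 0 b * D)"
  proof -
    have "hcat A B = four_block_mat A B (0\<^sub>m 0 a) (0\<^sub>m 0 b)" using assms by (simp add: hcat_def)
    then show ?thesis by (simp only:, intro mult_four_block_mat) (use assms in auto)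
  qed
  also have "\<dots> = hcat (A * C) (B * D)" using assms by (simp add: hcat_def)
  finally show ?thesis using assms by (simp add: direct_sum_mat_def)
qed

lemma direct_sum_mult_vcat:
  fixes A :: "'a::semiring_0 mat"
  assumes "A \<in> carrier_mat a c" "B \<in> carrier_mat b d" "C \<in> carrier_mat c n" "D \<in> carrier_mat d n"
  shows "(A \<oplus>\<^sub>m B) * vcat C D = vcat (A * C) (B * D)"
proof -
  have "four_block_mat A (0\<^sub>m a d) (0\<^sub>m b c) B * vcat C D
    = four_block_mat (A * C + 0\<^sub>m a d * D) (A * 0\<^sub>m c 0 + 0\<^sub>m a d * 0\<^sub>m d 0)
     (0\<^sub>m b c * C + B * D) (0\<^sub>m b c * 0\<^sub>m c 0 + B * 0\<^sub>m d 0)"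
  proof -
    have "vcat C D = four_block_mat C (0\<^sub>m c 0) D (0\<^sub>m d 0)" using assms by (simp add: vcat_def)
    then show ?thesis by (simp only:, intro mult_four_block_mat) (use assms in auto)
  qed
  also have "\<dots> = vcat (A * C) (B * D)" using assms by (simp add: vcat_def)
  finally show ?thesis using assms by (simp add: direct_sum_mat_def)
qed

lemma vcat_mult_hcat:
  fixes A :: "'a::semiring_0 mat"
  assumes "A \<in> carrier_mat a n" "B \<in> carrier_mat b n" "C \<in> carrier_mat n c" "D \<in> carrier_mat n d"
  shows "vcat A B * hcat C D = four_block_mat (A * C) (A * D) (B * C) (B * D)"
proof -
  have "vcat A B * hcat C D
    = four_block_mat (A * C + 0\<^sub>m a 0 * 0\<^sub>m 0 c) (A * D + 0\<^sub>m a 0 * 0\<^sub>m 0 d)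
     (B * C + 0\<^sub>m b 0 * 0\<^sub>m 0 c) (B * D + 0\<^sub>m b 0 * 0\<^sub>m 0 d)"
  proof -
    have "vcat A B = four_block_mat A (0\<^sub>m a 0) B (0\<^sub>m b 0)" using assms by (simp add: vcat_def)
    moreover have "hcat C D = four_block_mat C D (0\<^sub>m 0 c) (0\<^sub>m 0 d)" using assms by (simp add: hcat_def)
    ultimately show ?thesis by (simp only:, intro mult_four_block_mat) (use assms in auto)
  qed
  then show ?thesis using assms by simp
qed

lemma cong_mat_direct_sum:
  assumes "cong_mat k A B" "cong_mat k C D" shows "cong_mat k (A \<oplus>\<^sub>m C) (B \<oplus>\<^sub>m D)"
  using assms by (auto simp: cong_mat_def direct_sum_mat_def)

lemma prank_unit_block:
  fixes E :: "'p::prime_card padic_int mat"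
  assumes "E \<in> carrier_mat n m"
  shows "prank 1 (1\<^sub>m g \<oplus>\<^sub>m (\<varpi> \<cdot>\<^sub>m E)) = g"
proof (rule antisym)
  let ?M = "1\<^sub>m g \<oplus>\<^sub>m (\<varpi> \<cdot>\<^sub>m E)"
  have "vcat (1\<^sub>m g) (0\<^sub>m n g) * hcat (1\<^sub>m g) (0\<^sub>m g m) = 1\<^sub>m g \<oplus>\<^sub>m (0\<^sub>m n m :: 'p padic_int mat)"
    by (subst vcat_mult_hcat[of _ g g _ n _ g _ m]) (auto simp: direct_sum_mat_def)
  moreover have "cong_mat 1 ?M (1\<^sub>m g \<oplus>\<^sub>m 0\<^sub>m n m)"
    using assms by (intro cong_mat_direct_sum cong_mat_refl) (auto simp: cong_mat_def)
  ultimately show "prank 1 ?M \<le> g"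
    by (intro prank_le[of "vcat (1\<^sub>m g) (0\<^sub>m n g)" "g + n" g "hcat (1\<^sub>m g) (0\<^sub>m g m)" "g + m"]) auto
  have "hcat (1\<^sub>m g) (0\<^sub>m g n) * ?M = hcat (1\<^sub>m g) (0\<^sub>m g m)"
    using assms by (subst hcat_mult_direct_sum[of _ g g _ n _ g _ m]) auto
  moreover have "hcat (1\<^sub>m g) (0\<^sub>m g m) * vcat (1\<^sub>m g) (0\<^sub>m m g) = (1\<^sub>m g :: 'p padic_int mat)"
    by (subst hcat_mult_vcat[of _ g g _ m _ g]) auto
  ultimately have "hcat (1\<^sub>m g) (0\<^sub>m g n) * ?M * vcat (1\<^sub>m g) (0\<^sub>m m g) = \<varpi> ^ 0 \<cdot>\<^sub>m 1\<^sub>m g"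
    by (simp only: power_0) (simp add: mat_eq_iff del: index_mult_mat)
  then have "g \<le> prank (Suc 0) ?M"
    using assms by (intro prank_ge[of _ "g + n" "g + m" "hcat (1\<^sub>m g) (0\<^sub>m g n)" _ "vcat (1\<^sub>m g) (0\<^sub>m m g)"]) auto
  then show "g \<le> prank 1 ?M" by simp
qed

text \<open>Pins down the size of the unit block as the rank modulo \<varpi>; dimension counts below
  rely on this identification rather than on some unspecified g.\<close>

lemma unit_block_decomposition:
  fixes M :: "'p::prime_card padic_int mat"
  assumes "M \<in> carrier_mat n m"
  obtains E where "prank 1 M \<le> n" "prank 1 M \<le> m" "E \<in> carrier_mat (n - prank 1 M) (m - prank 1 M)"
    "equiv_mat M (1\<^sub>m (prank 1 M) \<oplus>\<^sub>m (\<varpi> \<cdot>\<^sub>m E))"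
proof -
  obtain g E where g: "g \<le> n" "g \<le> m" "E \<in> carrier_mat (n - g) (m - g)"
    "equiv_mat M (1\<^sub>m g \<oplus>\<^sub>m (\<varpi> \<cdot>\<^sub>m E))" by (rule equiv_mat_unit_block[OF assms])
  have "prank 1 M = g" using prank_equiv[OF g(4)] prank_unit_block[OF g(3)] by simp
  then show ?thesis using that g by simp
qed

section \<open>Sylvester type inequalities modulo the uniformizer and its square\<close>

text \<open>After \<open>X\<close> is brought to the form of a unit block of size a plus multiples
  of \<varpi>, the relation says that the first a rows of \<open>W = V * Y\<close> vanish modulo
  \<varpi>. So \<open>W\<close>, and with it \<open>Y\<close>, factors through the other R - a
  coordinates.\<close>

lemma prank_sylvester_zero:
  fixes X Y :: "'p::prime_card padic_int mat"
  assumes X: "X \<in> carrier_mat n R" and Y: "Y \<in> carrier_mat R m"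
    and XY: "cong_mat 1 (X * Y) (0\<^sub>m n m)"
  shows "prank 1 X + prank 1 Y \<le> R"
proof -
  define a where "a = prank 1 X"
  obtain E where a: "a \<le> n" "a \<le> R" and E: "E \<in> carrier_mat (n - a) (R - a)"
    and eq: "equiv_mat X (1\<^sub>m a \<oplus>\<^sub>m (\<varpi> \<cdot>\<^sub>m E))"
    using unit_block_decomposition[OF X] unfolding a_def by blast
  let ?M = "1\<^sub>m a \<oplus>\<^sub>m (\<varpi> \<cdot>\<^sub>m E)"
  obtain U V where UV: "gl n U" "gl R V" "X = U * ?M * V"
    using eq X by (rule equiv_matE)
  obtain U' where U': "gl n U'" "U * U' = 1\<^sub>m n" "U' * U = 1\<^sub>m n" by (rule gl_inverse[OF UV(1)])
  obtain V' where V': "gl R V'" "V * V' = 1\<^sub>m R" "V' * V = 1\<^sub>m R" by (rule gl_inverse[OF UV(2)])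
  note cU = gl_carrier[OF UV(1)] and cV = gl_carrier[OF UV(2)] and cU' = gl_carrier[OF U'(1)]
    and cV' = gl_carrier[OF V'(1)]
  have M: "?M \<in> carrier_mat n R" using direct_sum_mat_carrier[OF one_carrier_mat, of "\<varpi> \<cdot>\<^sub>m E" "n - a" "R - a" a] E a by simp
  define W where "W = V * Y"
  have W: "W \<in> carrier_mat R m" using cV Y unfolding W_def by simp
  have "U' * (X * Y) = (U' * U) * (?M * W)"
    unfolding UV(3) W_def using cU cU' cV M Y by (simp add: mat_mult_assoc del: dim_direct_sum_mat)
  also have "\<dots> = ?M * W" unfolding U'(3) by (rule left_mult_one_mat[OF mult_carrier_mat[OF M W]])
  finally have "cong_mat 1 (?M * W) (U' * 0\<^sub>m n m)"
    using cong_mat_mult[OF cong_mat_refl[of 1 U'] XY] cU' X by simp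
  then have MW: "cong_mat 1 (?M * W) (0\<^sub>m n m)" using cU' by simp
  let ?H = "hcat (1\<^sub>m a) (0\<^sub>m a (n - a)) :: 'p padic_int mat"
  let ?H' = "hcat (1\<^sub>m a) (0\<^sub>m a (R - a)) :: 'p padic_int mat"
  have H: "?H \<in> carrier_mat a n" "?H' \<in> carrier_mat a R"
    using a hcat_carrier[OF one_carrier_mat zero_carrier_mat, of a "n - a"]
      hcat_carrier[OF one_carrier_mat zero_carrier_mat, of a "R - a"] by simp_all
  have HM: "?H * ?M = ?H'"
    using E by (subst hcat_mult_direct_sum[of _ a a _ "n - a" _ a _ "R - a"]) auto
  have "?H * (?M * W) = ?H' * W"
    unfolding HM[symmetric] by (rule assoc_mult_mat[OF H(1) M W, symmetric])
  then have "cong_mat 1 (?H' * W) (?H * 0\<^sub>m n m)"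
    using cong_mat_mult[OF cong_mat_refl[of 1 ?H] MW] H M by (metis carrier_matD index_mult_mat(2))
  then have HW: "cong_mat 1 (?H' * W) (0\<^sub>m a m)" using right_mult_zero_mat[OF H(1)] by simp
  let ?K = "hcat (0\<^sub>m (R - a) a) (1\<^sub>m (R - a)) :: 'p padic_int mat"
  let ?V1 = "vcat (1\<^sub>m a) (0\<^sub>m (R - a) a) :: 'p padic_int mat"
  let ?V2 = "vcat (0\<^sub>m a (R - a)) (1\<^sub>m (R - a)) :: 'p padic_int mat"
  have c: "?K \<in> carrier_mat (R - a) R" "?V1 \<in> carrier_mat R a" "?V2 \<in> carrier_mat R (R - a)"
    using a hcat_carrier[OF zero_carrier_mat one_carrier_mat, of "R - a" a]
      vcat_carrier[OF one_carrier_mat zero_carrier_mat, of a "R - a"]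
      vcat_carrier[OF zero_carrier_mat one_carrier_mat, of a "R - a"] by simp_all
  \<comment> \<open>The two products are the projections onto the first a and the last R - a
    coordinates.\<close>
  have VH: "?V1 * ?H' + ?V2 * ?K = 1\<^sub>m R"
    unfolding vcat_mult_hcat[OF one_carrier_mat zero_carrier_mat one_carrier_mat zero_carrier_mat]
      vcat_mult_hcat[OF zero_carrier_mat one_carrier_mat zero_carrier_mat one_carrier_mat]
    using a by (intro eq_matI) auto
  have "W = (?V1 * ?H' + ?V2 * ?K) * W" unfolding VH using W by simp
  also have "\<dots> = ?V1 * ?H' * W + ?V2 * ?K * W"
    by (rule add_mult_distrib_mat[OF mult_carrier_mat[OF c(2) H(2)] mult_carrier_mat[OF c(3) c(1)] W])
  also have "\<dots> = ?V1 * (?H' * W) + ?V2 * (?K * W)"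
    unfolding assoc_mult_mat[OF c(2) H(2) W] assoc_mult_mat[OF c(3) c(1) W] by (rule refl)
  finally have W_eq: "W = ?V1 * (?H' * W) + ?V2 * (?K * W)" .
  have "cong_mat 1 (?V1 * (?H' * W) + ?V2 * (?K * W)) (?V1 * 0\<^sub>m a m + ?V2 * (?K * W))"
    by (intro cong_mat_add cong_mat_mult cong_mat_refl HW) (use H c W in auto)
  then have "cong_mat 1 W (?V1 * 0\<^sub>m a m + ?V2 * (?K * W))" using W_eq by simp
  moreover have "?V1 * 0\<^sub>m a m + ?V2 * (?K * W) = ?V2 * (?K * W)"
  proof -
    have "?V2 * (?K * W) \<in> carrier_mat R m" using c W by auto
    then show ?thesis using right_mult_zero_mat[OF c(2)] by simp
  qed
  ultimately have "cong_mat 1 W (?V2 * (?K * W))" by simp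
  then have "prank 1 W \<le> R - a" using c W by (intro prank_le[OF c(3)]) auto
  moreover have "Y = V' * W"
    unfolding W_def using assoc_mult_mat[OF cV' cV Y] V'(3) Y by simp
  then have "prank 1 Y \<le> prank 1 W" using prank_mult_left[OF cV' W] by simp
  ultimately show ?thesis using a unfolding a_def by simp
qed

lemma hcat_prank_ge:
  assumes "A \<in> carrier_mat n a" "B \<in> carrier_mat n b"
  shows "prank k A \<le> prank k (hcat A B)"
proof -
  have "hcat A B * vcat (1\<^sub>m a) (0\<^sub>m b a) = A"
    using assms by (subst hcat_mult_vcat[of _ n a _ b _ a]) auto
  then show ?thesis
    using prank_mult_right[OF hcat_carrier[OF assms] vcat_carrier[OF one_carrier_mat zero_carrier_mat]] by metis
qed

lemma vcat_prank_ge: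
  assumes "A \<in> carrier_mat a n" "B \<in> carrier_mat b n"
  shows "prank k A \<le> prank k (vcat A B)"
proof -
  have "hcat (1\<^sub>m a) (0\<^sub>m a b) * vcat A B = A"
    using assms by (subst hcat_mult_vcat[of _ a a _ b _ n]) auto
  then show ?thesis
    using prank_mult_left[OF hcat_carrier[OF one_carrier_mat zero_carrier_mat] vcat_carrier[OF assms]] by metis
qed

text \<open>Reduction to a vanishing product: if \<open>P * Q\<close> is a minimal factorization of
  \<open>X * Y\<close> modulo \<varpi>, then appending \<open>- P\<close> to \<open>X\<close> and
  \<open>Q\<close> to \<open>Y\<close> makes the product vanish and enlarges the inner dimension by
  \<open>prank 1 (X * Y)\<close>.\<close>

lemma prank_sylvester:
  fixes X Y :: "'p::prime_card padic_int mat"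
  assumes X: "X \<in> carrier_mat n R" and Y: "Y \<in> carrier_mat R m"
  shows "prank 1 X + prank 1 Y \<le> R + prank 1 (X * Y)"
proof -
  obtain P Q where PQ: "P \<in> carrier_mat n (prank 1 (X * Y))" "Q \<in> carrier_mat (prank 1 (X * Y)) m"
    "cong_mat 1 (X * Y) (P * Q)" by (rule prank_factor[OF mult_carrier_mat[OF X Y]])
  have mP: "- P \<in> carrier_mat n (prank 1 (X * Y))" using PQ(1) by simp
  have "hcat X (- P) * vcat Y Q = X * Y + (- P) * Q"
    by (rule hcat_mult_vcat[OF X mP Y PQ(2)])
  moreover have "cong_mat 1 (X * Y + (- P) * Q) (P * Q + (- P) * Q)"
    using PQ X Y by (intro cong_mat_add cong_mat_refl) auto
  moreover have "P * Q + (- P) * Q = 0\<^sub>m n m"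
    using PQ by (intro eq_matI) auto
  ultimately have "cong_mat 1 (hcat X (- P) * vcat Y Q) (0\<^sub>m n m)" by simp
  then have "prank 1 (hcat X (- P)) + prank 1 (vcat Y Q) \<le> R + prank 1 (X * Y)"
    by (rule prank_sylvester_zero[OF hcat_carrier[OF X mP] vcat_carrier[OF Y PQ(2)]])
  then show ?thesis using hcat_prank_ge[OF X mP, of 1] vcat_prank_ge[OF Y PQ(2), of 1] by linarith
qed

text \<open>The algebra behind \<open>prank_mult_two\<close>, in the manner of completing a product.
  \<open>J'\<close> is a generalized inverse of \<open>J\<close>, with complementary projections
  \<open>P\<close> and \<open>Q\<close>. The parts of \<open>H\<close> and \<open>C\<close> that
  pass through \<open>J\<close> are absorbed into the two outer factors of \<open>?L\<close>; what
  is left passes through \<open>P\<close> or through \<open>Q\<close>.\<close>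

lemma prank_mult_identity:
  fixes A :: "'p::prime_card padic_int mat"
  assumes A: "A \<in> carrier_mat n a" and B: "B \<in> carrier_mat n b"
    and C: "C \<in> carrier_mat b m" and H: "H \<in> carrier_mat a m"
    and J: "J \<in> carrier_mat a b" and J': "J' \<in> carrier_mat b a" and G: "G \<in> carrier_mat a b"
    and P: "P \<in> carrier_mat a a" and Q: "Q \<in> carrier_mat b b"
    and JP: "J * J' + P = 1\<^sub>m a" and JQ: "J' * J + Q = 1\<^sub>m b" and JJJ: "J * J' * J = J" and PG: "P * G = G"
  shows "prank 2 (A * (J + \<varpi> \<cdot>\<^sub>m G) * C + \<varpi> \<cdot>\<^sub>m (A * H + B * C)) \<le> prank 2 J + prank 2 P + prank 2 Q"
proof -
  let ?L = "(A + \<varpi> \<cdot>\<^sub>m (B * J')) * J * (C + \<varpi> \<cdot>\<^sub>m (J' * H))"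
  let ?R1 = "\<varpi> \<cdot>\<^sub>m (A * P * (G * C + H))" and ?R2 = "\<varpi> \<cdot>\<^sub>m (B * Q * C)"
  let ?S = "A * (J + \<varpi> \<cdot>\<^sub>m G) * C + \<varpi> \<cdot>\<^sub>m (A * H + B * C)"
  have cr: "A * P * (G * C + H) \<in> carrier_mat n m" "B * Q * C \<in> carrier_mat n m"
    using A B C H P Q G by auto
  have H_eq: "A * H = A * (J * (J' * H)) + A * (P * H)"
  proof -
    have "H = (J * J' + P) * H" using JP H by simp
    also have "\<dots> = J * (J' * H) + P * H" using J J' P H by (simp add: mat_algebra)
    finally have "A * H = A * (J * (J' * H) + P * H)" by simp
    then show ?thesis using A J J' P H by (simp add: mat_algebra)
  qed
  have C_eq: "B * C = B * (J' * (J * C)) + B * (Q * C)"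
  proof -
    have "C = (J' * J + Q) * C" using JQ C by simp
    also have "\<dots> = J' * (J * C) + Q * C" using J J' Q C by (simp add: mat_algebra)
    finally have "B * C = B * (J' * (J * C) + Q * C)" by simp
    then show ?thesis using B C J J' Q by (simp add: mat_algebra)
  qed
  have PGC: "P * (G * C) = G * C" using PG P G C by (simp add: mat_mult_assoc[symmetric])
  \<comment> \<open>The extra term is the product of the two first order corrections in
    \<open>?L\<close>; it disappears modulo \<varpi>^2.\<close>
  have "?S + \<varpi> ^ 2 \<cdot>\<^sub>m (B * (J' * (J * (J' * H)))) = ?L + (?R1 + ?R2)"
  proof -
    have "?S = A * (J * C) + (\<varpi> \<cdot>\<^sub>m (A * (G * C)) + (\<varpi> \<cdot>\<^sub>m (A * H) + \<varpi> \<cdot>\<^sub>m (B * C)))"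
      using A B C H J G by (simp add: mat_algebra)
    also have "\<dots> = A * (J * C) + (\<varpi> \<cdot>\<^sub>m (A * (G * C)) + (\<varpi> \<cdot>\<^sub>m (A * (J * (J' * H))) + \<varpi> \<cdot>\<^sub>m (A * (P * H)))
        + (\<varpi> \<cdot>\<^sub>m (B * (J' * (J * C))) + \<varpi> \<cdot>\<^sub>m (B * (Q * C))))"
      unfolding H_eq C_eq using A B C H J J' G P Q by (simp add: mat_algebra)
    finally have S_eq: "?S = \<dots>" .
    show ?thesis unfolding S_eq using A B C H J J' G P Q
      by (simp add: mat_algebra PGC power2_eq_square)
  qed
  then have "cong_mat 2 (?L + (?R1 + ?R2)) ?S"
    using A B C H J J' G cong_mat_add_smult[of ?S n m "B * (J' * (J * (J' * H)))" 2] by (auto intro!: carrier_matI)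
  then have "prank 2 ?S = prank 2 (?L + (?R1 + ?R2))" by (rule prank_cong[symmetric])
  also have "\<dots> \<le> prank 2 ?L + (prank 2 ?R1 + prank 2 ?R2)"
    using cr A B C H J J' by (intro order.trans[OF prank_add[of _ n m] add_mono[OF order_refl prank_add[of _ n m]]])
       (auto intro!: carrier_matI)
  also have "prank 2 ?L \<le> prank 2 J"
  proof -
    have "prank 2 ?L \<le> prank 2 ((A + \<varpi> \<cdot>\<^sub>m (B * J')) * J)"
      using A B C H J J' by (intro prank_mult_right[of _ n b _ m]) (auto intro!: carrier_matI)
    also have "\<dots> \<le> prank 2 J"
      using A B J J' by (intro prank_mult_left[of _ n a _ b]) (auto intro!: carrier_matI)
    finally show ?thesis .
  qed
  also have "prank 2 ?R1 \<le> prank 2 P"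
  proof -
    have "?R1 = ((\<varpi> \<cdot>\<^sub>m A) * P) * (G * C + H)" using A P G C H by (simp add: mat_algebra)
    also have "prank 2 \<dots> \<le> prank 2 ((\<varpi> \<cdot>\<^sub>m A) * P)"
      using A P G C H by (intro prank_mult_right[of _ n a _ m]) (auto intro!: carrier_matI)
    also have "\<dots> \<le> prank 2 P" using A P by (intro prank_mult_left[of _ n a _ a]) auto
    finally show ?thesis .
  qed
  also have "prank 2 ?R2 \<le> prank 2 Q"
  proof -
    have "?R2 = ((\<varpi> \<cdot>\<^sub>m B) * Q) * C" using B Q C by (simp add: mat_algebra)
    also have "prank 2 \<dots> \<le> prank 2 ((\<varpi> \<cdot>\<^sub>m B) * Q)"
      using B Q C by (intro prank_mult_right[of _ n b _ m]) (auto intro!: carrier_matI)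
    also have "\<dots> \<le> prank 2 Q" using B Q by (intro prank_mult_left[of _ n b _ b]) auto
    finally show ?thesis .
  qed
  finally show ?thesis by simp
qed

lemma prank_idempotent_block:
  "prank k (1\<^sub>m g \<oplus>\<^sub>m 0\<^sub>m n m :: 'p::prime_card padic_int mat) \<le> g"
  "prank k (0\<^sub>m n m \<oplus>\<^sub>m 1\<^sub>m g :: 'p::prime_card padic_int mat) \<le> g"
proof -
  have "vcat (1\<^sub>m g) (0\<^sub>m n g) * hcat (1\<^sub>m g) (0\<^sub>m g m) = 1\<^sub>m g \<oplus>\<^sub>m (0\<^sub>m n m :: 'p padic_int mat)"
    by (subst vcat_mult_hcat[of _ g g _ n _ g _ m]) (auto simp: direct_sum_mat_def)
  then show "prank k (1\<^sub>m g \<oplus>\<^sub>m 0\<^sub>m n m :: 'p padic_int mat) \<le> g"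
    by (intro prank_le[of "vcat (1\<^sub>m g) (0\<^sub>m n g)" "g + n" g "hcat (1\<^sub>m g) (0\<^sub>m g m)" "g + m"]) auto
  have "vcat (0\<^sub>m n g) (1\<^sub>m g) * hcat (0\<^sub>m g m) (1\<^sub>m g) = (0\<^sub>m n m :: 'p padic_int mat) \<oplus>\<^sub>m 1\<^sub>m g"
    by (subst vcat_mult_hcat[of _ n g _ g _ m _ g]) (auto simp: direct_sum_mat_def)
  then show "prank k (0\<^sub>m n m \<oplus>\<^sub>m 1\<^sub>m g :: 'p padic_int mat) \<le> g"
    by (intro prank_le[of "vcat (0\<^sub>m n g) (1\<^sub>m g)" "n + g" g "hcat (0\<^sub>m g m) (1\<^sub>m g)" "m + g"]) auto
qed

text \<open>Write X = X1 X2 + \<varpi> X3 and Y = Y1 Y2 + \<varpi> Y3 with minimal inner dimensions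
  a and b. The middle product \<open>Z = X2 * Y1\<close> decides everything: if it has rank g modulo
  \<varpi>, then X Y has rank at most g modulo \<varpi>, and modulo \<varpi>^2 at most g + (a - g) +
  (b - g), where the last two summands come from the terms of first order. Adding both bounds gives
  a + b.\<close>

lemma prank_mult_two:
  fixes X Y :: "'p::prime_card padic_int mat"
  assumes X: "X \<in> carrier_mat n R" and Y: "Y \<in> carrier_mat R m"
  shows "prank 2 (X * Y) + prank 1 (X * Y) \<le> prank 1 X + prank 1 Y"
proof -
  define a b where "a = prank 1 X" and "b = prank 1 Y"
  obtain X1 X2 where X12: "X1 \<in> carrier_mat n a" "X2 \<in> carrier_mat a R" "cong_mat 1 X (X1 * X2)"
    using prank_factor[OF X, of 1] unfolding a_def by blast
  obtain Y1 Y2 where Y12: "Y1 \<in> carrier_mat R b" "Y2 \<in> carrier_mat b m" "cong_mat 1 Y (Y1 * Y2)"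
    using prank_factor[OF Y, of 1] unfolding b_def by blast
  obtain X3 where X3: "X3 \<in> carrier_mat n R" "X = X1 * X2 + \<varpi> \<cdot>\<^sub>m X3"
    using X12(3) cong_mat_iff[OF X mult_carrier_mat[OF X12(1,2)], of 1] by auto
  obtain Y3 where Y3: "Y3 \<in> carrier_mat R m" "Y = Y1 * Y2 + \<varpi> \<cdot>\<^sub>m Y3"
    using Y12(3) cong_mat_iff[OF Y mult_carrier_mat[OF Y12(1,2)], of 1] by auto
  define Z where "Z = X2 * Y1"
  have Z: "Z \<in> carrier_mat a b" using X12 Y12 by (simp add: Z_def)
  define g where "g = prank 1 Z"
  obtain E where g: "g \<le> a" "g \<le> b" and E: "E \<in> carrier_mat (a - g) (b - g)"
    and eq: "equiv_mat Z (1\<^sub>m g \<oplus>\<^sub>m (\<varpi> \<cdot>\<^sub>m E))"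
    using unit_block_decomposition[OF Z] unfolding g_def by blast
  obtain S T where ST: "gl a S" "gl b T" "Z = S * (1\<^sub>m g \<oplus>\<^sub>m (\<varpi> \<cdot>\<^sub>m E)) * T"
    using eq Z by (rule equiv_matE)
  obtain S' where S': "gl a S'" "S * S' = 1\<^sub>m a" "S' * S = 1\<^sub>m a" by (rule gl_inverse[OF ST(1)])
  obtain T' where T': "gl b T'" "T * T' = 1\<^sub>m b" "T' * T = 1\<^sub>m b" by (rule gl_inverse[OF ST(2)])
  note cr = gl_carrier[OF ST(1)] gl_carrier[OF ST(2)] gl_carrier[OF S'(1)] gl_carrier[OF T'(1)]
  define J :: "'p padic_int mat" where "J = 1\<^sub>m g \<oplus>\<^sub>m 0\<^sub>m (a - g) (b - g)"
  define J' :: "'p padic_int mat" where "J' = 1\<^sub>m g \<oplus>\<^sub>m 0\<^sub>m (b - g) (a - g)"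
  define P :: "'p padic_int mat" where "P = 0\<^sub>m g g \<oplus>\<^sub>m 1\<^sub>m (a - g)"
  define Q :: "'p padic_int mat" where "Q = 0\<^sub>m g g \<oplus>\<^sub>m 1\<^sub>m (b - g)"
  define G where "G = 0\<^sub>m g g \<oplus>\<^sub>m E"
  have cJ: "J \<in> carrier_mat a b" "J' \<in> carrier_mat b a" "P \<in> carrier_mat a a" "Q \<in> carrier_mat b b" "G \<in> carrier_mat a b"
    using g E unfolding J_def J'_def P_def Q_def G_def by (auto intro!: carrier_matI)
  have JP: "J * J' + P = 1\<^sub>m a" "J' * J + Q = 1\<^sub>m b"
    using g unfolding J_def J'_def P_def Q_def by (simp_all add: direct_sum_mat_mult direct_sum_mat_add)
  have JJJ: "J * J' * J = J"
    unfolding J_def J'_def by (simp add: direct_sum_mat_mult)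
  have PG: "P * G = G" using E unfolding P_def G_def by (simp add: direct_sum_mat_mult)
  have JG: "J + \<varpi> \<cdot>\<^sub>m G = 1\<^sub>m g \<oplus>\<^sub>m (\<varpi> \<cdot>\<^sub>m E)"
    unfolding J_def G_def direct_sum_mat_smult using E by (simp add: direct_sum_mat_add)
  \<comment> \<open>\<open>S\<close> and \<open>T\<close> normalize \<open>Z\<close>; the inverses
    \<open>S'\<close> and \<open>T'\<close> in the first order terms compensate, so that the
    products \<open>A * H\<close> and \<open>B * C\<close> are the original ones.\<close>
  define A B C H where "A = X1 * S" and "B = X3 * (Y1 * T')" and "C = T * Y2" and "H = S' * (X2 * Y3)"
  have cA: "A \<in> carrier_mat n a" "B \<in> carrier_mat n b" "C \<in> carrier_mat b m" "H \<in> carrier_mat a m"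
    unfolding A_def B_def C_def H_def using cr X12 Y12 X3 Y3 by auto
  let ?S = "A * (J + \<varpi> \<cdot>\<^sub>m G) * C + \<varpi> \<cdot>\<^sub>m (A * H + B * C)"
  have AJC: "A * (J + \<varpi> \<cdot>\<^sub>m G) * C = X1 * (X2 * (Y1 * Y2))"
  proof -
    have M: "J + \<varpi> \<cdot>\<^sub>m G \<in> carrier_mat a b" using cJ by auto
    have "A * (J + \<varpi> \<cdot>\<^sub>m G) * C = X1 * ((S * (J + \<varpi> \<cdot>\<^sub>m G) * T) * Y2)"
      unfolding A_def C_def using cr X12 Y12 M by (simp add: mat_mult_assoc del: index_add_mat)
    also have "S * (J + \<varpi> \<cdot>\<^sub>m G) * T = X2 * Y1" unfolding JG ST(3)[symmetric] Z_def by (rule refl)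
    finally show ?thesis using X12 Y12 by (simp add: mat_mult_assoc)
  qed
  have AH: "A * H = X1 * (X2 * Y3)"
  proof -
    have "A * H = X1 * ((S * S') * (X2 * Y3))"
      unfolding A_def H_def using cr X12 Y3 by (simp add: mat_mult_assoc)
    then show ?thesis unfolding S'(2) using X12 Y3 by simp
  qed
  have BC: "B * C = X3 * (Y1 * Y2)"
  proof -
    have "B * C = X3 * (Y1 * ((T' * T) * Y2))"
      unfolding B_def C_def using cr Y12 X3 by (simp add: mat_mult_assoc)
    then show ?thesis unfolding T'(3) using Y12 by simp
  qed
  have XY_eq: "X * Y = ?S + \<varpi> ^ 2 \<cdot>\<^sub>m (X3 * Y3)"
  proof -
    have "(X1 * X2 + \<varpi> \<cdot>\<^sub>m X3) * (Y1 * Y2 + \<varpi> \<cdot>\<^sub>m Y3)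
        = X1 * (X2 * (Y1 * Y2)) + \<varpi> \<cdot>\<^sub>m (X1 * (X2 * Y3) + X3 * (Y1 * Y2)) + \<varpi> ^ 2 \<cdot>\<^sub>m (X3 * Y3)"
      using X12 Y12 X3(1) Y3(1) by (simp add: mat_algebra power2_eq_square)
    then show ?thesis unfolding X3(2)[symmetric] Y3(2)[symmetric] AJC AH BC .
  qed
  have S: "?S \<in> carrier_mat n m" using cA cJ by auto
  have "cong_mat 2 (X * Y) ?S"
    unfolding XY_eq using cong_mat_add_smult[OF S mult_carrier_mat[OF X3(1) Y3(1)]] .
  then have "prank 2 (X * Y) = prank 2 ?S" by (rule prank_cong)
  also have "\<dots> \<le> prank 2 J + prank 2 P + prank 2 Q"
    by (rule prank_mult_identity[OF cA(1-4) cJ(1,2,5,3,4) JP JJJ PG])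
  also have "\<dots> \<le> g + (a - g) + (b - g)"
    unfolding J_def P_def Q_def by (intro add_mono prank_idempotent_block)
  finally have 1: "prank 2 (X * Y) \<le> g + (a - g) + (b - g)" .
  have "cong_mat 1 (X * Y) ((X1 * X2) * (Y1 * Y2))"
    by (intro cong_mat_mult X12(3) Y12(3)) (use X Y in auto)
  moreover have "(X1 * X2) * (Y1 * Y2) = (X1 * Z) * Y2"
    unfolding Z_def using X12 Y12 by (simp add: mat_mult_assoc)
  ultimately have "prank 1 (X * Y) = prank 1 ((X1 * Z) * Y2)" by (simp add: prank_cong)
  also have "\<dots> \<le> prank 1 (X1 * Z)" using X12 Y12 Z by (intro prank_mult_right) auto
  also have "\<dots> \<le> g" unfolding g_def using X12 Z by (intro prank_mult_left) auto
  finally show ?thesis using 1 g unfolding a_def[symmetric] b_def[symmetric] by linarith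
qed

section \<open>Ranks of diagonal matrices and their consequences\<close>

lemma dim_mat_diag [simp]: "dim_row (mat_diag n f) = n" "dim_col (mat_diag n f) = n"
  by (simp_all add: mat_diag_def)

lemma prank_mat_diag:
  fixes f :: "nat \<Rightarrow> 'p::prime_card padic_int"
  assumes f: "\<And>i. i < n \<Longrightarrow> p_power (f i)"
  shows "prank k (mat_diag n f) = card {i. i < n \<and> \<not> \<varpi> ^ k dvd f i}"
proof -
  define S where "S = {i. i < n \<and> \<not> \<varpi> ^ k dvd f i}"
  define t where "t = card S"
  have "finite S" by (simp add: S_def)
  then obtain h where h: "bij_betw h {0..<t} S" unfolding t_def using ex_bij_betw_nat_finite by blast
  have hS: "h a < n" "\<not> \<varpi> ^ k dvd f (h a)" if "a < t" for a
    using bij_betwE[OF h] that by (auto simp: S_def)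
  have hinj: "h a = h b \<longleftrightarrow> a = b" if "a < t" "b < t" for a b
    using bij_betw_imp_inj_on[OF h] that by (auto dest: inj_onD)
  define X where "X = mat n t (\<lambda>(i, a). if i = h a then f i else 0)"
  define Y where "Y = mat t n (\<lambda>(a, j). if h a = j then 1 else 0 :: 'p padic_int)"
  have XY: "(X * Y) $$ (i, j) = (if i = j \<and> i \<in> S then f i else 0)" if ij: "i < n" "j < n" for i j
  proof -
    have "(X * Y) $$ (i, j) = (\<Sum>a = 0..<t. (if i = h a then f i else 0) * (if h a = j then 1 else 0))"
      using ij by (simp add: X_def Y_def scalar_prod_def)
    also have "\<dots> = (if i = j \<and> i \<in> S then f i else 0)"
    proof (cases "i = j \<and> i \<in> S")
      case True
      then obtain b where b: "b < t" "h b = i" using h by (auto simp: bij_betw_def)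
      have "(\<Sum>a = 0..<t. (if i = h a then f i else 0) * (if h a = j then 1 else 0))
          = (\<Sum>a = 0..<t. if a = b then f i else 0)"
        using True b hinj by (intro sum.cong) auto
      then show ?thesis using True b by auto
    next
      case False
      then show ?thesis using bij_betwE[OF h] by (auto intro!: sum.neutral)
    qed
    finally show ?thesis .
  qed
  have "cong_mat k (mat_diag n f) (X * Y)"
  proof (rule cong_matI[of _ n n])
    fix i j assume ij: "i < n" "j < n"
    show "\<varpi> ^ k dvd mat_diag n f $$ (i, j) - (X * Y) $$ (i, j)"
      unfolding XY[OF ij] using ij by (auto simp: mat_diag_def S_def)
  qed (auto simp: X_def Y_def)
  then have le: "prank k (mat_diag n f) \<le> t"
    by (intro prank_le[of X n t Y n]) (auto simp: X_def Y_def)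
  have ge: "t \<le> prank k (mat_diag n f)"
  proof (cases k)
    case 0
    then show ?thesis by (simp add: t_def S_def)
  next
    case (Suc l)
    have "\<exists>v. f (h a) = \<varpi> ^ v \<and> v \<le> l" if a: "a < t" for a
    proof -
      have "f (h a) \<noteq> 0" using hS(2)[OF a] by auto
      then obtain v where v: "f (h a) = \<varpi> ^ v" using f[OF hS(1)[OF a]] by (auto simp: p_power_def)
      have "\<not> Suc l \<le> v"
        using hS(2)[OF a] unfolding Suc v uniformizer_power_dvd_power_iff .
      then show ?thesis using v by auto
    qed
    then obtain v where v: "\<And>a. a < t \<Longrightarrow> f (h a) = \<varpi> ^ v a \<and> v a \<le> l" by metis
    \<comment> \<open>The surviving entries have valuations \<open>v a\<close> between 0 and l. The
      factor \<varpi>^(l - v a) raises all of them to exactly l, so that one scalar matrix certifies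
      the rank.\<close>
    define P where "P = mat t n (\<lambda>(a, i). if i = h a then \<varpi> ^ (l - v a) else (0 :: 'p padic_int))"
    define Q where "Q = mat n t (\<lambda>(j, a). if j = h a then 1 else (0 :: 'p padic_int))"
    have cPQ: "P \<in> carrier_mat t n" "Q \<in> carrier_mat n t" by (simp_all add: P_def Q_def)
    have "P * mat_diag n f = mat t n (\<lambda>(a, i). if i = h a then \<varpi> ^ l else 0)"
    proof -
      have "P * mat_diag n f = mat t n (\<lambda>(i, j). P $$ (i, j) * f j)"
        by (rule mat_diag_mult_right[OF cPQ(1)])
      also have "\<dots> = mat t n (\<lambda>(a, i). if i = h a then \<varpi> ^ l else 0)"
        using v by (intro eq_matI) (auto simp: P_def simp flip: power_add)
      finally show ?thesis .
    qed
    moreover have "mat t n (\<lambda>(a, i). if i = h a then \<varpi> ^ l else 0) * Q = \<varpi> ^ l \<cdot>\<^sub>m 1\<^sub>m t" (is "?K * Q = _")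
    proof (rule eq_matI)
      fix a b assume "a < dim_row (\<varpi> ^ l \<cdot>\<^sub>m 1\<^sub>m t :: 'p padic_int mat)" "b < dim_col (\<varpi> ^ l \<cdot>\<^sub>m 1\<^sub>m t :: 'p padic_int mat)"
      then have ab: "a < t" "b < t" by auto
      have "(?K * Q) $$ (a, b) = (\<Sum>i = 0..<n. (if i = h a then \<varpi> ^ l else 0) * (if i = h b then 1 else 0))"
        using ab by (simp add: Q_def scalar_prod_def)
      also have "\<dots> = (\<Sum>i = 0..<n. if i = h a then (if a = b then \<varpi> ^ l else 0) else 0)"
        using ab hinj by (intro sum.cong) auto
      also have "\<dots> = (if a = b then \<varpi> ^ l else 0)" using hS(1)[OF ab(1)] by simp
      finally show "(?K * Q) $$ (a, b) = (\<varpi> ^ l \<cdot>\<^sub>m 1\<^sub>m t) $$ (a, b)" using ab by simp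
    qed (auto simp: Q_def)
    ultimately have "P * mat_diag n f * Q = \<varpi> ^ l \<cdot>\<^sub>m 1\<^sub>m t" by simp
    then show ?thesis unfolding Suc by (intro prank_ge[OF mat_diag_dim cPQ]) simp
  qed
  show ?thesis using le ge unfolding t_def S_def by simp
qed

lemma smith_normal_form_square:
  fixes M :: "'p::prime_card padic_int mat"
  assumes "M \<in> carrier_mat n n"
  obtains f where "\<And>i. p_power (f i)" "equiv_mat M (mat_diag n f)"
    "\<And>k. prank k M = card {i. i < n \<and> \<not> \<varpi> ^ k dvd f i}"
proof -
  obtain f where f: "\<And>i. p_power (f i)" "equiv_mat M (rect_diag n n f)"
    by (rule smith_normal_form[OF assms]) blast
  then have eq: "equiv_mat M (mat_diag n f)" by (simp add: rect_diag_square)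
  have "prank k M = card {i. i < n \<and> \<not> \<varpi> ^ k dvd f i}" for k
    unfolding prank_equiv[OF eq] by (rule prank_mat_diag) (rule f(1))
  then show ?thesis by (rule that[OF f(1) eq])
qed

lemma prank_direct_sum:
  fixes A B :: "'p::prime_card padic_int mat"
  assumes A: "A \<in> carrier_mat n n" and B: "B \<in> carrier_mat m m"
  shows "prank k (A \<oplus>\<^sub>m B) = prank k A + prank k B"
proof -
  obtain f where f: "\<And>i. p_power (f i)" "equiv_mat A (mat_diag n f)"
    "\<And>k. prank k A = card {i. i < n \<and> \<not> \<varpi> ^ k dvd f i}" by (rule smith_normal_form_square[OF A]) blast
  obtain g where g: "\<And>i. p_power (g i)" "equiv_mat B (mat_diag m g)"
    "\<And>k. prank k B = card {i. i < m \<and> \<not> \<varpi> ^ k dvd g i}" by (rule smith_normal_form_square[OF B]) blast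
  let ?h = "\<lambda>i. if i < n then f i else g (i - n)"
  have "prank k (A \<oplus>\<^sub>m B) = prank k (mat_diag (n + m) ?h)"
    using prank_equiv[OF equiv_mat_direct_sum[OF f(2) g(2)]] by (simp add: direct_sum_mat_diag)
  also have "\<dots> = card {i. i < n + m \<and> \<not> \<varpi> ^ k dvd ?h i}"
    using f(1) g(1) by (intro prank_mat_diag) auto
  also have "{i. i < n + m \<and> \<not> \<varpi> ^ k dvd ?h i}
     = {i. i < n \<and> \<not> \<varpi> ^ k dvd f i} \<union> (\<lambda>i. i + n) ` {i. i < m \<and> \<not> \<varpi> ^ k dvd g i}"
  proof -
    have "i \<in> (\<lambda>i. i + n) ` {i. i < m \<and> \<not> \<varpi> ^ k dvd g i} \<longleftrightarrow> n \<le> i \<and> i < n + m \<and> \<not> \<varpi> ^ k dvd g (i - n)" for i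
      by (auto intro!: image_eqI[of _ _ "i - n"])
    then show ?thesis by auto
  qed
  also have "card \<dots> = prank k A + prank k B"
    unfolding f(3) g(3) by (subst card_Un_disjoint) (auto simp: card_image)
  finally show ?thesis .
qed

text \<open>In a Smith form the unit entries are separated from the others. The first part has the
  same rank modulo \<varpi> and \<varpi>^2, and the second contributes only the growth of the rank
  from one modulus to the other. This isolates the unit part of a matrix in
  \<open>prank_pencil_two_other\<close>.\<close>

lemma prank_split:
  fixes F :: "'p::prime_card padic_int mat"
  assumes F: "F \<in> carrier_mat n n"
  obtains F' F'' where "F' \<in> carrier_mat n n" "F'' \<in> carrier_mat n n" "F = F' + F''"
    "prank 1 F' = prank 1 F" "prank 2 F' = prank 1 F" "cong_mat 1 F'' (0\<^sub>m n n)" "prank 1 F + prank 2 F'' = prank 2 F"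
proof -
  obtain f where f: "\<And>i. p_power (f i)" "equiv_mat F (mat_diag n f)"
    "\<And>k. prank k F = card {i. i < n \<and> \<not> \<varpi> ^ k dvd f i}" by (rule smith_normal_form_square[OF F]) blast
  obtain U V where UV: "gl n U" "gl n V" "F = U * mat_diag n f * V"
    using f(2) F by (rule equiv_matE)
  note cr = gl_carrier[OF UV(1)] gl_carrier[OF UV(2)]
  define f1 where "f1 i = (if \<varpi> dvd f i then 0 else f i)" for i
  define f2 where "f2 i = (if \<varpi> dvd f i then f i else 0)" for i
  define F1 where "F1 = U * mat_diag n f1 * V"
  define F2 where "F2 = U * mat_diag n f2 * V"
  have pp: "p_power (f1 i)" "p_power (f2 i)" for i
    using f(1)[of i] by (auto simp: f1_def f2_def p_power_def)
  have "mat_diag n f = mat_diag n f1 + mat_diag n f2"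
    by (intro eq_matI) (auto simp: mat_diag_def f1_def f2_def)
  then have sum: "F = F1 + F2"
    unfolding UV(3) F1_def F2_def using cr by (simp add: mat_add_distrib)
  have rk: "prank k F1 = card {i. i < n \<and> \<not> \<varpi> ^ k dvd f1 i}" "prank k F2 = card {i. i < n \<and> \<not> \<varpi> ^ k dvd f2 i}" for k
    using prank_equiv[OF equiv_matI[OF mat_diag_dim UV(1,2) F1_def]] prank_equiv[OF equiv_matI[OF mat_diag_dim UV(1,2) F2_def]]
      prank_mat_diag pp by metis+
  have sq: "\<not> \<varpi> ^ 2 dvd f i" if "\<not> \<varpi> dvd f i" for i
    using that by (metis dvd_mult_left power2_eq_square)
  have c1: "{i. i < n \<and> \<not> \<varpi> ^ 2 dvd f1 i} = {i. i < n \<and> \<not> \<varpi> ^ 1 dvd f i}"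
    "{i. i < n \<and> \<not> \<varpi> ^ 1 dvd f1 i} = {i. i < n \<and> \<not> \<varpi> ^ 1 dvd f i}"
    using sq by (auto simp: f1_def)
  have "{i. i < n \<and> \<not> \<varpi> ^ 2 dvd f i} = {i. i < n \<and> \<not> \<varpi> ^ 1 dvd f i} \<union> {i. i < n \<and> \<not> \<varpi> ^ 2 dvd f2 i}"
    using sq by (auto simp: f2_def)
  moreover have "{i. i < n \<and> \<not> \<varpi> ^ 1 dvd f i} \<inter> {i. i < n \<and> \<not> \<varpi> ^ 2 dvd f2 i} = {}"
    by (auto simp: f2_def)
  ultimately have c2: "prank 1 F + prank 2 F2 = prank 2 F"
    unfolding f(3) rk by (simp add: card_Un_disjoint)
  have "cong_mat 1 (mat_diag n f2) (0\<^sub>m n n)"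
    by (auto simp: cong_mat_def mat_diag_def f2_def)
  then have "cong_mat 1 F2 (U * 0\<^sub>m n n * V)"
    unfolding F2_def using cr by (intro cong_mat_mult cong_mat_refl) auto
  then have c3: "cong_mat 1 F2 (0\<^sub>m n n)" using cr by simp
  have c4: "prank 1 F1 = prank 1 F" "prank 2 F1 = prank 1 F" unfolding rk c1 f(3) by simp_all
  have "F1 \<in> carrier_mat n n" "F2 \<in> carrier_mat n n"
    using cr unfolding F1_def F2_def by auto
  then show ?thesis by (rule that[OF _ _ sum c4 c3 c2])
qed

text \<open>With full row rank modulo \<varpi> the block \<open>E\<close> has no rows, so the normal
  form is an identity followed by zero columns, which has an evident right inverse.\<close>

lemma right_inverse_if_full_prank:
  fixes Y :: "'p::prime_card padic_int mat"
  assumes Y: "Y \<in> carrier_mat r m" and full: "prank 1 Y = r"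
  obtains Z where "Z \<in> carrier_mat m r" "Y * Z = 1\<^sub>m r"
proof -
  obtain E where rm: "r \<le> m" and E: "E \<in> carrier_mat 0 (m - r)"
    and eq: "equiv_mat Y (1\<^sub>m r \<oplus>\<^sub>m (\<varpi> \<cdot>\<^sub>m E))"
    using unit_block_decomposition[OF Y] unfolding full by auto
  obtain U V where UV: "gl r U" "gl m V" "Y = U * (1\<^sub>m r \<oplus>\<^sub>m (\<varpi> \<cdot>\<^sub>m E)) * V"
    using eq Y by (rule equiv_matE)
  obtain U' where U': "gl r U'" "U * U' = 1\<^sub>m r" "U' * U = 1\<^sub>m r" by (rule gl_inverse[OF UV(1)])
  obtain V' where V': "gl m V'" "V * V' = 1\<^sub>m m" "V' * V = 1\<^sub>m m" by (rule gl_inverse[OF UV(2)])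
  note cr = gl_carrier[OF UV(1)] gl_carrier[OF UV(2)] gl_carrier[OF U'(1)] gl_carrier[OF V'(1)]
  define D where "D = 1\<^sub>m r \<oplus>\<^sub>m (\<varpi> \<cdot>\<^sub>m E)"
  define K :: "'p padic_int mat" where "K = vcat (1\<^sub>m r) (0\<^sub>m (m - r) r)"
  have cDK: "D \<in> carrier_mat r m" "K \<in> carrier_mat m r"
    unfolding D_def K_def using rm E by (auto intro!: carrier_matI)
  have DK: "D * K = 1\<^sub>m r"
    unfolding D_def K_def using E
    by (subst direct_sum_mult_vcat[of _ r r _ 0 "m - r" _ r]) (auto simp: vcat_def intro!: eq_matI)
  have "Y * (V' * (K * U')) = U * ((D * ((V * V') * K)) * U')"
    unfolding UV(3) D_def[symmetric] using cr cDK by (simp add: mat_mult_assoc)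
  also have "\<dots> = 1\<^sub>m r" unfolding V'(2) using cr cDK DK U'(2) by simp
  finally show ?thesis using that[of "V' * (K * U')"] cr cDK by simp
qed

lemma prank_smult_le:
  fixes A :: "'p::prime_card padic_int mat"
  assumes "A \<in> carrier_mat n m" shows "prank k (c \<cdot>\<^sub>m A) \<le> prank k A"
proof -
  have "c \<cdot>\<^sub>m A = (c \<cdot>\<^sub>m 1\<^sub>m n) * A" using assms by (simp add: mat_smult_distrib)
  then show ?thesis using prank_mult_left[of "c \<cdot>\<^sub>m 1\<^sub>m n" n n A m k] assms by simp
qed

lemma prank_smult_unit:
  fixes A :: "'p::prime_card padic_int mat"
  assumes A: "A \<in> carrier_mat n m" and u: "u dvd 1" shows "prank k (u \<cdot>\<^sub>m A) = prank k A"
proof (rule antisym)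
  obtain v where "u * v = 1" using u by (metis dvdE)
  then have "v \<cdot>\<^sub>m (u \<cdot>\<^sub>m A) = A" by (intro eq_matI) (auto simp: mult.assoc[symmetric] mult.commute)
  then show "prank k A \<le> prank k (u \<cdot>\<^sub>m A)" using prank_smult_le[of "u \<cdot>\<^sub>m A" n m k v] A by simp
qed (rule prank_smult_le[OF A])

section \<open>Rank inequalities for matrices in linear relation\<close>

lemma hcat3_mult_vcat3:
  fixes X2 :: "'a::semiring_0 mat"
  assumes "X2 \<in> carrier_mat n a" "X3 \<in> carrier_mat n b" "X4 \<in> carrier_mat n c"
    "Y2 \<in> carrier_mat a m" "Y3 \<in> carrier_mat b m" "Y4 \<in> carrier_mat c m"
  shows "hcat X2 (hcat X3 X4) * vcat Y2 (vcat Y3 Y4) = X2 * Y2 + (X3 * Y3 + X4 * Y4)"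
  using assms by (subst hcat_mult_vcat[of _ n a _ "b + c" _ m]) (simp_all add: hcat_mult_vcat[of _ n b _ c _ m])

text \<open>Minimal factorizations of \<open>A2\<close>, \<open>A3\<close>, \<open>A4\<close> are
  placed side by side. The product \<open>X * Y\<close> is congruent to their sum, which vanishes
  modulo \<varpi>, so Sylvester's inequality bounds the ranks of the two long factors together.
  Rescaling the column blocks of \<open>X\<close> by \<open>\<Delta>\<close> does not raise its rank
  and turns the product into \<open>A1\<close>.\<close>

lemma prank_pencil_factor:
  fixes A1 :: "'p::prime_card padic_int mat"
  assumes A: "A1 \<in> carrier_mat n n" "A2 \<in> carrier_mat n n" "A3 \<in> carrier_mat n n" "A4 \<in> carrier_mat n n"
    and k: "1 \<le> k"
    and zero: "cong_mat 1 (A2 + (A3 + A4)) (0\<^sub>m n n)"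
    and comb: "cong_mat k A1 (c2 \<cdot>\<^sub>m A2 + (c3 \<cdot>\<^sub>m A3 + c4 \<cdot>\<^sub>m A4))"
  obtains X' Y R where "X' \<in> carrier_mat n R" "Y \<in> carrier_mat R n" "cong_mat k A1 (X' * Y)"
    "prank 1 X' + prank 1 Y \<le> prank k A2 + prank k A3 + prank k A4"
proof -
  let ?a = "prank k A2" and ?b = "prank k A3" and ?c = "prank k A4"
  obtain X2 Y2 where 2: "X2 \<in> carrier_mat n ?a" "Y2 \<in> carrier_mat ?a n" "cong_mat k A2 (X2 * Y2)"
    by (rule prank_factor[OF A(2)])
  obtain X3 Y3 where 3: "X3 \<in> carrier_mat n ?b" "Y3 \<in> carrier_mat ?b n" "cong_mat k A3 (X3 * Y3)"
    by (rule prank_factor[OF A(3)])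
  obtain X4 Y4 where 4: "X4 \<in> carrier_mat n ?c" "Y4 \<in> carrier_mat ?c n" "cong_mat k A4 (X4 * Y4)"
    by (rule prank_factor[OF A(4)])
  let ?R = "?a + (?b + ?c)"
  define X where "X = hcat X2 (hcat X3 X4)"
  define Y where "Y = vcat Y2 (vcat Y3 Y4)"
  define X' where "X' = hcat (c2 \<cdot>\<^sub>m X2) (hcat (c3 \<cdot>\<^sub>m X3) (c4 \<cdot>\<^sub>m X4))"
  define \<Delta> where "\<Delta> = (c2 \<cdot>\<^sub>m 1\<^sub>m ?a) \<oplus>\<^sub>m ((c3 \<cdot>\<^sub>m 1\<^sub>m ?b) \<oplus>\<^sub>m (c4 \<cdot>\<^sub>m 1\<^sub>m ?c))"
  have cr: "X \<in> carrier_mat n ?R" "Y \<in> carrier_mat ?R n" "X' \<in> carrier_mat n ?R" "\<Delta> \<in> carrier_mat ?R ?R"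
    unfolding X_def Y_def X'_def \<Delta>_def using 2 3 4 by auto
  have "X * \<Delta> = X'"
    unfolding X_def \<Delta>_def X'_def using 2(1) 3(1) 4(1)
    by (simp add: hcat_mult_direct_sum[of _ n ?a _ "?b + ?c" _ ?a _ "?b + ?c"]
        hcat_mult_direct_sum[of _ n ?b _ ?c _ ?b _ ?c] mat_smult_distrib)
  then have le: "prank 1 X' \<le> prank 1 X" using prank_mult_right[OF cr(1,4)] by metis
  have XY: "X * Y = X2 * Y2 + (X3 * Y3 + X4 * Y4)"
    unfolding X_def Y_def using 2 3 4 by (intro hcat3_mult_vcat3)
  have "cong_mat k (A2 + (A3 + A4)) (X * Y)"
    unfolding XY using A 2 3 4 by (intro cong_mat_add) auto
  then have "cong_mat 1 (X * Y) (0\<^sub>m n n)"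
    using zero cong_mat_le[OF _ k] cong_mat_sym cong_mat_trans by blast
  then have syl: "prank 1 X + prank 1 Y \<le> ?R" by (rule prank_sylvester_zero[OF cr(1,2)])
  have X'Y: "X' * Y = c2 \<cdot>\<^sub>m (X2 * Y2) + (c3 \<cdot>\<^sub>m (X3 * Y3) + c4 \<cdot>\<^sub>m (X4 * Y4))"
    unfolding X'_def Y_def using 2 3 4
    by (subst hcat3_mult_vcat3[of _ n ?a _ ?b _ ?c _ n]) (auto simp: mat_smult_distrib)
  have "cong_mat k (c2 \<cdot>\<^sub>m A2 + (c3 \<cdot>\<^sub>m A3 + c4 \<cdot>\<^sub>m A4)) (X' * Y)"
    unfolding X'Y using A 2 3 4 by (intro cong_mat_add cong_mat_smult) auto
  then have "cong_mat k A1 (X' * Y)" using comb cong_mat_trans by blast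
  then show ?thesis using that[OF cr(3,2)] syl le by simp
qed

text \<open>Each of the two factors found in \<open>prank_pencil_factor\<close> bounds the rank of
  the product, whence the factor 2.\<close>

lemma prank_pencil_one:
  fixes A1 :: "'p::prime_card padic_int mat"
  assumes "A1 \<in> carrier_mat n n" "A2 \<in> carrier_mat n n" "A3 \<in> carrier_mat n n" "A4 \<in> carrier_mat n n"
    and "cong_mat 1 (A2 + (A3 + A4)) (0\<^sub>m n n)"
    and "cong_mat 1 A1 (c2 \<cdot>\<^sub>m A2 + (c3 \<cdot>\<^sub>m A3 + c4 \<cdot>\<^sub>m A4))"
  shows "2 * prank 1 A1 \<le> prank 1 A2 + prank 1 A3 + prank 1 A4"
proof -
  obtain X Y R where *: "X \<in> carrier_mat n R" "Y \<in> carrier_mat R n" "cong_mat 1 A1 (X * Y)"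
    "prank 1 X + prank 1 Y \<le> prank 1 A2 + prank 1 A3 + prank 1 A4"
    by (rule prank_pencil_factor[OF assms(1-4) _ assms(5,6)]) simp
  then show ?thesis
    using prank_cong[OF *(3)] prank_mult_left[OF *(1,2), of 1] prank_mult_right[OF *(1,2), of 1] by linarith
qed

text \<open>Here the two trivial bounds on a product are replaced by \<open>prank_mult_two\<close>,
  which trades them for the ranks modulo \<varpi> and \<varpi>^2.\<close>

lemma prank_pencil_two_same:
  fixes A1 :: "'p::prime_card padic_int mat"
  assumes "A1 \<in> carrier_mat n n" "A2 \<in> carrier_mat n n" "A3 \<in> carrier_mat n n" "A4 \<in> carrier_mat n n"
    and "cong_mat 1 (A2 + (A3 + A4)) (0\<^sub>m n n)"
    and "cong_mat 2 A1 (c2 \<cdot>\<^sub>m A2 + (c3 \<cdot>\<^sub>m A3 + c4 \<cdot>\<^sub>m A4))"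
  shows "prank 1 A1 + prank 2 A1 \<le> prank 2 A2 + prank 2 A3 + prank 2 A4"
proof -
  obtain X Y R where *: "X \<in> carrier_mat n R" "Y \<in> carrier_mat R n" "cong_mat 2 A1 (X * Y)"
    "prank 1 X + prank 1 Y \<le> prank 2 A2 + prank 2 A3 + prank 2 A4"
    by (rule prank_pencil_factor[OF assms(1-4) _ assms(5,6)]) simp
  moreover have "cong_mat 1 A1 (X * Y)" using *(3) by (rule cong_mat_le) simp
  ultimately show ?thesis
    using prank_cong[of 1 A1 "X * Y"] prank_cong[OF *(3)] prank_mult_two[OF *(1,2)] by linarith
qed

lemma left_inverse_if_full_prank:
  fixes X :: "'p::prime_card padic_int mat"
  assumes X: "X \<in> carrier_mat n r" and full: "prank 1 X = r"
  obtains Z where "Z \<in> carrier_mat r n" "Z * X = 1\<^sub>m r"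
proof -
  obtain E where rn: "r \<le> n" and E: "E \<in> carrier_mat (n - r) 0"
    and eq: "equiv_mat X (1\<^sub>m r \<oplus>\<^sub>m (\<varpi> \<cdot>\<^sub>m E))"
    using unit_block_decomposition[OF X] unfolding full by auto
  obtain U V where UV: "gl n U" "gl r V" "X = U * (1\<^sub>m r \<oplus>\<^sub>m (\<varpi> \<cdot>\<^sub>m E)) * V"
    using eq X by (rule equiv_matE)
  obtain U' where U': "gl n U'" "U * U' = 1\<^sub>m n" "U' * U = 1\<^sub>m n" by (rule gl_inverse[OF UV(1)])
  obtain V' where V': "gl r V'" "V * V' = 1\<^sub>m r" "V' * V = 1\<^sub>m r" by (rule gl_inverse[OF UV(2)])
  note cr = gl_carrier[OF UV(1)] gl_carrier[OF UV(2)] gl_carrier[OF U'(1)] gl_carrier[OF V'(1)]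
  define D where "D = 1\<^sub>m r \<oplus>\<^sub>m (\<varpi> \<cdot>\<^sub>m E)"
  define K :: "'p padic_int mat" where "K = hcat (1\<^sub>m r) (0\<^sub>m r (n - r))"
  have cDK: "D \<in> carrier_mat n r" "K \<in> carrier_mat r n"
    unfolding D_def K_def using rn E by (auto intro!: carrier_matI)
  have KD: "K * D = 1\<^sub>m r"
    unfolding D_def K_def using E
    by (subst hcat_mult_direct_sum[of _ r r _ "n - r" _ r _ 0]) (auto simp: hcat_def intro!: eq_matI)
  have "V' * (K * U') * X = V' * (K * ((U' * U) * (D * V)))"
    unfolding UV(3) D_def[symmetric] using cr cDK by (simp add: mat_mult_assoc)
  also have "\<dots> = V' * ((K * D) * V)" unfolding U'(3) using cr cDK by (simp add: mat_mult_assoc)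
  also have "\<dots> = 1\<^sub>m r" unfolding KD using cr V'(3) by simp
  finally show ?thesis using that[of "V' * (K * U')"] cr cDK by simp
qed

lemma dvd_sum_of_congruent:
  fixes q :: "'a::comm_ring_1"
  assumes "q dvd a2 + (a3 + a4)" "q dvd a - a2" "q dvd a - y2" "q dvd a3 - y3" "q dvd a4 - y4"
  shows "q dvd y2 + (y3 + y4)"
proof -
  have "q dvd (a2 + (a3 + a4)) + (a - a2) - (a - y2) - (a3 - y3) - (a4 - y4)"
    by (rule dvd_diff[OF dvd_diff[OF dvd_diff[OF dvd_add]]]) (rule assms)+
  then show ?thesis by (simp add: algebra_simps)
qed

lemma dvd_combination_of_congruent:
  fixes q :: "'a::comm_ring_1"
  assumes "q dvd a2 + (a3 + a4)" "q dvd a3 - y3" "q dvd a4 - y4" "q dvd a1 - (c2 * a2 + (c3 * a3 + c4 * a4))"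
  shows "q dvd (c3 - c2) * y3 + (c4 - c2) * y4 - a1"
proof -
  have "q dvd - (c2 * (a2 + (a3 + a4))) - (c3 - c2) * (a3 - y3) - (c4 - c2) * (a4 - y4)
      - (a1 - (c2 * a2 + (c3 * a3 + c4 * a4)))"
    by (rule dvd_diff[OF dvd_diff[OF dvd_diff[OF iffD2[OF dvd_minus_iff] dvd_mult] dvd_mult]]; (rule dvd_mult)?; rule assms)
  then show ?thesis by (simp add: algebra_simps)
qed

text \<open>Modulo \<varpi> the unit part \<open>A'\<close> of \<open>A2\<close> is a combination of
  \<open>A3\<close> and \<open>A4\<close>, so its factors add nothing to the ranks of
  \<open>V\<close> and \<open>W\<close>. Eliminating \<open>A2\<close> modulo \<varpi> writes
  \<open>A1\<close> as \<open>V' * W\<close>, where \<open>V'\<close> is \<open>V\<close> with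
  column blocks scaled by units; Sylvester's inequality gives prank 1 V + prank 1 W \<le> b + c +
  prank 1 A1. The term prank 1 A1 cancels against prank 1 B in \<open>prank_mult_two\<close>,
  leaving prank 2 B \<le> b + c, and the discarded \<open>A''\<close> costs prank 2 A2 - prank 1
  A2.\<close>

lemma prank_pencil_two_other:
  fixes A1 :: "'p::prime_card padic_int mat"
  assumes A: "A1 \<in> carrier_mat n n" "A2 \<in> carrier_mat n n" "A3 \<in> carrier_mat n n" "A4 \<in> carrier_mat n n"
    and zero: "cong_mat 1 (A2 + (A3 + A4)) (0\<^sub>m n n)"
    and comb: "cong_mat 2 A1 (c2 \<cdot>\<^sub>m A2 + (c3 \<cdot>\<^sub>m A3 + c4 \<cdot>\<^sub>m A4))"
    and unit: "c3 - c2 dvd 1" "c4 - c2 dvd 1"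
  shows "prank 1 A2 + prank 2 A1 \<le> prank 2 A2 + prank 2 A3 + prank 2 A4"
proof -
  obtain A' A'' where A': "A' \<in> carrier_mat n n" "A'' \<in> carrier_mat n n" "A2 = A' + A''"
    "prank 1 A' = prank 1 A2" "prank 2 A' = prank 1 A2" "cong_mat 1 A'' (0\<^sub>m n n)" "prank 1 A2 + prank 2 A'' = prank 2 A2"
    by (rule prank_split[OF A(2)])
  define r b c where "r = prank 1 A2" and "b = prank 2 A3" and "c = prank 2 A4"
  obtain X2 Y2 where 2: "X2 \<in> carrier_mat n r" "Y2 \<in> carrier_mat r n" "cong_mat 2 A' (X2 * Y2)"
    using prank_factor[OF A'(1), of 2] unfolding A'(5) r_def by blast
  obtain X3 Y3 where 3: "X3 \<in> carrier_mat n b" "Y3 \<in> carrier_mat b n" "cong_mat 2 A3 (X3 * Y3)"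
    using prank_factor[OF A(3), of 2] unfolding b_def by blast
  obtain X4 Y4 where 4: "X4 \<in> carrier_mat n c" "Y4 \<in> carrier_mat c n" "cong_mat 2 A4 (X4 * Y4)"
    using prank_factor[OF A(4), of 2] unfolding c_def by blast
  have mod1: "cong_mat 1 A' (X2 * Y2)" "cong_mat 1 A3 (X3 * Y3)" "cong_mat 1 A4 (X4 * Y4)"
    using cong_mat_le[OF 2(3)] cong_mat_le[OF 3(3)] cong_mat_le[OF 4(3)] by simp_all
  \<comment> \<open>The combination for \<open>A1\<close> with \<open>A2\<close> replaced by its
    unit part. The difference is a multiple of \<open>A''\<close>, which vanishes modulo \<varpi>,
    so the rank modulo \<varpi> stays that of \<open>A1\<close>.\<close>
  define B where "B = c2 \<cdot>\<^sub>m A' + (c3 \<cdot>\<^sub>m A3 + c4 \<cdot>\<^sub>m A4)"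
  have B: "B \<in> carrier_mat n n" using A A' by (simp add: B_def)
  have "cong_mat 2 A1 (B + c2 \<cdot>\<^sub>m A'')"
    using comb A A'(1,2) unfolding A'(3) B_def by (simp add: mat_algebra)
  then have "prank 2 A1 = prank 2 (B + c2 \<cdot>\<^sub>m A'')" by (rule prank_cong)
  also have "\<dots> \<le> prank 2 B + prank 2 (c2 \<cdot>\<^sub>m A'')" using B A'(2) by (intro prank_add) auto
  also have "\<dots> \<le> prank 2 B + prank 2 A''" using prank_smult_le[OF A'(2)] by simp
  finally have A1B: "prank 2 A1 \<le> prank 2 B + prank 2 A''" .
  have A2': "cong_mat 1 A' A2"
  proof -
    have "cong_mat 1 (A' + A'') (A' + 0\<^sub>m n n)" using A' by (intro cong_mat_add cong_mat_refl) auto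
    then show ?thesis using A'(1,3) cong_mat_sym by simp
  qed
  have "cong_mat 1 B (c2 \<cdot>\<^sub>m A2 + (c3 \<cdot>\<^sub>m A3 + c4 \<cdot>\<^sub>m A4))"
    unfolding B_def using A A'(1) by (intro cong_mat_add cong_mat_smult cong_mat_refl A2') auto
  moreover have "cong_mat 1 A1 (c2 \<cdot>\<^sub>m A2 + (c3 \<cdot>\<^sub>m A3 + c4 \<cdot>\<^sub>m A4))" using comb by (rule cong_mat_le) simp
  ultimately have A1B1: "prank 1 B = prank 1 A1" using prank_cong by metis
  define X' where "X' = hcat (c2 \<cdot>\<^sub>m X2) (hcat (c3 \<cdot>\<^sub>m X3) (c4 \<cdot>\<^sub>m X4))"
  define Y where "Y = vcat Y2 (vcat Y3 Y4)"
  define V where "V = hcat X3 X4"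
  define W where "W = vcat Y3 Y4"
  have cr: "X' \<in> carrier_mat n (r + (b + c))" "Y \<in> carrier_mat (r + (b + c)) n"
    "V \<in> carrier_mat n (b + c)" "W \<in> carrier_mat (b + c) n"
    unfolding X'_def Y_def V_def W_def using 2 3 4 by auto
  have X'Y: "X' * Y = c2 \<cdot>\<^sub>m (X2 * Y2) + (c3 \<cdot>\<^sub>m (X3 * Y3) + c4 \<cdot>\<^sub>m (X4 * Y4))"
    unfolding X'_def Y_def using 2 3 4
    by (subst hcat3_mult_vcat3[of _ n r _ b _ c _ n]) (auto simp: mat_smult_distrib)
  have "cong_mat 2 B (X' * Y)"
    unfolding X'Y B_def using A A' 2 3 4 by (intro cong_mat_add cong_mat_smult) auto
  moreover from this have "cong_mat 1 B (X' * Y)" by (rule cong_mat_le) simp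
  ultimately have two: "prank 2 B + prank 1 B \<le> prank 1 X' + prank 1 Y"
    using prank_mult_two[OF cr(1,2)] prank_cong by metis
  have VW: "V * W = X3 * Y3 + X4 * Y4" unfolding V_def W_def using 3 4 by (intro hcat_mult_vcat)
  have XVW: "cong_mat 1 (X2 * Y2) (- (V * W))"
  proof (rule cong_matI[of _ n n])
    fix i j assume ij: "i < n" "j < n"
    let ?e = "\<lambda>M. M $$ (i, j)"
    have "\<varpi> ^ 1 dvd ?e A2 + (?e A3 + ?e A4)"
      using cong_matD[OF zero, of i j] A ij by simp
    moreover have "\<varpi> ^ 1 dvd ?e A' - ?e A2" using cong_matD[OF A2', of i j] A ij by simp
    moreover have "\<varpi> ^ 1 dvd ?e A' - ?e (X2 * Y2)" "\<varpi> ^ 1 dvd ?e A3 - ?e (X3 * Y3)" "\<varpi> ^ 1 dvd ?e A4 - ?e (X4 * Y4)"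
      using cong_matD[OF mod1(1), of i j] cong_matD[OF mod1(2), of i j] cong_matD[OF mod1(3), of i j] 2 3 4 ij by simp_all
    ultimately have "\<varpi> ^ 1 dvd ?e (X2 * Y2) + (?e (X3 * Y3) + ?e (X4 * Y4))"
      by (rule dvd_sum_of_congruent)
    moreover have "?e (- (V * W)) = - (?e (X3 * Y3) + ?e (X4 * Y4))"
      unfolding VW using 3 4 ij by (simp del: index_mult_mat(1))
    ultimately show "\<varpi> ^ 1 dvd ?e (X2 * Y2) - ?e (- (V * W))"
      by (simp only: diff_minus_eq_add)
  qed (use cr 2 in auto)
  have "prank 1 (X2 * Y2) = r"
    using prank_cong[OF mod1(1)] A'(4) r_def by simp
  then have full: "prank 1 Y2 = r" "prank 1 X2 = r"
    using prank_mult_left[OF 2(1,2), of 1] prank_mult_right[OF 2(1,2), of 1]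
      prank_le_dim(1)[OF 2(2), of 1] prank_le_dim(2)[OF 2(1), of 1] by simp_all
  obtain Z where Z: "Z \<in> carrier_mat n r" "Y2 * Z = 1\<^sub>m r"
    by (rule right_inverse_if_full_prank[OF 2(2) full(1)])
  \<comment> \<open>A right inverse of \<open>Y2\<close> applied to X2 Y2 \<equiv> - V W expresses
    the columns of \<open>X2\<close> by those of \<open>V\<close>; the bound for \<open>Y\<close>
    below is the transposed argument.\<close>
  have X'V: "prank 1 X' \<le> prank 1 V"
  proof -
    have "cong_mat 1 (X2 * Y2 * Z) (- (V * W) * Z)"
      using 2 cr Z by (intro cong_mat_mult XVW cong_mat_refl) auto
    moreover have "X2 * Y2 * Z = X2"
      using assoc_mult_mat[OF 2(1,2) Z(1)] Z(2) 2(1) by simp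
    moreover have "- (V * W) * Z = V * (- (W * Z))" using cr Z by (simp add: mat_mult_assoc)
    ultimately have "cong_mat 1 X2 (V * (- (W * Z)))" by simp
    then have c2X: "cong_mat 1 (c2 \<cdot>\<^sub>m X2) (V * (c2 \<cdot>\<^sub>m (- (W * Z))))"
      using cong_mat_smult[of 1 X2 "V * (- (W * Z))" c2] cr Z by (simp add: mat_smult_distrib)
    define K1 where "K1 = c2 \<cdot>\<^sub>m (- (W * Z))"
    define K2 where "K2 = (c3 \<cdot>\<^sub>m 1\<^sub>m b) \<oplus>\<^sub>m (c4 \<cdot>\<^sub>m 1\<^sub>m c)"
    have K: "K1 \<in> carrier_mat (b + c) r" "K2 \<in> carrier_mat (b + c) (b + c)"
      using cr Z unfolding K1_def K2_def by auto
    have VK2: "V * K2 = hcat (c3 \<cdot>\<^sub>m X3) (c4 \<cdot>\<^sub>m X4)"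
      unfolding V_def K2_def using 3(1) 4(1)
      by (simp add: hcat_mult_direct_sum[of _ n b _ c _ b _ c] mat_smult_distrib)
    have "V * hcat K1 K2 = hcat (V * K1) (V * K2)" by (rule mult_hcat[OF cr(3) K])
    moreover have "cong_mat 1 X' (hcat (V * K1) (V * K2))"
      unfolding X'_def VK2 using c2X[folded K1_def] by (auto simp: cong_mat_def hcat_def)
    ultimately have "prank 1 X' = prank 1 (V * hcat K1 K2)" using prank_cong by metis
    then show ?thesis using prank_mult_right[OF cr(3) hcat_carrier[OF K]] by simp
  qed
  obtain Z' where Z': "Z' \<in> carrier_mat r n" "Z' * X2 = 1\<^sub>m r"
    by (rule left_inverse_if_full_prank[OF 2(1) full(2)])
  have YW: "prank 1 Y \<le> prank 1 W"
  proof -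
    have "Z' * (X2 * Y2) = Y2"
      using assoc_mult_mat[OF Z'(1) 2(1,2)] Z'(2) 2(2) by simp
    then have "cong_mat 1 (Z' * (X2 * Y2)) Y2" by simp
    moreover have "cong_mat 1 (Z' * (X2 * Y2)) (Z' * (- (V * W)))"
      using 2 cr Z' by (intro cong_mat_mult XVW cong_mat_refl) auto
    moreover have "Z' * (- (V * W)) = (- (Z' * V)) * W"
      using cr Z' by (simp add: mat_mult_assoc)
    ultimately have Y2c: "cong_mat 1 Y2 ((- (Z' * V)) * W)" using cong_mat_trans cong_mat_sym by metis
    define K where "K = - (Z' * V)"
    have K: "K \<in> carrier_mat r (b + c)" using cr Z' by (simp add: K_def)
    have "vcat K (1\<^sub>m (b + c)) * W = vcat (K * W) W"
      using vcat_mult[OF K one_carrier_mat cr(4)] cr by simp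
    moreover have "cong_mat 1 Y (vcat (K * W) W)"
      unfolding Y_def W_def[symmetric] using Y2c[folded K_def] by (auto simp: cong_mat_def vcat_def)
    ultimately have "prank 1 Y = prank 1 (vcat K (1\<^sub>m (b + c)) * W)" using prank_cong by metis
    then show ?thesis
      using prank_mult_left[OF vcat_carrier[OF K one_carrier_mat] cr(4)] by simp
  qed
  define V' where "V' = hcat ((c3 - c2) \<cdot>\<^sub>m X3) ((c4 - c2) \<cdot>\<^sub>m X4)"
  have V': "V' \<in> carrier_mat n (b + c)" using 3 4 by (simp add: V'_def)
  obtain d3 d4 where d: "(c3 - c2) * d3 = 1" "(c4 - c2) * d4 = 1" using unit by (metis dvdE)
  \<comment> \<open>The only use of the unit differences of coefficients: they make the scaling from
    \<open>V\<close> to \<open>V'\<close> invertible.\<close>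
  have VV': "prank 1 V \<le> prank 1 V'"
  proof -
    define K where "K = (d3 \<cdot>\<^sub>m 1\<^sub>m b) \<oplus>\<^sub>m (d4 \<cdot>\<^sub>m 1\<^sub>m c)"
    have K: "K \<in> carrier_mat (b + c) (b + c)" by (simp add: K_def)
    have "((c3 - c2) \<cdot>\<^sub>m X3) * (d3 \<cdot>\<^sub>m 1\<^sub>m b) = X3" "((c4 - c2) \<cdot>\<^sub>m X4) * (d4 \<cdot>\<^sub>m 1\<^sub>m c) = X4"
      using 3(1) 4(1) d by (simp_all add: mat_smult_distrib mult.commute) (auto simp: mat_eq_iff)
    then have "V' * K = V"
      unfolding V'_def K_def V_def using 3(1) 4(1) by (subst hcat_mult_direct_sum[of _ n b _ c _ b _ c]) auto
    then show ?thesis using prank_mult_right[OF V' K] by metis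
  qed
  have V'W: "V' * W = (c3 - c2) \<cdot>\<^sub>m (X3 * Y3) + (c4 - c2) \<cdot>\<^sub>m (X4 * Y4)"
    unfolding V'_def W_def using 3 4 by (subst hcat_mult_vcat[of _ n b _ c _ n]) (auto simp: mat_smult_distrib)
  have "cong_mat 1 (V' * W) A1"
  proof (rule cong_matI[of _ n n])
    fix i j assume ij: "i < n" "j < n"
    let ?e = "\<lambda>M. M $$ (i, j)"
    have "\<varpi> ^ 1 dvd ?e A2 + (?e A3 + ?e A4)"
      using cong_matD[OF zero, of i j] A ij by simp
    moreover have "\<varpi> ^ 1 dvd ?e A3 - ?e (X3 * Y3)" "\<varpi> ^ 1 dvd ?e A4 - ?e (X4 * Y4)"
      using cong_matD[OF mod1(2), of i j] cong_matD[OF mod1(3), of i j] 3 4 ij by simp_all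
    moreover have "\<varpi> ^ 1 dvd ?e A1 - (c2 * ?e A2 + (c3 * ?e A3 + c4 * ?e A4))"
      using cong_matD[OF cong_mat_le[OF comb], of 1 i j] A ij by simp
    ultimately have "\<varpi> ^ 1 dvd (c3 - c2) * ?e (X3 * Y3) + (c4 - c2) * ?e (X4 * Y4) - ?e A1"
      by (rule dvd_combination_of_congruent)
    moreover have "?e (V' * W) = (c3 - c2) * ?e (X3 * Y3) + (c4 - c2) * ?e (X4 * Y4)"
      unfolding V'W using 3 4 ij by (simp del: index_mult_mat(1))
    ultimately show "\<varpi> ^ 1 dvd ?e (V' * W) - ?e A1" by (simp del: index_mult_mat(1))
  qed (use V' cr A in auto)
  then have "prank 1 (V' * W) = prank 1 A1" by (rule prank_cong)
  then have "prank 1 V' + prank 1 W \<le> b + c + prank 1 A1"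
    using prank_sylvester[OF V' cr(4)] by simp
  then show ?thesis
    using two A1B1 A1B X'V YW VV' A'(7) unfolding b_def c_def by linarith
qed

section \<open>Lagrange relations in a quadratic pencil\<close>

text \<open>Lagrange interpolation of the quadratic polynomial g at the nodes x2, x3, x4, evaluated
  at x1 and cleared of denominators by the Vandermonde product of the three nodes. The congruences
  pass through because all weights are ring elements.\<close>

lemma power_dvd_lagrange:
  fixes q x1 x2 x3 x4 :: "'a::comm_ring_1"
  assumes "q dvd f1 - g x1" "q dvd f2 - g x2" "q dvd f3 - g x3" "q dvd f4 - g x4"
    and g: "\<And>x. g x = a + x * b + x\<^sup>2 * c"
  shows "q dvd (x2 - x3) * (x2 - x4) * (x3 - x4) * f1 - ((x1 - x3) * (x1 - x4) * ((x3 - x4) * f2)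
     + ((x1 - x2) * (x1 - x4) * ((x4 - x2) * f3) + (x1 - x2) * (x1 - x3) * ((x2 - x3) * f4)))"
proof -
  have "q dvd (x2 - x3) * (x2 - x4) * (x3 - x4) * (f1 - g x1) - (x1 - x3) * (x1 - x4) * (x3 - x4) * (f2 - g x2)
     - (x1 - x2) * (x1 - x4) * (x4 - x2) * (f3 - g x3) - (x1 - x2) * (x1 - x3) * (x2 - x3) * (f4 - g x4)"
    by (rule dvd_diff[OF dvd_diff[OF dvd_diff]]; rule dvd_mult; rule assms)
  moreover have "(x2 - x3) * (x2 - x4) * (x3 - x4) * g x1 = (x1 - x3) * (x1 - x4) * (x3 - x4) * g x2
     + (x1 - x2) * (x1 - x4) * (x4 - x2) * g x3 + (x1 - x2) * (x1 - x3) * (x2 - x3) * g x4"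
    unfolding g by (simp add: algebra_simps power2_eq_square)
  ultimately show ?thesis by (simp add: algebra_simps)
qed

text \<open>The quadratic coefficient carries a factor \<varpi>, so the family is affine in
  \<open>x i\<close> modulo \<varpi> and quadratic modulo \<varpi>^2. The first fact produces
  relations between three members, the second between four.\<close>

definition quadratic_pencil :: "nat \<Rightarrow> nat set \<Rightarrow> (nat \<Rightarrow> 'p::prime_card padic_int) \<Rightarrow> (nat \<Rightarrow> 'p padic_int mat) \<Rightarrow> bool" where
  "quadratic_pencil n I x F \<longleftrightarrow> (\<exists>C0\<in>carrier_mat n n. \<exists>C1\<in>carrier_mat n n. \<exists>C2\<in>carrier_mat n n.
     \<forall>i\<in>I. F i \<in> carrier_mat n n \<and> cong_mat 2 (F i) (C0 + x i \<cdot>\<^sub>m C1 + (\<varpi> * (x i)\<^sup>2) \<cdot>\<^sub>m C2))"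

lemma quadratic_pencil_entry:
  assumes "quadratic_pencil n I x F" "i < n" "j < n"
  obtains a b c where "\<And>k. k \<in> I \<Longrightarrow> \<varpi> ^ 2 dvd F k $$ (i, j) - (a + x k * b + (x k)\<^sup>2 * (\<varpi> * c))"
proof -
  obtain C0 C1 C2 where C: "C0 \<in> carrier_mat n n" "C1 \<in> carrier_mat n n" "C2 \<in> carrier_mat n n"
    "\<And>k. k \<in> I \<Longrightarrow> F k \<in> carrier_mat n n \<and> cong_mat 2 (F k) (C0 + x k \<cdot>\<^sub>m C1 + (\<varpi> * (x k)\<^sup>2) \<cdot>\<^sub>m C2)"
    using assms(1) unfolding quadratic_pencil_def by blast
  show ?thesis
  proof (rule that[of "C0 $$ (i, j)" "C1 $$ (i, j)" "C2 $$ (i, j)"])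
    fix k assume "k \<in> I"
    then show "\<varpi> ^ 2 dvd F k $$ (i, j) - (C0 $$ (i, j) + x k * C1 $$ (i, j) + (x k)\<^sup>2 * (\<varpi> * C2 $$ (i, j)))"
      using cong_matD[OF conjunct2[OF C(4)], of k i j] C(1-3) assms(2,3) by (simp add: ac_simps)
  qed
qed

text \<open>The weights in \<open>A2\<close>, \<open>A3\<close>, \<open>A4\<close> are those of the
  second divided difference at the three nodes, cleared of denominators. They annihilate affine
  functions, hence the first congruence; multiplied by two further linear factors in
  \<open>x i1\<close> they are the Lagrange weights, hence the second.\<close>

lemma quadratic_pencil_weights:
  assumes pencil: "quadratic_pencil n I x F" and I: "i1 \<in> I" "i2 \<in> I" "i3 \<in> I" "i4 \<in> I"
  defines "A2 \<equiv> (x i3 - x i4) \<cdot>\<^sub>m F i2" and "A3 \<equiv> (x i4 - x i2) \<cdot>\<^sub>m F i3" and "A4 \<equiv> (x i2 - x i3) \<cdot>\<^sub>m F i4"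
  shows "cong_mat 1 (A2 + (A3 + A4)) (0\<^sub>m n n)"
    and "cong_mat 2 (((x i2 - x i3) * (x i2 - x i4) * (x i3 - x i4)) \<cdot>\<^sub>m F i1)
      (((x i1 - x i3) * (x i1 - x i4)) \<cdot>\<^sub>m A2 + (((x i1 - x i2) * (x i1 - x i4)) \<cdot>\<^sub>m A3
        + ((x i1 - x i2) * (x i1 - x i3)) \<cdot>\<^sub>m A4))"
proof -
  have F: "F i \<in> carrier_mat n n" if "i \<in> I" for i
    using pencil that unfolding quadratic_pencil_def by blast
  note cF = F[OF I(1)] F[OF I(2)] F[OF I(3)] F[OF I(4)]
  show "cong_mat 1 (A2 + (A3 + A4)) (0\<^sub>m n n)"
  proof (rule cong_matI[of _ n n])
    fix i j assume ij: "i < n" "j < n"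
    obtain a b c where abc: "\<And>k. k \<in> I \<Longrightarrow> \<varpi> ^ 2 dvd F k $$ (i, j) - (a + x k * b + (x k)\<^sup>2 * (\<varpi> * c))"
      by (rule quadratic_pencil_entry[OF pencil ij]) blast
    have d: "\<varpi> dvd F k $$ (i, j) - (a + x k * b)" if "k \<in> I" for k
    proof -
      have "\<varpi> dvd F k $$ (i, j) - (a + x k * b + (x k)\<^sup>2 * (\<varpi> * c))"
        using abc[OF that] by (metis dvd_mult_left power2_eq_square)
      then have "\<varpi> dvd F k $$ (i, j) - (a + x k * b + (x k)\<^sup>2 * (\<varpi> * c)) + (x k)\<^sup>2 * (\<varpi> * c)"
        by (intro dvd_add) simp_all
      then show ?thesis by (simp add: algebra_simps)
    qed
    have "\<varpi> dvd (x i3 - x i4) * (F i2 $$ (i, j) - (a + x i2 * b)) + ((x i4 - x i2) * (F i3 $$ (i, j) - (a + x i3 * b))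
       + (x i2 - x i3) * (F i4 $$ (i, j) - (a + x i4 * b)))"
      by (rule dvd_add[OF _ dvd_add]; rule dvd_mult; rule d; rule I)
    then show "\<varpi> ^ 1 dvd (A2 + (A3 + A4)) $$ (i, j) - 0\<^sub>m n n $$ (i, j)"
      using cF ij by (simp add: A2_def A3_def A4_def algebra_simps)
  qed (use cF in \<open>auto simp: A2_def A3_def A4_def\<close>)
  show "cong_mat 2 (((x i2 - x i3) * (x i2 - x i4) * (x i3 - x i4)) \<cdot>\<^sub>m F i1)
      (((x i1 - x i3) * (x i1 - x i4)) \<cdot>\<^sub>m A2 + (((x i1 - x i2) * (x i1 - x i4)) \<cdot>\<^sub>m A3
        + ((x i1 - x i2) * (x i1 - x i3)) \<cdot>\<^sub>m A4))"
  proof (rule cong_matI[of _ n n])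
    fix i j assume ij: "i < n" "j < n"
    obtain a b c where abc: "\<And>k. k \<in> I \<Longrightarrow> \<varpi> ^ 2 dvd F k $$ (i, j) - (a + x k * b + (x k)\<^sup>2 * (\<varpi> * c))"
      by (rule quadratic_pencil_entry[OF pencil ij]) blast
    show "\<varpi> ^ 2 dvd (((x i2 - x i3) * (x i2 - x i4) * (x i3 - x i4)) \<cdot>\<^sub>m F i1) $$ (i, j) -
      (((x i1 - x i3) * (x i1 - x i4)) \<cdot>\<^sub>m A2 + (((x i1 - x i2) * (x i1 - x i4)) \<cdot>\<^sub>m A3
        + ((x i1 - x i2) * (x i1 - x i3)) \<cdot>\<^sub>m A4)) $$ (i, j)"
      using power_dvd_lagrange[OF abc[OF I(1)] abc[OF I(2)] abc[OF I(3)] abc[OF I(4)] refl] cF ij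
      by (simp add: A2_def A3_def A4_def)
  qed (use cF in \<open>auto simp: A2_def A3_def A4_def\<close>)
qed

lemma quadratic_pencil_necessary:
  assumes pencil: "quadratic_pencil n I x F" and I: "i1 \<in> I" "i2 \<in> I" "i3 \<in> I" "i4 \<in> I"
    and unit: "x i1 - x i2 dvd 1" "x i1 - x i3 dvd 1" "x i1 - x i4 dvd 1"
      "x i2 - x i3 dvd 1" "x i2 - x i4 dvd 1" "x i3 - x i4 dvd 1"
  shows "2 * prank 1 (F i1) \<le> prank 1 (F i2) + prank 1 (F i3) + prank 1 (F i4)"
    and "prank 1 (F i1) + prank 2 (F i1) \<le> prank 2 (F i2) + prank 2 (F i3) + prank 2 (F i4)"
    and "prank 1 (F i2) + prank 2 (F i1) \<le> prank 2 (F i2) + prank 2 (F i3) + prank 2 (F i4)"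
proof -
  have F: "F i \<in> carrier_mat n n" if "i \<in> I" for i
    using pencil that unfolding quadratic_pencil_def by blast
  have u: "a * b dvd 1" if "a dvd 1" "b dvd 1" for a b :: "'a padic_int"
    using mult_dvd_mono[OF that] by simp
  have neg: "b - a dvd 1" if "a - b dvd 1" for a b :: "'a padic_int"
    using that by (metis dvd_minus_iff minus_diff_eq minus_dvd_iff)
  let ?u = "(x i2 - x i3) * (x i2 - x i4) * (x i3 - x i4)"
  have us: "?u dvd 1" "x i4 - x i2 dvd 1"
    using u[OF u[OF unit(4,5)] unit(6)] neg[OF unit(5)] by simp_all
  note w = quadratic_pencil_weights[OF pencil I]
  note pr = prank_smult_unit[OF F[OF I(1)] us(1)] prank_smult_unit[OF F[OF I(2)] unit(6)]
    prank_smult_unit[OF F[OF I(3)] us(2)] prank_smult_unit[OF F[OF I(4)] unit(4)]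
  have c: "c \<cdot>\<^sub>m F i \<in> carrier_mat n n" if "i \<in> I" for c i using F[OF that] by simp
  note c4 = c[OF I(1)] c[OF I(2)] c[OF I(3)] c[OF I(4)]
  show "2 * prank 1 (F i1) \<le> prank 1 (F i2) + prank 1 (F i3) + prank 1 (F i4)"
    using prank_pencil_one[OF c4 w(1) cong_mat_le[OF w(2)]] unfolding pr by simp
  show "prank 1 (F i1) + prank 2 (F i1) \<le> prank 2 (F i2) + prank 2 (F i3) + prank 2 (F i4)"
    using prank_pencil_two_same[OF c4 w] unfolding pr .
  \<comment> \<open>The differences of the Lagrange factors are again products of differences of
    nodes, so they are units, as \<open>prank_pencil_two_other\<close> demands.\<close>
  have "(x i1 - x i2) * (x i1 - x i4) - (x i1 - x i3) * (x i1 - x i4) = (x i1 - x i4) * (x i3 - x i2)"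
    "(x i1 - x i2) * (x i1 - x i3) - (x i1 - x i3) * (x i1 - x i4) = (x i1 - x i3) * (x i4 - x i2)"
    by (simp_all add: algebra_simps)
  then show "prank 1 (F i2) + prank 2 (F i1) \<le> prank 2 (F i2) + prank 2 (F i3) + prank 2 (F i4)"
    using prank_pencil_two_other[OF c4 w] u[OF unit(3) neg[OF unit(4)]] u[OF unit(2) us(2)] unfolding pr by simp
qed

subsection \<open>Presentations of modules by matrices\<close>

abbreviation free_module :: "nat \<Rightarrow> ('p::prime_card padic_int, 'p padic_int vec) module" where
  "free_module n \<equiv> module_vec TYPE('p padic_int) n"

definition mat_range :: "'a::comm_ring_1 mat \<Rightarrow> 'a vec set" where
  "mat_range B = (\<lambda>v. B *\<^sub>v v) ` carrier_vec (dim_col B)"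

text \<open>The cokernel is described by a surjection from a free module and its kernel instead of
  by cosets. Such a surjection can be composed with a matrix on one side and with an isomorphism on
  the other, independently of the type of the elements of \<open>H\<close>.\<close>

definition presents :: "'p::prime_card padic_int mat \<Rightarrow> ('p padic_int, 'a) module \<Rightarrow> bool" where
  "presents B H \<longleftrightarrow> (\<exists>h\<in>module_hom class_ring (free_module (dim_row B)) H.
     h ` carrier_vec (dim_row B) = carrier H \<and>
     (\<forall>v\<in>carrier_vec (dim_row B). \<forall>w\<in>carrier_vec (dim_row B). h v = h w \<longleftrightarrow> v - w \<in> mat_range B))"

lemma module_hom_vecD:
  assumes "h \<in> module_hom class_ring (free_module n) H"
  shows "v \<in> carrier_vec n \<Longrightarrow> h v \<in> carrier H"
    and "v \<in> carrier_vec n \<Longrightarrow> w \<in> carrier_vec n \<Longrightarrow> h (v + w) = h v \<oplus>\<^bsub>H\<^esub> h w"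
    and "v \<in> carrier_vec n \<Longrightarrow> h (c \<cdot>\<^sub>v v) = c \<odot>\<^bsub>H\<^esub> h v"
  using assms by (auto simp: module_hom_def module_vec_simps)

lemma module_hom_vecI:
  assumes "\<And>v. v \<in> carrier_vec n \<Longrightarrow> h v \<in> carrier H"
    and "\<And>v w. v \<in> carrier_vec n \<Longrightarrow> w \<in> carrier_vec n \<Longrightarrow> h (v + w) = h v \<oplus>\<^bsub>H\<^esub> h w"
    and "\<And>c v. v \<in> carrier_vec n \<Longrightarrow> h (c \<cdot>\<^sub>v v) = c \<odot>\<^bsub>H\<^esub> h v"
  shows "h \<in> module_hom class_ring (free_module n) H"
  using assms by (auto simp: module_hom_def module_vec_simps)

lemma presentsI:
  assumes "B \<in> carrier_mat n m"
    and "\<And>v. v \<in> carrier_vec n \<Longrightarrow> h v \<in> carrier H"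
    and "\<And>v w. v \<in> carrier_vec n \<Longrightarrow> w \<in> carrier_vec n \<Longrightarrow> h (v + w) = h v \<oplus>\<^bsub>H\<^esub> h w"
    and "\<And>c v. v \<in> carrier_vec n \<Longrightarrow> h (c \<cdot>\<^sub>v v) = c \<odot>\<^bsub>H\<^esub> h v"
    and "\<And>y. y \<in> carrier H \<Longrightarrow> \<exists>v\<in>carrier_vec n. h v = y"
    and "\<And>v w. v \<in> carrier_vec n \<Longrightarrow> w \<in> carrier_vec n \<Longrightarrow> h v = h w \<longleftrightarrow> v - w \<in> mat_range B"
  shows "presents B H"
proof -
  have "h ` carrier_vec n = carrier H" using assms(2,5) by (force simp: image_iff)
  moreover have "h \<in> module_hom class_ring (free_module n) H" by (rule module_hom_vecI) (fact assms)+
  ultimately show ?thesis unfolding presents_def using assms(1,6) by (intro bexI[of _ h]) auto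
qed

lemma presentsE:
  assumes "presents B H" "B \<in> carrier_mat n m"
  obtains h where "\<And>v. v \<in> carrier_vec n \<Longrightarrow> h v \<in> carrier H"
    and "\<And>v w. v \<in> carrier_vec n \<Longrightarrow> w \<in> carrier_vec n \<Longrightarrow> h (v + w) = h v \<oplus>\<^bsub>H\<^esub> h w"
    and "\<And>c v. v \<in> carrier_vec n \<Longrightarrow> h (c \<cdot>\<^sub>v v) = c \<odot>\<^bsub>H\<^esub> h v"
    and "\<And>y. y \<in> carrier H \<Longrightarrow> \<exists>v\<in>carrier_vec n. h v = y"
    and "\<And>v w. v \<in> carrier_vec n \<Longrightarrow> w \<in> carrier_vec n \<Longrightarrow> h v = h w \<longleftrightarrow> v - w \<in> mat_range B"
proof -
  obtain h where h: "h \<in> module_hom class_ring (free_module n) H" "h ` carrier_vec n = carrier H"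
    "\<forall>v\<in>carrier_vec n. \<forall>w\<in>carrier_vec n. h v = h w \<longleftrightarrow> v - w \<in> mat_range B"
    using assms unfolding presents_def by auto
  show ?thesis
  proof (rule that[OF module_hom_vecD[OF h(1)]])
    show "\<exists>v\<in>carrier_vec n. h v = y" if "y \<in> carrier H" for y
      using that unfolding h(2)[symmetric] by auto
    show "h v = h w \<longleftrightarrow> v - w \<in> mat_range B" if "v \<in> carrier_vec n" "w \<in> carrier_vec n" for v w
      using h(3) that by blast
  qed
qed

text \<open>The two surjections identify the same pairs of vectors, so picking any preimage under
  \<open>h\<close> and applying \<open>k\<close> is well defined, injective and compatible with the
  operations.\<close>

lemma presents_unique:
  assumes "presents B H" "presents B K"
  shows "module_iso class_ring H K"
proof -
  have B: "B \<in> carrier_mat (dim_row B) (dim_col B)" by auto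
  define n where "n = dim_row B"
  obtain h where h: "\<And>v. v \<in> carrier_vec n \<Longrightarrow> h v \<in> carrier H"
    "\<And>v w. v \<in> carrier_vec n \<Longrightarrow> w \<in> carrier_vec n \<Longrightarrow> h (v + w) = h v \<oplus>\<^bsub>H\<^esub> h w"
    "\<And>c v. v \<in> carrier_vec n \<Longrightarrow> h (c \<cdot>\<^sub>v v) = c \<odot>\<^bsub>H\<^esub> h v"
    "\<And>y. y \<in> carrier H \<Longrightarrow> \<exists>v\<in>carrier_vec n. h v = y"
    "\<And>v w. v \<in> carrier_vec n \<Longrightarrow> w \<in> carrier_vec n \<Longrightarrow> h v = h w \<longleftrightarrow> v - w \<in> mat_range B"
    unfolding n_def by (rule presentsE[OF assms(1) B]) blast
  obtain k where k: "\<And>v. v \<in> carrier_vec n \<Longrightarrow> k v \<in> carrier K"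
    "\<And>v w. v \<in> carrier_vec n \<Longrightarrow> w \<in> carrier_vec n \<Longrightarrow> k (v + w) = k v \<oplus>\<^bsub>K\<^esub> k w"
    "\<And>c v. v \<in> carrier_vec n \<Longrightarrow> k (c \<cdot>\<^sub>v v) = c \<odot>\<^bsub>K\<^esub> k v"
    "\<And>y. y \<in> carrier K \<Longrightarrow> \<exists>v\<in>carrier_vec n. k v = y"
    "\<And>v w. v \<in> carrier_vec n \<Longrightarrow> w \<in> carrier_vec n \<Longrightarrow> k v = k w \<longleftrightarrow> v - w \<in> mat_range B"
    unfolding n_def by (rule presentsE[OF assms(2) B]) blast
  define f where "f y = k (SOME v. v \<in> carrier_vec n \<and> h v = y)" for y
  have f: "f (h v) = k v" if v: "v \<in> carrier_vec n" for v
  proof -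
    have "(SOME w. w \<in> carrier_vec n \<and> h w = h v) \<in> carrier_vec n \<and> h (SOME w. w \<in> carrier_vec n \<and> h w = h v) = h v"
      by (rule someI[of _ v]) (use v in simp)
    then show ?thesis unfolding f_def using h(5) k(5) v by metis
  qed
  have "f \<in> module_hom class_ring H K"
    unfolding module_hom_def
  proof (intro CollectI conjI allI impI)
    show "f \<in> carrier H \<rightarrow> carrier K" using h(4) k(1) f by (metis Pi_I)
    fix x y assume "x \<in> carrier H \<and> y \<in> carrier H"
    then obtain v w where vw: "v \<in> carrier_vec n" "w \<in> carrier_vec n" "x = h v" "y = h w" using h(4) by metis
    then have "x \<oplus>\<^bsub>H\<^esub> y = h (v + w)" using h(2) by simp
    then show "f (x \<oplus>\<^bsub>H\<^esub> y) = f x \<oplus>\<^bsub>K\<^esub> f y" using vw f k(2) by simp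
  next
    fix c :: "'a padic_int" and x assume "c \<in> carrier class_ring \<and> x \<in> carrier H"
    then obtain v where v: "v \<in> carrier_vec n" "x = h v" using h(4) by metis
    then have "c \<odot>\<^bsub>H\<^esub> x = h (c \<cdot>\<^sub>v v)" using h(3) by simp
    then show "f (c \<odot>\<^bsub>H\<^esub> x) = c \<odot>\<^bsub>K\<^esub> f x" using v f k(3) by simp
  qed
  moreover have "bij_betw f (carrier H) (carrier K)"
  proof (rule bij_betwI')
    fix x y assume "x \<in> carrier H" "y \<in> carrier H"
    then obtain v w where "v \<in> carrier_vec n" "w \<in> carrier_vec n" "x = h v" "y = h w" using h(4) by metis
    then show "f x = f y \<longleftrightarrow> x = y" using f h(5) k(5) by simp
  next
    fix x assume "x \<in> carrier H" then show "f x \<in> carrier K" using h(4) k(1) f by metis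
  next
    fix y assume "y \<in> carrier K" then show "\<exists>x\<in>carrier H. y = f x" using k(4) h(1) f by metis
  qed
  ultimately show ?thesis unfolding module_iso_def by blast
qed

lemma presents_iso:
  assumes "presents B H" "module_iso class_ring H K"
  shows "presents B K"
proof -
  have B: "B \<in> carrier_mat (dim_row B) (dim_col B)" by auto
  obtain h where h: "\<And>v. v \<in> carrier_vec (dim_row B) \<Longrightarrow> h v \<in> carrier H"
    "\<And>v w. v \<in> carrier_vec (dim_row B) \<Longrightarrow> w \<in> carrier_vec (dim_row B) \<Longrightarrow> h (v + w) = h v \<oplus>\<^bsub>H\<^esub> h w"
    "\<And>c v. v \<in> carrier_vec (dim_row B) \<Longrightarrow> h (c \<cdot>\<^sub>v v) = c \<odot>\<^bsub>H\<^esub> h v"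
    "\<And>y. y \<in> carrier H \<Longrightarrow> \<exists>v\<in>carrier_vec (dim_row B). h v = y"
    "\<And>v w. v \<in> carrier_vec (dim_row B) \<Longrightarrow> w \<in> carrier_vec (dim_row B) \<Longrightarrow> h v = h w \<longleftrightarrow> v - w \<in> mat_range B"
    by (rule presentsE[OF assms(1) B]) blast
  obtain g where g: "g \<in> module_hom class_ring H K" "bij_betw g (carrier H) (carrier K)"
    using assms(2) unfolding module_iso_def by blast
  have gh: "x \<in> carrier H \<Longrightarrow> g x \<in> carrier K"
    "x \<in> carrier H \<Longrightarrow> y \<in> carrier H \<Longrightarrow> g (x \<oplus>\<^bsub>H\<^esub> y) = g x \<oplus>\<^bsub>K\<^esub> g y"
    "x \<in> carrier H \<Longrightarrow> g (c \<odot>\<^bsub>H\<^esub> x) = c \<odot>\<^bsub>K\<^esub> g x" for x y c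
    using g(1) by (auto simp: module_hom_def)
  show ?thesis
  proof (rule presentsI[OF B, of "\<lambda>v. g (h v)"])
    fix y assume "y \<in> carrier K"
    then have "y \<in> g ` carrier H" using g(2) by (simp add: bij_betw_def)
    then obtain x where "x \<in> carrier H" "g x = y" by (elim imageE) simp
    moreover from this obtain v where "v \<in> carrier_vec (dim_row B)" "h v = x" using h(4)[of x] by auto
    ultimately show "\<exists>v\<in>carrier_vec (dim_row B). g (h v) = y" by auto
  next
    fix v w :: "'a padic_int vec" assume vw: "v \<in> carrier_vec (dim_row B)" "w \<in> carrier_vec (dim_row B)"
    have "g (h v) = g (h w) \<longleftrightarrow> h v = h w"
      using g(2) h(1)[OF vw(1)] h(1)[OF vw(2)] by (auto simp: bij_betw_def dest: inj_onD)
    then show "g (h v) = g (h w) \<longleftrightarrow> v - w \<in> mat_range B" using h(5)[OF vw] by simp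
  qed (simp_all add: h(1-3) gh)
qed

lemma module_iso_sym:
  assumes "module R H" "module_iso R H K"
  shows "module_iso R K H"
proof -
  interpret module R H by (rule assms)
  obtain g where g: "g \<in> module_hom R H K" "bij_betw g (carrier H) (carrier K)"
    using assms(2) unfolding module_iso_def by blast
  define f where "f = inv_into (carrier H) g"
  have bij: "bij_betw f (carrier K) (carrier H)" unfolding f_def by (rule bij_betw_inv_into[OF g(2)])
  have fg: "f (g x) = x" if "x \<in> carrier H" for x
    unfolding f_def using g(2) that by (auto simp: bij_betw_def)
  have gf: "\<exists>x\<in>carrier H. y = g x" if "y \<in> carrier K" for y
    using g(2) that by (auto simp: bij_betw_def)
  have "f \<in> module_hom R K H"
    unfolding module_hom_def
  proof (intro CollectI conjI allI impI)
    show "f \<in> carrier K \<rightarrow> carrier H" using bij by (auto simp: bij_betw_def)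
    fix x y assume "x \<in> carrier K \<and> y \<in> carrier K"
    then obtain v w where vw: "v \<in> carrier H" "w \<in> carrier H" "x = g v" "y = g w" using gf by metis
    then have "x \<oplus>\<^bsub>K\<^esub> y = g (v \<oplus>\<^bsub>H\<^esub> w)" using g(1) by (simp add: module_hom_def)
    then show "f (x \<oplus>\<^bsub>K\<^esub> y) = f x \<oplus>\<^bsub>H\<^esub> f y" using vw fg by simp
  next
    fix c x assume *: "c \<in> carrier R \<and> x \<in> carrier K"
    then obtain v where v: "v \<in> carrier H" "x = g v" using gf by metis
    then have "c \<odot>\<^bsub>K\<^esub> x = g (c \<odot>\<^bsub>H\<^esub> v)" using g(1) * by (simp add: module_hom_def)
    then show "f (c \<odot>\<^bsub>K\<^esub> x) = c \<odot>\<^bsub>H\<^esub> f x" using v fg * by simp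
  qed
  then show ?thesis using bij unfolding module_iso_def by blast
qed

lemma mult_mat_smult_vec:
  fixes A :: "'a::comm_semiring_1 mat"
  assumes "A \<in> carrier_mat n m" "v \<in> carrier_vec m"
  shows "A *\<^sub>v (c \<cdot>\<^sub>v v) = c \<cdot>\<^sub>v (A *\<^sub>v v)"
  using assms by (intro eq_vecI) (auto simp: scalar_prod_def sum_distrib_left mult_ac)

lemma mat_range_carrier: "B \<in> carrier_mat n m \<Longrightarrow> mat_range B \<subseteq> carrier_vec n"
  unfolding mat_range_def by auto

lemma mat_range_zero: "B \<in> carrier_mat n m \<Longrightarrow> 0\<^sub>v n \<in> mat_range B"
  unfolding mat_range_def by (rule image_eqI[of _ _ "0\<^sub>v m"]) auto

lemma mat_range_add:
  assumes "B \<in> carrier_mat n m" "v \<in> mat_range B" "w \<in> mat_range B" shows "v + w \<in> mat_range B"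
proof -
  obtain a b where "a \<in> carrier_vec m" "b \<in> carrier_vec m" "v = B *\<^sub>v a" "w = B *\<^sub>v b"
    using assms unfolding mat_range_def by auto
  then show ?thesis using assms(1) unfolding mat_range_def
    by (intro image_eqI[of _ _ "a + b"]) (auto simp: mult_add_distrib_mat_vec[OF assms(1)])
qed

lemma mat_range_smult:
  assumes "B \<in> carrier_mat n m" "v \<in> mat_range B" shows "c \<cdot>\<^sub>v v \<in> mat_range B"
proof -
  obtain a where "a \<in> carrier_vec m" "v = B *\<^sub>v a"
    using assms unfolding mat_range_def by auto
  then show ?thesis using assms(1) unfolding mat_range_def
    by (intro image_eqI[of _ _ "c \<cdot>\<^sub>v a"]) (auto simp: mult_mat_smult_vec[OF assms(1)])
qed

lemma mat_range_equiv:
  fixes B :: "'a::comm_ring_1 mat"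
  assumes B: "B \<in> carrier_mat n m" and V: "gl m V"
  shows "mat_range (B * V) = mat_range B"
proof -
  obtain V' where V': "gl m V'" "V * V' = 1\<^sub>m m" "V' * V = 1\<^sub>m m" by (rule gl_inverse[OF V])
  note c = gl_carrier[OF V] gl_carrier[OF V'(1)]
  show ?thesis
  proof
    show "mat_range (B * V) \<subseteq> mat_range B"
      using B c unfolding mat_range_def by (auto simp: assoc_mult_mat_vec[OF B c(1)] intro!: imageI mult_mat_vec_carrier)
    show "mat_range B \<subseteq> mat_range (B * V)"
    proof
      fix x assume "x \<in> mat_range B"
      then obtain a where a: "a \<in> carrier_vec m" "x = B *\<^sub>v a" using B unfolding mat_range_def by auto
      have "V *\<^sub>v (V' *\<^sub>v a) = a"
        using assoc_mult_mat_vec[OF c(1,2) a(1)] V'(2) a(1) by simp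
      then have "x = (B * V) *\<^sub>v (V' *\<^sub>v a)"
        using assoc_mult_mat_vec[OF B c(1), of "V' *\<^sub>v a"] a c by simp
      then show "x \<in> mat_range (B * V)"
        using B c a unfolding mat_range_def by (auto intro!: imageI mult_mat_vec_carrier)
    qed
  qed
qed

text \<open>Column operations do not change the range, and row operations move it by
  \<open>U\<close>; composing the surjection with the inverse \<open>U'\<close> moves it
  back.\<close>

lemma presents_equiv:
  assumes "presents B H" "equiv_mat A B"
  shows "presents A H"
proof -
  define n m where "n = dim_row A" and "m = dim_col A"
  then have A: "A \<in> carrier_mat n m" by auto
  obtain U V where UV: "gl n U" "gl m V" "A = U * B * V" and B: "B \<in> carrier_mat n m"
    using assms(2) A by (rule equiv_matE)
  obtain h where h: "\<And>v. v \<in> carrier_vec n \<Longrightarrow> h v \<in> carrier H"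
    "\<And>v w. v \<in> carrier_vec n \<Longrightarrow> w \<in> carrier_vec n \<Longrightarrow> h (v + w) = h v \<oplus>\<^bsub>H\<^esub> h w"
    "\<And>c v. v \<in> carrier_vec n \<Longrightarrow> h (c \<cdot>\<^sub>v v) = c \<odot>\<^bsub>H\<^esub> h v"
    "\<And>y. y \<in> carrier H \<Longrightarrow> \<exists>v\<in>carrier_vec n. h v = y"
    "\<And>v w. v \<in> carrier_vec n \<Longrightarrow> w \<in> carrier_vec n \<Longrightarrow> h v = h w \<longleftrightarrow> v - w \<in> mat_range B"
    by (rule presentsE[OF assms(1) B]) blast
  obtain U' where U': "gl n U'" "U * U' = 1\<^sub>m n" "U' * U = 1\<^sub>m n" by (rule gl_inverse[OF UV(1)])
  note c = gl_carrier[OF UV(1)] gl_carrier[OF UV(2)] gl_carrier[OF U'(1)]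
  have c': "U' *\<^sub>v v \<in> carrier_vec n" if "v \<in> carrier_vec n" for v using c(3) that by simp
  have UU': "U *\<^sub>v (U' *\<^sub>v v) = v" "U' *\<^sub>v (U *\<^sub>v v) = v" if "v \<in> carrier_vec n" for v
    using assoc_mult_mat_vec[OF c(1,3) that] assoc_mult_mat_vec[OF c(3,1) that] U' that by simp_all
  have range: "mat_range A = (\<lambda>v. U *\<^sub>v v) ` mat_range B"
  proof -
    have UB: "U * B \<in> carrier_mat n m" using c B by simp
    have "mat_range A = mat_range (U * B)" unfolding UV(3) by (rule mat_range_equiv[OF UB UV(2)])
    also have "\<dots> = (\<lambda>v. U *\<^sub>v v) ` mat_range B"
      unfolding mat_range_def image_image using B c by (auto simp: assoc_mult_mat_vec[OF c(1) B])
    finally show ?thesis .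
  qed
  have range_iff: "v \<in> mat_range A \<longleftrightarrow> U' *\<^sub>v v \<in> mat_range B" if "v \<in> carrier_vec n" for v
    unfolding range using UU' that mat_range_carrier[OF B] by (metis (no_types, lifting) image_iff subsetD)
  show ?thesis
  proof (rule presentsI[OF A, of "\<lambda>v. h (U' *\<^sub>v v)"])
    fix y assume "y \<in> carrier H"
    then obtain v where "v \<in> carrier_vec n" "h v = y" using h(4) by blast
    then show "\<exists>v\<in>carrier_vec n. h (U' *\<^sub>v v) = y" using UU'(2) c(1) by (metis mult_mat_vec_carrier)
  next
    fix v w :: "'a padic_int vec" assume vw: "v \<in> carrier_vec n" "w \<in> carrier_vec n"
    show "h (U' *\<^sub>v v) = h (U' *\<^sub>v w) \<longleftrightarrow> v - w \<in> mat_range A"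
      using h(5)[OF c'[OF vw(1)] c'[OF vw(2)]] range_iff[of "v - w"] vw
        mult_minus_distrib_mat_vec[OF c(3) vw] by simp
  qed (simp_all add: h(1-3) c' mult_add_distrib_mat_vec[OF c(3)] mult_mat_smult_vec[OF c(3)])
qed

section \<open>Quotient modules and cokernels\<close>

text \<open>Provides the coset formulas for the operations of \<open>quot_module\<close>. They are
  applied twice, to the quotient of a free module by a matrix range and to the quotient of H by
  pH.\<close>

locale module_quotient = module R M
  for R :: "('r, 'e) ring_scheme" (structure) and M :: "('r, 'c) module" (structure) +
  fixes N
  assumes sub_carrier: "N \<subseteq> carrier M"
    and sub_zero: "\<zero>\<^bsub>M\<^esub> \<in> N"
    and sub_add: "\<And>x y. x \<in> N \<Longrightarrow> y \<in> N \<Longrightarrow> x \<oplus>\<^bsub>M\<^esub> y \<in> N"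
    and sub_smult: "\<And>c x. c \<in> carrier R \<Longrightarrow> x \<in> N \<Longrightarrow> c \<odot>\<^bsub>M\<^esub> x \<in> N"
begin

lemma sub_minus: "x \<in> N \<Longrightarrow> \<ominus>\<^bsub>M\<^esub> x \<in> N"
  using sub_smult[of "\<ominus> \<one>" x] sub_carrier smult_minus_1[of x] by auto

lemma abelian_subgroup_N: "abelian_subgroup N M"
proof (rule abelian_subgroupI3)
  show "additive_subgroup N M"
    unfolding additive_subgroup_def
    by (rule group.subgroupI[OF M.a_group]) (use sub_carrier sub_zero sub_add sub_minus in \<open>auto simp: a_inv_def\<close>)
qed (rule M.abelian_group_axioms)

lemma carrier_quot: "carrier (quot_module M N) = (\<lambda>v. N +>\<^bsub>M\<^esub> v) ` carrier M"
  unfolding quot_module_def by (auto simp: A_RCOSETS_def')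

lemma add_quot:
  assumes "v \<in> carrier M" "w \<in> carrier M"
  shows "(N +>\<^bsub>M\<^esub> v) \<oplus>\<^bsub>quot_module M N\<^esub> (N +>\<^bsub>M\<^esub> w) = N +>\<^bsub>M\<^esub> (v \<oplus>\<^bsub>M\<^esub> w)"
proof -
  interpret S: abelian_subgroup N M by (rule abelian_subgroup_N)
  show ?thesis using S.a_rcos_sum[OF assms] by (simp add: quot_module_def)
qed

lemma coset_eq_iff:
  assumes "v \<in> carrier M" "w \<in> carrier M"
  shows "N +>\<^bsub>M\<^esub> v = N +>\<^bsub>M\<^esub> w \<longleftrightarrow> v \<oplus>\<^bsub>M\<^esub> (\<ominus>\<^bsub>M\<^esub> w) \<in> N"
proof -
  interpret S: abelian_subgroup N M by (rule abelian_subgroup_N)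
  have "v \<in> N +>\<^bsub>M\<^esub> w \<longleftrightarrow> N +>\<^bsub>M\<^esub> v = N +>\<^bsub>M\<^esub> w"
    using M.a_repr_independence[of v N w] S.a_rcos_self[OF assms(1)] assms S.a_subgroup by metis
  then show ?thesis using S.a_rcos_module_imp[OF assms(2)] S.a_rcos_module_rev[OF assms(2,1)] by blast
qed

lemma smult_quot:
  assumes "v \<in> carrier M" "c \<in> carrier R"
  shows "c \<odot>\<^bsub>quot_module M N\<^esub> (N +>\<^bsub>M\<^esub> v) = N +>\<^bsub>M\<^esub> (c \<odot>\<^bsub>M\<^esub> v)"
proof -
  interpret S: abelian_subgroup N M by (rule abelian_subgroup_N)
  have eq: "N +>\<^bsub>M\<^esub> (c \<odot>\<^bsub>M\<^esub> w) = N +>\<^bsub>M\<^esub> (c \<odot>\<^bsub>M\<^esub> v)" if w: "w \<in> N +>\<^bsub>M\<^esub> v" for w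
  proof -
    have wc: "w \<in> carrier M" using S.a_elemrcos_carrier[OF assms(1) w] .
    have "w \<oplus>\<^bsub>M\<^esub> (\<ominus>\<^bsub>M\<^esub> v) \<in> N" by (rule S.a_rcos_module_imp[OF assms(1) w])
    then have "c \<odot>\<^bsub>M\<^esub> (w \<oplus>\<^bsub>M\<^esub> (\<ominus>\<^bsub>M\<^esub> v)) \<in> N" by (rule sub_smult[OF assms(2)])
    also have "c \<odot>\<^bsub>M\<^esub> (w \<oplus>\<^bsub>M\<^esub> (\<ominus>\<^bsub>M\<^esub> v)) = c \<odot>\<^bsub>M\<^esub> w \<oplus>\<^bsub>M\<^esub> (\<ominus>\<^bsub>M\<^esub> (c \<odot>\<^bsub>M\<^esub> v))"
      using wc assms by (simp add: smult_r_distr smult_r_minus)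
    finally show ?thesis using wc assms by (simp add: coset_eq_iff)
  qed
  have "(\<Union>w\<in>N +>\<^bsub>M\<^esub> v. N +>\<^bsub>M\<^esub> (c \<odot>\<^bsub>M\<^esub> w)) = N +>\<^bsub>M\<^esub> (c \<odot>\<^bsub>M\<^esub> v)"
  proof -
    have "(\<Union>w\<in>N +>\<^bsub>M\<^esub> v. N +>\<^bsub>M\<^esub> (c \<odot>\<^bsub>M\<^esub> w)) = (\<Union>w\<in>N +>\<^bsub>M\<^esub> v. N +>\<^bsub>M\<^esub> (c \<odot>\<^bsub>M\<^esub> v))"
      by (rule SUP_cong[OF refl eq])
    moreover have "N +>\<^bsub>M\<^esub> v \<noteq> {}" using S.a_rcos_self[OF assms(1)] by blast
    ultimately show ?thesis by (simp only: UN_constant if_False)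
  qed
  then show ?thesis by (simp add: quot_module_def)
qed

end

lemma module_free: "module class_ring (free_module n :: ('p::prime_card padic_int, 'p padic_int vec) module)"
proof -
  interpret vec_module "TYPE('p padic_int)" n .
  show ?thesis by (rule module_axioms)
qed

lemma a_inv_free:
  assumes "v \<in> carrier_vec n"
  shows "\<ominus>\<^bsub>free_module n\<^esub> v = - (v :: 'p::prime_card padic_int vec)"
proof -
  interpret vec_module "TYPE('p padic_int)" n .
  show ?thesis using assms M.minus_unique uminus_carrier_vec uminus_r_inv_vec
    by (metis M.minus_equality uminus_l_inv_vec)
qed

lemma presents_cok:
  fixes B :: "'p::prime_card padic_int mat"
  shows "presents B (cok B)"
proof -
  have B: "B \<in> carrier_mat (dim_row B) (dim_col B)" by auto
  define n where "n = dim_row B"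
  interpret Q: module_quotient class_ring "free_module n" "mat_range B"
  proof (rule module_quotient.intro[OF module_free], unfold_locales)
    show "mat_range B \<subseteq> carrier (free_module n)"
      using mat_range_carrier[OF B] by (simp add: module_vec_simps n_def)
    show "\<zero>\<^bsub>free_module n\<^esub> \<in> mat_range B" using mat_range_zero[OF B] by (simp add: module_vec_simps n_def)
  qed (use mat_range_add[OF B] mat_range_smult[OF B] in \<open>auto simp: module_vec_simps\<close>)
  have cok: "cok B = quot_module (free_module n) (mat_range B)"
    unfolding cok_def mat_range_def n_def by simp
  show ?thesis
  proof (rule presentsI[OF B, of "\<lambda>v. mat_range B +>\<^bsub>free_module n\<^esub> v"], goal_cases)
    case (1 v) then show ?case unfolding cok Q.carrier_quot by (auto simp: module_vec_simps n_def)
  next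
    case (2 v w) then show ?case unfolding cok using Q.add_quot[of v w] by (simp add: module_vec_simps n_def)
  next
    case (3 c v) then show ?case unfolding cok using Q.smult_quot[of v c] by (simp add: module_vec_simps n_def)
  next
    case (4 y) then show ?case unfolding cok Q.carrier_quot by (auto simp: module_vec_simps n_def)
  next
    case (5 v w)
    then have "v + - w = v - w" by (auto simp: n_def)
    then show ?case using 5 Q.coset_eq_iff[of v w] a_inv_free[of w n]
      by (simp add: module_vec_simps n_def)
  qed
qed

text \<open>From here on the condition on cokernels is handled through presentations alone.\<close>

lemma cok_iso_iff_presents: "cok B \<cong>\<^sub>p H \<longleftrightarrow> presents B H"
  using presents_cok presents_iso presents_unique by blast

section \<open>Diagonal presentations of finitely generated modules\<close>

lemma vec_unit_induct:
  fixes v :: "'a::comm_ring_1 vec"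
  assumes v: "v \<in> carrier_vec n"
    and zero: "P (0\<^sub>v n)" and unit: "\<And>j. j < n \<Longrightarrow> P (unit_vec n j)"
    and add: "\<And>v w. v \<in> carrier_vec n \<Longrightarrow> w \<in> carrier_vec n \<Longrightarrow> P v \<Longrightarrow> P w \<Longrightarrow> P (v + w)"
    and smult: "\<And>c v. v \<in> carrier_vec n \<Longrightarrow> P v \<Longrightarrow> P (c \<cdot>\<^sub>v v)"
  shows "P v"
proof -
  have "P (vec n (\<lambda>i. if i < l then v $ i else 0))" if "l \<le> n" for l
    using that
  proof (induction l)
    case 0
    have "vec n (\<lambda>i. if i < 0 then v $ i else 0) = 0\<^sub>v n" by (intro eq_vecI) auto
    then show ?case using zero by simp
  next
    case (Suc l)
    have "vec n (\<lambda>i. if i < Suc l then v $ i else 0)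
        = vec n (\<lambda>i. if i < l then v $ i else 0) + v $ l \<cdot>\<^sub>v unit_vec n l"
      using Suc.prems by (intro eq_vecI) (auto simp: less_Suc_eq)
    then show ?case using Suc add smult unit by simp
  qed
  from this[of n] have "P (vec n (\<lambda>i. if i < n then v $ i else 0))" by simp
  also have "vec n (\<lambda>i. if i < n then v $ i else 0) = v" using v by (intro eq_vecI) auto
  finally show ?thesis .
qed

text \<open>Induction on the rank of the free module. Among the leading coordinates of elements of
  \<open>N\<close> one of least valuation divides all others; let it belong to \<open>u\<close>.
  Subtracting a multiple of \<open>u\<close> leaves an element with leading coordinate 0, to which
  the induction applies. The resulting matrix has first column \<open>u\<close> and the smaller
  matrix in the remaining lower right block. If all leading coordinates vanish, \<open>u\<close> is
  0, so the matrix is always square.\<close>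

lemma submodule_eq_mat_range:
  fixes N :: "'p::prime_card padic_int vec set"
  assumes "N \<subseteq> carrier_vec n" "0\<^sub>v n \<in> N"
    "\<And>v w. v \<in> N \<Longrightarrow> w \<in> N \<Longrightarrow> v + w \<in> N" "\<And>c v. v \<in> N \<Longrightarrow> c \<cdot>\<^sub>v v \<in> N"
  obtains B where "B \<in> carrier_mat n n" "N = mat_range B"
proof -
  have "\<exists>B\<in>carrier_mat n n. N = mat_range B" using assms
  proof (induction n arbitrary: N)
    case 0
    have c0: "carrier_vec 0 = {0\<^sub>v 0 :: 'p padic_int vec}"
      by (simp only: carrier_vec_def vec_of_dim_0 singleton_conv)
    have "N = {0\<^sub>v 0}" using 0(1,2) unfolding c0 by blast
    also have "\<dots> = mat_range (0\<^sub>m 0 0)" 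
    proof -
      have "0\<^sub>m 0 0 *\<^sub>v 0\<^sub>v 0 = (0\<^sub>v 0 :: 'p padic_int vec)" by (rule eq_vecI) simp_all
      then show ?thesis by (simp only: mat_range_def index_zero_mat(3) c0 image_insert image_empty)
    qed
    finally show ?case by (intro bexI[of _ "0\<^sub>m 0 0"]) auto
  next
    case (Suc n)
    define tl where "tl v = vec n (\<lambda>i. v $ Suc i)" for v :: "'p padic_int vec"
    define N' where "N' = tl ` {v \<in> N. v $ 0 = 0}"
    have tl_add: "tl (v + w) = tl v + tl w" if "v \<in> carrier_vec (Suc n)" "w \<in> carrier_vec (Suc n)" for v w
      using that by (intro eq_vecI) (auto simp: tl_def)
    have tl_smult: "tl (c \<cdot>\<^sub>v v) = c \<cdot>\<^sub>v tl v" if "v \<in> carrier_vec (Suc n)" for v c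
      using that by (intro eq_vecI) (auto simp: tl_def)
    have Nc: "v \<in> carrier_vec (Suc n)" if "v \<in> N" for v using that Suc.prems(1) by blast
    obtain B' where B': "B' \<in> carrier_mat n n" "N' = mat_range B'"
    proof -
      have "\<exists>B\<in>carrier_mat n n. N' = mat_range B"
      proof (rule Suc.IH)
        show "N' \<subseteq> carrier_vec n" by (auto simp: N'_def tl_def)
        have "tl (0\<^sub>v (Suc n)) = 0\<^sub>v n" by (intro eq_vecI) (auto simp: tl_def)
        then show "0\<^sub>v n \<in> N'" unfolding N'_def using Suc.prems(2)
          by (intro image_eqI[of _ _ "0\<^sub>v (Suc n)"]) auto
        fix v w assume "v \<in> N'" "w \<in> N'"
        then obtain v' w' where "v' \<in> N" "v' $ 0 = 0" "v = tl v'" "w' \<in> N" "w' $ 0 = 0" "w = tl w'"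
          by (auto simp: N'_def)
        then show "v + w \<in> N'" unfolding N'_def using Suc.prems(3)[of v' w'] tl_add[of v' w'] Nc[of v'] Nc[of w']
          by (intro image_eqI[of _ _ "v' + w'"]) auto
      next
        fix v c assume "v \<in> N'"
        then obtain v' where "v' \<in> N" "v' $ 0 = 0" "v = tl v'" by (auto simp: N'_def)
        then show "c \<cdot>\<^sub>v v \<in> N'" unfolding N'_def using Suc.prems(4)[of v' c] tl_smult[of v' c] Nc[of v']
          by (intro image_eqI[of _ _ "c \<cdot>\<^sub>v v'"]) auto
      qed
      then show ?thesis using that by blast
    qed
    obtain u where u: "u \<in> N" "\<And>v. v \<in> N \<Longrightarrow> u $ 0 dvd v $ 0"
    proof (cases "\<exists>v\<in>N. v $ 0 \<noteq> 0")
      case False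
      then show ?thesis using that[of "0\<^sub>v (Suc n)"] Suc.prems(2) by auto
    next
      case True
      define P where "P k \<longleftrightarrow> (\<exists>v\<in>N. \<exists>c. c dvd 1 \<and> v $ 0 = \<varpi> ^ k * c)" for k
      obtain v where v: "v \<in> N" "v $ 0 \<noteq> 0" using True by blast
      obtain k c where "c dvd 1" "v $ 0 = \<varpi> ^ k * c" by (rule padic_decompose[OF v(2)])
      then have "P k" using v(1) unfolding P_def by blast
      then obtain l where l: "P l" "\<And>l'. l' < l \<Longrightarrow> \<not> P l'" using exists_least_iff[of P] by blast
      obtain u c where u: "u \<in> N" "c dvd 1" "u $ 0 = \<varpi> ^ l * c" using l(1) unfolding P_def by blast
      have "u $ 0 dvd w $ 0" if w: "w \<in> N" for w
      proof (cases "w $ 0 = 0")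
        case False
        obtain m d where d: "d dvd 1" "w $ 0 = \<varpi> ^ m * d" by (rule padic_decompose[OF False])
        then have "P m" using w unfolding P_def by blast
        then have "l \<le> m" using l(2) not_less by blast
        have "c dvd d" using u(2) dvd_trans one_dvd by blast
        then show ?thesis unfolding u(3) d(2) using \<open>l \<le> m\<close> by (intro mult_dvd_mono le_imp_power_dvd)
      qed simp
      then show ?thesis using that u(1) by blast
    qed
    define B where "B = mat (Suc n) (Suc n) (\<lambda>(i, j). if j = 0 then u $ i else if i = 0 then 0 else B' $$ (i - 1, j - 1))"
    have B: "B \<in> carrier_mat (Suc n) (Suc n)" by (simp add: B_def)
    have Bv: "(B *\<^sub>v v) $ 0 = v $ 0 * u $ 0" "tl (B *\<^sub>v v) = v $ 0 \<cdot>\<^sub>v tl u + B' *\<^sub>v tl v"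
      if v: "v \<in> carrier_vec (Suc n)" for v
    proof -
      show "(B *\<^sub>v v) $ 0 = v $ 0 * u $ 0" using v
        by (simp add: B_def scalar_prod_def sum.atLeast0_lessThan_Suc_shift del: sum.op_ivl_Suc)
      show "tl (B *\<^sub>v v) = v $ 0 \<cdot>\<^sub>v tl u + B' *\<^sub>v tl v"
        using v B'(1) by (intro eq_vecI)
          (auto simp: B_def tl_def scalar_prod_def sum.atLeast0_lessThan_Suc_shift simp del: sum.op_ivl_Suc)
    qed
    have eqI: "v = w" if "v \<in> carrier_vec (Suc n)" "w \<in> carrier_vec (Suc n)" "v $ 0 = w $ 0" "tl v = tl w" for v w
    proof (rule eq_vecI)
      fix i assume "i < dim_vec w"
      then show "v $ i = w $ i"
        using that by (cases i) (auto simp: tl_def dest: arg_cong[of _ _ "\<lambda>x. x $ (i - 1)"])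
    qed (use that in simp)
    have "N = mat_range B"
    proof
      show "N \<subseteq> mat_range B"
      proof
        fix v assume v: "v \<in> N"
        obtain c where c: "v $ 0 = u $ 0 * c" using u(2)[OF v] ..
        define w where "w = v + (- c) \<cdot>\<^sub>v u"
        have w: "w \<in> N" unfolding w_def by (intro Suc.prems(3,4) v u)
        have "w $ 0 = 0" using Nc[OF v] Nc[OF u(1)] c by (simp add: w_def mult.commute)
        then have "tl w \<in> N'" using w by (auto simp: N'_def)
        then obtain a where a: "a \<in> carrier_vec n" "tl w = B' *\<^sub>v a" using B' by (auto simp: mat_range_def)
        define a' where "a' = vec (Suc n) (\<lambda>i. if i = 0 then c else a $ (i - 1))"
        have a': "a' \<in> carrier_vec (Suc n)" "a' $ 0 = c" "tl a' = a"
          using a(1) by (auto simp: a'_def tl_def)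
        have tlv: "tl v = c \<cdot>\<^sub>v tl u + tl w"
          unfolding w_def using Nc[OF v] Nc[OF u(1)] by (intro eq_vecI) (auto simp: tl_def)
        have "v = B *\<^sub>v a'"
        proof (rule eqI[OF Nc[OF v] mult_mat_vec_carrier[OF B a'(1)]])
          show "v $ 0 = (B *\<^sub>v a') $ 0" unfolding Bv(1)[OF a'(1)] a'(2) c by (rule mult.commute)
          show "tl v = tl (B *\<^sub>v a')" unfolding Bv(2)[OF a'(1)] a'(2,3) tlv a(2) by (rule refl)
        qed
        then show "v \<in> mat_range B" using a'(1) B by (auto simp: mat_range_def)
      qed
      show "mat_range B \<subseteq> N"
      proof
        fix v assume "v \<in> mat_range B"
        then obtain a where a: "a \<in> carrier_vec (Suc n)" "v = B *\<^sub>v a" using B by (auto simp: mat_range_def)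
        have "B' *\<^sub>v tl a \<in> N'" using B' by (auto simp: mat_range_def tl_def)
        then obtain w where w: "w \<in> N" "w $ 0 = 0" "B' *\<^sub>v tl a = tl w" by (auto simp: N'_def)
        have "v = a $ 0 \<cdot>\<^sub>v u + w"
        proof (rule eqI)
          show "v \<in> carrier_vec (Suc n)" unfolding a(2) by (rule mult_mat_vec_carrier[OF B a(1)])
          show "a $ 0 \<cdot>\<^sub>v u + w \<in> carrier_vec (Suc n)" using Nc[OF w(1)] Nc[OF u(1)] by simp
          show "v $ 0 = (a $ 0 \<cdot>\<^sub>v u + w) $ 0"
            unfolding a(2) Bv(1)[OF a(1)] using Nc[OF w(1)] Nc[OF u(1)] w(2) by simp
          show "tl v = tl (a $ 0 \<cdot>\<^sub>v u + w)"
            unfolding a(2) Bv(2)[OF a(1)] w(3) using Nc[OF w(1)] Nc[OF u(1)] by (simp add: tl_add tl_smult)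
        qed
        then show "v \<in> N" using Suc.prems(3,4) u(1) w(1) by simp
      qed
    qed
    then show ?case using B by blast
  qed
  then show ?thesis using that by blast
qed

text \<open>A finite generating set gives a surjection from a free module. Its kernel is the range
  of a square matrix, and a Smith form of that matrix is diagonal.\<close>

lemma fg_module_presentation:
  fixes H :: "('p::prime_card padic_int, 'a) module"
  assumes "H \<in> fg_modules"
  obtains n f where "\<And>i. p_power (f i)" "presents (mat_diag n f) H"
proof -
  have mod: "module class_ring H" using assms by (simp add: fg_modules_def)
  interpret module class_ring H by (rule mod)
  obtain S where S: "finite S" "S \<subseteq> carrier H" "span S = carrier H"
    using assms by (auto simp: fg_modules_def)
  obtain s where s: "bij_betw s {0..<card S} S" using ex_bij_betw_nat_finite[OF S(1)] by blast
  define n where "n = card S"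
  have sc: "s i \<in> carrier H" if "i < n" for i
    using bij_betwE[OF s] that S(2) unfolding n_def by auto
  define h where "h v = (\<Oplus>\<^bsub>H\<^esub>i\<in>{0..<n}. v $ i \<odot>\<^bsub>H\<^esub> s i)" for v
  have hc: "h v \<in> carrier H" for v unfolding h_def using sc by (intro finsum_closed) auto
  have hadd: "h (v + w) = h v \<oplus>\<^bsub>H\<^esub> h w" if "v \<in> carrier_vec n" "w \<in> carrier_vec n" for v w
  proof -
    have "h (v + w) = (\<Oplus>\<^bsub>H\<^esub>i\<in>{0..<n}. v $ i \<odot>\<^bsub>H\<^esub> s i \<oplus>\<^bsub>H\<^esub> w $ i \<odot>\<^bsub>H\<^esub> s i)"
      unfolding h_def using that sc smult_l_distr by (intro finsum_cong') auto
    also have "\<dots> = h v \<oplus>\<^bsub>H\<^esub> h w" unfolding h_def using sc by (intro finsum_addf) auto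
    finally show ?thesis .
  qed
  have hsmult: "h (c \<cdot>\<^sub>v v) = c \<odot>\<^bsub>H\<^esub> h v" if "v \<in> carrier_vec n" for v c
  proof -
    have "h (c \<cdot>\<^sub>v v) = (\<Oplus>\<^bsub>H\<^esub>i\<in>{0..<n}. c \<odot>\<^bsub>H\<^esub> (v $ i \<odot>\<^bsub>H\<^esub> s i))"
      unfolding h_def using that sc smult_assoc1 by (intro finsum_cong') auto
    also have "\<dots> = c \<odot>\<^bsub>H\<^esub> h v" unfolding h_def using sc by (intro finsum_smult[symmetric]) auto
    finally show ?thesis .
  qed
  have hsurj: "\<exists>v\<in>carrier_vec n. h v = y" if "y \<in> carrier H" for y
  proof -
    have "y \<in> {lincomb a S | a. a \<in> S \<rightarrow> carrier class_ring}"
      using that unfolding finite_span[OF S(1,2), symmetric] S(3) .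
    then obtain a where a: "y = lincomb a S" by (elim CollectE exE conjE)
    have "lincomb a S = (\<Oplus>\<^bsub>H\<^esub>v\<in>s ` {0..<n}. a v \<odot>\<^bsub>H\<^esub> v)"
      unfolding lincomb_def n_def bij_betw_imp_surj_on[OF s] by (rule refl)
    also have "\<dots> = (\<Oplus>\<^bsub>H\<^esub>i\<in>{0..<n}. a (s i) \<odot>\<^bsub>H\<^esub> s i)"
      using s S(2) unfolding bij_betw_def n_def by (intro finsum_reindex) auto
    also have "\<dots> = h (vec n (\<lambda>i. a (s i)))"
      unfolding h_def using sc by (intro finsum_cong') auto
    finally show ?thesis using a by (intro bexI[of _ "vec n (\<lambda>i. a (s i))"]) auto
  qed
  have h0: "h (0\<^sub>v n) = \<zero>\<^bsub>H\<^esub>"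
  proof -
    have "(0 :: 'p padic_int) \<cdot>\<^sub>v 0\<^sub>v n = 0\<^sub>v n" by (intro eq_vecI) simp_all
    then show ?thesis using hsmult[of "0\<^sub>v n" 0] smult_l_null[OF hc] by simp
  qed
  define N where "N = {v \<in> carrier_vec n. h v = \<zero>\<^bsub>H\<^esub>}"
  obtain B where B: "B \<in> carrier_mat n n" "N = mat_range B"
  proof (rule submodule_eq_mat_range[of N n])
    show "v + w \<in> N" if "v \<in> N" "w \<in> N" for v w using that hadd by (auto simp: N_def)
    show "c \<cdot>\<^sub>v v \<in> N" if "v \<in> N" for v c using that hsmult smult_r_null by (auto simp: N_def)
  qed (use h0 in \<open>auto simp: N_def\<close>)
  have "presents B H"
  proof (rule presentsI[OF B(1), of h])
    fix v w :: "'p padic_int vec" assume vw: "v \<in> carrier_vec n" "w \<in> carrier_vec n"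
    have "v = (v - w) + w" using vw by (intro eq_vecI) auto
    then have "h v = h (v - w) \<oplus>\<^bsub>H\<^esub> h w" using hadd[of "v - w" w] vw by simp
    then have "h v = h w \<longleftrightarrow> h (v - w) = \<zero>\<^bsub>H\<^esub>"
      using M.add.r_cancel_one[OF hc[of w] hc[of "v - w"]] by simp
    then show "h v = h w \<longleftrightarrow> v - w \<in> mat_range B" using vw by (simp add: B(2)[symmetric] N_def)
  qed (use hc hadd hsmult hsurj in auto)
  moreover obtain f where "\<And>i. p_power (f i)" "equiv_mat B (mat_diag n f)"
    by (rule smith_normal_form_square[OF B(1)]) blast
  ultimately show ?thesis using that presents_equiv equiv_mat_sym by blast
qed

lemma mat_range_diag:
  fixes f :: "nat \<Rightarrow> 'a::comm_ring_1"
  shows "v \<in> mat_range (mat_diag n f) \<longleftrightarrow> v \<in> carrier_vec n \<and> (\<forall>i<n. f i dvd v $ i)"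
proof -
  have mv: "(mat_diag n f *\<^sub>v w) $ i = f i * w $ i" if "w \<in> carrier_vec n" "i < n" for w i
  proof -
    have "(mat_diag n f *\<^sub>v w) $ i = (\<Sum>j = 0..<n. (if i = j then f j else 0) * w $ j)"
      using that by (simp add: mat_diag_def scalar_prod_def)
    also have "\<dots> = (\<Sum>j = 0..<n. if j = i then f i * w $ i else 0)"
      by (intro sum.cong) auto
    finally show ?thesis using that by simp
  qed
  show ?thesis
  proof
    assume "v \<in> mat_range (mat_diag n f)"
    then obtain w where w: "w \<in> carrier_vec n" "v = mat_diag n f *\<^sub>v w" by (auto simp: mat_range_def)
    have "v \<in> carrier_vec n" unfolding w(2) by (rule mult_mat_vec_carrier[OF mat_diag_dim w(1)])
    then show "v \<in> carrier_vec n \<and> (\<forall>i<n. f i dvd v $ i)" using mv[OF w(1)] w(2) by simp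
  next
    assume v: "v \<in> carrier_vec n \<and> (\<forall>i<n. f i dvd v $ i)"
    then obtain c where c: "\<And>i. i < n \<Longrightarrow> v $ i = f i * c i" unfolding dvd_def by metis
    have "v = mat_diag n f *\<^sub>v vec n c"
      using v c mv[of "vec n c"] by (intro eq_vecI) auto
    then show "v \<in> mat_range (mat_diag n f)" by (auto simp: mat_range_def)
  qed
qed

lemma padic_residue_eq_iff: "padic_residue x r = padic_residue y r \<longleftrightarrow> \<varpi> ^ r dvd x - y"
proof -
  have "padic_residue (x - y) r = (padic_residue x r - padic_residue y r) mod int CARD('a) ^ r"
    using padic_residue_add[of x "- y" r] by (simp add: padic_residue_uminus mod_simps)
  then have "\<varpi> ^ r dvd x - y \<longleftrightarrow> padic_residue x r mod int CARD('a) ^ r = padic_residue y r mod int CARD('a) ^ r"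
    by (simp only: uniformizer_power_dvd_iff mod_eq_dvd_iff dvd_eq_mod_eq_0)
  then show ?thesis by simp
qed

definition torsion_index :: "(nat \<Rightarrow> nat) \<Rightarrow> (nat \<times> nat) set" where
  "torsion_index d = {(r, k). 1 \<le> r \<and> k < d r}"

lemma std_module_simps:
  "carrier (std_module e d :: ('p::prime_card padic_int, _) module)
    = carrier_vec e \<times> (\<Pi>\<^sub>E x\<in>torsion_index d. {0..<int CARD('p) ^ fst x})"
  "v \<oplus>\<^bsub>std_module e d :: ('p padic_int, _) module\<^esub> w
    = (fst v + fst w, \<lambda>x\<in>torsion_index d. (snd v x + snd w x) mod int CARD('p) ^ fst x)"
  "c \<odot>\<^bsub>std_module e d :: ('p padic_int, _) module\<^esub> v
    = (c \<cdot>\<^sub>v fst v, \<lambda>x\<in>torsion_index d. (padic_residue c (fst x) * snd v x) mod int CARD('p) ^ fst x)"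
proof -
  have eq: "(std_module e d :: ('p padic_int, _) module)
      = direct_sum (free_module e) (prod_module (torsion_index d) (\<lambda>x. cyclic_module (fst x)))"
    by (simp only: std_module_def torsion_index_def case_prod_unfold)
  show "carrier (std_module e d :: ('p padic_int, _) module)
    = carrier_vec e \<times> (\<Pi>\<^sub>E x\<in>torsion_index d. {0..<int CARD('p) ^ fst x})"
    "v \<oplus>\<^bsub>std_module e d :: ('p padic_int, _) module\<^esub> w
    = (fst v + fst w, \<lambda>x\<in>torsion_index d. (snd v x + snd w x) mod int CARD('p) ^ fst x)"
    "c \<odot>\<^bsub>std_module e d :: ('p padic_int, _) module\<^esub> v
    = (c \<cdot>\<^sub>v fst v, \<lambda>x\<in>torsion_index d. (padic_residue c (fst x) * snd v x) mod int CARD('p) ^ fst x)"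
    unfolding eq by (simp_all add: direct_sum_def prod_module_def cyclic_module_def module_vec_simps)
qed

text \<open>A diagonal entry 0 yields a free summand, \<varpi>^r with r at least 1 a cyclic one, and
  1 a trivial one. The bijections \<open>b0\<close> and \<open>b r\<close> number the positions of
  each kind and match them with the index set of \<open>std_module\<close>.\<close>

lemma presents_std_module:
  fixes f :: "nat \<Rightarrow> 'p::prime_card padic_int"
  assumes pp: "\<And>i. i < n \<Longrightarrow> p_power (f i)"
    and e: "e = card {i. i < n \<and> f i = 0}"
    and d: "\<And>r. 1 \<le> r \<Longrightarrow> d r = card {i. i < n \<and> f i = \<varpi> ^ r}"
  shows "presents (mat_diag n f) (std_module e d)"
proof -
  have "\<exists>b. bij_betw b {0..<e} {i. i < n \<and> f i = 0}"
    unfolding e by (rule ex_bij_betw_nat_finite) simp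
  then obtain b0 where b0: "bij_betw b0 {0..<e} {i. i < n \<and> f i = 0}" ..
  have "\<forall>r. \<exists>b. 1 \<le> r \<longrightarrow> bij_betw b {0..<d r} {i. i < n \<and> f i = \<varpi> ^ r}"
    using ex_bij_betw_nat_finite[of "{i. i < n \<and> f i = \<varpi> ^ r}" for r] d by auto
  then obtain b where b: "\<And>r. 1 \<le> r \<Longrightarrow> bij_betw (b r) {0..<d r} {i. i < n \<and> f i = \<varpi> ^ r}" by metis
  let ?I = "torsion_index d"
  let ?P = "\<lambda>r. int CARD('p) ^ r"
  have b0': "b0 i < n" "f (b0 i) = 0" if "i < e" for i using bij_betwE[OF b0] that by auto
  have b': "b (fst x) (snd x) < n" "f (b (fst x) (snd x)) = \<varpi> ^ fst x" if "x \<in> ?I" for x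
    using bij_betwE[OF b[of "fst x"]] that by (auto simp: torsion_index_def)
  define h where "h v = (vec e (\<lambda>i. v $ b0 i), \<lambda>x\<in>?I. padic_residue (v $ b (fst x) (snd x)) (fst x))" for v :: "'p padic_int vec"
  show ?thesis
  proof (rule presentsI[OF mat_diag_dim, of _ h], goal_cases)
    case (1 v)
    then show ?case by (auto simp: h_def std_module_simps padic_residue_bounds)
  next
    case (2 v w)
    have "vec e (\<lambda>i. (v + w) $ b0 i) = vec e (\<lambda>i. v $ b0 i) + vec e (\<lambda>i. w $ b0 i)"
      using 2 b0' by (intro eq_vecI) auto
    then show ?case using 2 b' by (auto simp: h_def std_module_simps padic_residue_add intro!: restrict_ext)
  next
    case (3 c v)
    have "vec e (\<lambda>i. (c \<cdot>\<^sub>v v) $ b0 i) = c \<cdot>\<^sub>v vec e (\<lambda>i. v $ b0 i)"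
      using 3 b0' by (intro eq_vecI) auto
    then show ?case using 3 b' by (auto simp: h_def std_module_simps padic_residue_mult intro!: restrict_ext)
  next
    case (4 y)
    obtain u w where y: "y = (u, w)" "u \<in> carrier_vec e" "w \<in> (\<Pi>\<^sub>E x\<in>?I. {0..<?P (fst x)})"
      using 4 by (auto simp: std_module_simps)
    have "\<exists>rr. \<forall>i<n. f i \<noteq> 0 \<longrightarrow> f i = \<varpi> ^ rr i"
      using pp unfolding p_power_def by metis
    then obtain rr where rr: "\<And>i. i < n \<Longrightarrow> f i \<noteq> 0 \<Longrightarrow> f i = \<varpi> ^ rr i" by blast
    \<comment> \<open>The preimage of \<open>y\<close> position by position, with integers lifted to
      p-adic integers. At positions with entry 1 any value would do, since \<open>h\<close> does not
      look at them.\<close>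
    define v where "v = vec n (\<lambda>j. if f j = 0 then u $ inv_into {0..<e} b0 j
      else of_int (w (rr j, inv_into {0..<d (rr j)} (b (rr j)) j)))"
    have v0: "v $ b0 i = u $ i" if "i < e" for i
      using b0'[OF that] bij_betw_inv_into_left[OF b0, of i] that by (simp add: v_def)
    have v1: "v $ b (fst x) (snd x) = of_int (w x)" if x: "x \<in> ?I" for x
    proof -
      have "f (b (fst x) (snd x)) \<noteq> 0" using b'(2)[OF x] by simp
      moreover from this have "rr (b (fst x) (snd x)) = fst x"
        using rr[OF b'(1)[OF x]] b'(2)[OF x] uniformizer_power_eq_iff by metis
      moreover have "inv_into {0..<d (fst x)} (b (fst x)) (b (fst x) (snd x)) = snd x"
        using x by (intro bij_betw_inv_into_left[OF b]) (auto simp: torsion_index_def)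
      ultimately show ?thesis using b'(1)[OF x] by (simp add: v_def)
    qed
    have "h v = y"
    proof -
      have "vec e (\<lambda>i. v $ b0 i) = u" using v0 y(2) by (intro eq_vecI) auto
      moreover have "(\<lambda>x\<in>?I. padic_residue (v $ b (fst x) (snd x)) (fst x)) = w"
      proof
        fix x
        show "(\<lambda>x\<in>?I. padic_residue (v $ b (fst x) (snd x)) (fst x)) x = w x"
        proof (cases "x \<in> ?I")
          case True
          then have "w x mod ?P (fst x) = w x" using PiE_mem[OF y(3) True] by (intro mod_pos_pos_trivial) auto
          then show ?thesis using True v1[OF True] by (simp add: padic_residue_of_int)
        next
          case False
          then show ?thesis using PiE_arb[OF y(3) False] by simp
        qed
      qed
      ultimately show ?thesis by (simp add: h_def y(1))
    qed
    moreover have "v \<in> carrier_vec n" by (simp add: v_def)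
    ultimately show ?case by blast
  next
    case (5 v w)
    have "h v = h w \<longleftrightarrow> (\<forall>i<e. v $ b0 i = w $ b0 i) \<and>
        (\<forall>x\<in>?I. padic_residue (v $ b (fst x) (snd x)) (fst x) = padic_residue (w $ b (fst x) (snd x)) (fst x))"
      unfolding h_def by (auto simp: vec_eq_iff restrict_def fun_eq_iff)
    also have "\<dots> \<longleftrightarrow> (\<forall>i<n. f i dvd v $ i - w $ i)"
    proof
      assume L: "(\<forall>i<e. v $ b0 i = w $ b0 i) \<and>
        (\<forall>x\<in>?I. padic_residue (v $ b (fst x) (snd x)) (fst x) = padic_residue (w $ b (fst x) (snd x)) (fst x))"
      show "\<forall>i<n. f i dvd v $ i - w $ i"
      proof (intro allI impI)
        fix i assume i: "i < n"
        consider "f i = 0" | "f i = \<varpi> ^ 0" | r where "1 \<le> r" "f i = \<varpi> ^ r"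
          using pp[OF i] unfolding p_power_def by (metis less_one not_le)
        then show "f i dvd v $ i - w $ i"
        proof cases
          case 1
          then have "i \<in> b0 ` {0..<e}" using bij_betw_imp_surj_on[OF b0] i by simp
          then show ?thesis using L 1 by auto
        next
          case (3 r)
          then have "i \<in> b r ` {0..<d r}" using bij_betw_imp_surj_on[OF b[OF 3(1)]] i by simp
          then obtain k where k: "k < d r" "i = b r k" by auto
          then have "(r, k) \<in> ?I" using 3 by (simp add: torsion_index_def)
          then have "padic_residue (v $ i) r = padic_residue (w $ i) r" using L k by fastforce
          then show ?thesis using 3(2) by (simp add: padic_residue_eq_iff)
        qed simp
      qed
    next
      assume R: "\<forall>i<n. f i dvd v $ i - w $ i"
      show "(\<forall>i<e. v $ b0 i = w $ b0 i) \<and>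
        (\<forall>x\<in>?I. padic_residue (v $ b (fst x) (snd x)) (fst x) = padic_residue (w $ b (fst x) (snd x)) (fst x))"
      proof (intro conjI allI impI ballI)
        fix i assume i: "i < e"
        have "f (b0 i) dvd v $ b0 i - w $ b0 i" using R b0'(1)[OF i] by blast
        then show "v $ b0 i = w $ b0 i" using b0'(2)[OF i] by simp
      next
        fix x assume x: "x \<in> ?I"
        have "f (b (fst x) (snd x)) dvd v $ b (fst x) (snd x) - w $ b (fst x) (snd x)" using R b'(1)[OF x] by blast
        then show "padic_residue (v $ b (fst x) (snd x)) (fst x) = padic_residue (w $ b (fst x) (snd x)) (fst x)"
          unfolding b'(2)[OF x] padic_residue_eq_iff .
      qed
    qed
    also have "\<dots> \<longleftrightarrow> v - w \<in> mat_range (mat_diag n f)"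
      using 5 by (simp add: mat_range_diag)
    finally show ?case .
  qed
qed

section \<open>Uniqueness of the diagonal presentation\<close>

lemma presents_hom_zero:
  assumes "module class_ring H" "\<And>c v. v \<in> carrier_vec n \<Longrightarrow> h (c \<cdot>\<^sub>v v) = c \<odot>\<^bsub>H\<^esub> h v"
    "\<And>v. v \<in> carrier_vec n \<Longrightarrow> h v \<in> carrier H"
  shows "h (0\<^sub>v n :: 'p::prime_card padic_int vec) = \<zero>\<^bsub>H\<^esub>"
proof -
  interpret module class_ring H by fact
  have "(0 :: 'p padic_int) \<cdot>\<^sub>v 0\<^sub>v n = 0\<^sub>v n" by (intro eq_vecI) simp_all
  then show ?thesis using assms(2)[of "0\<^sub>v n" 0] smult_l_null[OF assms(3)[of "0\<^sub>v n"]] by simp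
qed

text \<open>Free modules are projective: preimages under \<open>k\<close> of the images of the unit
  vectors form the columns of \<open>P\<close>.\<close>

lemma presents_lift:
  fixes H :: "('p::prime_card padic_int, 'a) module"
  assumes mod: "module class_ring H"
    and h: "\<And>v. v \<in> carrier_vec n \<Longrightarrow> h v \<in> carrier H"
      "\<And>v w. v \<in> carrier_vec n \<Longrightarrow> w \<in> carrier_vec n \<Longrightarrow> h (v + w) = h v \<oplus>\<^bsub>H\<^esub> h w"
      "\<And>c v. v \<in> carrier_vec n \<Longrightarrow> h (c \<cdot>\<^sub>v v) = c \<odot>\<^bsub>H\<^esub> h v"
    and k: "\<And>v. v \<in> carrier_vec m \<Longrightarrow> k v \<in> carrier H"
      "\<And>v w. v \<in> carrier_vec m \<Longrightarrow> w \<in> carrier_vec m \<Longrightarrow> k (v + w) = k v \<oplus>\<^bsub>H\<^esub> k w"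
      "\<And>c v. v \<in> carrier_vec m \<Longrightarrow> k (c \<cdot>\<^sub>v v) = c \<odot>\<^bsub>H\<^esub> k v"
      "\<And>y. y \<in> carrier H \<Longrightarrow> \<exists>v\<in>carrier_vec m. k v = y"
  obtains P where "P \<in> carrier_mat m n" "\<And>v. v \<in> carrier_vec n \<Longrightarrow> k (P *\<^sub>v v) = h v"
proof -
  have "\<forall>j. \<exists>w. j < n \<longrightarrow> w \<in> carrier_vec m \<and> k w = h (unit_vec n j)"
    using k(4) h(1) by (metis unit_vec_carrier)
  then obtain w where w: "\<And>j. j < n \<Longrightarrow> w j \<in> carrier_vec m \<and> k (w j) = h (unit_vec n j)" by metis
  define P where "P = mat m n (\<lambda>(i, j). w j $ i)"
  have P: "P \<in> carrier_mat m n" by (simp add: P_def)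
  have "k (P *\<^sub>v v) = h v" if v: "v \<in> carrier_vec n" for v
    using v
  proof (rule vec_unit_induct)
    have "P *\<^sub>v 0\<^sub>v n = 0\<^sub>v m" using P by (intro eq_vecI) auto
    then show "k (P *\<^sub>v 0\<^sub>v n) = h (0\<^sub>v n)"
      using presents_hom_zero[OF mod h(3,1)] presents_hom_zero[OF mod k(3,1)] by simp
  next
    fix j assume j: "j < n"
    have "P *\<^sub>v unit_vec n j = w j"
      using P w[OF j] j by (intro eq_vecI) (auto simp: P_def)
    then show "k (P *\<^sub>v unit_vec n j) = h (unit_vec n j)" using w[OF j] by simp
  next
    fix v v' assume "v \<in> carrier_vec n" "v' \<in> carrier_vec n" "k (P *\<^sub>v v) = h v" "k (P *\<^sub>v v') = h v'"
    then show "k (P *\<^sub>v (v + v')) = h (v + v')"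
      using P k(2) h(2) by (simp add: mult_add_distrib_mat_vec[OF P])
  next
    fix c v assume "v \<in> carrier_vec n" "k (P *\<^sub>v v) = h v"
    then show "k (P *\<^sub>v (c \<cdot>\<^sub>v v)) = h (c \<cdot>\<^sub>v v)"
      using P k(3) h(3) by (simp add: mult_mat_smult_vec[OF P])
  qed
  then show ?thesis using that P by blast
qed

text \<open>Lifting the identity of \<open>H\<close> in both directions gives \<open>P\<close> and
  \<open>Q\<close> with Q P congruent to the identity modulo the relations. Restricted to the
  nonunit positions of f outside \<open>T\<close>, a summand of Q P through a position i not counted
  on the right vanishes modulo \<varpi>: a unit \<open>g i\<close> forces \<varpi> to divide the
  entry of \<open>Q\<close>, and \<open>g i\<close> in \<open>T\<close> forces it to divide the
  entry of \<open>P\<close>. So an identity matrix modulo \<varpi> factors through the positions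
  counted on the right. The set \<open>T\<close> will be empty or consist of the multiples of some
  \<varpi>^k.\<close>

lemma presents_diag_count_le:
  fixes H :: "('p::prime_card padic_int, 'a) module"
  assumes mod: "module class_ring H" and f: "presents (mat_diag n f) H" and g: "presents (mat_diag m g) H"
    and T: "\<And>a b x. a \<in> T \<Longrightarrow> b \<notin> T \<Longrightarrow> a dvd x * b \<Longrightarrow> \<varpi> dvd x"
  shows "card {j. j < n \<and> \<varpi> dvd f j \<and> f j \<notin> T} \<le> card {i. i < m \<and> \<varpi> dvd g i \<and> g i \<notin> T}"
proof -
  obtain h where h: "\<And>v. v \<in> carrier_vec n \<Longrightarrow> h v \<in> carrier H"
    "\<And>v w. v \<in> carrier_vec n \<Longrightarrow> w \<in> carrier_vec n \<Longrightarrow> h (v + w) = h v \<oplus>\<^bsub>H\<^esub> h w"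
    "\<And>c v. v \<in> carrier_vec n \<Longrightarrow> h (c \<cdot>\<^sub>v v) = c \<odot>\<^bsub>H\<^esub> h v"
    "\<And>y. y \<in> carrier H \<Longrightarrow> \<exists>v\<in>carrier_vec n. h v = y"
    "\<And>v w. v \<in> carrier_vec n \<Longrightarrow> w \<in> carrier_vec n \<Longrightarrow> h v = h w \<longleftrightarrow> v - w \<in> mat_range (mat_diag n f)"
    by (rule presentsE[OF f mat_diag_dim]) blast
  obtain k where k: "\<And>v. v \<in> carrier_vec m \<Longrightarrow> k v \<in> carrier H"
    "\<And>v w. v \<in> carrier_vec m \<Longrightarrow> w \<in> carrier_vec m \<Longrightarrow> k (v + w) = k v \<oplus>\<^bsub>H\<^esub> k w"
    "\<And>c v. v \<in> carrier_vec m \<Longrightarrow> k (c \<cdot>\<^sub>v v) = c \<odot>\<^bsub>H\<^esub> k v"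
    "\<And>y. y \<in> carrier H \<Longrightarrow> \<exists>v\<in>carrier_vec m. k v = y"
    "\<And>v w. v \<in> carrier_vec m \<Longrightarrow> w \<in> carrier_vec m \<Longrightarrow> k v = k w \<longleftrightarrow> v - w \<in> mat_range (mat_diag m g)"
    by (rule presentsE[OF g mat_diag_dim]) blast
  obtain P where P: "P \<in> carrier_mat m n" "\<And>v. v \<in> carrier_vec n \<Longrightarrow> k (P *\<^sub>v v) = h v"
    using presents_lift[OF mod h(1-3) k(1-4)] by blast
  obtain Q where Q: "Q \<in> carrier_mat n m" "\<And>v. v \<in> carrier_vec m \<Longrightarrow> h (Q *\<^sub>v v) = k v"
    using presents_lift[OF mod k(1-3) h(1-4)] by blast
  have unit_entry: "(A *\<^sub>v (c \<cdot>\<^sub>v unit_vec b j)) $ i = A $$ (i, j) * c"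
    if "A \<in> carrier_mat a b" "i < a" "j < b" for A :: "'p padic_int mat" and a b c i j
    using that by (simp add: mult_mat_smult_vec[OF that(1)] mult.commute)
  have Pdvd: "g i dvd P $$ (i, j) * f j" if "i < m" "j < n" for i j
  proof -
    let ?v = "f j \<cdot>\<^sub>v unit_vec n j"
    have "?v \<in> mat_range (mat_diag n f)" using that by (auto simp: mat_range_diag)
    then have "h ?v = h (0\<^sub>v n)" using h(5)[of ?v "0\<^sub>v n"] that by simp
    then have "k (P *\<^sub>v ?v) = k (0\<^sub>v m)"
      using P(2)[of ?v] presents_hom_zero[OF mod h(3,1)] presents_hom_zero[OF mod k(3,1)] by simp
    then have "P *\<^sub>v ?v - 0\<^sub>v m \<in> mat_range (mat_diag m g)" using k(5)[of "P *\<^sub>v ?v" "0\<^sub>v m"] P(1) by simp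
    then have "P *\<^sub>v ?v \<in> mat_range (mat_diag m g)" using P(1) by (simp add: minus_zero_vec[of _ m])
    then have "g i dvd (P *\<^sub>v ?v) $ i" using that by (simp only: mat_range_diag)
    then show ?thesis by (simp only: unit_entry[OF P(1) that])
  qed
  have Qdvd: "f i dvd Q $$ (i, j) * g j" if "i < n" "j < m" for i j
  proof -
    let ?v = "g j \<cdot>\<^sub>v unit_vec m j"
    have "?v \<in> mat_range (mat_diag m g)" using that by (auto simp: mat_range_diag)
    then have "k ?v = k (0\<^sub>v m)" using k(5)[of ?v "0\<^sub>v m"] that by simp
    then have "h (Q *\<^sub>v ?v) = h (0\<^sub>v n)"
      using Q(2)[of ?v] presents_hom_zero[OF mod h(3,1)] presents_hom_zero[OF mod k(3,1)] by simp
    then have "Q *\<^sub>v ?v - 0\<^sub>v n \<in> mat_range (mat_diag n f)" using h(5)[of "Q *\<^sub>v ?v" "0\<^sub>v n"] Q(1) by simp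
    then have "Q *\<^sub>v ?v \<in> mat_range (mat_diag n f)" using Q(1) by (simp add: minus_zero_vec[of _ n])
    then have "f i dvd (Q *\<^sub>v ?v) $ i" using that by (simp only: mat_range_diag)
    then show ?thesis by (simp only: unit_entry[OF Q(1) that])
  qed
  have QP: "f i dvd (Q * P) $$ (i, j) - 1\<^sub>m n $$ (i, j)" if "i < n" "j < n" for i j
  proof -
    let ?v = "unit_vec n j :: 'p padic_int vec"
    have "h (Q *\<^sub>v (P *\<^sub>v ?v)) = h ?v" using P Q by simp
    then have "Q *\<^sub>v (P *\<^sub>v ?v) - ?v \<in> mat_range (mat_diag n f)"
      using h(5)[of "Q *\<^sub>v (P *\<^sub>v ?v)" ?v] P(1) Q(1) by simp
    moreover have "Q *\<^sub>v (P *\<^sub>v ?v) = (Q * P) *\<^sub>v ?v"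
      by (rule assoc_mult_mat_vec[OF Q(1) P(1), symmetric]) simp
    ultimately have "f i dvd ((Q * P) *\<^sub>v ?v - ?v) $ i" using that by (simp add: mat_range_diag)
    moreover have "((Q * P) *\<^sub>v ?v) $ i = (Q * P) $$ (i, j)"
      using unit_entry[OF mult_carrier_mat[OF Q(1) P(1)] that, of 1] by simp
    ultimately show ?thesis using that P(1) Q(1) by (simp del: index_mult_mat_vec index_mult_mat(1))
  qed
  define J where "J = {j. j < n \<and> \<varpi> dvd f j \<and> f j \<notin> T}"
  define I where "I = {i. i < m \<and> \<varpi> dvd g i \<and> g i \<notin> T}"
  obtain js where js: "bij_betw js {0..<card J} J" using ex_bij_betw_nat_finite[of J] by (auto simp: J_def)
  obtain ii where ii: "bij_betw ii {0..<card I} I" using ex_bij_betw_nat_finite[of I] by (auto simp: I_def)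
  have jsJ: "js a \<in> J" if "a < card J" for a using bij_betwE[OF js] that by auto
  have iiI: "ii b \<in> I" if "b < card I" for b using bij_betwE[OF ii] that by auto
  define X where "X = mat (card J) (card I) (\<lambda>(a, b). Q $$ (js a, ii b))"
  define Y where "Y = mat (card I) (card J) (\<lambda>(b, a). P $$ (ii b, js a))"
  have c: "X \<in> carrier_mat (card J) (card I)" "Y \<in> carrier_mat (card I) (card J)" by (simp_all add: X_def Y_def)
  have "cong_mat (Suc 0) (\<varpi> ^ 0 \<cdot>\<^sub>m 1\<^sub>m (card J)) (X * Y)"
  proof (rule cong_mat_sym, rule cong_matI[of _ "card J" "card J"])
    fix a a' assume a: "a < card J" "a' < card J"
    have ja: "js a < n" "\<varpi> dvd f (js a)" "js a' < n" "f (js a') \<notin> T" using jsJ[OF a(1)] jsJ[OF a(2)] by (auto simp: J_def)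
    have small: "\<varpi> dvd Q $$ (js a, i) * P $$ (i, js a')" if i: "i < m" "i \<notin> I" for i
    proof (cases "\<varpi> dvd g i")
      case True
      then have "g i \<in> T" using i by (simp add: I_def)
      then have "\<varpi> dvd P $$ (i, js a')" using T[OF _ ja(4)] Pdvd[OF i(1) ja(3)] by blast
      then show ?thesis by (rule dvd_mult)
    next
      case False
      have "\<varpi> dvd Q $$ (js a, i) * g i" using Qdvd[OF ja(1) i(1)] ja(2) dvd_trans by blast
      then have "\<varpi> dvd Q $$ (js a, i)" using False uniformizer_dvd_mult_iff by blast
      then show ?thesis by (rule dvd_mult2)
    qed
    have "(X * Y) $$ (a, a') = (\<Sum>b = 0..<card I. Q $$ (js a, ii b) * P $$ (ii b, js a'))"
      using a by (simp add: X_def Y_def scalar_prod_def)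
    also have "\<dots> = (\<Sum>i\<in>I. Q $$ (js a, i) * P $$ (i, js a'))"
      by (rule sum.reindex_bij_betw[OF ii])
    finally have XY: "(X * Y) $$ (a, a') = \<dots>" .
    have "(Q * P) $$ (js a, js a') = (\<Sum>i = 0..<m. Q $$ (js a, i) * P $$ (i, js a'))"
      using P(1) Q(1) ja by (simp add: scalar_prod_def)
    also have "\<dots> = (\<Sum>i\<in>{0..<m} - I. Q $$ (js a, i) * P $$ (i, js a')) + (\<Sum>i\<in>I. Q $$ (js a, i) * P $$ (i, js a'))"
      by (rule sum.subset_diff) (auto simp: I_def)
    finally have eqXY: "(X * Y) $$ (a, a') = (Q * P) $$ (js a, js a') - (\<Sum>i\<in>{0..<m} - I. Q $$ (js a, i) * P $$ (i, js a'))"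
      using XY by simp
    have rest: "\<varpi> dvd (\<Sum>i\<in>{0..<m} - I. Q $$ (js a, i) * P $$ (i, js a'))"
      using small by (intro dvd_sum) auto
    have "\<varpi> dvd (Q * P) $$ (js a, js a') - 1\<^sub>m n $$ (js a, js a')"
      using QP[OF ja(1,3)] ja(2) dvd_trans by blast
    moreover have one: "1\<^sub>m n $$ (js a, js a') = (\<varpi> ^ 0 \<cdot>\<^sub>m 1\<^sub>m (card J)) $$ (a, a')"
      using a ja bij_betw_imp_inj_on[OF js] by (auto dest: inj_onD)
    ultimately have "\<varpi> dvd (Q * P) $$ (js a, js a') - (\<varpi> ^ 0 \<cdot>\<^sub>m 1\<^sub>m (card J)) $$ (a, a')"
      by (simp only: one)
    then show "\<varpi> ^ Suc 0 dvd (X * Y) $$ (a, a') - (\<varpi> ^ 0 \<cdot>\<^sub>m 1\<^sub>m (card J)) $$ (a, a')"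
      using dvd_diff[OF _ rest] unfolding eqXY power_Suc0_right
      by (simp only: cancel_ab_semigroup_add_class.diff_right_commute)
  qed (use c in auto)
  then show ?thesis using uniformizer_scalar_factor[OF c] unfolding I_def J_def by blast
qed

lemma p_power_cases:
  assumes "p_power x"
  obtains "x = 0" | k where "x = \<varpi> ^ k"
  using assms by (auto simp: p_power_def)

lemma p_power_eq_iff:
  assumes "p_power x"
  shows "x = \<varpi> ^ r \<longleftrightarrow> \<varpi> ^ r dvd x \<and> \<not> \<varpi> ^ Suc r dvd x"
  using assms
proof (cases rule: p_power_cases)
  case (2 k)
  show ?thesis unfolding 2 uniformizer_power_dvd_power_iff uniformizer_power_eq_iff by auto
qed (use uniformizer_neq_0[of r] in auto)

lemma card_Collect_less_disj:
  fixes n :: nat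
  assumes "\<And>i. i < n \<Longrightarrow> P i \<longleftrightarrow> Q i \<or> R i" "\<And>i. i < n \<Longrightarrow> Q i \<Longrightarrow> \<not> R i"
  shows "card {i. i < n \<and> P i} = card {i. i < n \<and> Q i} + card {i. i < n \<and> R i}"
proof -
  have "{i. i < n \<and> P i} = {i. i < n \<and> Q i} \<union> {i. i < n \<and> R i}" using assms(1) by auto
  moreover have "{i. i < n \<and> Q i} \<inter> {i. i < n \<and> R i} = {}" using assms(2) by auto
  ultimately show ?thesis by (simp add: card_Un_disjoint)
qed

lemma uniformizer_power_Suc_dvdD: "\<varpi> ^ Suc r dvd x \<Longrightarrow> \<varpi> ^ r dvd x"
  using dvd_trans[OF le_imp_power_dvd[of r "Suc r" \<varpi>]] by (simp del: power_Suc)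

lemma card_diff_level:
  fixes f :: "nat \<Rightarrow> 'p::prime_card padic_int"
  assumes "\<And>i. i < n \<Longrightarrow> p_power (f i)"
  shows "card {i. i < n \<and> \<not> \<varpi> ^ Suc r dvd f i}
    = card {i. i < n \<and> \<not> \<varpi> ^ r dvd f i} + card {i. i < n \<and> f i = \<varpi> ^ r}"
proof (rule card_Collect_less_disj)
  fix i assume i: "i < n"
  note eq = p_power_eq_iff[OF assms[OF i], of r]
  show "\<not> \<varpi> ^ Suc r dvd f i \<longleftrightarrow> \<not> \<varpi> ^ r dvd f i \<or> f i = \<varpi> ^ r"
    unfolding eq using uniformizer_power_Suc_dvdD[of r "f i"] by argo
  show "\<not> \<varpi> ^ r dvd f i \<Longrightarrow> f i \<noteq> \<varpi> ^ r" unfolding eq by argo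
qed

text \<open>Taking for \<open>T\<close> the multiples of \<varpi>^k compares the numbers of nonunit
  entries of valuation below k. Differences for consecutive k give the count of each \<varpi>^r, and
  for k beyond all finite valuations the entries left over are the zeros.\<close>

lemma presents_diag_counts_eq:
  fixes H :: "('p::prime_card padic_int, 'a) module"
  assumes mod: "module class_ring H" and f: "presents (mat_diag n f) H" and g: "presents (mat_diag m g) H"
    and pf: "\<And>i. p_power (f i)" and pg: "\<And>i. p_power (g i)"
  shows "1 \<le> r \<Longrightarrow> card {i. i < n \<and> f i = \<varpi> ^ r} = card {i. i < m \<and> g i = \<varpi> ^ r}" (is "_ \<Longrightarrow> ?A")
    and "card {i. i < n \<and> f i = 0} = card {i. i < m \<and> g i = 0}" (is ?B)
proof -
  have T: "\<varpi> dvd x" if "\<varpi> ^ k dvd a" "\<not> \<varpi> ^ k dvd b" "a dvd x * b" for a b x :: "'p padic_int" and k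
  proof (rule ccontr)
    assume "\<not> \<varpi> dvd x"
    then obtain y where "x * y = 1" by (metis dvdE padic_unit_iff)
    moreover have "\<varpi> ^ k dvd x * b" by (rule dvd_trans[OF that(1,3)])
    then have "\<varpi> ^ k dvd (x * b) * y" by (rule dvd_mult2)
    ultimately show False using that(2) by (metis mult.assoc mult.commute mult_1)
  qed
  have lvl: "card {j. j < n \<and> \<varpi> dvd f j \<and> f j \<notin> {x. \<varpi> ^ k dvd x}} = card {j. j < m \<and> \<varpi> dvd g j \<and> g j \<notin> {x. \<varpi> ^ k dvd x}}" for k
  proof (rule antisym)
    have *: "\<varpi> dvd x" if "a \<in> {x. \<varpi> ^ k dvd x}" "b \<notin> {x. \<varpi> ^ k dvd x}" "a dvd x * b" for a b x :: "'p padic_int"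
      by (rule T[of k a b x]) (use that in simp_all)
    show "card {j. j < n \<and> \<varpi> dvd f j \<and> f j \<notin> {x. \<varpi> ^ k dvd x}} \<le> card {j. j < m \<and> \<varpi> dvd g j \<and> g j \<notin> {x. \<varpi> ^ k dvd x}}"
      by (rule presents_diag_count_le[OF mod f g *])
    show "card {j. j < m \<and> \<varpi> dvd g j \<and> g j \<notin> {x. \<varpi> ^ k dvd x}} \<le> card {j. j < n \<and> \<varpi> dvd f j \<and> f j \<notin> {x. \<varpi> ^ k dvd x}}"
      by (rule presents_diag_count_le[OF mod g f *])
  qed
  have tot: "card {j. j < n \<and> \<varpi> dvd f j} = card {j. j < m \<and> \<varpi> dvd g j}"
    using presents_diag_count_le[OF mod f g, of "{}"] presents_diag_count_le[OF mod g f, of "{}"] by simp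
  define F where "F k = card {j. j < n \<and> \<varpi> dvd f j \<and> \<not> \<varpi> ^ k dvd f j}" for k
  define G where "G k = card {j. j < m \<and> \<varpi> dvd g j \<and> \<not> \<varpi> ^ k dvd g j}" for k
  have FG: "F k = G k" for k using lvl[of k] by (simp add: F_def G_def)
  have level: "card {j. j < l \<and> \<varpi> dvd h j \<and> \<not> \<varpi> ^ Suc r dvd h j}
      = card {j. j < l \<and> \<varpi> dvd h j \<and> \<not> \<varpi> ^ r dvd h j} + card {i. i < l \<and> h i = \<varpi> ^ r}"
    if ph: "\<And>i. p_power (h i)" and r: "1 \<le> r" for h :: "nat \<Rightarrow> 'p padic_int" and l r
  proof -
    have "card {j. j < l \<and> (\<varpi> dvd h j \<and> \<not> \<varpi> ^ Suc r dvd h j)}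
      = card {j. j < l \<and> (\<varpi> dvd h j \<and> \<not> \<varpi> ^ r dvd h j)} + card {i. i < l \<and> h i = \<varpi> ^ r}"
    proof (rule card_Collect_less_disj)
      fix i
      note eq = p_power_eq_iff[OF ph, of i r]
      have "\<varpi> ^ r dvd h i \<Longrightarrow> \<varpi> dvd h i"
        using dvd_trans[OF le_imp_power_dvd[OF r], of \<varpi> "h i"] by simp
      then show "\<varpi> dvd h i \<and> \<not> \<varpi> ^ Suc r dvd h i \<longleftrightarrow> \<varpi> dvd h i \<and> \<not> \<varpi> ^ r dvd h i \<or> h i = \<varpi> ^ r"
        unfolding eq using uniformizer_power_Suc_dvdD[of r "h i"] by argo
      show "\<varpi> dvd h i \<and> \<not> \<varpi> ^ r dvd h i \<Longrightarrow> h i \<noteq> \<varpi> ^ r" unfolding eq by argo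
    qed
    then show ?thesis by simp
  qed
  show "1 \<le> r \<Longrightarrow> ?A"
    using level[OF pf, of r n] level[OF pg, of r m] FG[of r] FG[of "Suc r"] by (simp add: F_def G_def)
  have zero: "\<exists>K. \<forall>k\<ge>K. card {j. j < l \<and> \<varpi> dvd h j}
      = card {j. j < l \<and> \<varpi> dvd h j \<and> \<not> \<varpi> ^ k dvd h j} + card {i. i < l \<and> h i = 0}"
    if ph: "\<And>i. p_power (h i)" for h :: "nat \<Rightarrow> 'p padic_int" and l
  proof -
    have "\<forall>i. \<exists>v. h i \<noteq> 0 \<longrightarrow> h i = \<varpi> ^ v" using ph by (auto simp: p_power_def)
    then obtain v where v: "\<And>i. h i \<noteq> 0 \<Longrightarrow> h i = \<varpi> ^ v i" by metis
    \<comment> \<open>The sum of the exponents exceeds none of them less than any single one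
      requires: its successor lies above every finite valuation.\<close>
    define K where "K = Suc (\<Sum>i<l. v i)"
    have vK: "v i < K" if "i < l" for i
      unfolding K_def using that by (simp add: less_Suc_eq_le member_le_sum)
    have "card {j. j < l \<and> \<varpi> dvd h j}
      = card {j. j < l \<and> \<varpi> dvd h j \<and> \<not> \<varpi> ^ k dvd h j} + card {i. i < l \<and> h i = 0}" if k: "K \<le> k" for k
    proof -
      have zero_iff: "h i = 0 \<longleftrightarrow> \<varpi> ^ k dvd h i" if "i < l" for i
      proof
        assume "\<varpi> ^ k dvd h i"
        then show "h i = 0"
          using v[of i] vK[OF that] k uniformizer_power_dvd_power_iff[of k "v i", where 'p='p] by force
      qed simp
      have "card {j. j < l \<and> \<varpi> dvd h j}
        = card {j. j < l \<and> (\<varpi> dvd h j \<and> \<not> \<varpi> ^ k dvd h j)} + card {i. i < l \<and> h i = 0}"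
      proof (rule card_Collect_less_disj)
        fix i assume i: "i < l"
        show "\<varpi> dvd h i \<longleftrightarrow> \<varpi> dvd h i \<and> \<not> \<varpi> ^ k dvd h i \<or> h i = 0"
          unfolding zero_iff[OF i, symmetric] by (cases "h i = 0") simp_all
        show "\<varpi> dvd h i \<and> \<not> \<varpi> ^ k dvd h i \<Longrightarrow> h i \<noteq> 0" unfolding zero_iff[OF i] by argo
      qed
      then show ?thesis by simp
    qed
    then show ?thesis by blast
  qed
  have "\<exists>K. \<forall>k\<ge>K. card {j. j < n \<and> \<varpi> dvd f j} = F k + card {i. i < n \<and> f i = 0}"
    unfolding F_def by (rule zero) (rule pf)
  then obtain K where K: "\<forall>k\<ge>K. card {j. j < n \<and> \<varpi> dvd f j} = F k + card {i. i < n \<and> f i = 0}" ..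
  have "\<exists>K. \<forall>k\<ge>K. card {j. j < m \<and> \<varpi> dvd g j} = G k + card {i. i < m \<and> g i = 0}"
    unfolding G_def by (rule zero) (rule pg)
  then obtain K' where K': "\<forall>k\<ge>K'. card {j. j < m \<and> \<varpi> dvd g j} = G k + card {i. i < m \<and> g i = 0}" ..
  show ?B
    using K[rule_format, of "max K K'"] K'[rule_format, of "max K K'"] tot FG[of "max K K'"] by simp
qed

subsection \<open>The type of a finitely generated module\<close>

text \<open>The module axioms are transported along a surjection that respects the operations. This
  makes \<open>mod_p H\<close> a module although its scalars act through chosen lifts.\<close>

lemma module_surj_image:
  assumes mod: "module R M" and img: "f ` carrier M = carrier N"
    and add: "\<And>v w. v \<in> carrier M \<Longrightarrow> w \<in> carrier M \<Longrightarrow> f (v \<oplus>\<^bsub>M\<^esub> w) = f v \<oplus>\<^bsub>N\<^esub> f w"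
    and smult: "\<And>c v. c \<in> carrier R \<Longrightarrow> v \<in> carrier M \<Longrightarrow> f (c \<odot>\<^bsub>M\<^esub> v) = c \<odot>\<^bsub>N\<^esub> f v"
    and zero: "f \<zero>\<^bsub>M\<^esub> = \<zero>\<^bsub>N\<^esub>"
  shows "module R N"
proof -
  interpret M: module R M by (rule mod)
  note tr = add[symmetric] smult[symmetric] zero[symmetric]
  show ?thesis
  proof (rule module_criteria, goal_cases)
    case 1 show ?case by (rule M.R.cring_axioms)
  next
    case 4
    have "f v \<oplus>\<^bsub>N\<^esub> f (\<ominus>\<^bsub>M\<^esub> v) = \<zero>\<^bsub>N\<^esub>" if "v \<in> carrier M" for v
      using that by (simp add: tr M.r_neg)
    then show ?case unfolding img[symmetric] by (auto intro!: bexI[where x="f (\<ominus>\<^bsub>M\<^esub> v)" for v])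
  next
    case 7 then show ?case unfolding img[symmetric] by (auto simp: tr M.a_assoc)
  next
    case 6 then show ?case unfolding img[symmetric] by (auto simp: tr M.a_comm)
  next
    case 11 then show ?case unfolding img[symmetric] by (auto simp: tr M.smult_l_distr)
  next
    case 12 then show ?case unfolding img[symmetric] by (auto simp: tr M.smult_r_distr)
  next
    case 9 then show ?case unfolding img[symmetric] by (auto simp: tr M.smult_assoc1)
  qed (auto simp: img[symmetric] tr)
qed

text \<open>As all entries are divisible by \<varpi>, the relations already hold modulo \<varpi>, so
  the quotient of H by pH is the free module reduced modulo \<varpi>. The map \<open>\<psi>\<close>
  from the vectors over the residue field is that isomorphism; by \<open>cos_eq\<close> it does not
  depend on the lift.\<close>

lemma p_rank_presents_nonunit:
  fixes H :: "('p::prime_card padic_int, 'a) module"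
  assumes mod: "module class_ring H" and g: "presents (mat_diag m g) H" and dvd: "\<And>i. i < m \<Longrightarrow> \<varpi> dvd g i"
  shows "p_rank H = m"
proof -
  obtain h where h: "\<And>v. v \<in> carrier_vec m \<Longrightarrow> h v \<in> carrier H"
    "\<And>v w. v \<in> carrier_vec m \<Longrightarrow> w \<in> carrier_vec m \<Longrightarrow> h (v + w) = h v \<oplus>\<^bsub>H\<^esub> h w"
    "\<And>c v. v \<in> carrier_vec m \<Longrightarrow> h (c \<cdot>\<^sub>v v) = c \<odot>\<^bsub>H\<^esub> h v"
    "\<And>y. y \<in> carrier H \<Longrightarrow> \<exists>v\<in>carrier_vec m. h v = y"
    "\<And>v w. v \<in> carrier_vec m \<Longrightarrow> w \<in> carrier_vec m \<Longrightarrow> h v = h w \<longleftrightarrow> v - w \<in> mat_range (mat_diag m g)"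
    by (rule presentsE[OF g mat_diag_dim]) blast
  interpret H: module class_ring H by (rule mod)
  have cR [simp]: "c \<in> carrier class_ring" for c :: "'b::comm_ring_1" by (simp add: class_ring_simps)
  define N where "N = (\<lambda>y. \<varpi> \<odot>\<^bsub>H\<^esub> y) ` carrier H"
  interpret Q: module_quotient class_ring H N
  proof (rule module_quotient.intro[OF mod], unfold_locales)
    show "N \<subseteq> carrier H" unfolding N_def by auto
    show "\<zero>\<^bsub>H\<^esub> \<in> N" unfolding N_def by (rule image_eqI[of _ _ "\<zero>\<^bsub>H\<^esub>"]) (auto simp: H.smult_r_null)
    show "v \<oplus>\<^bsub>H\<^esub> w \<in> N" if vw: "v \<in> N" "w \<in> N" for v w
    proof -
      obtain a b where "a \<in> carrier H" "b \<in> carrier H" "v = \<varpi> \<odot>\<^bsub>H\<^esub> a" "w = \<varpi> \<odot>\<^bsub>H\<^esub> b"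
        using vw unfolding N_def by auto
      then show ?thesis unfolding N_def
        by (intro image_eqI[of _ _ "a \<oplus>\<^bsub>H\<^esub> b"]) (auto simp: H.smult_r_distr)
    qed
    show "c \<odot>\<^bsub>H\<^esub> v \<in> N" if cv: "c \<in> carrier class_ring" "v \<in> N" for c v
    proof -
      obtain a where a: "a \<in> carrier H" "v = \<varpi> \<odot>\<^bsub>H\<^esub> a" using cv unfolding N_def by auto
      have "c \<odot>\<^bsub>H\<^esub> (\<varpi> \<odot>\<^bsub>H\<^esub> a) = \<varpi> \<odot>\<^bsub>H\<^esub> (c \<odot>\<^bsub>H\<^esub> a)"
        using H.smult_assoc1[of c \<varpi> a] H.smult_assoc1[of \<varpi> c a] a by (simp add: class_ring_simps mult.commute)
      then show ?thesis unfolding N_def a using a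
        by (intro image_eqI[of _ _ "c \<odot>\<^bsub>H\<^esub> a"]) auto
    qed
  qed
  let ?V = "mod_p H"
  have V: "carrier ?V = carrier (quot_module H N)" "\<zero>\<^bsub>?V\<^esub> = N"
    "X \<oplus>\<^bsub>?V\<^esub> Y = X \<oplus>\<^bsub>quot_module H N\<^esub> Y"
    "c \<odot>\<^bsub>?V\<^esub> X = of_int (to_int_mod_ring c) \<odot>\<^bsub>quot_module H N\<^esub> X" for X Y c
    unfolding mod_p_def Let_def N_def uniformizer_def by (simp_all add: quot_module_def)
  have mem: "h v \<in> N \<longleftrightarrow> (\<forall>i<m. \<varpi> dvd v $ i)" if v: "v \<in> carrier_vec m" for v
  proof
    assume "h v \<in> N"
    then obtain y where y: "y \<in> carrier H" "h v = \<varpi> \<odot>\<^bsub>H\<^esub> y" unfolding N_def by auto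
    obtain u where u: "u \<in> carrier_vec m" "h u = y" using h(4)[OF y(1)] by blast
    have "h v = h (\<varpi> \<cdot>\<^sub>v u)" using y(2) u h(3)[OF u(1)] by simp
    then have "v - \<varpi> \<cdot>\<^sub>v u \<in> mat_range (mat_diag m g)" using h(5) v u by simp
    then have "g i dvd v $ i - \<varpi> * u $ i" if "i < m" for i
      using that u v unfolding mat_range_diag by auto
    then have "\<varpi> dvd v $ i - \<varpi> * u $ i" if "i < m" for i
      by (rule dvd_trans[OF dvd[OF that]]) (rule that)
    then have "\<varpi> dvd (v $ i - \<varpi> * u $ i) + \<varpi> * u $ i" if "i < m" for i
      using that by (intro dvd_add) simp_all
    then show "\<forall>i<m. \<varpi> dvd v $ i" by simp
  next
    assume "\<forall>i<m. \<varpi> dvd v $ i"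
    then have "\<forall>i. \<exists>u. i < m \<longrightarrow> v $ i = \<varpi> * u" by (auto simp: dvd_def)
    then obtain u where u: "\<And>i. i < m \<Longrightarrow> v $ i = \<varpi> * u i" by metis
    have "v = \<varpi> \<cdot>\<^sub>v vec m u" using u v by (intro eq_vecI) auto
    then have "h v = \<varpi> \<odot>\<^bsub>H\<^esub> h (vec m u)" using h(3)[of "vec m u" \<varpi>] by simp
    then show "h v \<in> N" unfolding N_def using h(1)[of "vec m u"] by simp
  qed
  have neg: "\<ominus>\<^bsub>H\<^esub> h w = h (- w)" if w: "w \<in> carrier_vec m" for w
  proof (rule H.minus_equality)
    show "h (- w) \<oplus>\<^bsub>H\<^esub> h w = \<zero>\<^bsub>H\<^esub>"
      using h(2)[of "- w" w] presents_hom_zero[OF mod h(3,1)] w by (simp add: uminus_l_inv_vec[of w m])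
  qed (use h(1) w in auto)
  have cos_eq: "N +>\<^bsub>H\<^esub> h v = N +>\<^bsub>H\<^esub> h w \<longleftrightarrow> (\<forall>i<m. \<varpi> dvd v $ i - w $ i)"
    if v: "v \<in> carrier_vec m" and w: "w \<in> carrier_vec m" for v w
  proof -
    have "N +>\<^bsub>H\<^esub> h v = N +>\<^bsub>H\<^esub> h w \<longleftrightarrow> h (v + - w) \<in> N"
      using Q.coset_eq_iff[of "h v" "h w"] h(1) neg[OF w] h(2)[of v "- w"] v w by simp
    also have "\<dots> \<longleftrightarrow> (\<forall>i<m. \<varpi> dvd v $ i - w $ i)"
      using mem[of "v + - w"] v w by simp
    finally show ?thesis .
  qed
  define lift :: "'p mod_ring vec \<Rightarrow> 'p padic_int vec" where "lift u = vec m (\<lambda>i. of_int (to_int_mod_ring (u $ i)))" for u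
  define \<psi> where "\<psi> u = N +>\<^bsub>H\<^esub> h (lift u)" for u
  have lift_c: "lift u \<in> carrier_vec m" for u by (simp add: lift_def)
  have \<psi>: "\<psi> u = N +>\<^bsub>H\<^esub> h v"
    if v: "v \<in> carrier_vec m" and "\<And>i. i < m \<Longrightarrow> u $ i = padic_reduce (v $ i)" for u v
    unfolding \<psi>_def cos_eq[OF lift_c v] padic_reduce_eq_iff[symmetric]
    using that by (simp add: lift_def padic_reduce_lift)
  have reduce_lift: "padic_reduce (lift u $ i) = u $ i" if "i < m" for u i
    using that by (simp add: lift_def padic_reduce_lift)
  let ?F = "module_vec TYPE('p mod_ring) m"
  interpret F: vec_space "TYPE('p mod_ring)" m .
  have add: "\<psi> (u \<oplus>\<^bsub>?F\<^esub> w) = \<psi> u \<oplus>\<^bsub>?V\<^esub> \<psi> w" if u: "u \<in> carrier ?F" and w: "w \<in> carrier ?F" for u w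
  proof -
    have "\<psi> (u + w) = N +>\<^bsub>H\<^esub> h (lift u + lift w)"
      using u w by (intro \<psi>) (simp_all add: lift_c module_vec_simps padic_reduce_add reduce_lift carrier_vecD[OF lift_c])
    then show ?thesis
      unfolding V \<psi>_def using Q.add_quot[of "h (lift u)" "h (lift w)"] h(1,2)[OF lift_c]
      by (simp add: module_vec_simps lift_c)
  qed
  have smult: "\<psi> (c \<odot>\<^bsub>?F\<^esub> u) = c \<odot>\<^bsub>?V\<^esub> \<psi> u" if u: "u \<in> carrier ?F" for c u
  proof -
    have "\<psi> (c \<cdot>\<^sub>v u) = N +>\<^bsub>H\<^esub> h (of_int (to_int_mod_ring c) \<cdot>\<^sub>v lift u)"
      using u by (intro \<psi>) (simp_all add: lift_c module_vec_simps padic_reduce_mult padic_reduce_lift reduce_lift carrier_vecD[OF lift_c])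
    then show ?thesis
      unfolding V \<psi>_def using Q.smult_quot[of "h (lift u)" "of_int (to_int_mod_ring c)"] h(1,3)[OF lift_c]
      by (simp add: module_vec_simps)
  qed
  have img: "\<psi> ` carrier ?F = carrier ?V"
  proof
    show "\<psi> ` carrier ?F \<subseteq> carrier ?V" unfolding V Q.carrier_quot \<psi>_def using h(1)[OF lift_c] by auto
    show "carrier ?V \<subseteq> \<psi> ` carrier ?F"
    proof
      fix X assume "X \<in> carrier ?V"
      then obtain y where y: "y \<in> carrier H" "X = N +>\<^bsub>H\<^esub> y" unfolding V Q.carrier_quot by auto
      obtain v where v: "v \<in> carrier_vec m" "h v = y" using h(4)[OF y(1)] by blast
      have "\<psi> (vec m (\<lambda>i. padic_reduce (v $ i))) = X" using \<psi>[OF v(1)] y v by simp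
      then show "X \<in> \<psi> ` carrier ?F" by (intro image_eqI[of _ _ "vec m (\<lambda>i. padic_reduce (v $ i))"]) (auto simp: module_vec_simps)
    qed
  qed
  have zero: "\<psi> \<zero>\<^bsub>?F\<^esub> = \<zero>\<^bsub>?V\<^esub>"
  proof -
    have "\<psi> (0\<^sub>v m) = N +>\<^bsub>H\<^esub> h (0\<^sub>v m)" by (rule \<psi>) (simp_all add: padic_reduce_eq_0_iff)
    also have "h (0\<^sub>v m) = \<zero>\<^bsub>H\<^esub>" by (rule presents_hom_zero[OF mod h(3,1)])
    also have "N +>\<^bsub>H\<^esub> \<zero>\<^bsub>H\<^esub> = N" using Q.sub_carrier by (rule H.a_coset_add_zero)
    finally show ?thesis unfolding V by (simp add: module_vec_simps)
  qed
  have modV: "module class_ring ?V"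
    by (rule module_surj_image[OF F.module_axioms img add smult zero])
  have inj: "inj_on \<psi> (carrier ?F)"
  proof (rule inj_onI)
    fix u w assume uw: "u \<in> carrier ?F" "w \<in> carrier ?F" and "\<psi> u = \<psi> w"
    then have "\<forall>i<m. padic_reduce (lift u $ i) = padic_reduce (lift w $ i)"
      unfolding \<psi>_def cos_eq[OF lift_c lift_c] padic_reduce_eq_iff by simp
    then show "u = w" using uw by (intro eq_vecI) (auto simp: reduce_lift module_vec_simps)
  qed
  interpret L: linear_map class_ring ?F ?V \<psi>
  proof -
    interpret W: module class_ring ?V by (rule modV)
    show "linear_map class_ring ?F ?V \<psi>"
    proof (intro linear_map.intro mod_hom.intro F.vectorspace_axioms)
      show "vectorspace class_ring ?V" by (rule vectorspace.intro[OF modV]) (use F.vectorspace_axioms in \<open>simp add: vectorspace_def\<close>)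
      show "mod_hom_axioms class_ring ?F ?V \<psi>"
        unfolding mod_hom_axioms_def module_hom_def using img add smult by auto
    qed (rule F.module_axioms modV)+
  qed
  have "F.dim = L.W.dim" by (rule L.dim_eq[OF F.fin_dim inj img])
  then show ?thesis unfolding p_rank_def F.dim_is_n by simp
qed

lemma finite_diag_powers:
  fixes n :: nat
  shows "finite {r. 1 \<le> r \<and> card {i. i < n \<and> f i = (\<varpi> ^ r :: 'p::prime_card padic_int)} \<noteq> 0}"
proof -
  have "finite ((\<lambda>r. \<varpi> ^ r :: 'p padic_int) -` (f ` {..<n}))"
    by (rule finite_vimageI) (auto intro!: injI)
  moreover have "{r. 1 \<le> r \<and> card {i. i < n \<and> f i = (\<varpi> ^ r :: 'p padic_int)} \<noteq> 0} \<subseteq> (\<lambda>r. \<varpi> ^ r) -` (f ` {..<n})"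
    by (auto simp: card_eq_0_iff) (metis imageI lessThan_iff)
  ultimately show ?thesis by (rule rev_finite_subset)
qed

text \<open>The list \<open>xs\<close> holds e zeros and d r copies of each \<varpi>^r. Beyond its
  length \<open>g\<close> is 0, which keeps \<open>p_power\<close> and divisibility by \<varpi>
  valid at every index without affecting the counts below m.\<close>

lemma diag_of_counts:
  fixes d :: "nat \<Rightarrow> nat"
  assumes fin: "finite {r. 1 \<le> r \<and> d r \<noteq> 0}"
  obtains m and g :: "nat \<Rightarrow> 'p::prime_card padic_int"
  where "m = (\<Sum>r | 1 \<le> r \<and> d r \<noteq> 0. d r) + e" "\<And>i. p_power (g i)" "\<And>i. \<varpi> dvd g i"
    "card {i. i < m \<and> g i = 0} = e" "\<And>r. 1 \<le> r \<Longrightarrow> card {i. i < m \<and> g i = \<varpi> ^ r} = d r"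
proof -
  define S where "S = {r. 1 \<le> r \<and> d r \<noteq> 0}"
  have S: "finite S" unfolding S_def by (rule fin)
  define rs where "rs = sorted_list_of_set S"
  define xs where "xs = replicate e 0 @ concat (map (\<lambda>r. replicate (d r) (\<varpi> ^ r :: 'p padic_int)) rs)"
  define g where "g i = (if i < length xs then xs ! i else 0)" for i
  have sum: "(\<Sum>r\<leftarrow>rs. F r) = sum F S" for F :: "nat \<Rightarrow> nat"
    unfolding rs_def using S by (simp add: sum_list_distinct_conv_sum_set)
  have len: "length xs = sum d S + e"
    unfolding xs_def by (simp add: length_concat comp_def sum)
  have count: "card {i. i < length xs \<and> g i = y} = length (filter (\<lambda>z. z = y) xs)" for y
    unfolding length_filter_conv_card g_def by (rule arg_cong[where f=card]) auto
  have fil: "length (filter (\<lambda>z. z = y) (replicate k z)) = (if z = y then k else 0)" for y z :: "'p padic_int" and k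
    by auto
  have cnt: "length (filter (\<lambda>z. z = y) xs) = (if y = 0 then e else 0) + (\<Sum>r\<in>S. if \<varpi> ^ r = y then d r else 0)" for y
    unfolding xs_def by (simp add: filter_concat length_concat comp_def fil sum del: filter_replicate)
  have set: "x \<in> set xs \<Longrightarrow> x = 0 \<or> (\<exists>r\<ge>1. x = \<varpi> ^ r)" for x
    unfolding xs_def rs_def using S by (auto simp: S_def)
  have gi: "g i = 0 \<or> (\<exists>r\<ge>1. g i = \<varpi> ^ r)" for i
    unfolding g_def using set[OF nth_mem, of i] by simp
  show ?thesis
  proof
    show "length xs = (\<Sum>r | 1 \<le> r \<and> d r \<noteq> 0. d r) + e" unfolding len S_def ..
    show "p_power (g i)" for i using gi[of i] by (auto simp: p_power_def)
    show "\<varpi> dvd g i" for i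
      using gi[of i] by (auto intro: dvd_power)
    show "card {i. i < length xs \<and> g i = 0} = e" unfolding count cnt by simp
    show "card {i. i < length xs \<and> g i = \<varpi> ^ r} = d r" if "1 \<le> r" for r
      unfolding count cnt using S that by (simp add: S_def)
  qed
qed

lemma has_type_of_presents:
  assumes "presents (mat_diag n f) H" "\<And>i. p_power (f i)"
  shows "has_type H (card {i. i < n \<and> f i = 0}) (\<lambda>r. card {i. i < n \<and> f i = \<varpi> ^ r})"
  unfolding has_type_def
  using finite_diag_powers presents_unique[OF assms(1) presents_std_module[OF assms(2) refl refl]] by blast

lemma presents_of_has_type:
  assumes "module class_ring H" "has_type H e d" "\<And>i. p_power (f i)"
    and "card {i. i < n \<and> f i = 0} = e" "\<And>r. 1 \<le> r \<Longrightarrow> card {i. i < n \<and> f i = \<varpi> ^ r} = d r"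
  shows "presents (mat_diag n f) H"
proof (rule presents_iso)
  show "presents (mat_diag n f) (std_module e d)"
    by (rule presents_std_module) (use assms in simp_all)
  show "std_module e d \<cong>\<^sub>p H"
    using module_iso_sym[OF assms(1)] assms(2) unfolding has_type_def by blast
qed

text \<open>The existence of some type makes the choice in \<open>module_type\<close> a genuine one.
  That the chosen type is the given one is a matter of uniqueness, settled in
  \<open>presents_type\<close>.\<close>

lemma has_type_module_type: "has_type H e d \<Longrightarrow> has_type H (d_inf H) (\<lambda>r. d_mult r H)"
proof -
  assume "has_type H e d"
  then have "case (e, d) of (e, d) \<Rightarrow> has_type H e d" by simp
  then have "case module_type H of (e, d) \<Rightarrow> has_type H e d" unfolding module_type_def by (rule someI)
  then show ?thesis by (simp add: d_inf_def d_mult_def split: prod.splits)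
qed

lemma module_fg: "H \<in> fg_modules \<Longrightarrow> module class_ring H"
  by (simp add: fg_modules_def)

text \<open>The type fixed by choice is realized by a second diagonal matrix, all of whose entries
  are nonunits. Comparison with the given one identifies all counts, and the size of the second
  matrix is the p-rank.\<close>

lemma presents_type:
  fixes H :: "('p::prime_card padic_int, 'a) module"
  assumes mod: "module class_ring H" and f: "presents (mat_diag n f) H" "\<And>i. p_power (f i)"
  shows "d_inf H = card {i. i < n \<and> f i = 0}"
    and "1 \<le> r \<Longrightarrow> d_mult r H = card {i. i < n \<and> f i = \<varpi> ^ r}"
    and "p_rank H = card {i. i < n \<and> \<varpi> dvd f i}"
    and "p_rank H = (\<Sum>r | 1 \<le> r \<and> d_mult r H \<noteq> 0. d_mult r H) + d_inf H"
proof -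
  note type = has_type_module_type[OF has_type_of_presents[OF f]]
  have "finite {r. 1 \<le> r \<and> d_mult r H \<noteq> 0}" using type unfolding has_type_def by blast
  then obtain m and g :: "nat \<Rightarrow> 'p padic_int" where g: "m = (\<Sum>r | 1 \<le> r \<and> d_mult r H \<noteq> 0. d_mult r H) + d_inf H"
    "\<And>i. p_power (g i)" "\<And>i. \<varpi> dvd g i"
    "card {i. i < m \<and> g i = 0} = d_inf H" "\<And>r. 1 \<le> r \<Longrightarrow> card {i. i < m \<and> g i = \<varpi> ^ r} = d_mult r H"
    by (rule diag_of_counts[where e="d_inf H" and 'p='p]) (rule that)
  have gH: "presents (mat_diag m g) H" by (rule presents_of_has_type[OF mod type g(2,4,5)])
  show "d_inf H = card {i. i < n \<and> f i = 0}"
    using presents_diag_counts_eq(2)[OF mod f(1) gH f(2) g(2)] g(4) by simp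
  show "1 \<le> r \<Longrightarrow> d_mult r H = card {i. i < n \<and> f i = \<varpi> ^ r}"
    using presents_diag_counts_eq(1)[OF mod f(1) gH f(2) g(2)] g(5) by simp
  have rank: "p_rank H = m" by (rule p_rank_presents_nonunit[OF mod gH g(3)])
  then show "p_rank H = (\<Sum>r | 1 \<le> r \<and> d_mult r H \<noteq> 0. d_mult r H) + d_inf H" using g(1) by simp
  have "card {i. i < n \<and> \<varpi> dvd f i} = card {i. i < m \<and> \<varpi> dvd g i}"
    using presents_diag_count_le[OF mod f(1) gH, of "{}"] presents_diag_count_le[OF mod gH f(1), of "{}"] by simp
  then show "p_rank H = card {i. i < n \<and> \<varpi> dvd f i}" unfolding rank using g(3) by simp
qed

lemma fg_module_type:
  assumes "H \<in> fg_modules"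
  shows "has_type H (d_inf H) (\<lambda>r. d_mult r H)"
    and "p_rank H = (\<Sum>r | 1 \<le> r \<and> d_mult r H \<noteq> 0. d_mult r H) + d_inf H"
proof -
  obtain n f where f: "\<And>i. p_power (f i)" "presents (mat_diag n f) H"
    by (rule fg_module_presentation[OF assms]) blast
  show "has_type H (d_inf H) (\<lambda>r. d_mult r H)"
    by (rule has_type_module_type[OF has_type_of_presents[OF f(2,1)]])
  show "p_rank H = (\<Sum>r | 1 \<le> r \<and> d_mult r H \<noteq> 0. d_mult r H) + d_inf H"
    by (rule presents_type(4)[OF module_fg[OF assms] f(2,1)])
qed

subsection \<open>Reduction to a quadratic pencil\<close>

lemma p_power_1 [simp]: "p_power 1"
  unfolding p_power_def by (auto intro: exI[of _ 0])

text \<open>Being congruent to the identity, the matrix has rank t modulo \<varpi>, so every entry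
  of its Smith form is a unit and hence 1.\<close>

lemma gl_one_add_uniformizer:
  fixes X :: "'p::prime_card padic_int mat"
  assumes X: "X \<in> carrier_mat t t"
  shows "gl t (1\<^sub>m t + \<varpi> \<cdot>\<^sub>m X)"
proof -
  let ?M = "1\<^sub>m t + \<varpi> \<cdot>\<^sub>m X"
  have M: "?M \<in> carrier_mat t t" using X by simp
  obtain f where f: "\<And>i. p_power (f i)" "equiv_mat ?M (mat_diag t f)"
    "\<And>k. prank k ?M = card {i. i < t \<and> \<not> \<varpi> ^ k dvd f i}"
    by (rule smith_normal_form_square[OF M]) blast
  have "cong_mat 1 ?M (1\<^sub>m t)" using cong_mat_add_smult[of "1\<^sub>m t" t t X 1] X by simp
  moreover have "prank 1 (1\<^sub>m t :: 'p padic_int mat) = t"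
    using prank_mat_diag[of t "\<lambda>_. 1 :: 'p padic_int" 1] by (simp add: mat_diag_one)
  ultimately have "card {i. i < t \<and> \<not> \<varpi> dvd f i} = card {i. i < t}"
    using f(3)[of 1] prank_cong[of 1 ?M "1\<^sub>m t"] by simp
  then have "{i. i < t \<and> \<not> \<varpi> dvd f i} = {i. i < t}"
    by (intro card_subset_eq) auto
  then have f1: "f i = 1" if "i < t" for i
    using p_power_eq_iff[OF f(1), of i 0] that by auto
  have "mat_diag t f = 1\<^sub>m t" by (intro eq_matI) (auto simp: mat_diag_def f1)
  then obtain U V where "gl t U" "gl t V" "?M = U * 1\<^sub>m t * V"
    using equiv_matE[OF f(2) M] by metis
  then show ?thesis using gl_mult gl_carrier by (metis right_mult_one_mat)
qed

text \<open>With A = U (1 + \<varpi> E) V as a block sum, adding \<varpi> x to A adds \<varpi> x W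
  between the outer factors, where W is the inverse of U times the inverse of V. The corner S = 1 +
  \<varpi> x W1 remains invertible, and its complement is \<varpi> times E + x W4 - \<varpi> x^2 W3
  S' W2. Since S' is congruent to 1 modulo \<varpi>, the last term may be replaced by - \<varpi> x^2
  W3 W2 modulo \<varpi>^2.\<close>

lemma schur_quadratic_pencil:
  fixes A :: "'p::prime_card padic_int mat"
  assumes A: "A \<in> carrier_mat n n"
  obtains t N C0 C1 C2 where "n = t + N" "C0 \<in> carrier_mat N N" "C1 \<in> carrier_mat N N" "C2 \<in> carrier_mat N N"
    "\<And>x. \<exists>F\<in>carrier_mat N N. cong_mat 2 F (C0 + x \<cdot>\<^sub>m C1 + (\<varpi> * x\<^sup>2) \<cdot>\<^sub>m C2) \<and>
       equiv_mat (A + (\<varpi> * x) \<cdot>\<^sub>m 1\<^sub>m n) (1\<^sub>m t \<oplus>\<^sub>m (\<varpi> \<cdot>\<^sub>m F))"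
proof -
  define t where "t = prank 1 A"
  define N where "N = n - t"
  obtain E where E: "t \<le> n" "E \<in> carrier_mat N N" "equiv_mat A (1\<^sub>m t \<oplus>\<^sub>m (\<varpi> \<cdot>\<^sub>m E))"
    using unit_block_decomposition[OF A] unfolding t_def N_def by metis
  have n: "n = t + N" using E(1) by (simp add: N_def)
  obtain U V where UV: "gl n U" "gl n V" "A = U * (1\<^sub>m t \<oplus>\<^sub>m (\<varpi> \<cdot>\<^sub>m E)) * V"
    by (rule equiv_matE[OF E(3) A]) blast
  obtain U' where U': "gl n U'" "U * U' = 1\<^sub>m n" "U' * U = 1\<^sub>m n" by (rule gl_inverse[OF UV(1)])
  obtain V' where V': "gl n V'" "V * V' = 1\<^sub>m n" "V' * V = 1\<^sub>m n" by (rule gl_inverse[OF UV(2)])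
  note gc = gl_carrier[OF UV(1)] gl_carrier[OF UV(2)] gl_carrier[OF U'(1)] gl_carrier[OF V'(1)]
  note gd = carrier_matD[OF gc(1)] carrier_matD[OF gc(2)] carrier_matD[OF gc(3)] carrier_matD[OF gc(4)]
  define W where "W = U' * V'"
  have W: "W \<in> carrier_mat (t + N) (t + N)" using gd n unfolding W_def by (intro carrier_matI) simp_all
  have UWV: "U * W * V = 1\<^sub>m n"
  proof -
    have "U * W * V = (U * U') * (V' * V)" unfolding W_def using gd by (simp add: mat_mult_assoc)
    then show ?thesis using U'(2) V'(3) by simp
  qed
  obtain W1 W2 W3 W4 where sp: "split_block W t t = (W1, W2, W3, W4)" by (cases "split_block W t t")
  note Wb = split_block[OF sp, of N N, OF carrier_matD(1)[OF W] carrier_matD(2)[OF W]]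
  note Wd = carrier_matD[OF Wb(1)] carrier_matD[OF Wb(2)] carrier_matD[OF Wb(3)] carrier_matD[OF Wb(4)] carrier_matD[OF E(2)]
  let ?C2 = "(- 1) \<cdot>\<^sub>m (W3 * W2)"
  have C2: "?C2 \<in> carrier_mat N N" using Wd by (intro carrier_matI) simp_all
  show ?thesis
  proof (rule that[OF n E(2) Wb(4) C2])
    fix x :: "'p padic_int"
    define S where "S = 1\<^sub>m t + \<varpi> \<cdot>\<^sub>m (x \<cdot>\<^sub>m W1)"
    have "gl t S" unfolding S_def by (rule gl_one_add_uniformizer) (use Wb(1) in simp)
    then obtain S' where S': "gl t S'" "S * S' = 1\<^sub>m t" "S' * S = 1\<^sub>m t" by (rule gl_inverse)
    have Sc: "S \<in> carrier_mat t t" "S' \<in> carrier_mat t t" using Wb(1) gl_carrier[OF S'(1)] by (auto simp: S_def)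
    note Sd = carrier_matD[OF Sc(1)] carrier_matD[OF Sc(2)]
    define c where "c = \<varpi> * x"
    define F where "F = E + x \<cdot>\<^sub>m W4 + (- (\<varpi> * x\<^sup>2)) \<cdot>\<^sub>m (W3 * (S' * W2))"
    have F: "F \<in> carrier_mat N N" unfolding F_def using Wd Sd by (intro carrier_matI) simp_all
    have "equiv_mat (A + c \<cdot>\<^sub>m 1\<^sub>m n) ((1\<^sub>m t \<oplus>\<^sub>m (\<varpi> \<cdot>\<^sub>m E)) + c \<cdot>\<^sub>m W)"
    proof (rule equiv_matI[OF _ UV(1,2)])
      show "(1\<^sub>m t \<oplus>\<^sub>m (\<varpi> \<cdot>\<^sub>m E)) + c \<cdot>\<^sub>m W \<in> carrier_mat n n" using W n by simp
      have "U * (c \<cdot>\<^sub>m W) * V = c \<cdot>\<^sub>m 1\<^sub>m n"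
        unfolding UWV[symmetric] using gd W n by (simp add: mat_smult_distrib carrier_matD[OF W])
      moreover have "U * ((1\<^sub>m t \<oplus>\<^sub>m (\<varpi> \<cdot>\<^sub>m E)) + c \<cdot>\<^sub>m W) * V
          = U * (1\<^sub>m t \<oplus>\<^sub>m (\<varpi> \<cdot>\<^sub>m E)) * V + U * (c \<cdot>\<^sub>m W) * V"
        using gd n by (simp add: mat_add_distrib carrier_matD[OF W] Wd)
      ultimately show "A + c \<cdot>\<^sub>m 1\<^sub>m n = U * ((1\<^sub>m t \<oplus>\<^sub>m (\<varpi> \<cdot>\<^sub>m E)) + c \<cdot>\<^sub>m W) * V"
        using UV(3) by simp
    qed
    also have "(1\<^sub>m t \<oplus>\<^sub>m (\<varpi> \<cdot>\<^sub>m E)) + c \<cdot>\<^sub>m W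
      = four_block_mat S (c \<cdot>\<^sub>m W2) (c \<cdot>\<^sub>m W3) (\<varpi> \<cdot>\<^sub>m E + c \<cdot>\<^sub>m W4)"
      unfolding Wb(5) S_def c_def direct_sum_mat_def
      by (intro eq_matI) (auto simp: Wd mult.assoc)
    also have "equiv_mat \<dots> (1\<^sub>m t \<oplus>\<^sub>m ((\<varpi> \<cdot>\<^sub>m E + c \<cdot>\<^sub>m W4) - (c \<cdot>\<^sub>m W3) * (S' * (c \<cdot>\<^sub>m W2))))"
      by (rule equiv_mat_schur_complement[OF Sc S'(2,3)]) (use Wb E(2) in auto)
    also (equiv_mat_trans) have "(\<varpi> \<cdot>\<^sub>m E + c \<cdot>\<^sub>m W4) - (c \<cdot>\<^sub>m W3) * (S' * (c \<cdot>\<^sub>m W2)) = \<varpi> \<cdot>\<^sub>m F"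
    proof -
      have "(c \<cdot>\<^sub>m W3) * (S' * (c \<cdot>\<^sub>m W2)) = (c * c) \<cdot>\<^sub>m (W3 * (S' * W2))"
        by (simp add: mat_smult_distrib Wd Sd)
      then show ?thesis unfolding F_def c_def
        by (intro eq_matI) (simp_all add: Wd Sd power2_eq_square algebra_simps del: index_mult_mat(1))
    qed
    finally have eq: "equiv_mat (A + (\<varpi> * x) \<cdot>\<^sub>m 1\<^sub>m n) (1\<^sub>m t \<oplus>\<^sub>m (\<varpi> \<cdot>\<^sub>m F))" unfolding c_def .
    have "cong_mat 2 F (E + x \<cdot>\<^sub>m W4 + (\<varpi> * x\<^sup>2) \<cdot>\<^sub>m ?C2)"
    proof -
      \<comment> \<open>The exact error of replacing \<open>S'\<close> by 1 is \<varpi>^2 x^3 times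
        this matrix.\<close>
      define Y where "Y = W3 * (W1 * (S' * W2))"
      have "S' = 1\<^sub>m t + (- (\<varpi> * x)) \<cdot>\<^sub>m (W1 * S')"
      proof -
        have "S * S' = S' + (\<varpi> * x) \<cdot>\<^sub>m (W1 * S')"
          unfolding S_def by (simp add: mat_add_distrib mat_smult_distrib Wd Sd left_mult_one_mat[OF Sc(2)])
        then have "1\<^sub>m t = S' + (\<varpi> * x) \<cdot>\<^sub>m (W1 * S')" using S'(2) by simp
        then show ?thesis using Sd Wd by (auto simp del: index_mult_mat(1))
      qed
      then have "S' * W2 = (1\<^sub>m t + (- (\<varpi> * x)) \<cdot>\<^sub>m (W1 * S')) * W2" by simp
      also have "\<dots> = W2 + (- (\<varpi> * x)) \<cdot>\<^sub>m (W1 * (S' * W2))"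
        by (simp add: mat_add_distrib mat_smult_distrib mat_mult_assoc Wd Sd left_mult_one_mat[OF Wb(2)])
      finally have "W3 * (S' * W2) = W3 * (W2 + (- (\<varpi> * x)) \<cdot>\<^sub>m (W1 * (S' * W2)))" by simp
      also have "\<dots> = W3 * W2 + (- (\<varpi> * x)) \<cdot>\<^sub>m Y"
        unfolding Y_def by (simp add: mat_add_distrib mat_smult_distrib Wd Sd)
      finally have *: "W3 * (S' * W2) = W3 * W2 + (- (\<varpi> * x)) \<cdot>\<^sub>m Y" .
      have Y: "Y \<in> carrier_mat N N" unfolding Y_def using Wd by (intro carrier_matI) simp_all
      have "F = (E + x \<cdot>\<^sub>m W4 + (\<varpi> * x\<^sup>2) \<cdot>\<^sub>m ?C2) + \<varpi> ^ 2 \<cdot>\<^sub>m (x ^ 3 \<cdot>\<^sub>m Y)"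
        unfolding F_def *
        by (intro eq_matI) (simp_all add: Wd carrier_matD[OF Y] power2_eq_square power3_eq_cube algebra_simps del: index_mult_mat(1))
      then show ?thesis
        using cong_mat_add_smult[of "E + x \<cdot>\<^sub>m W4 + (\<varpi> * x\<^sup>2) \<cdot>\<^sub>m ?C2" N N "x ^ 3 \<cdot>\<^sub>m Y" 2] E(2) Wb(4) C2 Y by simp
    qed
    then show "\<exists>F\<in>carrier_mat N N. cong_mat 2 F (E + x \<cdot>\<^sub>m W4 + (\<varpi> * x\<^sup>2) \<cdot>\<^sub>m ?C2) \<and>
       equiv_mat (A + (\<varpi> * x) \<cdot>\<^sub>m 1\<^sub>m n) (1\<^sub>m t \<oplus>\<^sub>m (\<varpi> \<cdot>\<^sub>m F))"
      using eq F by blast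
  qed
qed

lemma card_shift:
  fixes t N :: nat
  shows "card {i. i < t + N \<and> \<not> i < t \<and> Q (i - t)} = card {j. j < N \<and> Q j}"
proof -
  have "{i. i < t + N \<and> \<not> i < t \<and> Q (i - t)} = (\<lambda>j. j + t) ` {j. j < N \<and> Q j}"
  proof
    show "{i. i < t + N \<and> \<not> i < t \<and> Q (i - t)} \<subseteq> (\<lambda>j. j + t) ` {j. j < N \<and> Q j}"
    proof
      fix i assume "i \<in> {i. i < t + N \<and> \<not> i < t \<and> Q (i - t)}"
      then show "i \<in> (\<lambda>j. j + t) ` {j. j < N \<and> Q j}" by (intro image_eqI[of _ _ "i - t"]) auto
    qed
  qed auto
  then show ?thesis by (simp add: card_image)
qed

lemma p_power_mult_uniformizer: "p_power x \<Longrightarrow> p_power (\<varpi> * x)"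
  unfolding p_power_def by (metis mult_zero_right power_Suc)

lemma unit_block_diag:
  fixes f :: "nat \<Rightarrow> 'p::prime_card padic_int"
  defines "g \<equiv> \<lambda>t i. if i < t then 1 else \<varpi> * f (i - t)"
  shows "1\<^sub>m t \<oplus>\<^sub>m (\<varpi> \<cdot>\<^sub>m mat_diag N f) = mat_diag (t + N) (g t)"
    and "\<not> Q 1 \<Longrightarrow> card {i. i < t + N \<and> Q (g t i)} = card {j. j < N \<and> Q (\<varpi> * f j)}"
proof -
  have "\<varpi> \<cdot>\<^sub>m mat_diag N f = mat_diag N (\<lambda>i. \<varpi> * f i)" by (intro eq_matI) (auto simp: mat_diag_def)
  then show "1\<^sub>m t \<oplus>\<^sub>m (\<varpi> \<cdot>\<^sub>m mat_diag N f) = mat_diag (t + N) (g t)"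
    using direct_sum_mat_diag[of t "\<lambda>_. 1 :: 'p padic_int" N "\<lambda>i. \<varpi> * f i"] by (simp add: g_def mat_diag_one)
  assume "\<not> Q 1"
  then have "{i. i < t + N \<and> Q (g t i)} = {i. i < t + N \<and> \<not> i < t \<and> Q (\<varpi> * f (i - t))}"
    unfolding g_def by auto
  then show "card {i. i < t + N \<and> Q (g t i)} = card {j. j < N \<and> Q (\<varpi> * f j)}"
    using card_shift[of t N "\<lambda>j. Q (\<varpi> * f j)"] by simp
qed

text \<open>The factor \<varpi> in front of \<open>F\<close> shifts valuations: an entry \<varpi>^r
  in a Smith form of \<open>F\<close> becomes \<varpi>^(r+1) in the presentation. So the rank of
  \<open>F\<close> modulo \<varpi>^k is d_1 + ... + d_k, and all N positions count for the
  p-rank.\<close>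

lemma presents_unit_block_type:
  fixes H :: "('p::prime_card padic_int, 'a) module"
  assumes mod: "module class_ring H" and B: "presents B H" "equiv_mat B (1\<^sub>m t \<oplus>\<^sub>m (\<varpi> \<cdot>\<^sub>m F))"
    and F: "F \<in> carrier_mat N N"
  shows "p_rank H = N" "d_mult 1 H = prank 1 F" "d_mult 1 H + d_mult 2 H = prank 2 F"
proof -
  obtain f where f: "\<And>i. p_power (f i)" "equiv_mat F (mat_diag N f)"
    "\<And>k. prank k F = card {i. i < N \<and> \<not> \<varpi> ^ k dvd f i}"
    by (rule smith_normal_form_square[OF F]) blast
  define g where "g = (\<lambda>i. if i < t then 1 else \<varpi> * f (i - t))"
  have "equiv_mat B (mat_diag (t + N) g)"
    using equiv_mat_trans[OF B(2) equiv_mat_direct_sum[OF equiv_mat_refl equiv_mat_smult[OF f(2)]]]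
    unfolding unit_block_diag(1) g_def .
  then have gH: "presents (mat_diag (t + N) g) H" by (rule presents_equiv[OF B(1) equiv_mat_sym])
  have pg: "p_power (g i)" for i
    using p_power_mult_uniformizer[OF f(1)] by (auto simp: g_def p_power_def intro: exI[of _ 0])
  note type = presents_type[OF mod gH pg]
  have count: "\<not> Q 1 \<Longrightarrow> card {i. i < t + N \<and> Q (g i)} = card {j. j < N \<and> Q (\<varpi> * f j)}" for Q
    unfolding g_def by (rule unit_block_diag(2))
  show "p_rank H = N" using type(3) count[of "\<lambda>y. \<varpi> dvd y"] by simp
  have level: "d_mult (Suc r) H = card {i. i < N \<and> f i = \<varpi> ^ r}" for r
  proof -
    have "\<varpi> ^ Suc r \<noteq> (1 :: 'p padic_int)" using uniformizer_power_eq_iff[of "Suc r" 0, where 'p='p] by simp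
    moreover have "\<varpi> * f j = \<varpi> ^ Suc r \<longleftrightarrow> f j = \<varpi> ^ r" for j by simp
    ultimately show ?thesis using type(2)[of "Suc r"] count[of "\<lambda>y. y = \<varpi> ^ Suc r"] by (simp del: power_Suc)
  qed
  have d: "prank (Suc r) F = prank r F + d_mult (Suc r) H" for r
    unfolding f(3) level by (rule card_diff_level) (rule f(1))
  have "prank 0 F = 0" unfolding f(3) by simp
  then show "d_mult 1 H = prank 1 F" "d_mult 1 H + d_mult 2 H = prank 2 F"
    using d[of 0] d[of 1] by (simp_all add: numeral_2_eq_2)
qed

lemma cok_tuple_pencil:
  fixes x :: "nat \<Rightarrow> 'p::prime_card padic_int" and H :: "nat \<Rightarrow> ('p padic_int, 'a) module"
  assumes A: "A \<in> carrier_mat n n" and mod: "\<And>i. i \<in> I \<Longrightarrow> module class_ring (H i)"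
    and H: "\<And>i. i \<in> I \<Longrightarrow> presents (A + (\<varpi> * x i) \<cdot>\<^sub>m 1\<^sub>m n) (H i)"
  obtains N F where "quadratic_pencil N I x F" "\<And>i. i \<in> I \<Longrightarrow> p_rank (H i) = N"
    "\<And>i. i \<in> I \<Longrightarrow> prank 1 (F i) = d_mult 1 (H i)" "\<And>i. i \<in> I \<Longrightarrow> prank 2 (F i) = d_mult 1 (H i) + d_mult 2 (H i)"
proof -
  obtain t N C0 C1 C2 where C: "n = t + N" "C0 \<in> carrier_mat N N" "C1 \<in> carrier_mat N N" "C2 \<in> carrier_mat N N"
    "\<And>x. \<exists>F\<in>carrier_mat N N. cong_mat 2 F (C0 + x \<cdot>\<^sub>m C1 + (\<varpi> * x\<^sup>2) \<cdot>\<^sub>m C2) \<and>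
       equiv_mat (A + (\<varpi> * x) \<cdot>\<^sub>m 1\<^sub>m n) (1\<^sub>m t \<oplus>\<^sub>m (\<varpi> \<cdot>\<^sub>m F))"
    by (rule schur_quadratic_pencil[OF A]) blast
  have "\<forall>i. \<exists>F. F \<in> carrier_mat N N \<and> cong_mat 2 F (C0 + x i \<cdot>\<^sub>m C1 + (\<varpi> * (x i)\<^sup>2) \<cdot>\<^sub>m C2) \<and>
       equiv_mat (A + (\<varpi> * x i) \<cdot>\<^sub>m 1\<^sub>m n) (1\<^sub>m t \<oplus>\<^sub>m (\<varpi> \<cdot>\<^sub>m F))"
    using C(5) by (simp add: Bex_def)
  then obtain F where F: "\<And>i. F i \<in> carrier_mat N N"
    "\<And>i. cong_mat 2 (F i) (C0 + x i \<cdot>\<^sub>m C1 + (\<varpi> * (x i)\<^sup>2) \<cdot>\<^sub>m C2)"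
    "\<And>i. equiv_mat (A + (\<varpi> * x i) \<cdot>\<^sub>m 1\<^sub>m n) (1\<^sub>m t \<oplus>\<^sub>m (\<varpi> \<cdot>\<^sub>m F i))" by metis
  show ?thesis
  proof
    show "quadratic_pencil N I x F" unfolding quadratic_pencil_def using C(2-4) F(1,2) by blast
    fix i assume i: "i \<in> I"
    note type = presents_unit_block_type[OF mod[OF i] H[OF i] F(3) F(1)]
    show "p_rank (H i) = N" "prank 1 (F i) = d_mult 1 (H i)" "prank 2 (F i) = d_mult 1 (H i) + d_mult 2 (H i)"
      using type by simp_all
  qed
qed

text \<open>Modulo \<varpi> the pencil is affine in the node, so its value at one node is a
  combination of the values at two others, up to a unit.\<close>

lemma quadratic_pencil_prank_one:
  fixes x :: "nat \<Rightarrow> 'p::prime_card padic_int"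
  assumes pencil: "quadratic_pencil n I x F" and I: "i1 \<in> I" "i2 \<in> I" "i3 \<in> I"
    and unit: "x i2 - x i3 dvd 1"
  shows "prank 1 (F i1) \<le> prank 1 (F i2) + prank 1 (F i3)"
proof -
  have F: "F i \<in> carrier_mat n n" if "i \<in> I" for i using pencil that unfolding quadratic_pencil_def by blast
  let ?G = "(x i1 - x i3) \<cdot>\<^sub>m F i2 + (- (x i1 - x i2)) \<cdot>\<^sub>m F i3"
  have "cong_mat 1 ((x i2 - x i3) \<cdot>\<^sub>m F i1) ?G"
  proof (rule cong_matI[of _ n n])
    fix i j assume ij: "i < n" "j < n"
    obtain a b c where abc: "\<And>k. k \<in> I \<Longrightarrow> \<varpi> ^ 2 dvd F k $$ (i, j) - (a + x k * b + (x k)\<^sup>2 * (\<varpi> * c))"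
      by (rule quadratic_pencil_entry[OF pencil ij]) (rule that)
    have "\<varpi> dvd F k $$ (i, j) - (a + x k * b)" if k: "k \<in> I" for k
    proof -
      have "\<varpi> dvd F k $$ (i, j) - (a + x k * b + (x k)\<^sup>2 * (\<varpi> * c))"
        by (rule dvd_trans[OF _ abc[OF k]]) (simp add: power2_eq_square)
      then have "\<varpi> dvd (F k $$ (i, j) - (a + x k * b + (x k)\<^sup>2 * (\<varpi> * c))) + \<varpi> * ((x k)\<^sup>2 * c)"
        by (intro dvd_add) simp_all
      then show ?thesis by (simp add: algebra_simps)
    qed
    from this[OF I(1)] this[OF I(2)] this[OF I(3)]
    obtain u1 u2 u3 where u: "F i1 $$ (i, j) - (a + x i1 * b) = \<varpi> * u1" "F i2 $$ (i, j) - (a + x i2 * b) = \<varpi> * u2"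
      "F i3 $$ (i, j) - (a + x i3 * b) = \<varpi> * u3" by (elim dvdE)
    then have u': "F i1 $$ (i, j) = a + x i1 * b + \<varpi> * u1" "F i2 $$ (i, j) = a + x i2 * b + \<varpi> * u2"
      "F i3 $$ (i, j) = a + x i3 * b + \<varpi> * u3" by (simp_all add: algebra_simps)
    have "((x i2 - x i3) \<cdot>\<^sub>m F i1) $$ (i, j) - ?G $$ (i, j)
      = \<varpi> * ((x i2 - x i3) * u1 - (x i1 - x i3) * u2 + (x i1 - x i2) * u3)"
      using ij F[OF I(1)] F[OF I(2)] F[OF I(3)] by (simp add: u' algebra_simps)
    then show "\<varpi> ^ 1 dvd ((x i2 - x i3) \<cdot>\<^sub>m F i1) $$ (i, j) - ?G $$ (i, j)" by simp
  qed (use F I in auto)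
  then have "prank 1 (F i1) = prank 1 ?G" using prank_cong prank_smult_unit[OF F[OF I(1)] unit] by metis
  also have "\<dots> \<le> prank 1 ((x i1 - x i3) \<cdot>\<^sub>m F i2) + prank 1 ((- (x i1 - x i2)) \<cdot>\<^sub>m F i3)"
    by (rule prank_add) (use F[OF I(2)] F[OF I(3)] in auto)
  also have "\<dots> \<le> prank 1 (F i2) + prank 1 (F i3)"
    by (intro add_mono prank_smult_le[OF F] I)
  finally show ?thesis .
qed

subsection \<open>Block companion matrices\<close>

definition monic_mat_poly :: "nat \<Rightarrow> nat \<Rightarrow> (nat \<Rightarrow> 'a::comm_ring_1 mat) \<Rightarrow> 'a \<Rightarrow> 'a mat" where
  "monic_mat_poly N m C y = mat N N (\<lambda>(a, b). y ^ m * (1\<^sub>m N $$ (a, b)) + (\<Sum>l<m. y ^ l * C l $$ (a, b)))"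

lemma monic_mat_poly_carrier [simp]: "monic_mat_poly N m C y \<in> carrier_mat N N"
  by (simp add: monic_mat_poly_def)

lemma monic_mat_poly_Suc:
  assumes "C 0 \<in> carrier_mat N N"
  shows "monic_mat_poly N (Suc m) C y = C 0 + y \<cdot>\<^sub>m monic_mat_poly N m (\<lambda>l. C (Suc l)) y"
proof (rule eq_matI)
  fix a b assume "a < dim_row (C 0 + y \<cdot>\<^sub>m monic_mat_poly N m (\<lambda>l. C (Suc l)) y)"
    "b < dim_col (C 0 + y \<cdot>\<^sub>m monic_mat_poly N m (\<lambda>l. C (Suc l)) y)"
  then have "a < N" "b < N" by (simp_all add: monic_mat_poly_def)
  then show "monic_mat_poly N (Suc m) C y $$ (a, b) = (C 0 + y \<cdot>\<^sub>m monic_mat_poly N m (\<lambda>l. C (Suc l)) y) $$ (a, b)"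
    using assms unfolding monic_mat_poly_def
    by (simp add: sum.lessThan_Suc_shift sum_distrib_left algebra_simps del: sum.lessThan_Suc)
qed (use assms in \<open>simp_all add: monic_mat_poly_def\<close>)

lemma four_block_mat_hcat:
  assumes "A \<in> carrier_mat a c" "B \<in> carrier_mat a d" "C \<in> carrier_mat b c" "D \<in> carrier_mat b d"
  shows "four_block_mat A B C D = hcat (vcat A C) (vcat B D)"
  using assms unfolding hcat_def vcat_def by (intro eq_matI) auto

text \<open>The matrices \<open>h\<close>, \<open>E\<close>, \<open>L\<close>, \<open>K\<close>, \<open>S\<close> identify the cokernels of \<open>y + A\<close> and of the
  polynomial at \<open>y\<close>; the relation \<open>L * S = 0\<close> serves only to carry the induction on the degree.\<close>

lemma block_companion:
  fixes C :: "nat \<Rightarrow> 'a::comm_ring_1 mat"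
  assumes "\<And>l. C l \<in> carrier_mat N N"
  shows "\<exists>n A E L K. n = Suc m * N \<and> A \<in> carrier_mat n n \<and> E \<in> carrier_mat n N \<and> L \<in> carrier_mat N n \<and>
    K \<in> carrier_mat n N \<and> L * K = 1\<^sub>m N \<and>
    (\<forall>y. \<exists>h\<in>carrier_mat N n. \<exists>S\<in>carrier_mat n n. h * E = 1\<^sub>m N \<and>
       h * (y \<cdot>\<^sub>m 1\<^sub>m n + A) = monic_mat_poly N (Suc m) C y * L \<and>
       E * h + (y \<cdot>\<^sub>m 1\<^sub>m n + A) * S = 1\<^sub>m n \<and> L * S = 0\<^sub>m N n)"
  using assms
proof (induction m arbitrary: C)
  case 0
  have Q: "monic_mat_poly N (Suc 0) C y = y \<cdot>\<^sub>m 1\<^sub>m N + C 0" for y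
    using 0[of 0] by (intro eq_matI) (auto simp: monic_mat_poly_def)
  have main: "\<exists>h\<in>carrier_mat N N. \<exists>S\<in>carrier_mat N N. h * 1\<^sub>m N = 1\<^sub>m N \<and>
       h * (y \<cdot>\<^sub>m 1\<^sub>m N + C 0) = monic_mat_poly N (Suc 0) C y * 1\<^sub>m N \<and>
       1\<^sub>m N * h + (y \<cdot>\<^sub>m 1\<^sub>m N + C 0) * S = 1\<^sub>m N \<and> 1\<^sub>m N * S = 0\<^sub>m N N" for y
  proof -
    have c: "y \<cdot>\<^sub>m 1\<^sub>m N + C 0 \<in> carrier_mat N N" using 0[of 0] by simp
    have "1\<^sub>m N * (y \<cdot>\<^sub>m 1\<^sub>m N + C 0) = (y \<cdot>\<^sub>m 1\<^sub>m N + C 0) * 1\<^sub>m N"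
      unfolding left_mult_one_mat[OF c] right_mult_one_mat[OF c] ..
    moreover have "1\<^sub>m N * 1\<^sub>m N + (y \<cdot>\<^sub>m 1\<^sub>m N + C 0) * 0\<^sub>m N N = 1\<^sub>m N"
      unfolding right_mult_zero_mat[OF c] by simp
    ultimately show ?thesis unfolding Q
      by - (rule bexI[of _ "1\<^sub>m N"], rule bexI[of _ "0\<^sub>m N N"], simp_all)
  qed
  show ?case
    by (rule exI[of _ N], rule exI[of _ "C 0"], rule exI[of _ "1\<^sub>m N"], rule exI[of _ "1\<^sub>m N"], rule exI[of _ "1\<^sub>m N"],
      intro conjI allI main) (use 0[of 0] in simp_all)
next
  case (Suc m)
  let ?Q' = "monic_mat_poly N (Suc m) (\<lambda>l. C (Suc l))"
  obtain n A E L K where n: "n = Suc m * N" and A: "A \<in> carrier_mat n n" and E: "E \<in> carrier_mat n N"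
    and L: "L \<in> carrier_mat N n" and K: "K \<in> carrier_mat n N" and LK: "L * K = 1\<^sub>m N"
    and ids: "\<forall>y. \<exists>h\<in>carrier_mat N n. \<exists>S\<in>carrier_mat n n. h * E = 1\<^sub>m N \<and>
       h * (y \<cdot>\<^sub>m 1\<^sub>m n + A) = ?Q' y * L \<and> E * h + (y \<cdot>\<^sub>m 1\<^sub>m n + A) * S = 1\<^sub>m n \<and> L * S = 0\<^sub>m N n"
    using Suc.IH[of "\<lambda>l. C (Suc l)"] Suc.prems by blast
  note C0 = Suc.prems[of 0]
  note d = carrier_matD[OF A] carrier_matD[OF E] carrier_matD[OF L] carrier_matD[OF K] carrier_matD[OF C0]
  have CL: "C 0 * L \<in> carrier_mat N n" using d by (intro carrier_matI) simp_all
  \<comment> \<open>A Horner step. The new first block row feeds in \<open>C 0\<close>, and the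
    block \<open>- E\<close> cancels against \<open>y\<close> because \<open>h * E\<close> is the
    identity. So \<open>?h\<close> times the matrix is 0 in the first block and C 0 L + y h (y + A)
    in the second, which is the next polynomial times \<open>L\<close>.\<close>
  let ?A = "four_block_mat (0\<^sub>m N N) (C 0 * L) ((- 1) \<cdot>\<^sub>m E) A"
  let ?E = "vcat (1\<^sub>m N) (0\<^sub>m n N)" and ?L = "hcat (0\<^sub>m N N) L" and ?K = "vcat (0\<^sub>m N N) K"
  show ?case
  proof (rule exI[of _ "N + n"], rule exI[of _ ?A], rule exI[of _ ?E], rule exI[of _ ?L], rule exI[of _ ?K], intro conjI allI, goal_cases)
    case 6
    have "?L * ?K = 0\<^sub>m N N * 0\<^sub>m N N + L * K" by (rule hcat_mult_vcat) (use L K in auto)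
    then show ?case using LK by simp
  next
    case (7 y)
    obtain h S where h: "h \<in> carrier_mat N n" and S: "S \<in> carrier_mat n n" and hE: "h * E = 1\<^sub>m N"
      and hA: "h * (y \<cdot>\<^sub>m 1\<^sub>m n + A) = ?Q' y * L" and EhS: "E * h + (y \<cdot>\<^sub>m 1\<^sub>m n + A) * S = 1\<^sub>m n"
      and LS: "L * S = 0\<^sub>m N n"
      using ids by blast
    note d = d carrier_matD[OF h] carrier_matD[OF S] carrier_matD[OF monic_mat_poly_carrier]
    let ?h = "hcat (1\<^sub>m N) (y \<cdot>\<^sub>m h)"
    let ?S = "four_block_mat (0\<^sub>m N N) ((- 1) \<cdot>\<^sub>m h) (0\<^sub>m n N) S"
    let ?yA = "y \<cdot>\<^sub>m 1\<^sub>m n + A"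
    have yA: "?yA \<in> carrier_mat n n" using A by simp
    have M: "y \<cdot>\<^sub>m 1\<^sub>m (N + n) + ?A = four_block_mat (y \<cdot>\<^sub>m 1\<^sub>m N) (C 0 * L) ((- 1) \<cdot>\<^sub>m E) ?yA"
      by (rule eq_matI) (auto simp: d)
    have Q: "monic_mat_poly N (Suc (Suc m)) C y * L = C 0 * L + y \<cdot>\<^sub>m (?Q' y * L)"
      unfolding monic_mat_poly_Suc[of C N "Suc m" y, OF C0]
      by (simp add: mat_add_distrib mat_smult_distrib d)
    show ?case
    proof (rule bexI[of _ ?h], rule bexI[of _ ?S], intro conjI, goal_cases)
      case 1
      have "?h * ?E = 1\<^sub>m N * 1\<^sub>m N + (y \<cdot>\<^sub>m h) * 0\<^sub>m n N" by (rule hcat_mult_vcat) (use h in auto)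
      also have "(y \<cdot>\<^sub>m h) * 0\<^sub>m n N = 0\<^sub>m N N" using h by (intro right_mult_zero_mat) simp
      finally show ?case by simp
    next
      case 2
      have "?h * (y \<cdot>\<^sub>m 1\<^sub>m (N + n) + ?A)
        = ?h * hcat (vcat (y \<cdot>\<^sub>m 1\<^sub>m N) ((- 1) \<cdot>\<^sub>m E)) (vcat (C 0 * L) ?yA)"
        unfolding M by (subst four_block_mat_hcat[OF _ CL _ yA]) (use E in auto)
      also have "\<dots> = hcat (?h * vcat (y \<cdot>\<^sub>m 1\<^sub>m N) ((- 1) \<cdot>\<^sub>m E)) (?h * vcat (C 0 * L) ?yA)"
        by (rule mult_hcat[of _ N "N + n" _ N _ n]) (use h E CL yA in auto)
      also have "?h * vcat (y \<cdot>\<^sub>m 1\<^sub>m N) ((- 1) \<cdot>\<^sub>m E) = 1\<^sub>m N * (y \<cdot>\<^sub>m 1\<^sub>m N) + (y \<cdot>\<^sub>m h) * ((- 1) \<cdot>\<^sub>m E)"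
        by (rule hcat_mult_vcat) (use h E in auto)
      also have "\<dots> = 0\<^sub>m N N"
        using hE by (intro eq_matI) (simp_all add: mat_smult_distrib d del: index_mult_mat(1))
      also have "?h * vcat (C 0 * L) ?yA = 1\<^sub>m N * (C 0 * L) + (y \<cdot>\<^sub>m h) * ?yA"
        by (rule hcat_mult_vcat) (use h CL yA in auto)
      also have "\<dots> = C 0 * L + y \<cdot>\<^sub>m (h * ?yA)"
        using left_mult_one_mat[OF CL] by (simp add: mat_smult_distrib d)
      also have "\<dots> = monic_mat_poly N (Suc (Suc m)) C y * L" unfolding hA Q ..
      also have "hcat (0\<^sub>m N N) (monic_mat_poly N (Suc (Suc m)) C y * L)
        = monic_mat_poly N (Suc (Suc m)) C y * ?L"
        using mult_hcat[of "monic_mat_poly N (Suc (Suc m)) C y" N N "0\<^sub>m N N" N L n] L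
          right_mult_zero_mat[OF monic_mat_poly_carrier[of N "Suc (Suc m)" C y], of N] by simp
      finally show ?case .
    next
      case 3
      have "?E * ?h = four_block_mat (1\<^sub>m N * 1\<^sub>m N) (1\<^sub>m N * (y \<cdot>\<^sub>m h)) (0\<^sub>m n N * 1\<^sub>m N) (0\<^sub>m n N * (y \<cdot>\<^sub>m h))"
        by (rule vcat_mult_hcat) (use h in auto)
      also have "\<dots> = four_block_mat (1\<^sub>m N) (y \<cdot>\<^sub>m h) (0\<^sub>m n N) (0\<^sub>m n n)"
        using h left_mult_one_mat[of "y \<cdot>\<^sub>m h" N n] left_mult_zero_mat[of "y \<cdot>\<^sub>m h" N n n] by simp
      finally have EH: "?E * ?h = four_block_mat (1\<^sub>m N) (y \<cdot>\<^sub>m h) (0\<^sub>m n N) (0\<^sub>m n n)" .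
      have "(y \<cdot>\<^sub>m 1\<^sub>m (N + n) + ?A) * ?S = four_block_mat
          ((y \<cdot>\<^sub>m 1\<^sub>m N) * 0\<^sub>m N N + (C 0 * L) * 0\<^sub>m n N) ((y \<cdot>\<^sub>m 1\<^sub>m N) * ((- 1) \<cdot>\<^sub>m h) + (C 0 * L) * S)
          (((- 1) \<cdot>\<^sub>m E) * 0\<^sub>m N N + ?yA * 0\<^sub>m n N) (((- 1) \<cdot>\<^sub>m E) * ((- 1) \<cdot>\<^sub>m h) + ?yA * S)"
        unfolding M by (rule mult_four_block_mat[OF _ CL _ yA]) (use h E S in auto)
      also have "(y \<cdot>\<^sub>m 1\<^sub>m N) * 0\<^sub>m N N + (C 0 * L) * 0\<^sub>m n N = 0\<^sub>m N N"
        using right_mult_zero_mat[OF CL] right_mult_zero_mat[of "y \<cdot>\<^sub>m 1\<^sub>m N" N N N] by simp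
      also have "((- 1) \<cdot>\<^sub>m E) * 0\<^sub>m N N + ?yA * 0\<^sub>m n N = 0\<^sub>m n N"
        using right_mult_zero_mat[OF yA] right_mult_zero_mat[of "(- 1) \<cdot>\<^sub>m E" n N N] E by simp
      also have "(C 0 * L) * S = 0\<^sub>m N n"
        using LS right_mult_zero_mat[OF C0] by (simp add: mat_mult_assoc d)
      also have "(y \<cdot>\<^sub>m 1\<^sub>m N) * ((- 1) \<cdot>\<^sub>m h) + 0\<^sub>m N n = (- y) \<cdot>\<^sub>m h"
        using h by (simp add: mat_smult_distrib d left_mult_one_mat[OF h])
      also have "((- 1) \<cdot>\<^sub>m E) * ((- 1) \<cdot>\<^sub>m h) = E * h"
        by (intro eq_matI) (simp_all add: mat_smult_distrib d del: index_mult_mat(1))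
      also note EhS
      finally have "(y \<cdot>\<^sub>m 1\<^sub>m (N + n) + ?A) * ?S = four_block_mat (0\<^sub>m N N) ((- y) \<cdot>\<^sub>m h) (0\<^sub>m n N) (1\<^sub>m n)" .
      then show ?case unfolding EH by (intro eq_matI) (auto simp: d)
    next
      case 4
      have "?L * ?S = ?L * hcat (vcat (0\<^sub>m N N) (0\<^sub>m n N)) (vcat ((- 1) \<cdot>\<^sub>m h) S)"
        by (subst four_block_mat_hcat[OF _ _ _ S]) (use h in auto)
      also have "\<dots> = hcat (?L * vcat (0\<^sub>m N N) (0\<^sub>m n N)) (?L * vcat ((- 1) \<cdot>\<^sub>m h) S)"
        by (rule mult_hcat[of _ N "N + n" _ N _ n]) (use h L S in auto)
      also have "?L * vcat (0\<^sub>m N N) (0\<^sub>m n N) = 0\<^sub>m N N * 0\<^sub>m N N + L * 0\<^sub>m n N"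
        by (rule hcat_mult_vcat) (use L in auto)
      also have "\<dots> = 0\<^sub>m N N" using right_mult_zero_mat[OF L] by simp
      also have "?L * vcat ((- 1) \<cdot>\<^sub>m h) S = 0\<^sub>m N N * ((- 1) \<cdot>\<^sub>m h) + L * S"
        by (rule hcat_mult_vcat) (use L h S in auto)
      also have "\<dots> = 0\<^sub>m N n" using LS left_mult_zero_mat[of "(- 1) \<cdot>\<^sub>m h" N n N] h by simp
      finally show ?case by (simp add: hcat_def)
    next
      case 5 show ?case using S h by simp
    next
      case 6 show ?case using h by simp
    qed
  qed (use n E L K A CL in \<open>auto simp del: index_mult_mat(1)\<close>)
qed

text \<open>On the cokernels \<open>h\<close> and \<open>E\<close> are mutually inverse. The
  identity h M = Q L carries relations of \<open>M\<close> to relations of \<open>Q\<close>, and E Q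
  = M Z with Z = K - S M K carries them back; the term M S shows that E h differs from the identity
  by relations only.\<close>

lemma presents_retract:
  fixes M Q :: "'p::prime_card padic_int mat"
  assumes pres: "presents Q H" and Q: "Q \<in> carrier_mat N N" and M: "M \<in> carrier_mat n n"
    and h: "h \<in> carrier_mat N n" and S: "S \<in> carrier_mat n n" and E: "E \<in> carrier_mat n N"
    and L: "L \<in> carrier_mat N n" and K: "K \<in> carrier_mat n N"
    and ids: "L * K = 1\<^sub>m N" "h * E = 1\<^sub>m N" "h * M = Q * L" "E * h + M * S = 1\<^sub>m n"
  shows "presents M H"
proof -
  obtain g where g: "\<And>v. v \<in> carrier_vec N \<Longrightarrow> g v \<in> carrier H"
    "\<And>v w. v \<in> carrier_vec N \<Longrightarrow> w \<in> carrier_vec N \<Longrightarrow> g (v + w) = g v \<oplus>\<^bsub>H\<^esub> g w"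
    "\<And>c v. v \<in> carrier_vec N \<Longrightarrow> g (c \<cdot>\<^sub>v v) = c \<odot>\<^bsub>H\<^esub> g v"
    "\<And>y. y \<in> carrier H \<Longrightarrow> \<exists>v\<in>carrier_vec N. g v = y"
    "\<And>v w. v \<in> carrier_vec N \<Longrightarrow> w \<in> carrier_vec N \<Longrightarrow> g v = g w \<longleftrightarrow> v - w \<in> mat_range Q"
    by (rule presentsE[OF pres Q]) blast
  note d = carrier_matD[OF Q] carrier_matD[OF M] carrier_matD[OF h] carrier_matD[OF S] carrier_matD[OF E]
    carrier_matD[OF L] carrier_matD[OF K]
  have hv: "h *\<^sub>v v \<in> carrier_vec N" if "v \<in> carrier_vec n" for v
    using h that by (rule mult_mat_vec_carrier)
  have range_iff: "h *\<^sub>v u \<in> mat_range Q \<longleftrightarrow> u \<in> mat_range M" if u: "u \<in> carrier_vec n" for u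
  proof
    assume "u \<in> mat_range M"
    then obtain z where z: "z \<in> carrier_vec n" "u = M *\<^sub>v z" using M unfolding mat_range_def by auto
    have "h *\<^sub>v u = Q *\<^sub>v (L *\<^sub>v z)"
      unfolding z(2) assoc_mult_mat_vec[OF h M z(1), symmetric] ids(3)
      by (rule assoc_mult_mat_vec[OF Q L z(1)])
    then show "h *\<^sub>v u \<in> mat_range Q"
      using mult_mat_vec_carrier[OF L z(1)] Q unfolding mat_range_def by auto
  next
    assume "h *\<^sub>v u \<in> mat_range Q"
    then obtain w where w: "w \<in> carrier_vec N" "h *\<^sub>v u = Q *\<^sub>v w" using Q unfolding mat_range_def by auto
    define Z where "Z = K + (- 1) \<cdot>\<^sub>m (S * (M * K))"
    have Z: "Z \<in> carrier_mat n N" unfolding Z_def using d by (intro carrier_matI) simp_all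
    have EQ: "E * Q = M * Z"
    proof -
      have "E * Q = E * (Q * (L * K))" using ids(1) right_mult_one_mat[OF Q] by simp
      also have "\<dots> = E * (h * M * K)" unfolding ids(3) by (simp add: mat_mult_assoc d)
      also have "\<dots> = (E * h) * (M * K)" by (simp add: mat_mult_assoc d)
      also have "E * h = 1\<^sub>m n + (- 1) \<cdot>\<^sub>m (M * S)"
        unfolding ids(4)[symmetric] by (intro eq_matI) (simp_all add: d del: index_mult_mat(1))
      also have "\<dots> * (M * K) = M * K + (- 1) \<cdot>\<^sub>m (M * (S * (M * K)))"
        using left_mult_one_mat[of "M * K" n N] by (simp add: mat_add_distrib mat_smult_distrib mat_mult_assoc d)
      also have "\<dots> = M * Z" unfolding Z_def by (simp add: mat_add_distrib mat_smult_distrib d)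
      finally show ?thesis .
    qed
    have Eh: "E * h \<in> carrier_mat n n" and MS: "M * S \<in> carrier_mat n n" using d by (auto intro!: carrier_matI)
    have "u = (E * h + M * S) *\<^sub>v u" unfolding ids(4) using u by simp
    also have "\<dots> = (E * h) *\<^sub>v u + (M * S) *\<^sub>v u" by (rule add_mult_distrib_mat_vec[OF Eh MS u])
    also have "(E * h) *\<^sub>v u = E *\<^sub>v (Q *\<^sub>v w)" using assoc_mult_mat_vec[OF E h u] w(2) by simp
    also have "\<dots> = M *\<^sub>v (Z *\<^sub>v w)"
      using assoc_mult_mat_vec[OF E Q w(1)] assoc_mult_mat_vec[OF M Z w(1)] EQ by simp
    also have "(M * S) *\<^sub>v u = M *\<^sub>v (S *\<^sub>v u)" by (rule assoc_mult_mat_vec[OF M S u])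
    also have "M *\<^sub>v (Z *\<^sub>v w) + M *\<^sub>v (S *\<^sub>v u) = M *\<^sub>v (Z *\<^sub>v w + S *\<^sub>v u)"
      by (rule mult_add_distrib_mat_vec[symmetric, OF M]) (use Z S w u in auto)
    finally show "u \<in> mat_range M"
      unfolding mat_range_def using M S Z w(1) u by (intro image_eqI[of _ _ "Z *\<^sub>v w + S *\<^sub>v u"]) auto
  qed
  show ?thesis
  proof (rule presentsI[OF M, of "\<lambda>v. g (h *\<^sub>v v)"], goal_cases)
    case (1 v) then show ?case using g(1) hv by simp
  next
    case (2 v w) then show ?case using g(2) hv by (simp add: mult_add_distrib_mat_vec[OF h])
  next
    case (3 c v) then show ?case using g(3) hv by (simp add: mult_mat_smult_vec[OF h])
  next
    case (4 y)
    obtain v where v: "v \<in> carrier_vec N" "g v = y" using g(4)[OF 4] by blast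
    have "h *\<^sub>v (E *\<^sub>v v) = v" using assoc_mult_mat_vec[OF h E v(1)] ids(2) v(1) by simp
    then show ?case using v mult_mat_vec_carrier[OF E v(1)] by force
  next
    case (5 v w)
    have "h *\<^sub>v v - h *\<^sub>v w = h *\<^sub>v (v - w)" by (rule mult_minus_distrib_mat_vec[symmetric, OF h 5])
    then show ?case using g(5)[OF hv hv] range_iff[of "v - w"] 5 by simp
  qed
qed

lemma exists_companion:
  fixes C :: "nat \<Rightarrow> 'p::prime_card padic_int mat"
  assumes "\<And>l. C l \<in> carrier_mat N N" and m: "1 \<le> m"
  obtains A where "A \<in> carrier_mat (m * N) (m * N)"
    "\<And>y (H :: ('p padic_int, 'a) module). presents (monic_mat_poly N m C y) H \<Longrightarrow> presents (A + y \<cdot>\<^sub>m 1\<^sub>m (m * N)) H"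
proof -
  obtain k where k: "m = Suc k" using m by (cases m) auto
  obtain A E L K where AELK: "A \<in> carrier_mat (m * N) (m * N)" "E \<in> carrier_mat (m * N) N" "L \<in> carrier_mat N (m * N)"
    "K \<in> carrier_mat (m * N) N" "L * K = 1\<^sub>m N"
    and ids: "\<And>y. \<exists>h\<in>carrier_mat N (m * N). \<exists>S\<in>carrier_mat (m * N) (m * N). h * E = 1\<^sub>m N \<and>
       h * (y \<cdot>\<^sub>m 1\<^sub>m (m * N) + A) = monic_mat_poly N m C y * L \<and>
       E * h + (y \<cdot>\<^sub>m 1\<^sub>m (m * N) + A) * S = 1\<^sub>m (m * N) \<and> L * S = 0\<^sub>m N (m * N)"
    using block_companion[of C N k, OF assms(1)] unfolding k by blast
  show ?thesis
  proof (rule that[OF AELK(1)])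
    fix y and H :: "('p padic_int, 'a) module" assume pres: "presents (monic_mat_poly N m C y) H"
    obtain h S where hS: "h \<in> carrier_mat N (m * N)" "S \<in> carrier_mat (m * N) (m * N)" "h * E = 1\<^sub>m N"
       "h * (y \<cdot>\<^sub>m 1\<^sub>m (m * N) + A) = monic_mat_poly N m C y * L"
       "E * h + (y \<cdot>\<^sub>m 1\<^sub>m (m * N) + A) * S = 1\<^sub>m (m * N)"
      using ids[of y] by blast
    have M: "y \<cdot>\<^sub>m 1\<^sub>m (m * N) + A \<in> carrier_mat (m * N) (m * N)" using AELK(1) by simp
    have "presents (y \<cdot>\<^sub>m 1\<^sub>m (m * N) + A) H"
      by (rule presents_retract[OF pres monic_mat_poly_carrier M hS(1,2) AELK(2-5) hS(3-5)])
    then show "presents (A + y \<cdot>\<^sub>m 1\<^sub>m (m * N)) H"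
      using AELK(1) comm_add_mat[of "y \<cdot>\<^sub>m 1\<^sub>m (m * N)" "m * N" "m * N" A] by simp
  qed
qed

section \<open>Interpolation with unit differences\<close>

text \<open>Newton's form of interpolation: a new node j is served by a multiple of the product over
  the old nodes, which vanishes at those and takes a unit value at \<open>x j\<close>.\<close>

lemma poly_interpolation:
  fixes x k :: "'i \<Rightarrow> 'a::comm_ring_1"
  assumes "finite I" "\<And>i j. i \<in> I \<Longrightarrow> j \<in> I \<Longrightarrow> i \<noteq> j \<Longrightarrow> x i - x j dvd 1"
  shows "\<exists>d :: nat \<Rightarrow> 'a. \<forall>i\<in>I. (\<Sum>l<card I. x i ^ l * d l) = k i"
proof -
  have "\<exists>q. (\<forall>l\<ge>card I. coeff q l = 0) \<and> (\<forall>i\<in>I. poly q (x i) = k i)"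
    using assms
  proof (induction I rule: finite_induct)
    case empty show ?case by (intro exI[of _ 0]) simp
  next
    case (insert j I)
    obtain q where "(\<forall>l\<ge>card I. coeff q l = 0) \<and> (\<forall>i\<in>I. poly q (x i) = k i)"
      using insert.IH insert.prems by auto
    then have q: "\<And>l. card I \<le> l \<Longrightarrow> coeff q l = 0" "\<And>i. i \<in> I \<Longrightarrow> poly q (x i) = k i" by auto
    let ?P = "\<Prod>i\<in>I. [:- x i, 1:]"
    have "degree ?P \<le> (\<Sum>i\<in>I. degree [:- x i, 1:])" by (rule degree_prod_sum_le[OF insert.hyps(1), unfolded comp_def])
    also have "\<dots> = card I" by simp
    finally have P: "coeff ?P l = 0" if "card I < l" for l using that by (intro coeff_eq_0) simp
    have "(\<Prod>i\<in>I. x j - x i) dvd (\<Prod>i\<in>I. 1)" using insert by (intro prod_dvd_prod) auto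
    then obtain u where u: "(\<Prod>i\<in>I. x j - x i) * u = 1" by (metis dvdE prod.neutral_const)
    let ?c = "u * (k j - poly q (x j))"
    let ?q = "q + [:?c:] * ?P"
    have Pi: "poly ?P y = (\<Prod>i\<in>I. y - x i)" for y by (simp add: poly_prod)
    show ?case
    proof (intro exI[of _ ?q] conjI allI ballI impI)
      fix l assume "card (insert j I) \<le> l"
      then show "coeff ?q l = 0" using q(1)[of l] P[of l] insert.hyps by simp
    next
      fix i assume "i \<in> insert j I"
      then consider "i = j" | "i \<in> I" by auto
      then show "poly ?q (x i) = k i"
      proof cases
        case 1
        have "poly ?q (x j) = poly q (x j) + ((\<Prod>i\<in>I. x j - x i) * u) * (k j - poly q (x j))"
          unfolding poly_add poly_mult Pi by (simp add: ac_simps)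
        then show ?thesis unfolding u 1 by simp
      next
        case 2
        then have "(\<Prod>i'\<in>I. x i - x i') = 0" using insert.hyps(1) by (intro prod_zero) auto
        then show ?thesis using q(2)[OF 2] unfolding poly_add poly_mult Pi by simp
      qed
    qed
  qed
  then obtain q where q: "\<And>l. card I \<le> l \<Longrightarrow> coeff q l = 0" "\<And>i. i \<in> I \<Longrightarrow> poly q (x i) = k i" by blast
  have "(\<Sum>l<card I. y ^ l * coeff q l) = poly q y" for y
  proof -
    have "poly q y = (\<Sum>l\<le>degree q. coeff q l * y ^ l)" by (rule poly_altdef)
    also have "\<dots> = (\<Sum>l<card I + Suc (degree q). coeff q l * y ^ l)"
      by (rule sum.mono_neutral_left) (auto simp: coeff_eq_0)
    also have "\<dots> = (\<Sum>l<card I. coeff q l * y ^ l)"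
      by (rule sum.mono_neutral_right) (auto simp: q(1))
    finally show ?thesis by (simp add: mult.commute)
  qed
  then show ?thesis using q(2) by (intro exI[of _ "coeff q"]) simp
qed

text \<open>After division by \<varpi> the coefficient \<open>d l\<close> appears as \<varpi>^(l-1)
  x^l. The pencil supplies \<open>f\<close> up to \<varpi>^(m-2), and the remaining values
  \<varpi>^(m-2) k i are matched by interpolation of degree below m. For m at most 2 that modulus is
  1, so the pencil can be replaced by 0.\<close>

lemma monic_coefficients:
  fixes x f :: "nat \<Rightarrow> 'p::prime_card padic_int"
  assumes m: "1 \<le> m" "m \<le> 4"
    and unit: "\<And>i j. i \<in> {1..m} \<Longrightarrow> j \<in> {1..m} \<Longrightarrow> i \<noteq> j \<Longrightarrow> x i - x j dvd 1"
    and f: "\<And>i. i \<in> {1..m} \<Longrightarrow> \<varpi> ^ (m - 2) dvd f i - (c0 + x i * c1 + \<varpi> * (x i)\<^sup>2 * c2)"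
  shows "\<exists>d. \<forall>i\<in>{1..m}. (\<varpi> * x i) ^ m * e + (\<Sum>l<m. (\<varpi> * x i) ^ l * d l) = \<varpi> * f i"
proof -
  have "\<exists>b :: nat \<Rightarrow> 'p padic_int. \<forall>i\<in>{1..m}. \<varpi> ^ (m - 2) dvd f i - (if m \<le> 2 then 0 else b 0 + x i * b 1 + \<varpi> * (x i)\<^sup>2 * b 2)"
  proof (cases "m \<le> 2")
    case False
    then show ?thesis
      using f by (intro exI[of _ "\<lambda>l. if l = 0 then c0 else if l = 1 then c1 else c2 :: 'p padic_int"]) simp
  qed simp
  then obtain b where b: "\<forall>i\<in>{1..m}. \<varpi> ^ (m - 2) dvd f i - (if m \<le> 2 then 0 else b 0 + x i * b 1 + \<varpi> * (x i)\<^sup>2 * b (2::nat))"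
    by blast
  then have "\<forall>i. \<exists>k. i \<in> {1..m} \<longrightarrow> f i - (if m \<le> 2 then 0 else b 0 + x i * b 1 + \<varpi> * (x i)\<^sup>2 * b 2) = \<varpi> ^ (m - 2) * k"
    by (auto simp: dvd_def)
  then obtain k where k: "\<And>i. i \<in> {1..m} \<Longrightarrow>
      f i - (if m \<le> 2 then 0 else b 0 + x i * b 1 + \<varpi> * (x i)\<^sup>2 * b 2) = \<varpi> ^ (m - 2) * k i" by metis
  \<comment> \<open>The leading term (\<varpi> x)^m e, divided by \<varpi> and by \<varpi>^(m-2),
    leaves \<varpi> x^m e. For m = 1 the subtraction m - 2 stops at 0 and the factor is 1
    instead.\<close>
  have "\<exists>d. \<forall>i\<in>{1..m}. (\<Sum>l<card {1..m}. x i ^ l * d l) = k i - (if m = 1 then 1 else \<varpi>) * x i ^ m * e"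
    by (rule poly_interpolation) (use unit in auto)
  then obtain d where "\<forall>i\<in>{1..m}. (\<Sum>l<card {1..m}. x i ^ l * d l) = k i - (if m = 1 then 1 else \<varpi>) * x i ^ m * e" ..
  then have d: "(\<Sum>l<m. x i ^ l * d l) = k i - (if m = 1 then 1 else \<varpi>) * x i ^ m * e" if "i \<in> {1..m}" for i
    using that by simp
  \<comment> \<open>The exponent makes (\<varpi> x)^l times the first summand equal to
    \<varpi>^(1+(m-2)) x^l d l for every l below m. Among the pencil coefficients only b 0 needs an
    extra \<varpi>; b 1 and b 2 receive theirs from the powers of \<varpi> x.\<close>
  define D where "D l = \<varpi> ^ (1 + (m - 2) - l) * d l
    + (if m \<le> 2 then 0 else if l = 0 then \<varpi> * b 0 else if l = 1 then b 1 else if l = 2 then b 2 else 0)" for l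
  have "(\<varpi> * x i) ^ m * e + (\<Sum>l<m. (\<varpi> * x i) ^ l * D l) = \<varpi> * f i" if i: "i \<in> {1..m}" for i
  proof -
    have fi: "f i = (if m \<le> 2 then 0 else b 0 + x i * b 1 + \<varpi> * (x i)\<^sup>2 * b 2)
      + \<varpi> ^ (m - 2) * ((\<Sum>l<m. x i ^ l * d l) + (if m = 1 then 1 else \<varpi>) * x i ^ m * e)"
      using k[OF i] d[OF i] by (simp add: algebra_simps)
    consider "m = 1" | "m = 2" | "m = 3" | "m = 4" using m by linarith
    then show ?thesis
      unfolding fi D_def
      by cases (simp_all add: numeral_eq_Suc algebra_simps power_mult_distrib)
  qed
  then show ?thesis by blast
qed

subsection \<open>Quadratic pencils with prescribed ranks\<close>

lemma prank_scalar:
  fixes c :: "'p::prime_card padic_int"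
  shows "prank k (c \<cdot>\<^sub>m 1\<^sub>m 1) = (if \<varpi> ^ k dvd c then 0 else 1)"
proof (cases "c = 0")
  case True
  have "prank k (mat_diag 1 (\<lambda>_. 0 :: 'p padic_int)) = 0"
    by (subst prank_mat_diag) (auto simp: p_power_def)
  moreover have "c \<cdot>\<^sub>m 1\<^sub>m 1 = mat_diag 1 (\<lambda>_. 0)" using True by (intro eq_matI) (auto simp: mat_diag_def)
  ultimately show ?thesis using True by simp
next
  case False
  obtain l u where u: "u dvd 1" "c = \<varpi> ^ l * u" by (rule padic_decompose[OF False])
  have eq: "c \<cdot>\<^sub>m 1\<^sub>m 1 = u \<cdot>\<^sub>m mat_diag 1 (\<lambda>_. \<varpi> ^ l)" unfolding u(2) by (intro eq_matI) (auto simp: mat_diag_def)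
  have "prank k (c \<cdot>\<^sub>m 1\<^sub>m 1) = prank k (mat_diag 1 (\<lambda>_. \<varpi> ^ l :: 'p padic_int))"
    unfolding eq by (rule prank_smult_unit[OF mat_diag_dim u(1)])
  also have "\<dots> = card {i :: nat. i < 1 \<and> \<not> k \<le> l}"
    by (subst prank_mat_diag) (auto simp: p_power_def)
  also have "\<dots> = (if k \<le> l then 0 else 1)" by simp
  also have "k \<le> l \<longleftrightarrow> \<varpi> ^ k dvd c"
  proof
    assume "k \<le> l"
    then show "\<varpi> ^ k dvd c" unfolding u(2) by (intro dvd_mult2) simp
  next
    assume "\<varpi> ^ k dvd c"
    obtain v where v: "u * v = 1" using u(1) by (metis dvdE)
    have "\<varpi> ^ k dvd c * v" by (rule dvd_mult2) fact
    also have "c * v = \<varpi> ^ l" unfolding u(2) using v by (simp add: mult.assoc)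
    finally show "k \<le> l" by simp
  qed
  finally show ?thesis .
qed

definition mat_two :: "'a::comm_ring_1 \<Rightarrow> 'a \<Rightarrow> 'a \<Rightarrow> 'a \<Rightarrow> 'a mat" where
  "mat_two a b c d = four_block_mat (a \<cdot>\<^sub>m 1\<^sub>m 1) (b \<cdot>\<^sub>m 1\<^sub>m 1) (c \<cdot>\<^sub>m 1\<^sub>m 1) (d \<cdot>\<^sub>m 1\<^sub>m 1)"

lemma mat_two_carrier [simp]: "mat_two a b c d \<in> carrier_mat 2 2"
  unfolding mat_two_def by (rule carrier_matI) simp_all

lemma dim_mat_two [simp]: "dim_row (mat_two a b c d) = 2" "dim_col (mat_two a b c d) = 2"
  by (simp_all add: mat_two_def)

lemma mat_two_add: "mat_two a b c d + mat_two a' b' c' d' = mat_two (a + a') (b + b') (c + c') (d + d')"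
  unfolding mat_two_def by (intro eq_matI) (auto simp: algebra_simps)

lemma mat_two_smult: "t \<cdot>\<^sub>m mat_two a b c d = mat_two (t * a) (t * b) (t * c) (t * d)"
  unfolding mat_two_def by (intro eq_matI) (auto simp: algebra_simps)

text \<open>Schur complement at the unit entry a. The scalar t stays outside the elimination, so
  that matrices divisible by \<varpi> are covered as well.\<close>

lemma prank_mat_two:
  fixes a :: "'p::prime_card padic_int"
  assumes a: "a * a' = 1"
  shows "prank k (t \<cdot>\<^sub>m mat_two a b c d) = prank k (t \<cdot>\<^sub>m 1\<^sub>m 1) + prank k ((t * (d - c * (a' * b))) \<cdot>\<^sub>m 1\<^sub>m 1)"
proof -
  have one: "(1\<^sub>m 1 :: 'p padic_int mat) * 1\<^sub>m 1 = 1\<^sub>m 1" by simp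
  have inv: "a \<cdot>\<^sub>m 1\<^sub>m 1 * (a' \<cdot>\<^sub>m 1\<^sub>m 1) = 1\<^sub>m 1" "a' \<cdot>\<^sub>m 1\<^sub>m 1 * (a \<cdot>\<^sub>m 1\<^sub>m 1) = 1\<^sub>m 1"
    using a by (simp_all add: mat_smult_distrib mult.commute) (auto intro!: eq_matI)
  have "equiv_mat (mat_two a b c d) (1\<^sub>m 1 \<oplus>\<^sub>m (d \<cdot>\<^sub>m 1\<^sub>m 1 - c \<cdot>\<^sub>m 1\<^sub>m 1 * (a' \<cdot>\<^sub>m 1\<^sub>m 1 * (b \<cdot>\<^sub>m 1\<^sub>m 1))))"
    unfolding mat_two_def by (rule equiv_mat_schur_complement[OF _ _ inv, where m=1 and n=1]) simp_all
  also have "d \<cdot>\<^sub>m 1\<^sub>m 1 - c \<cdot>\<^sub>m 1\<^sub>m 1 * (a' \<cdot>\<^sub>m 1\<^sub>m 1 * (b \<cdot>\<^sub>m 1\<^sub>m 1)) = (d - c * (a' * b)) \<cdot>\<^sub>m 1\<^sub>m 1"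
    by (simp add: mat_smult_distrib) (auto intro!: eq_matI)
  finally have "equiv_mat (t \<cdot>\<^sub>m mat_two a b c d) (t \<cdot>\<^sub>m (1\<^sub>m 1 \<oplus>\<^sub>m ((d - c * (a' * b)) \<cdot>\<^sub>m 1\<^sub>m 1)))"
    by (rule equiv_mat_smult)
  also have "t \<cdot>\<^sub>m (1\<^sub>m 1 \<oplus>\<^sub>m ((d - c * (a' * b)) \<cdot>\<^sub>m 1\<^sub>m 1)) = (t \<cdot>\<^sub>m 1\<^sub>m 1) \<oplus>\<^sub>m ((t * (d - c * (a' * b))) \<cdot>\<^sub>m 1\<^sub>m 1)"
    unfolding direct_sum_mat_smult by (simp add: mat_smult_distrib)
  finally have E: "equiv_mat (t \<cdot>\<^sub>m mat_two a b c d) ((t \<cdot>\<^sub>m 1\<^sub>m 1) \<oplus>\<^sub>m ((t * (d - c * (a' * b))) \<cdot>\<^sub>m 1\<^sub>m 1))" .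
  show ?thesis unfolding prank_equiv[OF E] by (rule prank_direct_sum[of _ 1 _ 1]) simp_all
qed

definition pencil_at :: "'a::comm_ring_1 \<Rightarrow> 'a \<Rightarrow> 'a mat \<Rightarrow> 'a mat \<Rightarrow> 'a mat \<Rightarrow> 'a mat" where
  "pencil_at q y C0 C1 C2 = C0 + y \<cdot>\<^sub>m C1 + (q * y\<^sup>2) \<cdot>\<^sub>m C2"

section \<open>Pencils of size one and two\<close>

locale unit_differences =
  fixes x :: "nat \<Rightarrow> 'p::prime_card padic_int" and I :: "nat set"
  assumes fin: "finite I" and unit: "\<And>i j. i \<in> I \<Longrightarrow> j \<in> I \<Longrightarrow> i \<noteq> j \<Longrightarrow> \<not> \<varpi> dvd x i - x j"
begin

text \<open>r and e stand for d_1 and d_2 as functions of the index: e is the growth of the rank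
  between the moduli \<varpi> and \<varpi>^2. In these terms direct sums of pencils simply
  add.\<close>

definition good :: "nat \<Rightarrow> (nat \<Rightarrow> nat) \<Rightarrow> (nat \<Rightarrow> nat) \<Rightarrow> bool" where
  "good N r e \<longleftrightarrow> (\<exists>C0\<in>carrier_mat N N. \<exists>C1\<in>carrier_mat N N. \<exists>C2\<in>carrier_mat N N.
     \<forall>i\<in>I. prank 1 (pencil_at \<varpi> (x i) C0 C1 C2) = r i \<and> prank 2 (pencil_at \<varpi> (x i) C0 C1 C2) = r i + e i)"

lemma good_cong:
  assumes "good N r e" "N = N'" "\<And>i. i \<in> I \<Longrightarrow> r i = r' i" "\<And>i. i \<in> I \<Longrightarrow> e i = e' i"
  shows "good N' r' e'"
  using assms unfolding good_def by simp

lemma good_zero: "good 0 (\<lambda>_. 0) (\<lambda>_. 0)"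
proof -
  have "prank k M = 0" if "M \<in> carrier_mat 0 0" for k and M :: "'p padic_int mat"
    using prank_le_dim[OF that] by simp
  then show ?thesis unfolding good_def pencil_at_def by (intro bexI[of _ "0\<^sub>m 0 0"]) auto
qed

lemma good_add:
  assumes "good N r e" "good M s f"
  shows "good (N + M) (\<lambda>i. r i + s i) (\<lambda>i. e i + f i)"
proof -
  obtain C0 C1 C2 where C: "C0 \<in> carrier_mat N N" "C1 \<in> carrier_mat N N" "C2 \<in> carrier_mat N N"
    "\<forall>i\<in>I. prank 1 (pencil_at \<varpi> (x i) C0 C1 C2) = r i \<and> prank 2 (pencil_at \<varpi> (x i) C0 C1 C2) = r i + e i"
    using assms(1) unfolding good_def by blast
  obtain D0 D1 D2 where D: "D0 \<in> carrier_mat M M" "D1 \<in> carrier_mat M M" "D2 \<in> carrier_mat M M"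
    "\<forall>i\<in>I. prank 1 (pencil_at \<varpi> (x i) D0 D1 D2) = s i \<and> prank 2 (pencil_at \<varpi> (x i) D0 D1 D2) = s i + f i"
    using assms(2) unfolding good_def by blast
  have dims: "pencil_at \<varpi> y C0 C1 C2 \<in> carrier_mat N N" "pencil_at \<varpi> y D0 D1 D2 \<in> carrier_mat M M" for y
    using C(1-3) D(1-3) unfolding pencil_at_def by auto
  have sum: "pencil_at \<varpi> y (C0 \<oplus>\<^sub>m D0) (C1 \<oplus>\<^sub>m D1) (C2 \<oplus>\<^sub>m D2) = pencil_at \<varpi> y C0 C1 C2 \<oplus>\<^sub>m pencil_at \<varpi> y D0 D1 D2" for y
    unfolding pencil_at_def direct_sum_mat_smult using C(1-3) D(1-3) by (simp add: direct_sum_mat_add)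
  show ?thesis
    unfolding good_def
  proof (rule bexI[of _ "C0 \<oplus>\<^sub>m D0"], rule bexI[of _ "C1 \<oplus>\<^sub>m D1"], rule bexI[of _ "C2 \<oplus>\<^sub>m D2"])
    show "\<forall>i\<in>I. prank 1 (pencil_at \<varpi> (x i) (C0 \<oplus>\<^sub>m D0) (C1 \<oplus>\<^sub>m D1) (C2 \<oplus>\<^sub>m D2)) = r i + s i \<and>
      prank 2 (pencil_at \<varpi> (x i) (C0 \<oplus>\<^sub>m D0) (C1 \<oplus>\<^sub>m D1) (C2 \<oplus>\<^sub>m D2)) = r i + s i + (e i + f i)"
      unfolding sum prank_direct_sum[OF dims] using C(4) D(4) by simp
  qed (use C D in auto)
qed

lemma good_scale: "good N r e \<Longrightarrow> good (c * N) (\<lambda>i. c * r i) (\<lambda>i. c * e i)"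
proof (induction c)
  case (Suc c)
  show ?case using good_add[OF Suc.prems Suc.IH[OF Suc.prems]] by simp
qed (simp add: good_zero)

lemma good_sum:
  assumes "finite K" "\<And>k. k \<in> K \<Longrightarrow> good (N k) (r k) (e k)"
  shows "good (\<Sum>k\<in>K. N k) (\<lambda>i. \<Sum>k\<in>K. r k i) (\<lambda>i. \<Sum>k\<in>K. e k i)"
  using assms
proof (induction K rule: finite_induct)
  case (insert k K)
  have "good (\<Sum>k\<in>K. N k) (\<lambda>i. \<Sum>k\<in>K. r k i) (\<lambda>i. \<Sum>k\<in>K. e k i)" using insert by auto
  from good_add[OF insert.prems[of k] this] insert.hyps show ?case by simp
qed (simp add: good_zero)

lemma good_scalar:
  assumes g: "\<And>i. i \<in> I \<Longrightarrow> g i = a + x i * b + \<varpi> * (x i)\<^sup>2 * c"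
  shows "good 1 (\<lambda>i. if \<varpi> dvd g i then 0 else 1) (\<lambda>i. if \<varpi> dvd g i \<and> \<not> \<varpi>\<^sup>2 dvd g i then 1 else 0)"
  unfolding good_def
proof (rule bexI[of _ "a \<cdot>\<^sub>m 1\<^sub>m 1"], rule bexI[of _ "b \<cdot>\<^sub>m 1\<^sub>m 1"], rule bexI[of _ "c \<cdot>\<^sub>m 1\<^sub>m 1"], rule ballI)
  fix i assume i: "i \<in> I"
  have eq: "pencil_at \<varpi> (x i) (a \<cdot>\<^sub>m 1\<^sub>m 1) (b \<cdot>\<^sub>m 1\<^sub>m 1) (c \<cdot>\<^sub>m 1\<^sub>m 1) = g i \<cdot>\<^sub>m 1\<^sub>m 1"
    unfolding pencil_at_def g[OF i] by (intro eq_matI) auto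
  have "\<varpi>\<^sup>2 dvd g i \<Longrightarrow> \<varpi> dvd g i" by (rule dvd_trans[of \<varpi> "\<varpi>\<^sup>2"]) simp_all
  then show "prank 1 (pencil_at \<varpi> (x i) (a \<cdot>\<^sub>m 1\<^sub>m 1) (b \<cdot>\<^sub>m 1\<^sub>m 1) (c \<cdot>\<^sub>m 1\<^sub>m 1)) = (if \<varpi> dvd g i then 0 else 1) \<and>
      prank 2 (pencil_at \<varpi> (x i) (a \<cdot>\<^sub>m 1\<^sub>m 1) (b \<cdot>\<^sub>m 1\<^sub>m 1) (c \<cdot>\<^sub>m 1\<^sub>m 1))
        = (if \<varpi> dvd g i then 0 else 1) + (if \<varpi> dvd g i \<and> \<not> \<varpi>\<^sup>2 dvd g i then 1 else 0)"
    unfolding eq prank_scalar by simp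
qed simp_all

lemma uniformizer_sq_dvd: "\<varpi>\<^sup>2 dvd \<varpi> * (y :: 'p padic_int) \<longleftrightarrow> \<varpi> dvd y"
  by (simp add: power2_eq_square)

lemma good_one: "good 1 (\<lambda>_. 1) (\<lambda>_. 0)"
  by (rule good_cong[OF good_scalar[of "\<lambda>_. 1" 1 0 0]]) simp_all

text \<open>The blocks are x - x j and x - x j + \<varpi>. Both are units at every other index; at j
  the first vanishes and the second equals \<varpi>.\<close>

lemma good_root:
  assumes j: "j \<in> I"
  shows "good 1 (\<lambda>i. if i = j then 0 else 1) (\<lambda>_. 0)"
    and "good 1 (\<lambda>i. if i = j then 0 else 1) (\<lambda>i. if i = j then 1 else 0)"
proof -
  have root: "\<varpi> dvd x i - x j \<longleftrightarrow> i = j" if "i \<in> I" for i using unit[OF that j] by auto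
  have root': "\<varpi> dvd x i - x j + \<varpi> \<longleftrightarrow> i = j" if "i \<in> I" for i
    unfolding root[OF that, symmetric] by (rule dvd_add_left_iff) simp
  have sq: "\<not> \<varpi>\<^sup>2 dvd (\<varpi> :: 'p padic_int)" using uniformizer_sq_dvd[of 1] by simp
  show "good 1 (\<lambda>i. if i = j then 0 else 1) (\<lambda>_. 0)"
    by (rule good_cong[OF good_scalar[of "\<lambda>i. x i - x j" "- x j" 1 0]]) (auto simp: root)
  show "good 1 (\<lambda>i. if i = j then 0 else 1) (\<lambda>i. if i = j then 1 else 0)"
    by (rule good_cong[OF good_scalar[of "\<lambda>i. x i - x j + \<varpi>" "- x j + \<varpi>" 1 0]])
      (auto simp: root root' sq)
qed

lemma prod_quadratic:
  fixes y :: "nat \<Rightarrow> 'a::comm_ring_1"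
  assumes "finite K" "card K \<le> 2"
  shows "\<exists>a b c. \<forall>t. (\<Prod>k\<in>K. t - y k) = a + t * b + t\<^sup>2 * c"
proof -
  consider "card K = 0" | "card K = 1" | "card K = 2" using assms(2) by linarith
  then show ?thesis
  proof cases
    case 1
    then show ?thesis using assms(1) by (intro exI[of _ 1] exI[of _ 0]) (simp add: card_eq_0_iff)
  next
    case 2
    then obtain k where "K = {k}" by (rule card_1_singletonE)
    then show ?thesis by - (rule exI[of _ "- y k"], rule exI[of _ 1], rule exI[of _ 0], simp)
  next
    case 3
    then obtain k l where "K = {k, l}" "k \<noteq> l" by (auto simp: card_2_iff)
    then show ?thesis
      by - (rule exI[of _ "y k * y l"], rule exI[of _ "- y k - y l"], rule exI[of _ 1],
        simp add: algebra_simps power2_eq_square)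
  qed
qed

lemma uniformizer_dvd_prod_iff:
  assumes "i \<in> I" "K \<subseteq> I"
  shows "\<varpi> dvd (\<Prod>k\<in>K. x i - x k) \<longleftrightarrow> i \<in> K"
proof -
  have "finite K" using fin assms(2) by (rule rev_finite_subset)
  then have "\<varpi> dvd (\<Prod>k\<in>K. x i - x k) \<longleftrightarrow> (\<exists>k\<in>K. \<varpi> dvd x i - x k)"
    by (induction K rule: finite_induct) (auto simp: uniformizer_dvd_mult_iff)
  also have "\<dots> \<longleftrightarrow> i \<in> K" using unit assms by (auto intro: bexI[of _ i])
  finally show ?thesis .
qed

text \<open>The block is \<varpi> times the product of x - x k over the indices k outside
  \<open>S\<close>. The factor \<varpi> makes a quadratic coefficient admissible, but the degree may
  not exceed 2, which limits the number of indices outside \<open>S\<close>.\<close>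

lemma good_indicator:
  assumes S: "S \<subseteq> I" "S = {} \<or> card (I - S) \<le> 2"
  shows "good 1 (\<lambda>_. 0) (\<lambda>i. if i \<in> S then 1 else 0)"
proof (cases "S = {}")
  case True
  show ?thesis by (rule good_cong[OF good_scalar[of "\<lambda>_. 0" 0 0 0]]) (simp_all add: True)
next
  case False
  obtain a b c where abc: "\<And>t. (\<Prod>k\<in>I - S. t - x k) = a + t * b + t\<^sup>2 * c"
    using prod_quadratic[of "I - S" x] S(2) False fin by auto
  have "\<varpi> dvd (\<Prod>k\<in>I - S. x i - x k) \<longleftrightarrow> i \<notin> S" if "i \<in> I" for i
    using uniformizer_dvd_prod_iff[of i "I - S"] that by auto
  note mem = this
  define P where "P i = (\<Prod>k\<in>I - S. x i - x k)" for i
  have "good 1 (\<lambda>i. if \<varpi> dvd \<varpi> * P i then 0 else 1) (\<lambda>i. if \<varpi> dvd \<varpi> * P i \<and> \<not> \<varpi>\<^sup>2 dvd \<varpi> * P i then 1 else 0)"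
    by (rule good_scalar[of _ "\<varpi> * a" "\<varpi> * b" c]) (simp add: P_def abc algebra_simps)
  then show ?thesis
    by (rule good_cong) (simp_all add: uniformizer_sq_dvd mem[folded P_def])
qed

text \<open>At j the matrix is \<varpi> times an invertible one. Elsewhere the unit in the corner
  leaves a Schur complement divisible by \<varpi>^2. So two units of e fall on one index, which
  scalar blocks sharing that index could not always provide.\<close>

lemma good_double_root:
  assumes j: "j \<in> I"
  shows "good 2 (\<lambda>i. if i = j then 0 else 1) (\<lambda>i. if i = j then 2 else 0)"
  unfolding good_def
proof (rule bexI[of _ "mat_two (- x j + \<varpi>) \<varpi> \<varpi> 0"], rule bexI[of _ "mat_two 1 0 0 0"], rule bexI[of _ "mat_two 0 0 0 0"], rule ballI)
  fix i assume i: "i \<in> I"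
  have eq: "pencil_at \<varpi> (x i) (mat_two (- x j + \<varpi>) \<varpi> \<varpi> 0) (mat_two 1 0 0 0) (mat_two 0 0 0 0)
      = mat_two (x i - x j + \<varpi>) \<varpi> \<varpi> 0"
    unfolding pencil_at_def mat_two_smult mat_two_add by (simp add: algebra_simps)
  have sq: "\<not> \<varpi>\<^sup>2 dvd (\<varpi> :: 'p padic_int)" using uniformizer_sq_dvd[of 1] by simp
  show "prank 1 (pencil_at \<varpi> (x i) (mat_two (- x j + \<varpi>) \<varpi> \<varpi> 0) (mat_two 1 0 0 0) (mat_two 0 0 0 0)) = (if i = j then 0 else 1) \<and>
    prank 2 (pencil_at \<varpi> (x i) (mat_two (- x j + \<varpi>) \<varpi> \<varpi> 0) (mat_two 1 0 0 0) (mat_two 0 0 0 0))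
      = (if i = j then 0 else 1) + (if i = j then 2 else 0)"
  proof (cases "i = j")
    case True
    have "mat_two (x i - x j + \<varpi>) \<varpi> \<varpi> 0 = \<varpi> \<cdot>\<^sub>m mat_two 1 1 1 0" unfolding mat_two_smult True by simp
    then show ?thesis
      unfolding eq using prank_mat_two[of "1 :: 'p padic_int" 1 _ \<varpi> 1 1 0] sq
      by (simp add: prank_scalar True del: One_nat_def)
  next
    case False
    have "\<not> \<varpi> dvd x i - x j + \<varpi>" using unit[OF i j False] by (simp add: dvd_add_left_iff)
    then obtain a' where a': "(x i - x j + \<varpi>) * a' = 1" by (metis dvdE padic_unit_iff)
    have "\<varpi>\<^sup>2 dvd \<varpi> * (a' * \<varpi>)" "\<varpi> dvd \<varpi> * (a' * \<varpi>)"
      by (simp_all add: power2_eq_square mult.commute mult.left_commute)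
    then show ?thesis
      unfolding eq using prank_mat_two[OF a', of _ 1 \<varpi> \<varpi> 0] sq False uniformizer_power_dvd_power_iff[of 2 0, where 'p='p]
      by (simp add: prank_scalar mat_two_smult del: One_nat_def)
  qed
qed simp_all

text \<open>To be nonzero modulo \<varpi>^2 at a single index, \<varpi> times a polynomial needs
  three roots, beyond the degree of a scalar pencil. With entries 1 and x in the first row and
  \<varpi> x^2 below the unit, elimination contributes - \<varpi> x^3, so the Schur complement may
  be cubic.\<close>

lemma good_cubic:
  assumes j: "j \<in> I" and card: "card I = 4"
  shows "good 2 (\<lambda>_. 1) (\<lambda>i. if i = j then 1 else 0)"
proof -
  have "card (I - {j}) = 3" using fin j card by simp
  then have "I - {j} \<noteq> {}" by force
  then obtain k where k: "k \<in> I - {j}" by blast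
  have "card (I - {j} - {k}) = 2" using fin k \<open>card (I - {j}) = 3\<close> by simp
  then obtain l n where ln: "I - {j} - {k} = {l, n}" "l \<noteq> n" unfolding card_2_iff by blast
  have prod: "(\<Prod>l\<in>I - {j}. t - x l) = (t - x k) * ((t - x l) * (t - x n))" for t
    using prod.remove[of "I - {j}" k "\<lambda>l. t - x l"] fin k ln by simp
  \<comment> \<open>The coefficients of minus the monic cubic with roots at the other three nodes,
    apart from the leading one, which the elimination supplies.\<close>
  define c0 c1 c2 where "c0 = x k * (x l * x n)" and "c1 = - (x k * x l) - x k * x n - x l * x n" and "c2 = x k + x l + x n"
  have cubic: "c0 + t * c1 + t\<^sup>2 * c2 - t ^ 3 = - (\<Prod>l\<in>I - {j}. t - x l)" for t
    unfolding prod c0_def c1_def c2_def by (simp add: algebra_simps power2_eq_square power3_eq_cube)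
  show ?thesis
    unfolding good_def
  proof (rule bexI[of _ "mat_two 1 0 0 (\<varpi> * c0)"], rule bexI[of _ "mat_two 0 1 0 (\<varpi> * c1)"],
      rule bexI[of _ "mat_two 0 0 1 c2"], rule ballI)
    fix i assume i: "i \<in> I"
    have eq: "pencil_at \<varpi> (x i) (mat_two 1 0 0 (\<varpi> * c0)) (mat_two 0 1 0 (\<varpi> * c1)) (mat_two 0 0 1 c2)
        = 1 \<cdot>\<^sub>m mat_two 1 (x i) (\<varpi> * (x i)\<^sup>2) (\<varpi> * (c0 + x i * c1 + (x i)\<^sup>2 * c2))"
      unfolding pencil_at_def mat_two_smult mat_two_add by (simp add: algebra_simps)
    have schur: "1 * (\<varpi> * (c0 + x i * c1 + (x i)\<^sup>2 * c2) - \<varpi> * (x i)\<^sup>2 * (1 * x i)) = \<varpi> * - (\<Prod>l\<in>I - {j}. x i - x l)"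
      unfolding cubic[symmetric] by (simp add: algebra_simps power2_eq_square power3_eq_cube)
    have "\<varpi> dvd - (\<Prod>l\<in>I - {j}. x i - x l) \<longleftrightarrow> i \<noteq> j"
      using uniformizer_dvd_prod_iff[OF i, of "I - {j}"] i by auto
    then show "prank 1 (pencil_at \<varpi> (x i) (mat_two 1 0 0 (\<varpi> * c0)) (mat_two 0 1 0 (\<varpi> * c1)) (mat_two 0 0 1 c2)) = 1 \<and>
      prank 2 (pencil_at \<varpi> (x i) (mat_two 1 0 0 (\<varpi> * c0)) (mat_two 0 1 0 (\<varpi> * c1)) (mat_two 0 0 1 c2)) = 1 + (if i = j then 1 else 0)"
      unfolding eq prank_mat_two[of 1 1, OF mult_1] schur prank_scalar uniformizer_sq_dvd
      using uniformizer_power_dvd_power_iff[of 2 0, where 'p='p] by simp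
  qed simp_all
qed

section \<open>Combining the blocks\<close>

lemma sum_if_neq:
  fixes b :: "nat \<Rightarrow> nat"
  assumes "i \<in> I"
  shows "(\<Sum>k\<in>I. if i = k then 0 else b k) + b i = (\<Sum>k\<in>I. b k)"
proof -
  have "(\<Sum>k\<in>I. if i = k then 0 else b k) + (\<Sum>k\<in>I. if i = k then b k else 0) = (\<Sum>k\<in>I. b k)"
    unfolding sum.distrib[symmetric] by (rule sum.cong) auto
  then show ?thesis using fin assms by simp
qed

text \<open>Uses a constant blocks and, for each k, \<open>b k\<close> blocks with a root at k,
  \<open>f k\<close> of which are shifted by \<varpi>. Index i loses rank only in its own
  \<open>b i\<close> blocks.\<close>

lemma good_linear:
  assumes f: "\<And>k. k \<in> I \<Longrightarrow> f k \<le> b k"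
  shows "good (a + (\<Sum>k\<in>I. b k)) (\<lambda>i. a + (\<Sum>k\<in>I. b k) - b i) f"
proof -
  have "good (\<Sum>k\<in>I. (b k - f k) * 1 + f k * 1)
    (\<lambda>i. \<Sum>k\<in>I. (b k - f k) * (if i = k then 0 else 1) + f k * (if i = k then 0 else 1))
    (\<lambda>i. \<Sum>k\<in>I. (b k - f k) * 0 + f k * (if i = k then 1 else 0))"
    by (rule good_sum[OF fin], intro good_add good_scale good_root)
  from good_add[OF good_scale[OF good_one, of a] this]
  show ?thesis
  proof (rule good_cong)
    show "a * 1 + (\<Sum>k\<in>I. (b k - f k) * 1 + f k * 1) = a + (\<Sum>k\<in>I. b k)" using f by simp
    fix i assume i: "i \<in> I"
    have "(\<Sum>k\<in>I. (b k - f k) * (if i = k then 0 else 1) + f k * (if i = k then 0 else 1)) = (\<Sum>k\<in>I. if i = k then 0 else b k)"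
      by (rule sum.cong) (use f in auto)
    then show "a * 1 + (\<Sum>k\<in>I. (b k - f k) * (if i = k then 0 else 1) + f k * (if i = k then 0 else 1)) = a + (\<Sum>k\<in>I. b k) - b i"
      using sum_if_neq[OF i, of b] by simp
    have "(\<Sum>k\<in>I. (b k - f k) * 0 + f k * (if i = k then 1 else 0)) = (\<Sum>k\<in>I. if i = k then f k else 0)"
      by (rule sum.cong) auto
    then show "a * 0 + (\<Sum>k\<in>I. (b k - f k) * 0 + f k * (if i = k then 1 else 0)) = f i"
      using fin i by simp
  qed
qed

text \<open>A greedy filling of M scalar blocks. Each block is zero or serves a set \<open>S\<close>
  of at least two indices, so that with at most four nodes at most two are left outside. The two
  invariants are that no demand exceeds the number of blocks left and that no demand exceeds the sum
  of the others.\<close>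

lemma good_slots:
  assumes "card I \<le> 4" "\<And>j. j \<in> I \<Longrightarrow> e j \<le> M" "\<And>j. j \<in> I \<Longrightarrow> 2 * e j \<le> (\<Sum>k\<in>I. e k)"
  shows "good M (\<lambda>_. 0) e"
  using assms(2,3)
proof (induction M arbitrary: e)
  case 0
  then show ?case using good_cong[OF good_zero] by simp
next
  case (Suc M)
  \<comment> \<open>These indices need all \<open>Suc M\<close> blocks, so the block chosen now has
    to serve every one of them.\<close>
  define S0 where "S0 = {j \<in> I. e j = Suc M}"
  have S0: "S0 \<subseteq> I" "finite S0" unfolding S0_def using fin by auto
  have "\<exists>S. S \<subseteq> I \<and> (S = {} \<or> 2 \<le> card S) \<and> S0 \<subseteq> S \<and> (\<forall>j\<in>S. 1 \<le> e j) \<and>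
      (\<forall>j\<in>I. 2 * (e j - (if j \<in> S then 1 else 0)) + card S \<le> (\<Sum>k\<in>I. e k))"
  proof -
    have "S0 = {} \<or> 2 \<le> card S0 \<or> (\<exists>j. S0 = {j})"
    proof (cases "card S0 = 1")
      case False
      then show ?thesis using card_0_eq[OF S0(2)] by linarith
    qed (simp add: card_1_singleton_iff)
    then consider "S0 = {}" | "2 \<le> card S0" | j where "S0 = {j}" by blast
    then show ?thesis
    proof cases
      case 1
      then show ?thesis using Suc.prems by (intro exI[of _ "{}"]) simp
    next
      case 2
      have split: "(\<Sum>k\<in>I. e k) = card S0 * Suc M + (\<Sum>k\<in>I - S0. e k)"
        using sum.subset_diff[OF S0(1) fin, of e] by (simp add: S0_def)
      have cM: "2 * M \<le> card S0 * M" using 2 by (rule mult_le_mono1)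
      show ?thesis
      proof (intro exI[of _ S0] conjI ballI)
        fix j assume j: "j \<in> I"
        show "2 * (e j - (if j \<in> S0 then 1 else 0)) + card S0 \<le> (\<Sum>k\<in>I. e k)"
        proof (cases "j \<in> S0")
          case True
          then have e2: "2 * (e j - (if j \<in> S0 then 1 else 0)) = 2 * M" by (simp add: S0_def)
          show ?thesis unfolding split e2 mult_Suc_right using cM by linarith
        next
          case False
          have "e j \<le> (\<Sum>k\<in>I - S0. e k)" using j False fin by (intro member_le_sum) auto
          moreover have "e j \<le> M" using Suc.prems(1)[OF j] False j unfolding S0_def by auto
          moreover have e2: "2 * (e j - (if j \<in> S0 then 1 else 0)) = 2 * e j" using False by simp
          ultimately show ?thesis unfolding split e2 mult_Suc_right using cM by linarith
        qed
      qed (use 2 S0 in \<open>auto simp: S0_def\<close>)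
    next
      case 3
      \<comment> \<open>A lone saturated index needs a partner. Choosing one of largest demand among
        the rest preserves the second invariant for the indices not served.\<close>
      have j: "j \<in> I" "e j = Suc M" using 3 unfolding S0_def by auto
      have le: "e k \<le> M" if "k \<in> I - {j}" for k
      proof -
        have "k \<notin> S0" using that 3 by simp
        then have "e k \<noteq> Suc M" using that by (simp add: S0_def)
        then show ?thesis using Suc.prems(1)[of k] that by simp
      qed
      have split: "(\<Sum>k\<in>I. e k) = Suc M + (\<Sum>k\<in>I - {j}. e k)" using sum.remove[OF fin j(1), of e] j(2) by simp
      have pos: "Suc M \<le> (\<Sum>k\<in>I - {j}. e k)" using Suc.prems(2)[OF j(1)] unfolding split j(2) by simp
      then have ne: "I - {j} \<noteq> {}" by (metis not_less_eq_eq sum.empty zero_le)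
      have "finite (e ` (I - {j}))" "e ` (I - {j}) \<noteq> {}" using fin ne by auto
      then have "Max (e ` (I - {j})) \<in> e ` (I - {j})" by (rule Max_in)
      then obtain k where kM: "Max (e ` (I - {j})) = e k" and k: "k \<in> I - {j}" by (rule imageE)
      have kmax: "e l \<le> e k" if "l \<in> I - {j}" for l unfolding kM[symmetric] using fin that by simp
      have split2: "(\<Sum>l\<in>I. e l) = Suc M + (e k + (\<Sum>l\<in>I - {j} - {k}. e l))"
        unfolding split using sum.remove[OF _ k, of e] fin by simp
      have k1: "1 \<le> e k"
      proof (rule ccontr)
        assume "\<not> 1 \<le> e k"
        then have "e l = 0" if "l \<in> I - {j}" for l using kmax[OF that] by simp
        then have "(\<Sum>k\<in>I - {j}. e k) = 0" by (intro sum.neutral) blast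
        then show False using pos by simp
      qed
      show ?thesis
      proof (intro exI[of _ "{j, k}"] conjI ballI)
        show "{j, k} = {} \<or> 2 \<le> card {j, k}" using k by simp
        fix l assume l: "l \<in> I"
        show "2 * (e l - (if l \<in> {j, k} then 1 else 0)) + card {j, k} \<le> (\<Sum>k\<in>I. e k)"
        proof (cases "l \<in> {j, k}")
          case True
          have "1 \<le> e l" using True k1 j(2) by auto
          then show ?thesis using Suc.prems(2)[OF l] True k by simp
        next
          case False
          have "e l \<le> (\<Sum>l\<in>I - {j} - {k}. e l)" using l False fin by (intro member_le_sum) auto
          moreover have "e l \<le> e k" using kmax[of l] l False by simp
          moreover have "e k \<le> M" by (rule le[OF k])
          ultimately show ?thesis unfolding split2 using False k1 k by simp
        qed
      qed (use 3 j k k1 in auto)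
    qed
  qed
  then obtain S where S: "S \<subseteq> I" "S = {} \<or> 2 \<le> card S" "S0 \<subseteq> S" "\<And>j. j \<in> S \<Longrightarrow> 1 \<le> e j"
      "\<And>j. j \<in> I \<Longrightarrow> 2 * (e j - (if j \<in> S then 1 else 0)) + card S \<le> (\<Sum>k\<in>I. e k)" by blast
  define e' where "e' j = e j - (if j \<in> S then 1 else 0)" for j
  have e': "e j = (if j \<in> S then 1 else 0) + e' j" for j unfolding e'_def using S(4)[of j] by simp
  have "(\<Sum>k\<in>I. e k) = (\<Sum>k\<in>I. if k \<in> S then 1 else 0) + (\<Sum>k\<in>I. e' k)"
    unfolding e' sum.distrib by simp
  also have "(\<Sum>k\<in>I. if k \<in> S then 1 else 0) = card S"
    using fin S(1) by (simp add: sum.If_cases Int_absorb1)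
  finally have sum: "(\<Sum>k\<in>I. e k) = card S + (\<Sum>k\<in>I. e' k)" .
  have "good M (\<lambda>_. 0) e'"
  proof (rule Suc.IH)
    fix j assume j: "j \<in> I"
    show "e' j \<le> M" using Suc.prems(1)[OF j] S(3) j unfolding e'_def S0_def by (cases "e j = Suc M") auto
    show "2 * e' j \<le> (\<Sum>k\<in>I. e' k)" using S(5)[OF j] unfolding sum e'_def[of j, symmetric] by simp
  qed
  moreover have "card (I - S) \<le> 2" if "S \<noteq> {}"
    using S(1,2) that assms(1) card_Diff_subset[of S I] fin rev_finite_subset[OF fin S(1)] by simp
  ultimately have "good (1 + M) (\<lambda>_. 0 + 0) (\<lambda>i. (if i \<in> S then 1 else 0) + e' i)"
    using good_add[OF good_indicator[OF S(1)]] by blast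
  then show ?case by (rule good_cong) (simp_all add: e'[symmetric])
qed

text \<open>Discrete intermediate values: starting at \<open>lo\<close>, one coordinate below its
  upper bound is raised by 1 at a time.\<close>

lemma sum_between:
  fixes lo hi :: "'i \<Rightarrow> nat"
  assumes "finite K" "\<And>k. k \<in> K \<Longrightarrow> lo k \<le> hi k" "sum lo K \<le> s" "s \<le> sum hi K"
  shows "\<exists>e. (\<forall>k\<in>K. lo k \<le> e k \<and> e k \<le> hi k) \<and> sum e K = s"
  using assms(3,4)
proof (induction s rule: dec_induct)
  case base
  then show ?case using assms(2) by (intro exI[of _ lo]) simp
next
  case (step s)
  obtain e where e: "\<forall>k\<in>K. lo k \<le> e k \<and> e k \<le> hi k" "sum e K = s" using step by auto
  have "\<exists>k\<in>K. e k < hi k"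
  proof (rule ccontr)
    assume "\<not> (\<exists>k\<in>K. e k < hi k)"
    then have "sum hi K \<le> sum e K" by (intro sum_mono) (simp add: not_less)
    then show False using e(2) step by simp
  qed
  then obtain k where k: "k \<in> K" "e k < hi k" by blast
  have "sum (e(k := Suc (e k))) K = Suc s"
    using sum.remove[OF assms(1) k(1), of e] sum.remove[OF assms(1) k(1), of "e(k := Suc (e k))"] e(2) by simp
  then show ?case using e(1) k by (intro exI[of _ "e(k := Suc (e k))"]) auto
qed

text \<open>T is the largest rank. Index k gets T - r k blocks with a root there, and a = \<Sum> r -
  c T constant blocks bring the total size to T. The hypothesis at the maximum says exactly that a
  is not negative; with c one less than the number of nodes, this is the origin of the coefficients
  2 and 3.\<close>

lemma max_rank_decomposition:
  assumes card: "card I = Suc c" and r: "\<And>i. i \<in> I \<Longrightarrow> c * r i \<le> (\<Sum>k\<in>I. r k)"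
  obtains T a i0 where "i0 \<in> I" "r i0 = T" "\<And>i. i \<in> I \<Longrightarrow> r i \<le> T" "a + (\<Sum>k\<in>I. T - r k) = T"
    "a + c * T = (\<Sum>k\<in>I. r k)"
proof -
  have "finite (r ` I)" "r ` I \<noteq> {}" using fin card by auto
  then have "Max (r ` I) \<in> r ` I" by (rule Max_in)
  then obtain i0 where i0M: "Max (r ` I) = r i0" and i0: "i0 \<in> I" by (rule imageE)
  have max: "r i \<le> r i0" if "i \<in> I" for i unfolding i0M[symmetric] using fin that by simp
  have "(\<Sum>k\<in>I. r i0 - r k) + (\<Sum>k\<in>I. r k) = (\<Sum>k\<in>I. r i0)"
    unfolding sum.distrib[symmetric] by (rule sum.cong) (use max in auto)
  then have total: "(\<Sum>k\<in>I. r i0 - r k) + (\<Sum>k\<in>I. r k) = r i0 + c * r i0" using card by simp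
  show ?thesis
  proof (rule that[OF i0 refl max])
    show "((\<Sum>k\<in>I. r k) - c * r i0) + (\<Sum>k\<in>I. r i0 - r k) = r i0" using total r[OF i0] by simp
    show "((\<Sum>k\<in>I. r k) - c * r i0) + c * r i0 = (\<Sum>k\<in>I. r k)" using r[OF i0] by simp
  qed
qed

text \<open>Blocks of total size T produce r; the remaining N - T places are filled by
  \<open>good_slots\<close> with zero demand.\<close>

lemma good_three:
  assumes card: "card I = 3" and N: "\<And>i. i \<in> I \<Longrightarrow> r i \<le> N"
    and r: "\<And>i. i \<in> I \<Longrightarrow> 2 * r i \<le> (\<Sum>k\<in>I. r k)"
  shows "good N r (\<lambda>_. 0)"
proof -
  obtain T a i0 where T: "i0 \<in> I" "r i0 = T" "\<And>i. i \<in> I \<Longrightarrow> r i \<le> T" "a + (\<Sum>k\<in>I. T - r k) = T"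
    by (rule max_rank_decomposition[of 2 r]) (use card r in auto)
  have "good (N - T) (\<lambda>_. 0) (\<lambda>_. 0)" by (rule good_slots) (use card in simp_all)
  from good_add[OF good_linear[of "\<lambda>_. 0" "\<lambda>k. T - r k" a] this]
  show ?thesis
    by (rule good_cong) (use T N[OF T(1)] in simp_all)
qed

text \<open>At \<open>j\<close>, the \<open>b j\<close> root blocks and \<open>M\<close> scalar blocks shared with other indices contribute to
  \<open>e j\<close>. If \<open>e j\<close> is too large to find partners, the remaining \<open>y\<close> units are attached to \<open>y1\<close> unit
  blocks by \<open>good_cubic\<close> and to \<open>y2\<close> root blocks by \<open>good_double_root\<close>.\<close>

lemma good_four:
  assumes card: "card I = 4" and N: "\<And>i. i \<in> I \<Longrightarrow> r i + e i \<le> N"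
    and r: "\<And>i. i \<in> I \<Longrightarrow> 3 * r i \<le> (\<Sum>k\<in>I. r k)"
    and re: "\<And>i j. i \<in> I \<Longrightarrow> j \<in> I \<Longrightarrow> r i + 2 * (r j + e j) \<le> (\<Sum>k\<in>I. r k) + (\<Sum>k\<in>I. e k)"
  shows "good N r e"
proof -
  obtain T a i0 where T: "i0 \<in> I" "r i0 = T" "\<And>i. i \<in> I \<Longrightarrow> r i \<le> T" "a + (\<Sum>k\<in>I. T - r k) = T"
      "a + 3 * T = (\<Sum>k\<in>I. r k)"
    by (rule max_rank_decomposition[of 3 r]) (use card r in auto)
  define b where "b k = T - r k" for k
  define M where "M = N - T"
  have TN: "T \<le> N" using N[OF T(1)] T(2) by simp
  have br: "b k + r k = T" if "k \<in> I" for k unfolding b_def using T(3)[OF that] by simp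
  have ab: "a + (\<Sum>k\<in>I. b k) = T" using T(4) unfolding b_def .
  have eM: "e k \<le> M + b k" if "k \<in> I" for k using N[OF that] br[OF that] TN unfolding M_def by simp
  show ?thesis
  proof (cases "\<forall>j\<in>I. e j - b j \<le> (\<Sum>k\<in>I - {j}. e k)")
    case True
    \<comment> \<open>\<open>e'\<close> is the share of e given to the M scalar blocks. The root
      blocks can take at most b, which is the lower bound, and the last two conditions are those of
      \<open>good_slots\<close>.\<close>
    have "\<exists>e'. (\<forall>k\<in>I. e k - b k \<le> e' k \<and> e' k \<le> e k \<and> e' k \<le> M \<and> 2 * e' k \<le> (\<Sum>k\<in>I. e' k))"
    proof (cases "\<forall>j\<in>I. 2 * (e j - b j) \<le> (\<Sum>k\<in>I. e k - b k)")
      case True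
      then show ?thesis using eM by (intro exI[of _ "\<lambda>k. e k - b k"]) (auto simp: le_diff_conv)
    next
      case False
      then obtain j where j: "j \<in> I" "(\<Sum>k\<in>I. e k - b k) < 2 * (e j - b j)" by (auto simp: not_le)
      have "(\<Sum>k\<in>I - {j}. e k - b k) \<le> e j - b j" using j sum.remove[OF fin j(1), of "\<lambda>k. e k - b k"] by simp
      \<comment> \<open>The demand at j is too large for the bare excesses. The shares of the others
        are raised within their e until they total the excess at j, which the case assumption
        allows.\<close>
      then obtain g where g: "\<forall>k\<in>I - {j}. e k - b k \<le> g k \<and> g k \<le> e k" "sum g (I - {j}) = e j - b j"
        using sum_between[of "I - {j}" "\<lambda>k. e k - b k" e "e j - b j"] True j(1) fin by auto
      define e' where "e' = g(j := e j - b j)"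
      have "(\<Sum>k\<in>I - {j}. e' k) = e j - b j" unfolding g(2)[symmetric] e'_def by (rule sum.cong) auto
      then have sum: "(\<Sum>k\<in>I. e' k) = 2 * (e j - b j)" using sum.remove[OF fin j(1), of e'] by (simp add: e'_def)
      have gj: "g k \<le> e j - b j" if "k \<in> I - {j}" for k
        unfolding g(2)[symmetric] using fin that by (intro member_le_sum) auto
      then have gM: "g k \<le> M" if "k \<in> I - {j}" for k using that eM[OF j(1)] by force
      show ?thesis
      proof (intro exI[of _ e'] ballI)
        fix k assume k: "k \<in> I"
        show "e k - b k \<le> e' k \<and> e' k \<le> e k \<and> e' k \<le> M \<and> 2 * e' k \<le> (\<Sum>k\<in>I. e' k)"
        proof (cases "k = j")
          case True
          then show ?thesis using eM[OF j(1)] unfolding sum by (simp add: e'_def le_diff_conv)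
        next
          case False
          then have kj: "k \<in> I - {j}" using k by simp
          have "e' k = g k" using False by (simp add: e'_def)
          moreover have "e k - b k \<le> g k \<and> g k \<le> e k" using g(1) kj by blast
          ultimately show ?thesis using gM[OF kj] gj[OF kj] unfolding sum by simp
        qed
      qed
    qed
    then obtain e' where e': "\<And>k. k \<in> I \<Longrightarrow> e k - b k \<le> e' k" "\<And>k. k \<in> I \<Longrightarrow> e' k \<le> e k"
      "\<And>k. k \<in> I \<Longrightarrow> e' k \<le> M" "\<And>k. k \<in> I \<Longrightarrow> 2 * e' k \<le> (\<Sum>k\<in>I. e' k)" by blast
    have "good M (\<lambda>_. 0) e'" by (rule good_slots) (use card e' in simp_all)
    moreover have "good (a + (\<Sum>k\<in>I. b k)) (\<lambda>i. a + (\<Sum>k\<in>I. b k) - b i) (\<lambda>k. e k - e' k)"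
      by (rule good_linear) (use e'(1) in \<open>simp add: le_diff_conv add.commute\<close>)
    ultimately have "good (a + (\<Sum>k\<in>I. b k) + M) (\<lambda>i. a + (\<Sum>k\<in>I. b k) - b i + 0) (\<lambda>k. e k - e' k + e' k)"
      using good_add by blast
    then show ?thesis
    proof (rule good_cong)
      show "a + (\<Sum>k\<in>I. b k) + M = N" using TN by (simp add: ab M_def)
      fix i assume i: "i \<in> I"
      show "a + (\<Sum>k\<in>I. b k) - b i + 0 = r i" unfolding ab br[OF i, symmetric] by simp
      show "e i - e' i + e' i = e i" using e'(2)[OF i] by simp
    qed
  next
    case False
    then obtain j where j: "j \<in> I" "(\<Sum>k\<in>I - {j}. e k) < e j - b j" by (auto simp: not_le)
    define s where "s = (\<Sum>k\<in>I - {j}. e k)"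
    have sum_e: "(\<Sum>k\<in>I. e k) = e j + s" unfolding s_def by (rule sum.remove[OF fin j(1)])
    define y where "y = e j - b j - s"
    have y: "e j = b j + s + y" using j(2) unfolding y_def s_def by simp
    \<comment> \<open>The mixed inequality, taken at the index \<open>i0\<close> of largest rank,
      becomes the bound of y by the number of constant blocks plus root blocks at j.\<close>
    have "T + 2 * (r j + e j) \<le> (a + 3 * T) + (e j + s)" using re[OF T(1) j(1)] unfolding T(2,5) sum_e .
    then have "y \<le> a + b j" using y br[OF j(1)] by simp
    then have "min y a + (y - min y a) = y" "y - min y a \<le> b j" by (auto simp: min_def)
    then obtain y1 y2 where y12: "y = y1 + y2" "y1 \<le> a" "y2 \<le> b j" by (metis min.cobounded2)
    have syM: "s + y \<le> M" using eM[OF j(1)] y by simp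
    \<comment> \<open>The y2 root blocks at j that are replaced by \<open>good_double_root\<close>
      leave the linear part. Each replacement, like each use of \<open>good_cubic\<close>, enlarges
      a block by 1 and so occupies one of the M places.\<close>
    define b' where "b' = b(j := b j - y2)"
    have sum_b: "(\<Sum>k\<in>I. b k) = (\<Sum>k\<in>I. b' k) + y2"
      using sum.remove[OF fin j(1), of b] sum.remove[OF fin j(1), of b'] y12(3)
        sum.cong[of "I - {j}" "I - {j}" b b'] by (simp add: b'_def)
    have lin: "good (a - y1 + (\<Sum>k\<in>I. b' k)) (\<lambda>i. a - y1 + (\<Sum>k\<in>I. b' k) - b' i) (\<lambda>i. if i = j then b' j else 0)"
      by (rule good_linear) simp
    \<comment> \<open>In the remaining places j keeps the demand s, equal to the total of the
      others, so that it can be paired off completely.\<close>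
    have "good (M - y) (\<lambda>_. 0) (e(j := s))"
    proof (rule good_slots)
      have "sum (e(j := s)) (I - {j}) = s" unfolding s_def by (rule sum.cong) auto
      then have sums: "sum (e(j := s)) I = 2 * s" using sum.remove[OF fin j(1), of "e(j := s)"] by simp
      have le: "e k \<le> s" if "k \<in> I" "k \<noteq> j" for k
        unfolding s_def using fin that by (intro member_le_sum) auto
      fix k assume k: "k \<in> I"
      have "(e(j := s)) k \<le> s" using le[OF k] by simp
      then show "(e(j := s)) k \<le> M - y" "2 * (e(j := s)) k \<le> sum (e(j := s)) I"
        unfolding sums using syM by linarith+
    qed (use card in simp)
    from good_add[OF good_add[OF good_add[OF lin good_scale[OF good_cubic[OF j(1) card], of y1]]
        good_scale[OF good_double_root[OF j(1)], of y2]] this]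
    show ?thesis
    proof (rule good_cong)
      show "a - y1 + (\<Sum>k\<in>I. b' k) + y1 * 2 + y2 * 2 + (M - y) = N"
        using ab y12 sum_b syM TN unfolding M_def by simp
      fix i assume i: "i \<in> I"
      have b'_le: "b' i \<le> (\<Sum>k\<in>I. b' k)" using fin i by (intro member_le_sum) auto
      show "a - y1 + (\<Sum>k\<in>I. b' k) - b' i + y1 * 1 + y2 * (if i = j then 0 else 1) + 0 = r i"
        using ab y12 sum_b b'_le br[OF i] by (cases "i = j") (simp_all add: b'_def)
      show "(if i = j then b' j else 0) + y1 * (if i = j then 1 else 0) + y2 * (if i = j then 2 else 0) + (e(j := s)) i = e i"
        using y y12 by (simp add: b'_def)
    qed
  qed
qed

end

subsection \<open>Realization of prescribed cokernels\<close>

text \<open>Entry by entry, \<open>monic_coefficients\<close> yields a monic matrix polynomial of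
  degree m whose value at \<varpi> x i is \<varpi> F i; its leading coefficient is the identity,
  which enters as the entry e. The block companion matrix then has the required cokernels.\<close>

lemma pencil_companion:
  fixes x :: "nat \<Rightarrow> 'p::prime_card padic_int"
  assumes m: "1 \<le> m" "m \<le> 4"
    and unit: "\<And>i j. i \<in> {1..m} \<Longrightarrow> j \<in> {1..m} \<Longrightarrow> i \<noteq> j \<Longrightarrow> x i - x j dvd 1"
    and C: "C0 \<in> carrier_mat N N" "C1 \<in> carrier_mat N N" "C2 \<in> carrier_mat N N"
    and F: "\<And>i. i \<in> {1..m} \<Longrightarrow> F i \<in> carrier_mat N N"
      "\<And>i. i \<in> {1..m} \<Longrightarrow> cong_mat (m - 2) (F i) (pencil_at \<varpi> (x i) C0 C1 C2)"
  obtains A where "A \<in> carrier_mat (m * N) (m * N)"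
    "\<And>i (H :: ('p padic_int, 'a) module). i \<in> {1..m} \<Longrightarrow> presents (\<varpi> \<cdot>\<^sub>m F i) H \<Longrightarrow>
       presents (A + (\<varpi> * x i) \<cdot>\<^sub>m 1\<^sub>m (m * N)) H"
proof -
  define P where "P a b d \<longleftrightarrow> (\<forall>i\<in>{1..m}.
    (\<varpi> * x i) ^ m * (1\<^sub>m N $$ (a, b)) + (\<Sum>l<m. (\<varpi> * x i) ^ l * d l) = \<varpi> * F i $$ (a, b))" for a b d
  have "\<exists>d. P a b d" if ab: "a < N" "b < N" for a b
    unfolding P_def
  proof (rule monic_coefficients[OF m unit])
    fix i assume i: "i \<in> {1..m}"
    have "\<varpi> ^ (m - 2) dvd F i $$ (a, b) - pencil_at \<varpi> (x i) C0 C1 C2 $$ (a, b)"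
      by (rule cong_matD[OF F(2)[OF i]]) (use ab C in \<open>auto simp: pencil_at_def\<close>)
    then show "\<varpi> ^ (m - 2) dvd F i $$ (a, b) - (C0 $$ (a, b) + x i * C1 $$ (a, b) + \<varpi> * (x i)\<^sup>2 * C2 $$ (a, b))"
      using ab C by (simp add: pencil_at_def add.assoc)
  qed
  then obtain d where "\<And>a b. a < N \<Longrightarrow> b < N \<Longrightarrow> P a b (d a b)" by metis
  then have d: "(\<varpi> * x i) ^ m * (1\<^sub>m N $$ (a, b)) + (\<Sum>l<m. (\<varpi> * x i) ^ l * d a b l) = \<varpi> * F i $$ (a, b)"
    if "a < N" "b < N" "i \<in> {1..m}" for a b i
    using that unfolding P_def by blast
  define C where "C l = mat N N (\<lambda>(a, b). d a b l)" for l
  have poly: "monic_mat_poly N m C (\<varpi> * x i) = \<varpi> \<cdot>\<^sub>m F i" if i: "i \<in> {1..m}" for i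
  proof (rule eq_matI)
    fix a b assume "a < dim_row (\<varpi> \<cdot>\<^sub>m F i)" "b < dim_col (\<varpi> \<cdot>\<^sub>m F i)"
    then have ab: "a < N" "b < N" using F(1)[OF i] by auto
    then show "monic_mat_poly N m C (\<varpi> * x i) $$ (a, b) = (\<varpi> \<cdot>\<^sub>m F i) $$ (a, b)"
      using d[OF ab i] F(1)[OF i] by (simp add: monic_mat_poly_def C_def)
  qed (use F(1)[OF i] in \<open>auto simp: monic_mat_poly_def\<close>)
  obtain A where A: "A \<in> carrier_mat (m * N) (m * N)"
    "\<And>y (H :: ('p padic_int, 'a) module). presents (monic_mat_poly N m C y) H \<Longrightarrow> presents (A + y \<cdot>\<^sub>m 1\<^sub>m (m * N)) H"
    by (rule exists_companion[of C N m, OF _ m(1)]) (simp add: C_def, rule that)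
  show ?thesis by (rule that[OF A(1)]) (simp add: A(2) poly)
qed

lemma count_mset_map_upt: "count (mset (map \<phi> [0..<N])) z = card {i. i < N \<and> \<phi> i = z}"
proof (induction N)
  case (Suc N)
  have "{i. i < Suc N \<and> \<phi> i = z} = (if \<phi> N = z then insert N {i. i < N \<and> \<phi> i = z} else {i. i < N \<and> \<phi> i = z})"
    by (auto simp: less_Suc_eq)
  then show ?case using Suc by simp
qed simp

lemma card_permutes:
  assumes p: "p permutes {..<N}"
  shows "card {i. i < N \<and> Q (h (p i))} = card {i. i < N \<and> Q (h i)}"
proof (rule bij_betw_same_card[of p])
  have "p ` {i. i < N \<and> Q (h (p i))} = {i. i < N \<and> Q (h i)}"
  proof
    show "p ` {i. i < N \<and> Q (h (p i))} \<subseteq> {i. i < N \<and> Q (h i)}"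
      using permutes_in_image[OF p] by auto
    show "{i. i < N \<and> Q (h i)} \<subseteq> p ` {i. i < N \<and> Q (h (p i))}"
    proof
      fix i assume i: "i \<in> {i. i < N \<and> Q (h i)}"
      obtain j where j: "i = p j" using permutes_surj[OF p] by (metis surjD)
      then have "j < N" using permutes_in_image[OF p, of j] i by auto
      then show "i \<in> p ` {i. i < N \<and> Q (h (p i))}" using i j by auto
    qed
  qed
  then show "bij_betw p {i. i < N \<and> Q (h (p i))} {i. i < N \<and> Q (h i)}"
    by (rule bij_betw_imageI[OF permutes_inj_on[OF p]])
qed

text \<open>Replacing multiples of \<varpi>^k by 0 turns the congruence to be achieved into an
  equality. The counts at the levels up to k say that the truncated diagonals have equal multisets
  of entries, and equal multisets differ by a permutation.\<close>

lemma truncated_counts_eq: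
  fixes f h :: "nat \<Rightarrow> 'p::prime_card padic_int"
  assumes f: "\<And>i. p_power (f i)" and h: "\<And>i. p_power (h i)"
    and count: "\<And>j. j \<le> k \<Longrightarrow> card {i. i < N \<and> \<not> \<varpi> ^ j dvd f i} = card {i. i < N \<and> \<not> \<varpi> ^ j dvd h i}"
  obtains p where "p permutes {..<N}" "\<And>i. i < N \<Longrightarrow> \<varpi> ^ k dvd h (p i) - f i"
proof -
  define c where "c y = (if \<varpi> ^ k dvd y then 0 else y)" for y :: "'p padic_int"
  have zero: "card {i. i < N \<and> c (\<phi> i) = 0} + card {i. i < N \<and> \<not> \<varpi> ^ k dvd \<phi> i} = N" for \<phi>
  proof -
    have "card {i. i < N \<and> True} = card {i. i < N \<and> c (\<phi> i) = 0} + card {i. i < N \<and> \<not> \<varpi> ^ k dvd \<phi> i}"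
      by (rule card_Collect_less_disj) (auto simp: c_def split: if_splits)
    then show ?thesis by simp
  qed
  have pow: "card {i. i < N \<and> c (\<phi> i) = \<varpi> ^ j} + card {i. i < N \<and> \<not> \<varpi> ^ j dvd \<phi> i}
      = card {i. i < N \<and> \<not> \<varpi> ^ Suc j dvd \<phi> i}" if \<phi>: "\<And>i. p_power (\<phi> i)" and j: "j < k" for \<phi> j
  proof -
    have "c y = \<varpi> ^ j \<longleftrightarrow> y = \<varpi> ^ j" for y
      using j uniformizer_neq_0[of j, where 'a='p] by (auto simp: c_def)
    then show ?thesis using card_diff_level[of N \<phi> j, OF \<phi>] by simp
  qed
  have other: "{i. i < N \<and> c (\<phi> i) = z} = {}"
    if \<phi>: "\<And>i. p_power (\<phi> i)" and z: "z \<noteq> 0" "\<And>j. j < k \<Longrightarrow> z \<noteq> \<varpi> ^ j" for \<phi> z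
  proof -
    have "c (\<phi> i) \<noteq> z" for i
      using \<phi>[of i]
    proof (cases rule: p_power_cases)
      case (2 l)
      then show ?thesis using z(1) z(2)[of l] by (cases "k \<le> l") (auto simp: c_def)
    qed (use z(1) in \<open>simp add: c_def\<close>)
    then show ?thesis by blast
  qed
  have eq: "card {i. i < N \<and> c (f i) = z} = card {i. i < N \<and> c (h i) = z}" for z
  proof (cases "z = 0")
    case True
    then show ?thesis using zero[of f] zero[of h] count[of k] by simp
  next
    case z: False
    show ?thesis
    proof (cases "\<exists>j<k. z = \<varpi> ^ j")
      case True
      then obtain j where j: "j < k" "z = \<varpi> ^ j" by blast
      show ?thesis
        using pow[of f j, OF f j(1)] pow[of h j, OF h j(1)] count[of j] count[of "Suc j"] j
        by (simp del: power_Suc)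
    next
      case False
      then show ?thesis using other[of f z, OF f z] other[of h z, OF h z] by (metis (lifting))
    qed
  qed
  have "mset (map (\<lambda>i. c (f i)) [0..<N]) = mset (map (\<lambda>i. c (h i)) [0..<N])"
    by (rule multiset_eqI) (simp only: count_mset_map_upt eq)
  then obtain p where p: "p permutes {..<length (map (\<lambda>i. c (h i)) [0..<N])}"
    "permute_list p (map (\<lambda>i. c (h i)) [0..<N]) = map (\<lambda>i. c (f i)) [0..<N]"
    by (rule mset_eq_permutation)
  have pN: "p permutes {..<N}" using p(1) by simp
  show ?thesis
  proof (rule that[OF pN])
    fix i assume i: "i < N"
    have pi: "p i < N" using permutes_in_image[OF pN, of i] i by simp
    have "permute_list p (map (\<lambda>i. c (h i)) [0..<N]) ! i = c (h (p i))"
      using i pi by (simp add: permute_list_def)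
    then have "c (h (p i)) = c (f i)" unfolding p(2) using i by simp
    then show "\<varpi> ^ k dvd h (p i) - f i"
      unfolding c_def by (cases "\<varpi> ^ k dvd h (p i)"; cases "\<varpi> ^ k dvd f i") (auto simp: dvd_diff)
  qed
qed

text \<open>\<open>H\<close> is presented by \<varpi> times a diagonal matrix with entries
  \<open>h\<close>. By the rank hypothesis these entries and the Smith form of \<open>G\<close> have
  the same valuations below k, so after a permutation they are congruent modulo \<varpi>^k.
  Multiplying by the transformation matrices of \<open>G\<close> gives \<open>F\<close>.\<close>

lemma exists_lift:
  fixes H :: "('p::prime_card padic_int, 'a) module"
  assumes H: "H \<in> fg_modules" "p_rank H = N" and G: "G \<in> carrier_mat N N"
    and rank: "\<And>j. j \<in> {1..k} \<Longrightarrow> prank j G = (\<Sum>r=1..j. d_mult r H)"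
  obtains F where "F \<in> carrier_mat N N" "cong_mat k F G" "presents (\<varpi> \<cdot>\<^sub>m F) H"
proof -
  note type = fg_module_type[OF H(1)]
  have "finite {r. 1 \<le> r \<and> d_mult r H \<noteq> 0}" using type(1) unfolding has_type_def by blast
  then obtain m and g :: "nat \<Rightarrow> 'p padic_int" where g: "m = (\<Sum>r | 1 \<le> r \<and> d_mult r H \<noteq> 0. d_mult r H) + d_inf H"
    "\<And>i. p_power (g i)" "\<And>i. \<varpi> dvd g i"
    "card {i. i < m \<and> g i = 0} = d_inf H" "\<And>r. 1 \<le> r \<Longrightarrow> card {i. i < m \<and> g i = \<varpi> ^ r} = d_mult r H"
    by (rule diag_of_counts[where e="d_inf H" and 'p='p]) (rule that)
  have mN: "m = N" using g(1) type(2) H(2) by simp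
  have "\<exists>h. g i = \<varpi> * h \<and> p_power h" for i
    using g(2)[of i]
  proof (cases rule: p_power_cases)
    case 1
    then show ?thesis by (intro exI[of _ 0]) (simp add: p_power_def)
  next
    case (2 l)
    then have "l \<noteq> 0" using g(3)[of i] by (metis power_0 uniformizer_not_dvd_1)
    then obtain l' where "l = Suc l'" by (cases l) auto
    then show ?thesis using 2 by (intro exI[of _ "\<varpi> ^ l'"]) (auto simp: p_power_def)
  qed
  then obtain h where h: "\<And>i. g i = \<varpi> * h i" "\<And>i. p_power (h i)" by metis
  obtain f where f: "\<And>i. p_power (f i)" "equiv_mat G (mat_diag N f)"
    "\<And>k. prank k G = card {i. i < N \<and> \<not> \<varpi> ^ k dvd f i}"
    by (rule smith_normal_form_square[OF G]) blast
  have hcount: "card {i. i < N \<and> \<not> \<varpi> ^ j dvd h i} = (\<Sum>r=1..j. d_mult r H)" for j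
  proof (induction j)
    case (Suc j)
    have "card {i. i < N \<and> h i = \<varpi> ^ j} = d_mult (Suc j) H"
      using g(5)[of "Suc j"] unfolding mN h(1) by simp
    then show ?case using card_diff_level[of N h j, OF h(2)] Suc by simp
  qed simp
  have "card {i. i < N \<and> \<not> \<varpi> ^ j dvd f i} = card {i. i < N \<and> \<not> \<varpi> ^ j dvd h i}" if "j \<le> k" for j
  proof (cases "j = 0")
    case False
    then have "j \<in> {1..k}" using that by simp
    then show ?thesis using rank hcount f(3) by simp
  qed simp
  then obtain p where p: "p permutes {..<N}" "\<And>i. i < N \<Longrightarrow> \<varpi> ^ k dvd h (p i) - f i"
    by (rule truncated_counts_eq[of f h k N, OF f(1) h(2)]) (assumption, rule that)
  obtain U V where UV: "gl N U" "gl N V" "G = U * mat_diag N f * V" by (rule equiv_matE[OF f(2) G]) blast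
  note c = gl_carrier[OF UV(1)] gl_carrier[OF UV(2)]
  let ?D = "mat_diag N (\<lambda>i. h (p i))"
  have D: "?D \<in> carrier_mat N N" by simp
  show ?thesis
  proof
    show "U * ?D * V \<in> carrier_mat N N" using c D by (metis mult_carrier_mat)
    have "cong_mat k ?D (mat_diag N f)"
      by (rule cong_matI[of _ N N]) (auto simp: mat_diag_def p(2))
    then show "cong_mat k (U * ?D * V) G"
      unfolding UV(3) using c by (intro cong_mat_mult cong_mat_refl) auto
    have "presents (mat_diag N (\<lambda>i. g (p i))) H"
    proof (rule presents_of_has_type[OF module_fg[OF H(1)] type(1)])
      show "card {i. i < N \<and> g (p i) = 0} = d_inf H"
        using card_permutes[OF p(1), of "\<lambda>y. y = 0" g] g(4) unfolding mN by simp
      show "card {i. i < N \<and> g (p i) = \<varpi> ^ r} = d_mult r H" if "1 \<le> r" for r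
        using card_permutes[OF p(1), of "\<lambda>y. y = \<varpi> ^ r" g] g(5)[OF that] unfolding mN by simp
    qed (rule g(2))
    moreover have "\<varpi> \<cdot>\<^sub>m ?D = mat_diag N (\<lambda>i. g (p i))" by (intro eq_matI) (auto simp: mat_diag_def h(1))
    moreover have "equiv_mat (\<varpi> \<cdot>\<^sub>m (U * ?D * V)) (\<varpi> \<cdot>\<^sub>m ?D)"
      by (intro equiv_mat_smult equiv_matI[OF D UV(1,2) refl])
    ultimately show "presents (\<varpi> \<cdot>\<^sub>m (U * ?D * V)) H" using presents_equiv by metis
  qed
qed

section \<open>Realizable tuples for up to four points\<close>

definition realizable :: "nat \<Rightarrow> (nat \<Rightarrow> 'p::prime_card padic_int) \<Rightarrow> (nat \<Rightarrow> ('p padic_int, 'a) module) \<Rightarrow> bool" where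
  "realizable m x H \<longleftrightarrow> (\<exists>n A. 0 < n \<and> A \<in> carrier_mat n n \<and>
     (\<forall>i\<in>{1..m}. presents (A + (\<varpi> * x i) \<cdot>\<^sub>m 1\<^sub>m n) (H i)))"

lemma cok_tuples_realizable: "cok_tuples m x = {H \<in> {1..m} \<rightarrow>\<^sub>E fg_modules. realizable m x H}"
  unfolding cok_tuples_def realizable_def cok_iso_iff_presents uniformizer_def ..

lemma realizable_pencil:
  fixes H :: "nat \<Rightarrow> ('p::prime_card padic_int, 'a) module"
  assumes "realizable m x H" "\<And>i. i \<in> {1..m} \<Longrightarrow> H i \<in> fg_modules"
  obtains N F where "quadratic_pencil N {1..m} x F" "\<And>i. i \<in> {1..m} \<Longrightarrow> p_rank (H i) = N"
    "\<And>i. i \<in> {1..m} \<Longrightarrow> prank 1 (F i) = d_mult 1 (H i)"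
    "\<And>i. i \<in> {1..m} \<Longrightarrow> prank 2 (F i) = d_mult 1 (H i) + d_mult 2 (H i)"
proof -
  obtain n A where A: "A \<in> carrier_mat n n" "\<And>i. i \<in> {1..m} \<Longrightarrow> presents (A + (\<varpi> * x i) \<cdot>\<^sub>m 1\<^sub>m n) (H i)"
    using assms(1) unfolding realizable_def by blast
  show ?thesis
  proof (rule cok_tuple_pencil[OF A(1), where I="{1..m}" and x=x and H=H])
    show "module class_ring (H i)" if "i \<in> {1..m}" for i by (rule module_fg[OF assms(2)[OF that]])
  qed (fact A(2), rule that)
qed

text \<open>Each member of the pencil is changed modulo \<varpi>^(m-2) so as to have the exact
  cokernel wanted. The companion construction needs agreement with the pencil only to that modulus,
  so only d_1, ..., d_(m-2) have to be prescribed.\<close>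

lemma pencil_realizable:
  fixes H :: "nat \<Rightarrow> ('p::prime_card padic_int, 'a) module"
  assumes m: "1 \<le> m" "m \<le> 4"
    and unit: "\<And>i j. i \<in> {1..m} \<Longrightarrow> j \<in> {1..m} \<Longrightarrow> i \<noteq> j \<Longrightarrow> x i - x j dvd 1"
    and H: "\<And>i. i \<in> {1..m} \<Longrightarrow> H i \<in> fg_modules" "\<And>i. i \<in> {1..m} \<Longrightarrow> p_rank (H i) = N"
    and C: "C0 \<in> carrier_mat N N" "C1 \<in> carrier_mat N N" "C2 \<in> carrier_mat N N"
    and rank: "\<And>i j. i \<in> {1..m} \<Longrightarrow> j \<in> {1..m - 2} \<Longrightarrow>
      prank j (pencil_at \<varpi> (x i) C0 C1 C2) = (\<Sum>r=1..j. d_mult r (H i))"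
  shows "realizable m x H"
proof (cases "N = 0")
  case True
  \<comment> \<open>For N = 0 the companion matrix would be empty, while n has to be positive. The
    identity of size 1 serves, since 1 + \<varpi> x i is a unit.\<close>
  have "presents (1\<^sub>m 1 + (\<varpi> * x i) \<cdot>\<^sub>m 1\<^sub>m 1) (H i)" if i: "i \<in> {1..m}" for i
  proof -
    note type = fg_module_type[OF H(1)[OF i]]
    have fin: "finite {r. 1 \<le> r \<and> d_mult r (H i) \<noteq> 0}" using type(1) unfolding has_type_def by blast
    have zero: "(\<Sum>r | 1 \<le> r \<and> d_mult r (H i) \<noteq> 0. d_mult r (H i)) = 0" "d_inf (H i) = 0"
      using type(2) H(2)[OF i] True by simp_all
    have d: "d_mult r (H i) = 0" if "1 \<le> r" for r
    proof (rule ccontr)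
      assume ne: "d_mult r (H i) \<noteq> 0"
      then have "r \<in> {r. 1 \<le> r \<and> d_mult r (H i) \<noteq> 0}" using that by simp
      from member_le_sum[OF this _ fin, of "\<lambda>r. d_mult r (H i)"] show False using zero(1) ne by simp
    qed
    have pres: "presents (mat_diag 1 (\<lambda>_. 1)) (H i)"
    proof (rule presents_of_has_type[OF module_fg[OF H(1)[OF i]] type(1)])
      show "card {j :: nat. j < 1 \<and> (1 :: 'p padic_int) = \<varpi> ^ r} = d_mult r (H i)" if "1 \<le> r" for r
      proof -
        have "(1 :: 'p padic_int) \<noteq> \<varpi> ^ r" using uniformizer_power_eq_iff[of 0 r, where 'p='p] that by simp
        then show ?thesis using d[OF that] by simp
      qed
    qed (simp_all add: zero)
    have M: "(1\<^sub>m 1 :: 'p padic_int mat) + (\<varpi> * x i) \<cdot>\<^sub>m 1\<^sub>m 1 = 1\<^sub>m 1 + \<varpi> \<cdot>\<^sub>m (x i \<cdot>\<^sub>m 1\<^sub>m 1)"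
      by (intro eq_matI) auto
    have gl: "gl 1 (1\<^sub>m 1 + (\<varpi> * x i) \<cdot>\<^sub>m 1\<^sub>m 1)" unfolding M by (rule gl_one_add_uniformizer) simp
    have "equiv_mat (1\<^sub>m 1 + (\<varpi> * x i) \<cdot>\<^sub>m 1\<^sub>m 1) (1\<^sub>m 1)"
    proof (rule equiv_matI[OF _ gl gl_one])
      show "1\<^sub>m 1 + (\<varpi> * x i) \<cdot>\<^sub>m 1\<^sub>m 1 = (1\<^sub>m 1 + (\<varpi> * x i) \<cdot>\<^sub>m 1\<^sub>m 1) * 1\<^sub>m 1 * 1\<^sub>m 1"
        using right_mult_one_mat[OF gl_carrier[OF gl]] by simp
    qed simp
    then show ?thesis using presents_equiv[OF pres] by (simp add: mat_diag_one)
  qed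
  then show ?thesis
    unfolding realizable_def by (intro exI[of _ "1 :: nat"] exI[of _ "1\<^sub>m 1"]) (simp del: One_nat_def)
next
  case False
  have G: "pencil_at \<varpi> (x i) C0 C1 C2 \<in> carrier_mat N N" for i using C by (simp add: pencil_at_def)
  have "\<exists>F. i \<in> {1..m} \<longrightarrow> F \<in> carrier_mat N N \<and> cong_mat (m - 2) F (pencil_at \<varpi> (x i) C0 C1 C2) \<and> presents (\<varpi> \<cdot>\<^sub>m F) (H i)" for i
  proof (cases "i \<in> {1..m}")
    case i: True
    show ?thesis by (rule exists_lift[OF H(1,2)[OF i] G rank[OF i]]) blast+
  qed blast
  then obtain F where F: "\<And>i. i \<in> {1..m} \<Longrightarrow> F i \<in> carrier_mat N N"
    "\<And>i. i \<in> {1..m} \<Longrightarrow> cong_mat (m - 2) (F i) (pencil_at \<varpi> (x i) C0 C1 C2)"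
    "\<And>i. i \<in> {1..m} \<Longrightarrow> presents (\<varpi> \<cdot>\<^sub>m F i) (H i)" by metis
  obtain A where A: "A \<in> carrier_mat (m * N) (m * N)"
    "\<And>i (H :: ('p padic_int, 'a) module). i \<in> {1..m} \<Longrightarrow> presents (\<varpi> \<cdot>\<^sub>m F i) H \<Longrightarrow>
       presents (A + (\<varpi> * x i) \<cdot>\<^sub>m 1\<^sub>m (m * N)) H"
    by (rule pencil_companion[where x=x and F=F, OF m unit C F(1,2)]) (assumption+, rule that)
  show ?thesis
    unfolding realizable_def
  proof (intro exI conjI ballI)
    show "0 < m * N" using m(1) False by simp
    show "A \<in> carrier_mat (m * N) (m * N)" by (rule A(1))
    show "presents (A + (\<varpi> * x i) \<cdot>\<^sub>m 1\<^sub>m (m * N)) (H i)" if "i \<in> {1..m}" for i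
      by (rule A(2)[OF that F(3)[OF that]])
  qed
qed

lemma d_mult_le_p_rank:
  assumes "H \<in> fg_modules" "finite R" "\<And>r. r \<in> R \<Longrightarrow> 1 \<le> r"
  shows "(\<Sum>r\<in>R. d_mult r H) \<le> p_rank H"
proof -
  let ?S = "{r. 1 \<le> r \<and> d_mult r H \<noteq> 0}"
  note type = fg_module_type[OF assms(1)]
  have fin: "finite ?S" using type(1) unfolding has_type_def by blast
  have "(\<Sum>r\<in>R. d_mult r H) = (\<Sum>r\<in>R \<inter> ?S. d_mult r H)"
    by (rule sum.mono_neutral_right) (use assms in auto)
  also have "\<dots> \<le> (\<Sum>r\<in>?S. d_mult r H)" by (rule sum_mono2) (use fin in auto)
  finally show ?thesis using type(2) by simp
qed

lemma other_elements:
  fixes i :: nat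
  assumes "i \<in> {1..3}"
  obtains j k where "{1..3} = {i, j, k}" "i \<noteq> j" "i \<noteq> k" "j \<noteq> k"
proof -
  have "card ({1..3} - {i}) = 2" using assms by simp
  then obtain j k where "{1..3} - {i} = {j, k}" "j \<noteq> k" unfolding card_2_iff by blast
  then have "{1..3} = {i, j, k}" "i \<noteq> j" "i \<noteq> k" "j \<noteq> k" using assms by blast+
  then show ?thesis by (rule that)
qed

lemma other_elements':
  fixes i j :: nat
  assumes "i \<in> {1..4}" "j \<in> {1..4}" "i \<noteq> j"
  obtains k l where "{1..4} = {i, j, k, l}" "i \<noteq> k" "i \<noteq> l" "j \<noteq> k" "j \<noteq> l" "k \<noteq> l"
proof -
  have "card ({1..4} - {i} - {j}) = 2" using assms by simp
  then obtain k l where "{1..4} - {i} - {j} = {k, l}" "k \<noteq> l" unfolding card_2_iff by blast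
  then have "{1..4} = {i, j, k, l}" "i \<noteq> k" "i \<noteq> l" "j \<noteq> k" "j \<noteq> l" "k \<noteq> l" using assms by blast+
  then show ?thesis by (rule that)
qed

text \<open>For m at most 2 no rank has to be prescribed, so the zero pencil of the common size is
  good enough.\<close>

lemma realizable_two:
  fixes H :: "nat \<Rightarrow> ('p::prime_card padic_int, 'a) module"
  assumes m: "1 \<le> m" "m \<le> 2"
    and unit: "\<And>i j. i \<in> {1..m} \<Longrightarrow> j \<in> {1..m} \<Longrightarrow> i \<noteq> j \<Longrightarrow> x i - x j dvd 1"
    and H: "\<And>i. i \<in> {1..m} \<Longrightarrow> H i \<in> fg_modules"
  shows "realizable m x H \<longleftrightarrow> (\<forall>i\<in>{1..m}. p_rank (H i) = p_rank (H 1))"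
proof
  assume "realizable m x H"
  then obtain N F where "quadratic_pencil N {1..m} x F" and N: "\<And>i. i \<in> {1..m} \<Longrightarrow> p_rank (H i) = N"
    by (rule realizable_pencil[OF _ H]) (assumption, rule that)
  then show "\<forall>i\<in>{1..m}. p_rank (H i) = p_rank (H 1)" using N[of 1] m(1) by simp
next
  assume rank: "\<forall>i\<in>{1..m}. p_rank (H i) = p_rank (H 1)"
  let ?O = "0\<^sub>m (p_rank (H 1)) (p_rank (H 1))"
  show "realizable m x H"
  proof (rule pencil_realizable[OF m(1) _ unit H])
    show "p_rank (H i) = p_rank (H 1)" if "i \<in> {1..m}" for i using rank that by blast
    show "?O \<in> carrier_mat (p_rank (H 1)) (p_rank (H 1))" "?O \<in> carrier_mat (p_rank (H 1)) (p_rank (H 1))"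
      "?O \<in> carrier_mat (p_rank (H 1)) (p_rank (H 1))" by simp_all
    show "prank j (pencil_at \<varpi> (x i) ?O ?O ?O) = (\<Sum>r=1..j. d_mult r (H i))" if "j \<in> {1..m - 2}" for i j
      using m(2) that by simp
  qed (use m(2) in simp_all)
qed

text \<open>Necessity is the rank inequality for affine families, with the rank at i added to both
  sides. For sufficiency only the rank modulo \<varpi> matters, so the pencil is built with e =
  0.\<close>

lemma realizable_three:
  fixes H :: "nat \<Rightarrow> ('p::prime_card padic_int, 'a) module"
  assumes unit: "\<And>i j. i \<in> {1..3} \<Longrightarrow> j \<in> {1..3} \<Longrightarrow> i \<noteq> j \<Longrightarrow> x i - x j dvd 1"
    and H: "\<And>i. i \<in> {1..3} \<Longrightarrow> H i \<in> fg_modules"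
  shows "realizable 3 x H \<longleftrightarrow> (\<forall>i\<in>{1..3}. p_rank (H i) = p_rank (H 1)) \<and>
    (\<forall>i\<in>{1..3}. 2 * d_mult 1 (H i) \<le> (\<Sum>i=1..3. d_mult 1 (H i)))"
proof
  assume "realizable 3 x H"
  then obtain N F where pencil: "quadratic_pencil N {1..3} x F" and N: "\<And>i. i \<in> {1..3} \<Longrightarrow> p_rank (H i) = N"
    and d: "\<And>i. i \<in> {1..3} \<Longrightarrow> prank 1 (F i) = d_mult 1 (H i)"
    by (rule realizable_pencil[OF _ H]) (assumption, rule that)
  have "2 * d_mult 1 (H i) \<le> (\<Sum>i=1..3. d_mult 1 (H i))" if i: "i \<in> {1..3}" for i
  proof -
    obtain j k where jk: "{1..3} = {i, j, k}" "i \<noteq> j" "i \<noteq> k" "j \<noteq> k" by (rule other_elements[OF i])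
    then have I: "j \<in> {1..3}" "k \<in> {1..3}" by blast+
    have "prank 1 (F i) \<le> prank 1 (F j) + prank 1 (F k)"
      by (rule quadratic_pencil_prank_one[OF pencil i I unit[OF I jk(4)]])
    moreover have "(\<Sum>i=1..3. d_mult 1 (H i)) = d_mult 1 (H i) + (d_mult 1 (H j) + d_mult 1 (H k))"
      unfolding jk(1) using jk(2-4) by simp
    ultimately show ?thesis using d[OF i] d[OF I(1)] d[OF I(2)] by simp
  qed
  then show "(\<forall>i\<in>{1..3}. p_rank (H i) = p_rank (H 1)) \<and>
    (\<forall>i\<in>{1..3}. 2 * d_mult 1 (H i) \<le> (\<Sum>i=1..3. d_mult 1 (H i)))"
    using N by simp
next
  assume *: "(\<forall>i\<in>{1..3}. p_rank (H i) = p_rank (H 1)) \<and>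
    (\<forall>i\<in>{1..3}. 2 * d_mult 1 (H i) \<le> (\<Sum>i=1..3. d_mult 1 (H i)))"
  define N where "N = p_rank (H 1)"
  have N: "p_rank (H i) = N" if "i \<in> {1..3}" for i using * that unfolding N_def by blast
  interpret P: unit_differences x "{1..3}"
    using unit by unfold_locales (simp_all add: padic_unit_iff)
  have "P.good N (\<lambda>i. d_mult 1 (H i)) (\<lambda>_. 0)"
  proof (rule P.good_three)
    show "d_mult 1 (H i) \<le> N" if "i \<in> {1..3}" for i
      using d_mult_le_p_rank[OF H[OF that], of "{1}"] N[OF that] by simp
  qed (use * in simp_all)
  then obtain C0 C1 C2 where C: "C0 \<in> carrier_mat N N" "C1 \<in> carrier_mat N N" "C2 \<in> carrier_mat N N"
    "\<forall>i\<in>{1..3}. prank 1 (pencil_at \<varpi> (x i) C0 C1 C2) = d_mult 1 (H i) \<and>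
       prank 2 (pencil_at \<varpi> (x i) C0 C1 C2) = d_mult 1 (H i) + 0"
    unfolding P.good_def by blast
  show "realizable 3 x H"
  proof (rule pencil_realizable[OF _ _ unit H N C(1-3)])
    fix i j :: nat assume ij: "i \<in> {1..3}" "j \<in> {1..3 - 2}"
    then have "j = 1" by simp
    then show "prank j (pencil_at \<varpi> (x i) C0 C1 C2) = (\<Sum>r=1..j. d_mult r (H i))"
      using C(4) ij(1) by simp
  qed simp_all
qed

lemma realizable_four:
  fixes H :: "nat \<Rightarrow> ('p::prime_card padic_int, 'a) module"
  assumes unit: "\<And>i j. i \<in> {1..4} \<Longrightarrow> j \<in> {1..4} \<Longrightarrow> i \<noteq> j \<Longrightarrow> x i - x j dvd 1"
    and H: "\<And>i. i \<in> {1..4} \<Longrightarrow> H i \<in> fg_modules"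
  defines "D \<equiv> \<lambda>r. \<Sum>i=1..4. d_mult r (H i)"
  shows "realizable 4 x H \<longleftrightarrow> (\<forall>i\<in>{1..4}. p_rank (H i) = p_rank (H 1)) \<and>
    (\<forall>i\<in>{1..4}. 3 * d_mult 1 (H i) \<le> D 1) \<and>
    (\<forall>i\<in>{1..4}. \<forall>j\<in>{1..4}. d_mult 1 (H i) + 2 * (d_mult 1 (H j) + d_mult 2 (H j)) \<le> D 1 + D 2)"
proof
  assume "realizable 4 x H"
  then obtain N F where pencil: "quadratic_pencil N {1..4} x F" and N: "\<And>i. i \<in> {1..4} \<Longrightarrow> p_rank (H i) = N"
    and d1: "\<And>i. i \<in> {1..4} \<Longrightarrow> prank 1 (F i) = d_mult 1 (H i)"
    and d2: "\<And>i. i \<in> {1..4} \<Longrightarrow> prank 2 (F i) = d_mult 1 (H i) + d_mult 2 (H i)"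
    by (rule realizable_pencil[OF _ H]) (assumption, rule that)
  have ineq: "3 * d_mult 1 (H i) \<le> D 1 \<and> d_mult 1 (H i) + 2 * (d_mult 1 (H i) + d_mult 2 (H i)) \<le> D 1 + D 2 \<and>
      d_mult 1 (H j) + 2 * (d_mult 1 (H i) + d_mult 2 (H i)) \<le> D 1 + D 2"
    if ij: "i \<in> {1..4}" "j \<in> {1..4}" "i \<noteq> j" for i j
  proof -
    obtain k l where kl: "{1..4} = {i, j, k, l}" "i \<noteq> k" "i \<noteq> l" "j \<noteq> k" "j \<noteq> l" "k \<noteq> l"
      by (rule other_elements'[OF ij])
    then have I: "k \<in> {1..4}" "l \<in> {1..4}" by blast+
    have D: "D r = d_mult r (H i) + (d_mult r (H j) + (d_mult r (H k) + d_mult r (H l)))" for r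
      unfolding D_def kl(1) using kl(2-6) ij(3) by simp
    \<comment> \<open>Adding the rank at i itself, modulo \<varpi> or \<varpi>^2, to both sides
      completes the right-hand sides to \<open>D 1\<close> or \<open>D 1 + D 2\<close>.\<close>
    note nec = quadratic_pencil_necessary[OF pencil ij(1,2) I unit[OF ij] unit[OF ij(1) I(1) kl(2)] unit[OF ij(1) I(2) kl(3)]
        unit[OF ij(2) I(1) kl(4)] unit[OF ij(2) I(2) kl(5)] unit[OF I kl(6)]]
    note d = d1[OF ij(1)] d1[OF ij(2)] d1[OF I(1)] d1[OF I(2)] d2[OF ij(1)] d2[OF ij(2)] d2[OF I(1)] d2[OF I(2)]
    show ?thesis
      unfolding D using nec(1)[unfolded d] nec(2)[unfolded d] nec(3)[unfolded d] by simp
  qed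
  have single: "3 * d_mult 1 (H i) \<le> D 1 \<and> d_mult 1 (H i) + 2 * (d_mult 1 (H i) + d_mult 2 (H i)) \<le> D 1 + D 2"
    if i: "i \<in> {1..4}" for i
  proof -
    \<comment> \<open>The inequalities at a single index still come from a relation between four
      nodes, so some second index has to be named.\<close>
    define j :: nat where "j = (if i = 1 then 2 else 1)"
    have "j \<in> {1..4}" "i \<noteq> j" by (auto simp: j_def)
    then show ?thesis using ineq[OF i] by blast
  qed
  show "(\<forall>i\<in>{1..4}. p_rank (H i) = p_rank (H 1)) \<and> (\<forall>i\<in>{1..4}. 3 * d_mult 1 (H i) \<le> D 1) \<and>
    (\<forall>i\<in>{1..4}. \<forall>j\<in>{1..4}. d_mult 1 (H i) + 2 * (d_mult 1 (H j) + d_mult 2 (H j)) \<le> D 1 + D 2)"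
  proof (intro conjI ballI)
    fix i j :: nat assume ij: "i \<in> {1..4}" "j \<in> {1..4}"
    show "d_mult 1 (H i) + 2 * (d_mult 1 (H j) + d_mult 2 (H j)) \<le> D 1 + D 2"
      using single[OF ij(1)] ineq[OF ij(2,1)] by (cases "i = j") auto
  qed (use N single in auto)
next
  assume *: "(\<forall>i\<in>{1..4}. p_rank (H i) = p_rank (H 1)) \<and> (\<forall>i\<in>{1..4}. 3 * d_mult 1 (H i) \<le> D 1) \<and>
    (\<forall>i\<in>{1..4}. \<forall>j\<in>{1..4}. d_mult 1 (H i) + 2 * (d_mult 1 (H j) + d_mult 2 (H j)) \<le> D 1 + D 2)"
  define N where "N = p_rank (H 1)"
  have N: "p_rank (H i) = N" if "i \<in> {1..4}" for i using * that unfolding N_def by blast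
  interpret P: unit_differences x "{1..4}"
    using unit by unfold_locales (simp_all add: padic_unit_iff)
  have "P.good N (\<lambda>i. d_mult 1 (H i)) (\<lambda>i. d_mult 2 (H i))"
  proof (rule P.good_four)
    show "d_mult 1 (H i) + d_mult 2 (H i) \<le> N" if "i \<in> {1..4}" for i
    proof -
      have "(\<Sum>r\<in>{1, 2}. d_mult r (H i)) \<le> p_rank (H i)" by (rule d_mult_le_p_rank[OF H[OF that]]) auto
      then show ?thesis using N[OF that] by simp
    qed
    show "3 * d_mult 1 (H i) \<le> (\<Sum>k=1..4. d_mult 1 (H k))" if "i \<in> {1..4}" for i
      using * that unfolding D_def by blast
    show "d_mult 1 (H i) + 2 * (d_mult 1 (H j) + d_mult 2 (H j))
        \<le> (\<Sum>k=1..4. d_mult 1 (H k)) + (\<Sum>k=1..4. d_mult 2 (H k))" if "i \<in> {1..4}" "j \<in> {1..4}" for i j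
      using * that unfolding D_def by blast
  qed simp
  then obtain C0 C1 C2 where C: "C0 \<in> carrier_mat N N" "C1 \<in> carrier_mat N N" "C2 \<in> carrier_mat N N"
    "\<forall>i\<in>{1..4}. prank 1 (pencil_at \<varpi> (x i) C0 C1 C2) = d_mult 1 (H i) \<and>
       prank 2 (pencil_at \<varpi> (x i) C0 C1 C2) = d_mult 1 (H i) + d_mult 2 (H i)"
    unfolding P.good_def by blast
  show "realizable 4 x H"
  proof (rule pencil_realizable[OF _ _ unit H N C(1-3)])
    fix i j :: nat assume ij: "i \<in> {1..4}" "j \<in> {1..4 - 2}"
    then have "j = 1 \<or> j = 2" by auto
    then show "prank j (pencil_at \<varpi> (x i) C0 C1 C2) = (\<Sum>r=1..j. d_mult r (H i))"
      using C(4) ij(1) by (auto simp: numeral_2_eq_2)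
  qed simp_all
qed

text \<open>The numbers \<open>d_inf\<close> and \<open>d_mult\<close> are fixed by choice. The
  first clause certifies that they describe the isomorphism type and that the p-rank is their sum,
  so that the clauses for the single values of m speak of the intended invariants.\<close>

theorem theorem1p8:
  fixes m :: nat and x :: "nat \<Rightarrow> 'p::prime_card padic_int"
  assumes "1 \<le> m" and "m \<le> 4"
    and "inj_on (\<lambda>i. padic_reduce (x i)) {1..m}"
  defines "\<M> \<equiv> fg_modules :: ('p padic_int, 'a) module set"
    and "D \<equiv> \<lambda>r (H :: nat \<Rightarrow> ('p padic_int, 'a) module). \<Sum>i=1..m. d_mult r (H i)"
  shows
    "(\<forall>H\<in>\<M>. has_type H (d_inf H) (\<lambda>r. d_mult r H) \<and>
        p_rank H = (\<Sum>r | 1 \<le> r \<and> d_mult r H \<noteq> 0. d_mult r H) + d_inf H) \<and>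
     (m = 1 \<longrightarrow> cok_tuples m x = ({1..m} \<rightarrow>\<^sub>E \<M>)) \<and>
     (m = 2 \<longrightarrow> cok_tuples m x = {H \<in> {1..m} \<rightarrow>\<^sub>E \<M>. p_rank (H 1) = p_rank (H 2)}) \<and>
     (m = 3 \<longrightarrow> cok_tuples m x = {H \<in> {1..m} \<rightarrow>\<^sub>E \<M>.
        p_rank (H 1) = p_rank (H 2) \<and> p_rank (H 2) = p_rank (H 3) \<and>
        (\<forall>i\<in>{1..3}. 2 * d_mult 1 (H i) \<le> D 1 H)}) \<and>
     (m = 4 \<longrightarrow> cok_tuples m x = {H \<in> {1..m} \<rightarrow>\<^sub>E \<M>.
        p_rank (H 1) = p_rank (H 2) \<and> p_rank (H 2) = p_rank (H 3) \<and> p_rank (H 3) = p_rank (H 4) \<and>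
        (\<forall>i\<in>{1..4}. 3 * d_mult 1 (H i) \<le> D 1 H) \<and>
        (\<forall>i\<in>{1..4}. \<forall>j\<in>{1..4}.
           d_mult 1 (H i) + 2 * (d_mult 1 (H j) + d_mult 2 (H j)) \<le> D 1 H + D 2 H)})"
proof -
  have unit: "x i - x j dvd 1" if "i \<in> {1..m}" "j \<in> {1..m}" "i \<noteq> j" for i j
    unfolding padic_unit_iff padic_reduce_eq_iff[symmetric] using assms(3) that by (auto dest: inj_onD)
  have fg: "H i \<in> fg_modules" if "H \<in> {1..m} \<rightarrow>\<^sub>E \<M>" "i \<in> {1..m}" for i and H :: "nat \<Rightarrow> ('p padic_int, 'a) module"
    using PiE_mem[OF that] unfolding \<M>_def .
  have atLeastAtMost: "{1..2} = {1, 2 :: nat}" "{1..3} = {1, 2, 3 :: nat}" "{1..4} = {1, 2, 3, 4 :: nat}" by auto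
  show ?thesis
  proof (intro conjI impI ballI)
    fix H assume "H \<in> \<M>"
    then show "has_type H (d_inf H) (\<lambda>r. d_mult r H)"
      "p_rank H = (\<Sum>r | 1 \<le> r \<and> d_mult r H \<noteq> 0. d_mult r H) + d_inf H"
      unfolding \<M>_def by (rule fg_module_type)+
  next
    assume m: "m = 1"
    have "realizable m x H" if "H \<in> {1..m} \<rightarrow>\<^sub>E \<M>" for H :: "nat \<Rightarrow> ('p padic_int, 'a) module"
      using realizable_two[of m x H, OF assms(1) _ unit fg[OF that]] m by simp
    then show "cok_tuples m x = ({1..m} \<rightarrow>\<^sub>E \<M>)"
      unfolding cok_tuples_realizable \<M>_def by blast
  next
    assume m: "m = 2"
    have "realizable m x H \<longleftrightarrow> p_rank (H 1) = p_rank (H 2)" if "H \<in> {1..m} \<rightarrow>\<^sub>E \<M>" for H :: "nat \<Rightarrow> ('p padic_int, 'a) module"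
    proof -
      have "realizable m x H \<longleftrightarrow> (\<forall>i\<in>{1..m}. p_rank (H i) = p_rank (H 1))"
        by (rule realizable_two[OF assms(1) _ unit fg[OF that]]) (use m in simp_all)
      then show ?thesis unfolding m atLeastAtMost by auto
    qed
    then show "cok_tuples m x = {H \<in> {1..m} \<rightarrow>\<^sub>E \<M>. p_rank (H 1) = p_rank (H 2)}"
      unfolding cok_tuples_realizable \<M>_def by blast
  next
    assume m: "m = 3"
    have "realizable m x H \<longleftrightarrow> p_rank (H 1) = p_rank (H 2) \<and> p_rank (H 2) = p_rank (H 3) \<and>
        (\<forall>i\<in>{1..3}. 2 * d_mult 1 (H i) \<le> D 1 H)" if "H \<in> {1..m} \<rightarrow>\<^sub>E \<M>" for H :: "nat \<Rightarrow> ('p padic_int, 'a) module"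
    proof -
      have "(\<forall>i\<in>{1..3}. p_rank (H i) = p_rank (H 1)) \<longleftrightarrow> p_rank (H 1) = p_rank (H 2) \<and> p_rank (H 2) = p_rank (H 3)"
        unfolding atLeastAtMost by auto
      then show ?thesis
        using realizable_three[of x H, OF unit[unfolded m] fg[OF that, unfolded m]] unfolding m D_def by blast
    qed
    then show "cok_tuples m x = {H \<in> {1..m} \<rightarrow>\<^sub>E \<M>.
        p_rank (H 1) = p_rank (H 2) \<and> p_rank (H 2) = p_rank (H 3) \<and>
        (\<forall>i\<in>{1..3}. 2 * d_mult 1 (H i) \<le> D 1 H)}"
      unfolding cok_tuples_realizable \<M>_def by blast
  next
    assume m: "m = 4"
    have "realizable m x H \<longleftrightarrow> p_rank (H 1) = p_rank (H 2) \<and> p_rank (H 2) = p_rank (H 3) \<and> p_rank (H 3) = p_rank (H 4) \<and>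
        (\<forall>i\<in>{1..4}. 3 * d_mult 1 (H i) \<le> D 1 H) \<and>
        (\<forall>i\<in>{1..4}. \<forall>j\<in>{1..4}. d_mult 1 (H i) + 2 * (d_mult 1 (H j) + d_mult 2 (H j)) \<le> D 1 H + D 2 H)"
      if "H \<in> {1..m} \<rightarrow>\<^sub>E \<M>" for H :: "nat \<Rightarrow> ('p padic_int, 'a) module"
    proof -
      have "(\<forall>i\<in>{1..4}. p_rank (H i) = p_rank (H 1)) \<longleftrightarrow>
          p_rank (H 1) = p_rank (H 2) \<and> p_rank (H 2) = p_rank (H 3) \<and> p_rank (H 3) = p_rank (H 4)"
        unfolding atLeastAtMost by auto
      then show ?thesis
        using realizable_four[of x H, OF unit[unfolded m] fg[OF that, unfolded m]] unfolding m D_def by blast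
    qed
    then show "cok_tuples m x = {H \<in> {1..m} \<rightarrow>\<^sub>E \<M>.
        p_rank (H 1) = p_rank (H 2) \<and> p_rank (H 2) = p_rank (H 3) \<and> p_rank (H 3) = p_rank (H 4) \<and>
        (\<forall>i\<in>{1..4}. 3 * d_mult 1 (H i) \<le> D 1 H) \<and>
        (\<forall>i\<in>{1..4}. \<forall>j\<in>{1..4}.
           d_mult 1 (H i) + 2 * (d_mult 1 (H j) + d_mult 2 (H j)) \<le> D 1 H + D 2 H)}"
      unfolding cok_tuples_realizable \<M>_def by blast
  qed
qed

end
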